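(* There is an algorithm in the hash-ordered neighbor access model that, given an integer $1\le s\le n$ and $\delta\in(0,1)$, on an $n$-vertex graph with $m$ edges, with probability at least $1-\delta$ returns $s$ oriented edges sampled uniformly with replacement from $\vec E$, and runs in time $O\!\left(\sqrt s\,\frac{n}{\sqrt m}\log n\log(n/\delta)+s\log^2 n\log(n/\delta)\right)$ with high probability.
   Context: $G=(V,E)$ is an undirected graph with $n$ vertices and $m$ edges; $\vec E$ denotes the set of oriented edges obtained by replacing each undirected edge $\{u,v\}$ by $(u,v)$ and $(v,u)$. Hash-ordered neighbor access model: the algorithm knows $n$ and may query the $i$-th vertex, the degree $d(v)$, the $i$-th neighbor of $v$, $id(v)$, and a hash value $h(v)$, where the $h(v)$ are independent and uniform on $[0,1]$; each vertex's neighbor list is ordered by increasing hash value. Each query has unit cost. *)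

theory Defs
  imports "HOL-Probability.Probability"
begin

text \<open>
  Finite simple undirected graphs whose vertices are named by natural numbers (the machine words by
  which an algorithm refers to them). The list fixes which vertex is the \<open>i\<close>-th one; names,
  enumeration and identifiers are otherwise arbitrary.
\<close>

record graph =
  vertices :: "nat list"
  edges :: "nat set set"
  ident :: "nat \<Rightarrow> nat"

definition wf_graph :: "graph \<Rightarrow> bool" where
  "wf_graph G \<longleftrightarrow> distinct (vertices G)
     \<and> edges G \<subseteq> {e. e \<subseteq> set (vertices G) \<and> card e = 2}
     \<and> inj_on (ident G) (set (vertices G))"

definition num_vertices :: "graph \<Rightarrow> nat" where
  "num_vertices G = length (vertices G)"

definition num_edges :: "graph \<Rightarrow> nat" where
  "num_edges G = card (edges G)"

definition oriented_edges :: "graph \<Rightarrow> (nat \<times> nat) set" where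
  "oriented_edges G = {(u, v). {u, v} \<in> edges G}"

definition neighbors :: "graph \<Rightarrow> nat \<Rightarrow> nat set" where
  "neighbors G v = {u. {v, u} \<in> edges G}"

text \<open>
  Neighbors in order of increasing hash value. Ties have probability zero; they are broken by the
  vertex name.
\<close>

definition neighbor_list :: "graph \<Rightarrow> (nat \<Rightarrow> real) \<Rightarrow> nat \<Rightarrow> nat list" where
  "neighbor_list G h v = sort_key h (sorted_list_of_set (neighbors G v))"

text \<open>
  The five queries, with hash function \<open>h\<close>. Indices start at 0; an illegal query is answered by
  \<open>-1\<close>, which is never the name of a vertex.
\<close>

definition vertex_query :: "graph \<Rightarrow> nat \<Rightarrow> real" where
  "vertex_query G i = (if i < num_vertices G then real (vertices G ! i) else -1)"

definition degree_query :: "graph \<Rightarrow> nat \<Rightarrow> real" where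
  "degree_query G v = (if v \<in> set (vertices G) then real (card (neighbors G v)) else -1)"

definition neighbor_query :: "graph \<Rightarrow> (nat \<Rightarrow> real) \<Rightarrow> nat \<Rightarrow> nat \<Rightarrow> real" where
  "neighbor_query G h v i =
     (if v \<in> set (vertices G) \<and> i < card (neighbors G v) then real (neighbor_list G h v ! i) else -1)"

definition ident_query :: "graph \<Rightarrow> nat \<Rightarrow> real" where
  "ident_query G v = (if v \<in> set (vertices G) then real (ident G v) else -1)"

definition hash_query :: "graph \<Rightarrow> (nat \<Rightarrow> real) \<Rightarrow> nat \<Rightarrow> real" where
  "hash_query G h v = (if v \<in> set (vertices G) then h v else -1)"

text \<open>
  Algorithms are while programs for a real random access machine. The memory consists of named
  arrays of reals, all cells being initially zero except for the input; a scalar variable is cell 0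
  of an array. Array indices and query arguments \<open>x\<close> denote the natural number \<open>nat \<lfloor>x\<rfloor>\<close>. Constants
  are integers, so that a program is a finite object that cannot hide information in a real constant.
\<close>

datatype binop = Plus | Minus | Times | Divide | Less

datatype unop = Floor | Ln | Exp

datatype expr =
    Const int
  | Read string expr
  | Unary unop expr
  | Binary binop expr expr
  | Vertex expr
  | Degree expr
  | Neighbor expr expr
  | Ident expr
  | Hash expr

datatype prog =
    Skip
  | Write string expr expr
  | Random string expr
  | Seq prog prog
  | If expr prog prog
  | While expr prog

type_synonym store = "string \<Rightarrow> nat \<Rightarrow> real"

fun apply_unop :: "unop \<Rightarrow> real \<Rightarrow> real" where
  "apply_unop Floor x = real_of_int \<lfloor>x\<rfloor>"
| "apply_unop Ln x = ln x"
| "apply_unop Exp x = exp x"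

fun apply_binop :: "binop \<Rightarrow> real \<Rightarrow> real \<Rightarrow> real" where
  "apply_binop Plus x y = x + y"
| "apply_binop Minus x y = x - y"
| "apply_binop Times x y = x * y"
| "apply_binop Divide x y = x / y"
| "apply_binop Less x y = (if x < y then 1 else 0)"

abbreviation index :: "real \<Rightarrow> nat" where
  "index x \<equiv> nat \<lfloor>x\<rfloor>"

primrec eval_expr :: "graph \<Rightarrow> (nat \<Rightarrow> real) \<Rightarrow> store \<Rightarrow> expr \<Rightarrow> real" where
  "eval_expr G h \<sigma> (Const k) = real_of_int k"
| "eval_expr G h \<sigma> (Read a e) = \<sigma> a (index (eval_expr G h \<sigma> e))"
| "eval_expr G h \<sigma> (Unary f e) = apply_unop f (eval_expr G h \<sigma> e)"
| "eval_expr G h \<sigma> (Binary f e1 e2) = apply_binop f (eval_expr G h \<sigma> e1) (eval_expr G h \<sigma> e2)"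
| "eval_expr G h \<sigma> (Vertex e) = vertex_query G (index (eval_expr G h \<sigma> e))"
| "eval_expr G h \<sigma> (Degree e) = degree_query G (index (eval_expr G h \<sigma> e))"
| "eval_expr G h \<sigma> (Neighbor e1 e2) =
     neighbor_query G h (index (eval_expr G h \<sigma> e1)) (index (eval_expr G h \<sigma> e2))"
| "eval_expr G h \<sigma> (Ident e) = ident_query G (index (eval_expr G h \<sigma> e))"
| "eval_expr G h \<sigma> (Hash e) = hash_query G h (index (eval_expr G h \<sigma> e))"

text \<open>Every operation, memory access and query occurring in an expression has unit cost.\<close>

primrec expr_cost :: "expr \<Rightarrow> nat" where
  "expr_cost (Const k) = 1"
| "expr_cost (Read a e) = 1 + expr_cost e"
| "expr_cost (Unary f e) = 1 + expr_cost e"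
| "expr_cost (Binary f e1 e2) = 1 + expr_cost e1 + expr_cost e2"
| "expr_cost (Vertex e) = 1 + expr_cost e"
| "expr_cost (Degree e) = 1 + expr_cost e"
| "expr_cost (Neighbor e1 e2) = 1 + expr_cost e1 + expr_cost e2"
| "expr_cost (Ident e) = 1 + expr_cost e"
| "expr_cost (Hash e) = 1 + expr_cost e"

definition update :: "store \<Rightarrow> string \<Rightarrow> nat \<Rightarrow> real \<Rightarrow> store" where
  "update \<sigma> a i x = \<sigma>(a := (\<sigma> a)(i := x))"

text \<open>
  \<open>exec G h r (p, \<sigma>, k) t (\<sigma>', k')\<close>: with hash function \<open>h\<close> and random tape \<open>r\<close>, the program \<open>p\<close>
  started in store \<open>\<sigma>\<close> after \<open>k\<close> cells of the tape have been consumed terminates after exactly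
  \<open>t\<close> time units in store \<open>\<sigma>'\<close>, \<open>k'\<close> cells of the tape having been consumed.
\<close>

inductive exec ::
  "graph \<Rightarrow> (nat \<Rightarrow> real) \<Rightarrow> (nat \<Rightarrow> real) \<Rightarrow> prog \<times> store \<times> nat \<Rightarrow> nat \<Rightarrow> store \<times> nat \<Rightarrow> bool"
  for G h r where
  Skip: "exec G h r (Skip, \<sigma>, k) 1 (\<sigma>, k)"
| Write: "exec G h r (Write a i e, \<sigma>, k) (1 + expr_cost i + expr_cost e)
     (update \<sigma> a (index (eval_expr G h \<sigma> i)) (eval_expr G h \<sigma> e), k)"
| Random: "exec G h r (Random a i, \<sigma>, k) (1 + expr_cost i)
     (update \<sigma> a (index (eval_expr G h \<sigma> i)) (r k), Suc k)"
| Seq: "exec G h r (p, \<sigma>, k) t (\<sigma>', k') \<Longrightarrow> exec G h r (q, \<sigma>', k') t' (\<sigma>'', k'')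
     \<Longrightarrow> exec G h r (Seq p q, \<sigma>, k) (1 + t + t') (\<sigma>'', k'')"
| IfTrue: "eval_expr G h \<sigma> b \<noteq> 0 \<Longrightarrow> exec G h r (p, \<sigma>, k) t (\<sigma>', k')
     \<Longrightarrow> exec G h r (If b p q, \<sigma>, k) (1 + expr_cost b + t) (\<sigma>', k')"
| IfFalse: "eval_expr G h \<sigma> b = 0 \<Longrightarrow> exec G h r (q, \<sigma>, k) t (\<sigma>', k')
     \<Longrightarrow> exec G h r (If b p q, \<sigma>, k) (1 + expr_cost b + t) (\<sigma>', k')"
| WhileFalse: "eval_expr G h \<sigma> b = 0
     \<Longrightarrow> exec G h r (While b p, \<sigma>, k) (1 + expr_cost b) (\<sigma>, k)"
| WhileTrue: "eval_expr G h \<sigma> b \<noteq> 0 \<Longrightarrow> exec G h r (p, \<sigma>, k) t (\<sigma>', k')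
     \<Longrightarrow> exec G h r (While b p, \<sigma>', k') t' (\<sigma>'', k'')
     \<Longrightarrow> exec G h r (While b p, \<sigma>, k) (1 + expr_cost b + t + t') (\<sigma>'', k'')"

definition input_store :: "nat \<Rightarrow> nat \<Rightarrow> real \<Rightarrow> store" where
  "input_store n s \<delta> = (\<lambda>a i.
     if i \<noteq> 0 then 0
     else if a = ''n'' then real n
     else if a = ''s'' then real s
     else if a = ''delta'' then \<delta>
     else 0)"

text \<open>
  The sources of randomness: independent uniform hash values of the vertices, and independently of
  them the algorithm's own tape of independent uniform numbers.
\<close>

definition unif01 :: "real measure" where
  "unif01 = uniform_measure lborel {0..1}"

definition rand_space :: "graph \<Rightarrow> ((nat \<Rightarrow> real) \<times> (nat \<Rightarrow> real)) measure" where
  "rand_space G = (\<Pi>\<^sub>M v\<in>set (vertices G). unif01) \<Otimes>\<^sub>M (\<Pi>\<^sub>M i\<in>(UNIV :: nat set). unif01)"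

text \<open>The output is the list of pairs stored in the first \<open>s\<close> cells of the arrays ''src'', ''dst''.\<close>

definition returns ::
  "prog \<Rightarrow> graph \<Rightarrow> nat \<Rightarrow> real \<Rightarrow> (nat \<Rightarrow> real) \<times> (nat \<Rightarrow> real) \<Rightarrow> (nat \<times> nat) list \<Rightarrow> bool" where
  "returns p G s \<delta> \<omega> xs \<longleftrightarrow> length xs = s \<and>
     (\<exists>t \<sigma> k. exec G (fst \<omega>) (snd \<omega>) (p, input_store (num_vertices G) s \<delta>, 0) t (\<sigma>, k)
       \<and> (\<forall>i<s. \<sigma> ''src'' i = real (fst (xs ! i)) \<and> \<sigma> ''dst'' i = real (snd (xs ! i))))"

definition runs_in_time ::
  "prog \<Rightarrow> graph \<Rightarrow> nat \<Rightarrow> real \<Rightarrow> (nat \<Rightarrow> real) \<times> (nat \<Rightarrow> real) \<Rightarrow> real \<Rightarrow> bool" where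
  "runs_in_time p G s \<delta> \<omega> T \<longleftrightarrow>
     (\<exists>t \<sigma> k. exec G (fst \<omega>) (snd \<omega>) (p, input_store (num_vertices G) s \<delta>, 0) t (\<sigma>, k)
       \<and> real t \<le> T)"

text \<open>
  With probability at least \<open>1 - \<delta>\<close> the output is a sample from \<open>D\<close>: there is a success event of
  at least that probability, conditioned on which the output has distribution \<open>D\<close>.
\<close>

definition samples_with_prob ::
  "prog \<Rightarrow> graph \<Rightarrow> nat \<Rightarrow> real \<Rightarrow> (nat \<times> nat) list pmf \<Rightarrow> bool" where
  "samples_with_prob p G s \<delta> D \<longleftrightarrow>
     (\<exists>A \<in> sets (rand_space G).
        measure (rand_space G) A \<ge> 1 - \<delta> \<and>
        (\<forall>xs. \<P>(\<omega> in rand_space G. returns p G s \<delta> \<omega> xs \<bar> \<omega> \<in> A) = pmf D xs))"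

definition valid_input :: "graph \<Rightarrow> nat \<Rightarrow> real \<Rightarrow> bool" where
  "valid_input G s \<delta> \<longleftrightarrow> wf_graph G \<and> num_edges G \<ge> 1
     \<and> 1 \<le> s \<and> s \<le> num_vertices G \<and> 0 < \<delta> \<and> \<delta> < 1"

definition time_bound :: "nat \<Rightarrow> nat \<Rightarrow> nat \<Rightarrow> real \<Rightarrow> real" where
  "time_bound n m s \<delta> =
     sqrt (real s) * (real n / sqrt (real m)) * ln (real n) * ln (real n / \<delta>)
     + real s * (ln (real n))\<^sup>2 * ln (real n / \<delta>)"

end

theory Submission
  imports Defs
begin

text \<open>
  Truncating degrees at \<open>x\<close> and halving \<open>x\<close> until \<open>\<Sum>v. min (deg v) x\<close> is found to exceed a multiple of
  \<open>x\<^sup>2\<close> yields a number \<open>y\<close> of order \<open>\<surd>m\<close> with about \<open>(n / \<surd>m) log (n / \<delta>)\<close> queries.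

  Put \<open>th = y / \<surd>s + y\<^sup>2 / n\<close> and call a vertex heavy if its degree exceeds \<open>th\<close>. Sampling proceeds in
  independent slots. In each of them every heavy \<open>v\<close> is active independently with odds
  \<open>deg v / (n th) : 1\<close>; the pattern of all its activations is decoded from the single hash value \<open>h v\<close>.
  A slot with exactly one active vertex outputs a uniform edge out of it, a slot with none performs a
  rejection step that yields any given edge out of a light vertex with probability \<open>1 / (n th)\<close>, and all
  others fail. Because activation is expressed by odds, every oriented edge is the outcome of a slot with
  the same probability \<open>Z / (n th)\<close>, where \<open>Z\<close> is the probability that no vertex is active. Hence the
  successful slots are exactly uniform and independent.

  A vertex that is active in one of the first \<open>J\<close> slots has a hash value of at most \<open>J deg v / (n th)\<close>.
  As the neighbor lists are sorted by hash value, these vertices are found by reading short prefixes of the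
  lists of random vertices: the \<open>t\<close>-th random vertex is responsible for heavy vertices of degree about
  \<open>n log (n / \<delta>) / t\<close>, so the prefix shrinks like \<open>1 / t\<close>, and the total work is a harmonic sum, which
  accounts for one of the logarithms. Phases with a growing number of slots repeat this until \<open>s\<close> slots
  have succeeded. The random vertices and the randomness of the slots occupy disjoint cells of the tape, so
  that conditioning on all searches being successful leaves the output distribution unchanged.
\<close>

text \<open>The two terms of \<open>th\<close> answer two demands. The term \<open>y * y / n\<close>
  gives n * th >= y^2, which keeps Z above a constant when y^2 is of order m. The term
  \<open>y / sqrt s\<close> keeps the number of sampled vertices, about n R / th, near sqrt s * n /
  y. Some s n th / m, that is sqrt s * n / sqrt m + s, slots then suffice.

  The obstacle to exactness is that the hash values both decide the activity and order the lists
  from which edges are read. But for fixed hash values the order merely permutes the neighbors, so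
  the law of a slot given its active set does not involve them. Moreover, success of a search is
  expressed by a condition on the tape alone that works for all hash values.

  The obstacle to the time bound is that failure probability \<open>n powr - c\<close> is wanted for
  every c from one program with fixed constants. For \<delta> near 1 one estimate or one phase is
  reliable only up to a fixed power of n. So the analysis adapts instead of the program: it
  tolerates an estimate that is off by a factor depending on c, and a number K of phases depending
  on c, and pays with the constant C.\<close>

subsection \<open>Running programs\<close>

text \<open>Existence of a terminating run is enough because runs are unique
  (\<open>exec_deterministic\<close>). The time is an argument of the postcondition, so that
  correctness and cost are proved in one pass.\<close>

definition wp :: "graph \<Rightarrow> (nat \<Rightarrow> real) \<Rightarrow> (nat \<Rightarrow> real) \<Rightarrow> prog
    \<Rightarrow> (nat \<Rightarrow> store \<Rightarrow> nat \<Rightarrow> bool) \<Rightarrow> store \<Rightarrow> nat \<Rightarrow> bool" where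
  "wp G h r p Q \<sigma> k \<longleftrightarrow> (\<exists>t \<sigma>' k'. exec G h r (p, \<sigma>, k) t (\<sigma>', k') \<and> Q t \<sigma>' k')"

lemma wp_Skip: "Q 1 \<sigma> k \<Longrightarrow> wp G h r Skip Q \<sigma> k"
  unfolding wp_def using exec.Skip by blast

lemma wp_Write:
  "Q (1 + expr_cost i + expr_cost e) (update \<sigma> a (index (eval_expr G h \<sigma> i)) (eval_expr G h \<sigma> e)) k
    \<Longrightarrow> wp G h r (Write a i e) Q \<sigma> k"
  unfolding wp_def using exec.Write by blast

lemma wp_Random:
  "Q (1 + expr_cost i) (update \<sigma> a (index (eval_expr G h \<sigma> i)) (r k)) (Suc k)
    \<Longrightarrow> wp G h r (Random a i) Q \<sigma> k"
  unfolding wp_def using exec.Random by blast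

lemma wp_Seq:
  "wp G h r p (\<lambda>t \<sigma>' k'. wp G h r q (\<lambda>t'. Q (1 + t + t')) \<sigma>' k') \<sigma> k
    \<Longrightarrow> wp G h r (Seq p q) Q \<sigma> k"
  unfolding wp_def using exec.Seq by blast

lemma wp_If:
  assumes "eval_expr G h \<sigma> b \<noteq> 0 \<Longrightarrow> wp G h r p (\<lambda>t. Q (1 + expr_cost b + t)) \<sigma> k"
    and "eval_expr G h \<sigma> b = 0 \<Longrightarrow> wp G h r q (\<lambda>t. Q (1 + expr_cost b + t)) \<sigma> k"
  shows "wp G h r (If b p q) Q \<sigma> k"
  using assms unfolding wp_def
  by (cases "eval_expr G h \<sigma> b = 0") (blast intro: exec.IfTrue exec.IfFalse)+

text \<open>
  The invariant carries a credit that pays for all remaining steps, which gives termination and an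
  amortised time bound at once.
\<close>

lemma wp_While:
  assumes step: "\<And>c \<sigma> k. I c \<sigma> k \<Longrightarrow> eval_expr G h \<sigma> b \<noteq> 0 \<Longrightarrow>
      wp G h r p (\<lambda>t \<sigma>' k'. \<exists>c'. c' + t + 1 + expr_cost b \<le> c \<and> I c' \<sigma>' k') \<sigma> k"
    and init: "I c \<sigma> k"
    and conseq: "\<And>t c' \<sigma>' k'. t + c' \<le> c + 1 + expr_cost b \<Longrightarrow> I c' \<sigma>' k' \<Longrightarrow>
      eval_expr G h \<sigma>' b = 0 \<Longrightarrow> Q t \<sigma>' k'"
  shows "wp G h r (While b p) Q \<sigma> k"
proof -
  have "I c \<sigma> k \<Longrightarrow> \<exists>t \<sigma>' k' c'. exec G h r (While b p, \<sigma>, k) t (\<sigma>', k') \<and> t + c' \<le> c + 1 + expr_cost b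
      \<and> I c' \<sigma>' k' \<and> eval_expr G h \<sigma>' b = 0" for c \<sigma> k
  \<comment> \<open>Every iteration spends at least one unit of credit, so strong induction on the
    credit proves termination. The surplus \<open>1 + expr_cost b\<close> pays for the final,
    failing test of the guard.\<close>
  proof (induction c arbitrary: \<sigma> k rule: less_induct)
    case (less c)
    show ?case
    proof (cases "eval_expr G h \<sigma> b = 0")
      case True
      have "1 + expr_cost b + c \<le> c + 1 + expr_cost b" by simp
      then show ?thesis using less.prems True exec.WhileFalse[OF True] by blast
    next
      case False
      obtain t \<sigma>' k' c' where 1: "exec G h r (p, \<sigma>, k) t (\<sigma>', k')" "c' + t + 1 + expr_cost b \<le> c"
        "I c' \<sigma>' k'"
        using step[OF less.prems False] unfolding wp_def by blast
      have "c' < c" using 1(2) by linarith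
      from less.IH[OF this 1(3)] obtain t2 \<sigma>2 k2 c2 where 2:
        "exec G h r (While b p, \<sigma>', k') t2 (\<sigma>2, k2)" "t2 + c2 \<le> c' + 1 + expr_cost b" "I c2 \<sigma>2 k2"
        "eval_expr G h \<sigma>2 b = 0"
        by blast
      have "1 + expr_cost b + t + t2 + c2 \<le> c + 1 + expr_cost b" using 1(2) 2(2) by linarith
      then show ?thesis using exec.WhileTrue[OF False 1(1) 2(1)] 2(3,4) by blast
    qed
  qed
  from this[OF init] show ?thesis unfolding wp_def using conseq by blast
qed

lemma update_apply: "update \<sigma> a i x b j = (if a = b \<and> i = j then x else \<sigma> b j)"
  by (auto simp: update_def)

subsection \<open>Determinism and measurability of runs\<close>

text \<open>
  An evaluator with fuel; the first component tells whether the fuel was sufficient. It is total, so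
  that measurability is a matter of composing functions.
\<close>

fun run :: "graph \<Rightarrow> (nat \<Rightarrow> real) \<Rightarrow> (nat \<Rightarrow> real) \<Rightarrow> nat \<Rightarrow> prog \<Rightarrow> store \<Rightarrow> nat
    \<Rightarrow> bool \<times> nat \<times> store \<times> nat" where
  "run G h r f Skip \<sigma> k = (True, 1, \<sigma>, k)"
| "run G h r f (Write a i e) \<sigma> k = (True, 1 + expr_cost i + expr_cost e,
     update \<sigma> a (index (eval_expr G h \<sigma> i)) (eval_expr G h \<sigma> e), k)"
| "run G h r f (Random a i) \<sigma> k = (True, 1 + expr_cost i,
     update \<sigma> a (index (eval_expr G h \<sigma> i)) (r k), Suc k)"
| "run G h r f (Seq p q) \<sigma> k = (case run G h r f p \<sigma> k of (b, t, \<sigma>', k') \<Rightarrow>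
     case run G h r f q \<sigma>' k' of (b', t', \<sigma>'', k'') \<Rightarrow> (b \<and> b', 1 + t + t', \<sigma>'', k''))"
| "run G h r f (If e p q) \<sigma> k = (if eval_expr G h \<sigma> e \<noteq> 0
     then case run G h r f p \<sigma> k of (b, t, \<sigma>', k') \<Rightarrow> (b, 1 + expr_cost e + t, \<sigma>', k')
     else case run G h r f q \<sigma> k of (b, t, \<sigma>', k') \<Rightarrow> (b, 1 + expr_cost e + t, \<sigma>', k'))"
| "run G h r 0 (While e p) \<sigma> k = (False, 0, \<sigma>, k)"
| "run G h r (Suc f) (While e p) \<sigma> k = (if eval_expr G h \<sigma> e \<noteq> 0
     then case run G h r f p \<sigma> k of (b, t, \<sigma>', k') \<Rightarrow>
       case run G h r f (While e p) \<sigma>' k' of (b', t', \<sigma>'', k'') \<Rightarrow>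
         (b \<and> b', 1 + expr_cost e + t + t', \<sigma>'', k'')
     else (True, 1 + expr_cost e, \<sigma>, k))"

lemma run_imp_exec:
  "run G h r f p \<sigma> k = (True, t, \<sigma>', k') \<Longrightarrow> exec G h r (p, \<sigma>, k) t (\<sigma>', k')"
proof (induction G h r f p \<sigma> k arbitrary: t \<sigma>' k' rule: run.induct)
  case (1 G h r f \<sigma> k) then show ?case using exec.Skip[of G h r \<sigma> k] by simp
next
  case (2 G h r f a i e \<sigma> k) then show ?case using exec.Write[of G h r a i e \<sigma> k] by simp
next
  case (3 G h r f a i \<sigma> k) then show ?case using exec.Random[of G h r a i \<sigma> k] by simp
next
  case (4 G h r f p q \<sigma> k)
  obtain b1 t1 \<sigma>1 k1 where r1: "run G h r f p \<sigma> k = (b1, t1, \<sigma>1, k1)" by (metis prod_cases4)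
  obtain b2 t2 \<sigma>2 k2 where r2: "run G h r f q \<sigma>1 k1 = (b2, t2, \<sigma>2, k2)" by (metis prod_cases4)
  have *: "b1" "b2" "t = 1 + t1 + t2" "\<sigma>' = \<sigma>2" "k' = k2" using 4(3) r1 r2 by auto
  have "exec G h r (p, \<sigma>, k) t1 (\<sigma>1, k1)" using 4(1) r1 *(1) by simp
  moreover have "exec G h r (q, \<sigma>1, k1) t2 (\<sigma>2, k2)" using 4(2) r1 r2 *(1,2) by simp
  ultimately show ?case using exec.Seq * by simp
next
  case (5 G h r f e p q \<sigma> k)
  then show ?case
    using exec.IfTrue[of G h \<sigma> e r p k] exec.IfFalse[of G h \<sigma> e r q k]
    by (auto split: prod.splits if_splits)
next
  case (6 G h r e p \<sigma> k) then show ?case by simp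
next
  case (7 G h r f e p \<sigma> k)
  show ?case
  proof (cases "eval_expr G h \<sigma> e = 0")
    case True
    then show ?thesis using 7(3) exec.WhileFalse[OF True] by auto
  next
    case False
    obtain b1 t1 \<sigma>1 k1 where r1: "run G h r f p \<sigma> k = (b1, t1, \<sigma>1, k1)" by (metis prod_cases4)
    obtain b2 t2 \<sigma>2 k2 where r2: "run G h r f (While e p) \<sigma>1 k1 = (b2, t2, \<sigma>2, k2)"
      by (metis prod_cases4)
    have *: "b1" "b2" "t = 1 + expr_cost e + t1 + t2" "\<sigma>' = \<sigma>2" "k' = k2"
      using 7(3) False r1 r2 by auto
    have "exec G h r (p, \<sigma>, k) t1 (\<sigma>1, k1)" using 7(1)[OF False] r1 *(1) by simp
    moreover have "exec G h r (While e p, \<sigma>1, k1) t2 (\<sigma>2, k2)"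
      using 7(2)[OF False] r1 r2 *(1,2) by simp
    ultimately show ?thesis using exec.WhileTrue[OF False] * by simp
  qed
qed

lemma run_mono_Suc:
  "run G h r f p \<sigma> k = (True, t, \<sigma>', k') \<Longrightarrow> run G h r (Suc f) p \<sigma> k = (True, t, \<sigma>', k')"
proof (induction G h r f p \<sigma> k arbitrary: t \<sigma>' k' rule: run.induct)
  case (4 G h r f p q \<sigma> k)
  then show ?case by (auto split: prod.splits)
next
  case (5 G h r f e p q \<sigma> k)
  then show ?case by (auto split: prod.splits if_splits)
next
  case (7 G h r f e p \<sigma> k)
  show ?case
  proof (cases "eval_expr G h \<sigma> e = 0")
    case False
    obtain b1 t1 \<sigma>1 k1 where r1: "run G h r f p \<sigma> k = (b1, t1, \<sigma>1, k1)" by (metis prod_cases4)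
    obtain b2 t2 \<sigma>2 k2 where r2: "run G h r f (While e p) \<sigma>1 k1 = (b2, t2, \<sigma>2, k2)"
      by (metis prod_cases4)
    have *: "b1" "b2" "t = 1 + expr_cost e + t1 + t2" "\<sigma>' = \<sigma>2" "k' = k2"
      using 7(3) False r1 r2 by auto
    have "run G h r (Suc f) p \<sigma> k = (True, t1, \<sigma>1, k1)" using 7(1)[OF False] r1 *(1) by simp
    moreover have "run G h r (Suc f) (While e p) \<sigma>1 k1 = (True, t2, \<sigma>2, k2)"
      using 7(2)[OF False] r1 r2 *(1,2) by simp
    ultimately show ?thesis using False * run.simps(7)[of G h r "Suc f"] by simp
  qed (use 7(3) in simp)
qed auto

lemma run_mono:
  "run G h r f p \<sigma> k = (True, t, \<sigma>', k') \<Longrightarrow> f \<le> f' \<Longrightarrow> run G h r f' p \<sigma> k = (True, t, \<sigma>', k')"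
  by (rotate_tac 1, induction rule: dec_induct) (auto dest: run_mono_Suc simp del: run.simps)

lemma exec_imp_run:
  "exec G h r x t y \<Longrightarrow> \<exists>f. run G h r f (fst x) (fst (snd x)) (snd (snd x)) = (True, t, fst y, snd y)"
proof (induction rule: exec.induct)
  case (Seq p \<sigma> k t \<sigma>' k' q t' \<sigma>'' k'')
  then obtain f1 f2 where "run G h r f1 p \<sigma> k = (True, t, \<sigma>', k')"
    "run G h r f2 q \<sigma>' k' = (True, t', \<sigma>'', k'')" by auto
  then have "run G h r (max f1 f2) p \<sigma> k = (True, t, \<sigma>', k')"
    "run G h r (max f1 f2) q \<sigma>' k' = (True, t', \<sigma>'', k'')"
    by (auto intro: run_mono)
  then show ?case by (intro exI[of _ "max f1 f2"]) simp
next
  case (WhileTrue \<sigma> b p k t \<sigma>' k' t' \<sigma>'' k'')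
  then obtain f1 f2 where "run G h r f1 p \<sigma> k = (True, t, \<sigma>', k')"
    "run G h r f2 (While b p) \<sigma>' k' = (True, t', \<sigma>'', k'')" by auto
  then have "run G h r (max f1 f2) p \<sigma> k = (True, t, \<sigma>', k')"
    "run G h r (max f1 f2) (While b p) \<sigma>' k' = (True, t', \<sigma>'', k'')"
    by (auto intro: run_mono simp del: run.simps)
  then show ?case using WhileTrue(1) by (intro exI[of _ "Suc (max f1 f2)"]) simp
next
  case (WhileFalse \<sigma> b p k)
  then show ?case by (intro exI[of _ "Suc 0"]) simp
next
  case (IfTrue \<sigma> b p k t \<sigma>' k' q)
  then obtain f where "run G h r f p \<sigma> k = (True, t, \<sigma>', k')" by auto
  then show ?case using IfTrue(1) by (intro exI[of _ f]) simp
next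
  case (IfFalse \<sigma> b q k t \<sigma>' k' p)
  then obtain f where "run G h r f q \<sigma> k = (True, t, \<sigma>', k')" by auto
  then show ?case using IfFalse(1) by (intro exI[of _ f]) simp
qed auto

text \<open>The evaluator is a function and monotone in its fuel; the larger of the two fuels
  reproduces both runs.\<close>

lemma exec_deterministic:
  assumes "exec G h r (p, \<sigma>, k) t y" "exec G h r (p, \<sigma>, k) t' y'"
  shows "t = t' \<and> y = y'"
proof -
  obtain f where f: "run G h r f p \<sigma> k = (True, t, fst y, snd y)"
    using exec_imp_run[OF assms(1)] by auto
  obtain f' where f': "run G h r f' p \<sigma> k = (True, t', fst y', snd y')"
    using exec_imp_run[OF assms(2)] by auto
  have "run G h r (max f f') p \<sigma> k = (True, t, fst y, snd y)"
    "run G h r (max f f') p \<sigma> k = (True, t', fst y', snd y')"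
    using run_mono[OF f, of "max f f'"] run_mono[OF f', of "max f f'"] by auto
  then show ?thesis by (auto simp: prod_eq_iff)
qed

section \<open>Measurability of neighbor lists, expressions and runs\<close>

lemma measurable_sort_key:
  fixes h :: "'w \<Rightarrow> nat \<Rightarrow> real"
  assumes "\<And>v. v \<in> set xs \<Longrightarrow> (\<lambda>\<omega>. h \<omega> v) \<in> borel_measurable M"
  shows "(\<lambda>\<omega>. sort_key (h \<omega>) xs) \<in> measurable M (count_space UNIV)"
  using assms
proof (induction xs)
  case (Cons x xs)
  have ins: "(\<lambda>\<omega>. insort_key (h \<omega>) x ys) \<in> measurable M (count_space UNIV)"
    if "set ys \<subseteq> set xs" for ys
    using that
  proof (induction ys)
    case (Cons y ys)
    have [measurable]: "(\<lambda>\<omega>. h \<omega> x) \<in> borel_measurable M" "(\<lambda>\<omega>. h \<omega> y) \<in> borel_measurable M"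
      "(\<lambda>\<omega>. insort_key (h \<omega>) x ys) \<in> measurable M (count_space UNIV)"
      using Cons Cons.prems \<open>\<And>v. v \<in> set (x # xs) \<Longrightarrow> _\<close> by auto
    show ?case by simp
  qed simp
  have [measurable]: "(\<lambda>\<omega>. sort_key (h \<omega>) xs) \<in> measurable M (count_space UNIV)"
    using Cons by simp
  \<comment> \<open>Only the keys of elements of \<open>xs\<close> are known to be measurable, but
    countable composition asks for every list \<open>ys\<close>. The guard replaces the other lists
    by a constant and is always true on the list actually inserted into.\<close>
  have "(\<lambda>\<omega>. (if set ys \<subseteq> set xs then insort_key (h \<omega>) x ys else []))
      \<in> measurable M (count_space UNIV)" for ys
    using ins[of ys] by (cases "set ys \<subseteq> set xs") simp_all
  from measurable_compose_countable[where
      f = "\<lambda>ys \<omega>. if set ys \<subseteq> set xs then insort_key (h \<omega>) x ys else []", OF this,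
      of "\<lambda>\<omega>. sort_key (h \<omega>) xs"]
  show ?case by simp
qed simp

lemma measurable_neighbor_list:
  assumes "wf_graph G" "\<And>v. v \<in> set (vertices G) \<Longrightarrow> (\<lambda>\<omega>. h \<omega> v) \<in> borel_measurable M"
  shows "(\<lambda>\<omega>. neighbor_list G (h \<omega>) v) \<in> measurable M (count_space UNIV)"
proof -
  have "neighbors G v \<subseteq> set (vertices G)"
    using assms(1) by (auto simp: neighbors_def wf_graph_def)
  moreover from this have "finite (neighbors G v)" by (rule finite_subset) simp
  ultimately show ?thesis
    unfolding neighbor_list_def using assms(2) by (intro measurable_sort_key) auto
qed

lemma measurable_index [measurable]:
  "f \<in> borel_measurable M \<Longrightarrow> (\<lambda>\<omega>. index (f \<omega>)) \<in> measurable M (count_space UNIV)"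
  by measurable

text \<open>Stores carry no sigma-algebra here: each memory cell is required to be measurable
  separately, which is all that later reads need.\<close>

definition measurable_outcome :: "'w measure \<Rightarrow> ('w \<Rightarrow> bool \<times> nat \<times> store \<times> nat) \<Rightarrow> bool" where
  "measurable_outcome M A \<longleftrightarrow> (\<lambda>\<omega>. fst (A \<omega>)) \<in> measurable M (count_space UNIV)
    \<and> (\<lambda>\<omega>. fst (snd (A \<omega>))) \<in> measurable M (count_space UNIV)
    \<and> (\<forall>a i. (\<lambda>\<omega>. fst (snd (snd (A \<omega>))) a i) \<in> borel_measurable M)
    \<and> (\<lambda>\<omega>. snd (snd (snd (A \<omega>)))) \<in> measurable M (count_space UNIV)"

context
  fixes G :: graph and M :: "'w measure" and h r :: "'w \<Rightarrow> nat \<Rightarrow> real"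
  assumes wf: "wf_graph G"
    and h [measurable]: "\<And>v. v \<in> set (vertices G) \<Longrightarrow> (\<lambda>\<omega>. h \<omega> v) \<in> borel_measurable M"
    and r [measurable]: "\<And>i. (\<lambda>\<omega>. r \<omega> i) \<in> borel_measurable M"
begin

text \<open>Indices and query arguments are natural numbers, so a read at a random position is a
  countable composition of reads at fixed positions.\<close>

lemma measurable_eval_expr:
  assumes \<sigma>: "\<And>a i. (\<lambda>\<omega>. \<sigma> \<omega> a i) \<in> borel_measurable M"
  shows "(\<lambda>\<omega>. eval_expr G (h \<omega>) (\<sigma> \<omega>) e) \<in> borel_measurable M"
proof (induction e)
  case (Read a e)
  show ?case
    using measurable_compose_countable[of "\<lambda>i \<omega>. \<sigma> \<omega> a i" M borel "\<lambda>\<omega>. index (eval_expr G (h \<omega>) (\<sigma> \<omega>) e)"]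
      \<sigma> Read measurable_index[OF Read] by simp
next
  case (Unary f e)
  then show ?case by (cases f) simp_all
next
  case (Binary f e1 e2)
  then show ?case by (cases f) simp_all
next
  case (Vertex e)
  show ?case using measurable_compose_countable[of "\<lambda>i \<omega>. vertex_query G i" M borel, OF _ measurable_index[OF Vertex]]
    by simp
next
  case (Degree e)
  show ?case using measurable_compose_countable[of "\<lambda>i \<omega>. degree_query G i" M borel, OF _ measurable_index[OF Degree]]
    by simp
next
  case (Ident e)
  show ?case using measurable_compose_countable[of "\<lambda>i \<omega>. ident_query G i" M borel, OF _ measurable_index[OF Ident]]
    by simp
next
  case (Hash e)
  have "(\<lambda>\<omega>. hash_query G (h \<omega>) i) \<in> borel_measurable M" for i
    using h[of i] by (cases "i \<in> set (vertices G)") (simp_all add: hash_query_def)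
  from measurable_compose_countable[OF this measurable_index[OF Hash]]
  show ?case by simp
next
  case (Neighbor e1 e2)
  have "(\<lambda>\<omega>. neighbor_query G (h \<omega>) v i) \<in> borel_measurable M" for v i
  proof -
    have [measurable]: "(\<lambda>\<omega>. neighbor_list G (h \<omega>) v) \<in> measurable M (count_space UNIV)"
      by (rule measurable_neighbor_list[OF wf h])
    show ?thesis unfolding neighbor_query_def by measurable
  qed
  from measurable_compose_countable[OF this measurable_index[OF Neighbor(1)]]
  have "(\<lambda>\<omega>. neighbor_query G (h \<omega>) (index (eval_expr G (h \<omega>) (\<sigma> \<omega>) e1)) i) \<in> borel_measurable M" for i .
  from measurable_compose_countable[OF this measurable_index[OF Neighbor(2)]]
  show ?case by simp
qed simp

lemma measurable_update:
  assumes \<sigma>: "\<And>a i. (\<lambda>\<omega>. \<sigma> \<omega> a i) \<in> borel_measurable M"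
    and [measurable]: "(\<lambda>\<omega>. j \<omega>) \<in> measurable M (count_space UNIV)" "(\<lambda>\<omega>. x \<omega>) \<in> borel_measurable M"
  shows "(\<lambda>\<omega>. update (\<sigma> \<omega>) b (j \<omega>) (x \<omega>) a i) \<in> borel_measurable M"
proof -
  have [measurable]: "(\<lambda>\<omega>. \<sigma> \<omega> a i) \<in> borel_measurable M" by (rule \<sigma>)
  show ?thesis unfolding update_apply by measurable
qed

lemma measurable_outcome_if:
  assumes "measurable_outcome M A" "measurable_outcome M B" and [measurable]: "Measurable.pred M c"
  shows "measurable_outcome M (\<lambda>\<omega>. if c \<omega> then A \<omega> else B \<omega>)"
proof -
  have [measurable]: "(\<lambda>\<omega>. fst (A \<omega>)) \<in> measurable M (count_space UNIV)"
    "(\<lambda>\<omega>. fst (B \<omega>)) \<in> measurable M (count_space UNIV)"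
    "(\<lambda>\<omega>. fst (snd (A \<omega>))) \<in> measurable M (count_space UNIV)"
    "(\<lambda>\<omega>. fst (snd (B \<omega>))) \<in> measurable M (count_space UNIV)"
    "\<And>a i. (\<lambda>\<omega>. fst (snd (snd (A \<omega>))) a i) \<in> borel_measurable M"
    "\<And>a i. (\<lambda>\<omega>. fst (snd (snd (B \<omega>))) a i) \<in> borel_measurable M"
    "(\<lambda>\<omega>. snd (snd (snd (A \<omega>)))) \<in> measurable M (count_space UNIV)"
    "(\<lambda>\<omega>. snd (snd (snd (B \<omega>)))) \<in> measurable M (count_space UNIV)"
    using assms(1,2) unfolding measurable_outcome_def by auto
  show ?thesis
    unfolding measurable_outcome_def if_distrib[of fst] if_distrib[of snd] if_distribR
    by (intro conjI allI) measurable
qed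

lemma measurable_outcome_seq:
  assumes "measurable_outcome M A" "measurable_outcome M B"
  shows "measurable_outcome M (\<lambda>\<omega>. (fst (A \<omega>) \<and> fst (B \<omega>), c + fst (snd (A \<omega>)) + fst (snd (B \<omega>)), snd (snd (B \<omega>))))"
proof -
  have [measurable]: "(\<lambda>\<omega>. fst (A \<omega>)) \<in> measurable M (count_space UNIV)"
    "(\<lambda>\<omega>. fst (B \<omega>)) \<in> measurable M (count_space UNIV)"
    "(\<lambda>\<omega>. fst (snd (A \<omega>))) \<in> measurable M (count_space UNIV)"
    "(\<lambda>\<omega>. fst (snd (B \<omega>))) \<in> measurable M (count_space UNIV)"
    using assms unfolding measurable_outcome_def by auto
  show ?thesis
    using assms(2) unfolding measurable_outcome_def by simp
qed

lemma measurable_outcome_add: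
  assumes "measurable_outcome M A"
  shows "measurable_outcome M (\<lambda>\<omega>. (fst (A \<omega>), c + fst (snd (A \<omega>)), snd (snd (A \<omega>))))"
proof -
  have [measurable]: "(\<lambda>\<omega>. fst (snd (A \<omega>))) \<in> measurable M (count_space UNIV)"
    using assms unfolding measurable_outcome_def by auto
  show ?thesis
    using assms unfolding measurable_outcome_def by simp
qed

text \<open>The outer induction on the fuel serves loops, whose recursive calls have less of it; the
  inner induction on the program serves the constructs that pass the fuel on unchanged.\<close>

lemma measurable_run:
  assumes "\<And>a i. (\<lambda>\<omega>. \<sigma> \<omega> a i) \<in> borel_measurable M" "k \<in> measurable M (count_space UNIV)"
  shows "measurable_outcome M (\<lambda>\<omega>. run G (h \<omega>) (r \<omega>) f p (\<sigma> \<omega>) (k \<omega>))"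
  using assms
proof (induction f arbitrary: p \<sigma> k rule: less_induct)
  case (less f)
  from less.prems show ?case
  proof (induction p arbitrary: \<sigma> k)
    case Skip
    then show ?case by (simp add: measurable_outcome_def)
  next
    case (Write a i e)
    then show ?case
      by (auto simp: measurable_outcome_def
          intro!: measurable_update measurable_index measurable_eval_expr)
  next
    case (Random a i)
    note [measurable] = Random(2)
    have "(\<lambda>\<omega>. r \<omega> (k \<omega>)) \<in> borel_measurable M"
      using measurable_compose_countable[of "\<lambda>i \<omega>. r \<omega> i" M borel k, OF r Random(2)] by simp
    then show ?case using Random
      by (auto simp: measurable_outcome_def
          intro!: measurable_update measurable_index measurable_eval_expr)
  next
    case (Seq p q)
    note 1 = Seq(1)[OF Seq(3,4)]
    have 2: "measurable_outcome M (\<lambda>\<omega>. run G (h \<omega>) (r \<omega>) f q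
        (fst (snd (snd (run G (h \<omega>) (r \<omega>) f p (\<sigma> \<omega>) (k \<omega>)))))
        (snd (snd (snd (run G (h \<omega>) (r \<omega>) f p (\<sigma> \<omega>) (k \<omega>))))))"
      using 1 by (intro Seq(2)) (auto simp: measurable_outcome_def)
    show ?case using measurable_outcome_seq[OF 1 2, where c = 1] by (simp add: case_prod_unfold)
  next
    case (If e p q)
    have [measurable]: "(\<lambda>\<omega>. eval_expr G (h \<omega>) (\<sigma> \<omega>) e) \<in> borel_measurable M"
      using measurable_eval_expr If by blast
    show ?case
      unfolding run.simps case_prod_unfold prod.collapse
      by (intro measurable_outcome_if measurable_outcome_add If) measurable
  next
    case (While e p)
    show ?case
    proof (cases f)
      case 0
      then show ?thesis using While by (simp add: measurable_outcome_def)
    next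
      case (Suc f')
      have [measurable]: "(\<lambda>\<omega>. eval_expr G (h \<omega>) (\<sigma> \<omega>) e) \<in> borel_measurable M"
        using measurable_eval_expr While by blast
      have 1: "measurable_outcome M (\<lambda>\<omega>. run G (h \<omega>) (r \<omega>) f' p (\<sigma> \<omega>) (k \<omega>))"
        using less.IH[of f'] Suc While by blast
      have 2: "measurable_outcome M (\<lambda>\<omega>. run G (h \<omega>) (r \<omega>) f' (While e p)
          (fst (snd (snd (run G (h \<omega>) (r \<omega>) f' p (\<sigma> \<omega>) (k \<omega>)))))
          (snd (snd (snd (run G (h \<omega>) (r \<omega>) f' p (\<sigma> \<omega>) (k \<omega>))))))"
        using 1 Suc by (intro less.IH) (auto simp: measurable_outcome_def)
      have 3: "measurable_outcome M (\<lambda>\<omega>. (True, 1 + expr_cost e, \<sigma> \<omega>, k \<omega>))"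
        using While by (simp add: measurable_outcome_def)
      show ?thesis
        unfolding Suc run.simps case_prod_unfold prod.collapse
        by (intro measurable_outcome_if measurable_outcome_seq 1 2 3) measurable
    qed
  qed
qed

end

text \<open>The event is a countable union over the fuel. Its measurability is needed to pass to the
  complement in the time analysis.\<close>

lemma sets_rand_space_runs_in_time:
  assumes "wf_graph G"
  shows "{\<omega> \<in> space (rand_space G). runs_in_time p G s \<delta> \<omega> T} \<in> sets (rand_space G)"
proof -
  let ?R = "\<lambda>f \<omega>. run G (fst \<omega>) (snd \<omega>) f p (input_store (num_vertices G) s \<delta>) 0"
  have h: "(\<lambda>\<omega>. fst \<omega> v) \<in> borel_measurable (rand_space G)" if "v \<in> set (vertices G)" for v
    using that unfolding rand_space_def unif01_def by measurable
  have r: "(\<lambda>\<omega>. snd \<omega> i) \<in> borel_measurable (rand_space G)" for i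
    unfolding rand_space_def unif01_def by measurable
  have [measurable]: "(\<lambda>\<omega>. fst (?R f \<omega>)) \<in> measurable (rand_space G) (count_space UNIV)"
    "(\<lambda>\<omega>. fst (snd (?R f \<omega>))) \<in> measurable (rand_space G) (count_space UNIV)" for f
    using measurable_run[where h = fst and r = snd, OF assms h r, where \<sigma> = "\<lambda>_. input_store (num_vertices G) s \<delta>"
        and k = "\<lambda>_. 0" and f = f and p = p]
    unfolding measurable_outcome_def by simp_all
  have "runs_in_time p G s \<delta> \<omega> T \<longleftrightarrow> (\<exists>f. fst (?R f \<omega>) \<and> real (fst (snd (?R f \<omega>))) \<le> T)" for \<omega>
  proof
    assume "runs_in_time p G s \<delta> \<omega> T"
    then obtain t \<sigma> k where 1: "exec G (fst \<omega>) (snd \<omega>) (p, input_store (num_vertices G) s \<delta>, 0) t (\<sigma>, k)"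
      "real t \<le> T" unfolding runs_in_time_def by blast
    obtain f where "?R f \<omega> = (True, t, \<sigma>, k)" using exec_imp_run[OF 1(1)] by auto
    then show "\<exists>f. fst (?R f \<omega>) \<and> real (fst (snd (?R f \<omega>))) \<le> T" using 1(2) by (intro exI[of _ f]) simp
  next
    assume "\<exists>f. fst (?R f \<omega>) \<and> real (fst (snd (?R f \<omega>))) \<le> T"
    then obtain f where f: "fst (?R f \<omega>)" "real (fst (snd (?R f \<omega>))) \<le> T" by blast
    obtain b t \<sigma> k where R: "?R f \<omega> = (b, t, \<sigma>, k)" by (metis prod_cases4)
    then show "runs_in_time p G s \<delta> \<omega> T"
      using f run_imp_exec[of G "fst \<omega>" "snd \<omega>" f p _ 0 t \<sigma> k] unfolding runs_in_time_def by auto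
  qed
  then show ?thesis by simp
qed

subsection \<open>Decoding a hash value\<close>

text \<open>
  A uniform \<open>y\<close> encodes a sequence of independent bits with bias \<open>1 - q\<close>: the first bit is \<open>q < y\<close>,
  and \<open>y\<close> rescaled within the interval selected by this bit is uniform again.
\<close>

primrec act :: "real \<Rightarrow> real \<Rightarrow> nat \<Rightarrow> bool" where
  "act q y 0 \<longleftrightarrow> q < y"
| "act q y (Suc j) \<longleftrightarrow> act q (if q < y then (y - q) / (1 - q) else y / q) j"

text \<open>An inactive slot divides \<open>y\<close> by \<open>q\<close>, so \<open>g\<close>
  inactive slots in a row collapse into one division by \<open>q ^ g\<close>.\<close>

lemma act_skip:
  assumes q: "0 < q" "q < 1" and "y \<le> q ^ g"
  shows "(\<forall>i<g. \<not> act q y i) \<and> (\<forall>i. act q y (g + i) = act q (y / q ^ g) i)"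
  using assms(3)
proof (induction g arbitrary: y)
  case (Suc g)
  have "q ^ Suc g \<le> q" using q power_decreasing[of 1 "Suc g" q] by simp
  with Suc.prems have yq: "\<not> q < y" by simp
  have "y / q \<le> q ^ g" using Suc.prems q by (simp add: field_simps)
  note IH = Suc.IH[OF this]
  have "\<not> act q y i" if "i < Suc g" for i
    using that IH yq by (cases i) auto
  moreover have "act q y (Suc g + i) = act q (y / q ^ Suc g) i" for i
    using IH yq by (auto simp: field_simps)
  ultimately show ?case by blast
qed simp

text \<open>The number \<open>g\<close> is determined by \<open>q ^ Suc g < y \<le> q ^ g\<close>,
  so it is the exact length of the run of inactive slots before the next active one. Jumping over
  the run takes constant time, hence decoding is charged per active slot instead of per slot. The
  rescaled value lies in (0, 1] again, where the next logarithm is taken.\<close>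

lemma act_next:
  fixes q y :: real
  defines "g \<equiv> nat \<lfloor>ln y / ln q\<rfloor>"
  assumes q: "0 < q" "q < 1" and y: "0 < y" "y \<le> 1"
  shows "\<forall>i<g. \<not> act q y i" "act q y g"
    "\<And>i. act q y (Suc g + i) = act q ((y / q ^ g - q) / (1 - q)) i"
    "0 < (y / q ^ g - q) / (1 - q)" "(y / q ^ g - q) / (1 - q) \<le> 1"
    "real_of_int \<lfloor>ln y / ln q\<rfloor> = real g"
proof -
  have lq: "ln q < 0" using q by simp
  have ly: "ln y \<le> 0" using y by simp
  have nn: "0 \<le> ln y / ln q" using lq ly by (simp add: divide_nonpos_neg)
  then show g: "real_of_int \<lfloor>ln y / ln q\<rfloor> = real g" unfolding g_def by simp
  have "real g \<le> ln y / ln q" using g by linarith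
  then have "ln y \<le> real g * ln q" using lq by (simp add: field_simps)
  also have "\<dots> = ln (q ^ g)" using q by (simp add: ln_realpow)
  finally have 1: "y \<le> q ^ g" using q y by simp
  have "ln y / ln q < real g + 1" using g by linarith
  then have "real (Suc g) * ln q < ln y" using lq by (simp add: field_simps)
  then have "ln (q ^ Suc g) < ln y" using q by (simp add: ln_realpow del: power_Suc)
  then have 2: "q ^ Suc g < y" using q y by (simp del: power_Suc)
  have 3: "q < y / q ^ g" using 2 q by (simp add: field_simps)
  have 4: "y / q ^ g \<le> 1" using 1 q by simp
  note sk = act_skip[OF q 1]
  show "\<forall>i<g. \<not> act q y i" using sk by blast
  show "act q y g" using sk[THEN conjunct2, rule_format, of 0] 3 by simp
  show "act q y (Suc g + i) = act q ((y / q ^ g - q) / (1 - q)) i" for i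
    using sk[THEN conjunct2, rule_format, of "Suc i"] 3 by simp
  show "0 < (y / q ^ g - q) / (1 - q)" using 3 q by simp
  show "(y / q ^ g - q) / (1 - q) \<le> 1" using 4 q by (simp add: field_simps)
qed

lemma act_imp_gt_power:
  assumes q: "0 < q" "q < 1" and "act q y j" "j < J"
  shows "q ^ J < y"
proof (rule ccontr)
  assume "\<not> q ^ J < y"
  then have "y \<le> q ^ J" by simp
  from act_skip[OF q this] show False using assms by blast
qed

subsection \<open>The program\<close>

abbreviation var :: "string \<Rightarrow> expr" where "var x \<equiv> Read x (Const 0)"
abbreviation assign :: "string \<Rightarrow> expr \<Rightarrow> prog" (infix "::=" 63) where "x ::= e \<equiv> Write x (Const 0) e"
abbreviation seq :: "prog \<Rightarrow> prog \<Rightarrow> prog" (infixr "\<^bold>;" 62) where "p \<^bold>; q \<equiv> Seq p q"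
abbreviation plus_expr (infixl "\<^bold>+" 65) where "a \<^bold>+ b \<equiv> Binary Plus a b"
abbreviation minus_expr (infixl "\<^bold>-" 65) where "a \<^bold>- b \<equiv> Binary Minus a b"
abbreviation times_expr (infixl "\<^bold>*" 70) where "a \<^bold>* b \<equiv> Binary Times a b"
abbreviation divide_expr (infixl "\<^bold>'/" 70) where "a \<^bold>/ b \<equiv> Binary Divide a b"
abbreviation less_expr (infix "\<^bold><" 64) where "a \<^bold>< b \<equiv> Binary Less a b"

lemma wp_assign:
  "eval_expr G h \<sigma> e = x \<Longrightarrow> Q (2 + expr_cost e) (update \<sigma> a 0 x) k \<Longrightarrow> wp G h r (a ::= e) Q \<sigma> k"
  by (rule wp_Write) simp

text \<open>One uniform number does the work of two: the integer part of \<open>n * u\<close>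
  selects a vertex, and the fractional part is a fresh uniform number for the acceptance test, which
  truncates the degree at \<open>x\<close>.\<close>

definition estimate_round :: prog where
  "estimate_round =
    While (var ''i'' \<^bold>< var ''b'')
     (Random ''u'' (Const 0) \<^bold>;
      ''w'' ::= var ''n'' \<^bold>* var ''u'' \<^bold>;
      ''c'' ::= var ''c'' \<^bold>+ ((var ''w'' \<^bold>- Unary Floor (var ''w'')) \<^bold>* var ''x'' \<^bold>< Degree (Vertex (var ''w''))) \<^bold>;
      ''i'' ::= var ''i'' \<^bold>+ Const 1)"

text \<open>A trial hits with probability \<open>F x / (n * x)\<close> (\<open>measure_hit\<close>)
  and a round has \<open>40 * \<l> * n / x\<close> trials, so its mean count is 40 \<l> F(x) / x^2.
  Stopping at \<open>20 * \<l>\<close> tests whether F(x) exceeds x^2 / 2, with Chernoff exponents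
  proportional to \<open>\<l>\<close>.\<close>

definition estimate :: prog where
  "estimate =
    (''l'' ::= Unary Floor (Unary Ln (var ''n'' \<^bold>/ var ''delta'')) \<^bold>+ Const 1 \<^bold>;
     ''x'' ::= var ''n'' \<^bold>;
     ''b'' ::= Const 40 \<^bold>* var ''l'' \<^bold>;
     While (var ''c'' \<^bold>< Const 20 \<^bold>* var ''l'')
      (''c'' ::= Const 0 \<^bold>;
       ''i'' ::= Const 0 \<^bold>;
       estimate_round \<^bold>;
       ''x'' ::= var ''x'' \<^bold>/ Const 2 \<^bold>;
       ''b'' ::= Const 2 \<^bold>* var ''b''))"

text \<open>When the estimation loop ends, \<open>x\<close> has been halved once more after the decisive round: \<open>6 * x\<close> is \<open>3 * X g\<close>.\<close>

definition setup_params :: prog where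
  "setup_params =
    (''y'' ::= Const 6 \<^bold>* var ''x'' \<^bold>;
     ''th'' ::= var ''y'' \<^bold>/ Unary Exp (Unary Ln (var ''s'') \<^bold>/ Const 2) \<^bold>+ var ''y'' \<^bold>* var ''y'' \<^bold>/ var ''n'' \<^bold>;
     ''R'' ::= Const 8 \<^bold>* var ''l'' \<^bold>;
     ''J1'' ::= Unary Floor (Const 100000 \<^bold>* var ''s'' \<^bold>* (Unary Floor (Unary Ln (var ''n'')) \<^bold>+ Const 1)
        \<^bold>* var ''n'' \<^bold>* var ''th'' \<^bold>/ (var ''y'' \<^bold>* var ''y'')) \<^bold>+ Const 1 \<^bold>;
     ''i'' ::= Const 0)"

text \<open>Alternating draws fix the tape offset of entry \<open>i\<close> of \<open>S\<close> at
  \<open>2 * i\<close> and of \<open>A\<close> at \<open>2 * i + 1\<close>, whatever the number of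
  phases. The counter \<open>f\<close> survives between phases, so no entry is ever redrawn.\<close>

definition fill :: prog where
  "fill =
    While (var ''f'' \<^bold>< var ''T'' \<^bold>+ var ''J'' \<^bold>+ Const 1)
     (Random ''S'' (var ''f'') \<^bold>;
      Random ''A'' (var ''f'') \<^bold>;
      ''f'' ::= var ''f'' \<^bold>+ Const 1)"

text \<open>
  Cell \<open>j\<close> of \<open>H\<close> records which vertices were found active in slot \<open>j\<close>: \<open>0\<close> if none, \<open>w + 1\<close> if only \<open>w\<close>, and
  \<open>- 1\<close> if at least two.
\<close>

definition mark :: prog where
  "mark =
    If (Read ''H'' (var ''j''))
     (If (Read ''H'' (var ''j'') \<^bold>- (var ''w'' \<^bold>+ Const 1)) (Write ''H'' (var ''j'') (Const (- 1))) Skip)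
     (Write ''H'' (var ''j'') (var ''w'' \<^bold>+ Const 1))"

text \<open>The value decoded is 1 minus the hash: activity in one of the first slots then forces a
  small hash value, which is what sorted lists expose, and hash values in
  [0, 1) become arguments in (0, 1] for the logarithm. Powers of \<open>q\<close> are computed as
  exponentials.\<close>

definition decode :: prog where
  "decode =
    (''q'' ::= Const 1 \<^bold>/ (Const 1 \<^bold>+ Degree (var ''w'') \<^bold>/ (var ''n'' \<^bold>* var ''th'')) \<^bold>;
     ''z'' ::= Const 1 \<^bold>- Hash (var ''w'') \<^bold>;
     ''j'' ::= Const 0 \<^bold>;
     While (var ''j'' \<^bold>< var ''J'')
      (''m'' ::= Unary Floor (Unary Ln (var ''z'') \<^bold>/ Unary Ln (var ''q'')) \<^bold>;
       ''j'' ::= var ''j'' \<^bold>+ var ''m'' \<^bold>;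
       mark \<^bold>;
       ''z'' ::= (var ''z'' \<^bold>/ Unary Exp (var ''m'' \<^bold>* Unary Ln (var ''q'')) \<^bold>- var ''q'') \<^bold>/ (Const 1 \<^bold>- var ''q'') \<^bold>;
       ''j'' ::= var ''j'' \<^bold>+ Const 1))"

text \<open>Cell \<open>w\<close> of \<open>K\<close> holds the last phase in which \<open>w\<close>
  was decoded, initially 0. A vertex met on many lists is thus decoded only once per phase.\<close>

definition visit :: prog where
  "visit =
    If ((Read ''K'' (var ''w'') \<^bold>< var ''k'') \<^bold>* (var ''th'' \<^bold>< Degree (var ''w'')))
     (Write ''K'' (var ''w'') (var ''k'') \<^bold>; decode) Skip"

text \<open>A conjunction is a product of truth values, so both factors are evaluated. At
  \<open>e = d\<close> the neighbor query answers -1 and the hash read with it is meaningless, but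
  then the first factor is 0.\<close>

definition enumerate :: prog where
  "enumerate =
    (''e'' ::= Const 0 \<^bold>;
     While ((var ''e'' \<^bold>< var ''d'') \<^bold>* (Hash (Neighbor (var ''u'') (var ''e'')) \<^bold>< var ''p''))
      (''w'' ::= Neighbor (var ''u'') (var ''e'') \<^bold>;
       visit \<^bold>;
       ''e'' ::= var ''e'' \<^bold>+ Const 1))"

text \<open>The \<open>t\<close>-th random vertex looks for degrees d up to 2 n Rk / t; for these,
  \<open>p\<close> is at least J d / (n th), below which lie the hash values of all such vertices
  that are active in the first \<open>J\<close> slots. The test on the degree of the random vertex
  itself discards hubs, whose lists would spoil the concentration of the cost;
  \<open>uncovered_vertex\<close> shows that enough neighbors of each heavy vertex remain.\<close>

definition search :: prog where
  "search =
    (''t'' ::= var ''Rk'' \<^bold>;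
     While (var ''t'' \<^bold>< var ''T'')
      (''t'' ::= var ''t'' \<^bold>+ Const 1 \<^bold>;
       ''u'' ::= Vertex (var ''n'' \<^bold>* Read ''S'' (var ''t'')) \<^bold>;
       ''d'' ::= Degree (var ''u'') \<^bold>;
       If (var ''d'' \<^bold>* var ''n'' \<^bold>* var ''R'' \<^bold>< Const 4 \<^bold>* var ''y'' \<^bold>* var ''y'' \<^bold>* var ''t'')
        (''p'' ::= Const 2 \<^bold>* var ''J'' \<^bold>* var ''Rk'' \<^bold>/ (var ''th'' \<^bold>* var ''t'') \<^bold>; enumerate) Skip))"

definition scan_slot :: prog where
  "scan_slot =
    (''a'' ::= Read ''A'' (var ''j'') \<^bold>;
     If (Read ''H'' (var ''j''))
      (''u'' ::= Read ''H'' (var ''j'') \<^bold>- Const 1 \<^bold>;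
       ''e'' ::= Degree (var ''u'') \<^bold>* var ''a'' \<^bold>;
       ''c'' ::= Const 0 \<^bold>< Read ''H'' (var ''j''))
      (''w'' ::= var ''n'' \<^bold>* var ''a'' \<^bold>;
       ''u'' ::= Vertex (var ''w'') \<^bold>;
       ''e'' ::= var ''th'' \<^bold>* (var ''w'' \<^bold>- Unary Floor (var ''w'')) \<^bold>;
       ''c'' ::= (var ''e'' \<^bold>< Degree (var ''u'')) \<^bold>* (Const 1 \<^bold>- (var ''th'' \<^bold>< Degree (var ''u'')))) \<^bold>;
     If (var ''c'')
      (Write ''src'' (var ''i'') (var ''u'') \<^bold>;
       Write ''dst'' (var ''i'') (Neighbor (var ''u'') (var ''e'')) \<^bold>;
       ''i'' ::= var ''i'' \<^bold>+ Const 1) Skip \<^bold>;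
     ''j'' ::= var ''j'' \<^bold>+ Const 1)"

definition scan :: prog where
  "scan =
    (''i'' ::= Const 0 \<^bold>;
     ''j'' ::= Const 0 \<^bold>;
     While ((var ''i'' \<^bold>< var ''s'') \<^bold>* (var ''j'' \<^bold>< var ''J'')) scan_slot)"

definition phase :: prog where
  "phase =
    (''k'' ::= var ''k'' \<^bold>+ Const 1 \<^bold>;
     ''J'' ::= var ''J'' \<^bold>+ var ''J1'' \<^bold>;
     ''Rk'' ::= var ''Rk'' \<^bold>+ var ''R'' \<^bold>;
     ''T'' ::= Unary Floor (Const 2 \<^bold>* var ''n'' \<^bold>* var ''Rk'' \<^bold>/ var ''th'') \<^bold>+ Const 1 \<^bold>;
     fill \<^bold>; search \<^bold>; scan)"

definition sampler :: prog where
  "sampler =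
    (estimate \<^bold>; setup_params \<^bold>;
     While ((var ''i'' \<^bold>< var ''s'') \<^bold>* (var ''k'' \<^bold>< var ''l'')) phase)"

subsection \<open>Parameters of a run\<close>

definition hval :: "nat set \<Rightarrow> real" where
  "hval B = (if B = {} then 0 else if \<exists>w. B = {w} then real (the_elem B) + 1 else - 1)"

text \<open>The code of \<open>insert w B\<close> is a function of \<open>w\<close> and the code of
  \<open>B\<close>, so \<open>mark\<close> maintains it without storing sets, and marking twice with
  the same vertex is harmless.\<close>

lemma hval_insert:
  "hval (insert w B) = (if hval B = 0 then real w + 1 else if hval B = real w + 1 then real w + 1 else - 1)"
proof -
  consider "B = {}" | "B = {w}" | v where "B = {v}" "v \<noteq> w" | "B \<noteq> {}" "\<nexists>v. B = {v}" by blast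
  then show ?thesis
  proof cases
    case 3
    then have "\<nexists>x. insert w B = {x}" by auto
    with 3 show ?thesis by (auto simp: hval_def)
  next
    case 4
    then have "\<nexists>x. insert w B = {x}" by (metis insert_eq_iff subset_singletonD subset_insertI)
    with 4 show ?thesis by (auto simp: hval_def)
  qed (auto simp: hval_def)
qed

locale edge_sampler =
  fixes G :: graph and s :: nat and \<delta> :: real
  assumes valid: "valid_input G s \<delta>"
begin

abbreviation n :: nat where "n \<equiv> num_vertices G"
abbreviation m :: nat where "m \<equiv> num_edges G"
abbreviation V :: "nat set" where "V \<equiv> set (vertices G)"
abbreviation N :: "nat \<Rightarrow> nat set" where "N \<equiv> neighbors G"
abbreviation deg :: "nat \<Rightarrow> nat" where "deg v \<equiv> card (N v)"

definition \<l> :: nat where "\<l> = nat \<lfloor>ln (real n / \<delta>)\<rfloor> + 1"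
definition \<nu> :: nat where "\<nu> = nat \<lfloor>ln (real n)\<rfloor> + 1"

definition pick :: "real \<Rightarrow> nat" where "pick a = vertices G ! nat \<lfloor>real n * a\<rfloor>"

definition hit :: "real \<Rightarrow> real \<Rightarrow> bool" where
  "hit x a \<longleftrightarrow> frac (real n * a) * x < real (deg (pick a))"

definition trials :: "nat \<Rightarrow> nat" where "trials g = 40 * \<l> * 2 ^ g"
definition pos :: "nat \<Rightarrow> nat" where "pos g = (\<Sum>i<g. trials i)"
definition X :: "nat \<Rightarrow> real" where "X g = real n / 2 ^ g"
definition cnt :: "(nat \<Rightarrow> real) \<Rightarrow> nat \<Rightarrow> nat" where
  "cnt r g = card {i. i < trials g \<and> hit (X g) (r (pos g + i))}"
definition stops :: "(nat \<Rightarrow> real) \<Rightarrow> nat \<Rightarrow> bool" where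
  "stops r g \<longleftrightarrow> 20 * \<l> \<le> cnt r g \<and> (\<forall>g'<g. cnt r g' < 20 * \<l>)"

lemma wf: "wf_graph G" and m1: "1 \<le> m" and s1: "1 \<le> s" and sn: "s \<le> n" and \<delta>0: "0 < \<delta>" and \<delta>1: "\<delta> < 1"
  using valid by (auto simp: valid_input_def)

lemma edgesD: "{u, v} \<in> edges G \<Longrightarrow> u \<in> V \<and> v \<in> V \<and> u \<noteq> v"
proof -
  assume "{u, v} \<in> edges G"
  then have "{u, v} \<subseteq> V" "card {u, v} = 2" using wf unfolding wf_graph_def by auto
  then show ?thesis by (cases "u = v") auto
qed

lemma N_subset: "N v \<subseteq> V" and N_self: "v \<notin> N v"
  using edgesD[of v] edgesD[of v v] by (auto simp: neighbors_def)

lemma finite_N [simp]: "finite (N v)"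
  using N_subset finite_subset by blast

lemma N_sym: "u \<in> N v \<longleftrightarrow> v \<in> N u"
  by (simp add: neighbors_def insert_commute)

lemma card_V: "card V = n"
  using wf by (simp add: wf_graph_def num_vertices_def distinct_card)

lemma n2: "2 \<le> n"
proof -
  have "edges G \<noteq> {}" using m1 by (auto simp: num_edges_def)
  then obtain e where "e \<in> edges G" by blast
  then have "e \<subseteq> V" "card e = 2" using wf unfolding wf_graph_def by auto
  then have "2 \<le> card V" using card_mono[of V e] by simp
  then show ?thesis using card_V by simp
qed

lemma deg_less: "v \<in> V \<Longrightarrow> deg v < n"
  using psubset_card_mono[of V "N v"] N_subset[of v] N_self[of v] card_V by (auto simp: psubset_eq)

lemma pick_index:
  assumes "0 \<le> a" "a < 1" shows "nat \<lfloor>real n * a\<rfloor> < n"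
proof -
  have "real n * a < real n * 1" using n2 assms by (intro mult_strict_left_mono) auto
  then show ?thesis using assms n2 by (simp add: floor_less_iff nat_less_iff)
qed

lemma pick_in_V: "0 \<le> a \<Longrightarrow> a < 1 \<Longrightarrow> pick a \<in> V"
  using pick_index[of a] by (simp add: pick_def num_vertices_def)

lemma vertex_query_pick:
  "0 \<le> a \<Longrightarrow> a < 1 \<Longrightarrow> vertex_query G (index (real n * a)) = real (pick a)"
  using pick_index[of a] by (simp add: vertex_query_def pick_def)

lemma length_neighbor_list: "length (neighbor_list G h v) = deg v"
  by (simp add: neighbor_list_def)

lemma set_neighbor_list: "set (neighbor_list G h v) = N v"
  by (simp add: neighbor_list_def)

lemma distinct_neighbor_list: "distinct (neighbor_list G h v)"
  by (simp add: neighbor_list_def)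

lemma sorted_neighbor_list: "sorted (map h (neighbor_list G h v))"
  by (simp add: neighbor_list_def)

lemma \<l>_ge: "ln (real n / \<delta>) \<le> real \<l>" and \<l>_pos: "1 \<le> \<l>"
  unfolding \<l>_def by linarith+

lemma ln_n_pos: "0 < ln (real n)" and ln_n_le: "ln (real n) \<le> ln (real n / \<delta>)"
proof -
  show "0 < ln (real n)" using n2 by simp
  have "real n \<le> real n / \<delta>" using \<delta>0 \<delta>1 n2 by (simp add: field_simps)
  then show "ln (real n) \<le> ln (real n / \<delta>)" using n2 \<delta>0 by simp
qed

lemma \<l>_real: "real_of_int \<lfloor>ln (real n / \<delta>)\<rfloor> + 1 = real \<l>"
  unfolding \<l>_def using ln_n_pos ln_n_le by simp

lemma \<nu>_real: "real_of_int \<lfloor>ln (real n)\<rfloor> + 1 = real \<nu>"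
  unfolding \<nu>_def using ln_n_pos by simp

end

text \<open>The scale \<open>y\<close> is a free parameter: slots are analysed for a fixed scale.
  The random scale is handled by splitting according to the round \<open>g\<close> at which the
  estimate stops, where \<open>y = 3 * X g\<close>.\<close>

locale scaled_sampler = edge_sampler +
  fixes y :: real
  assumes y0: "0 < y"
begin

definition th :: real where "th = y / sqrt (real s) + y * y / real n"
definition R :: nat where "R = 8 * \<l>"
text \<open>A slot succeeds with probability \<open>2 * m * Z / (n * th)\<close>, so
  \<open>J1\<close> slots produce on average order of \<open>s * \<nu>\<close> successes once
  \<open>y * y\<close> is of order \<open>m\<close>. The factor is \<open>\<nu>\<close> and not
  \<open>\<l>\<close> because the search already contributes an \<open>\<l>\<close> through
  \<open>R\<close>. The constant is explained in \<open>incorrect_run\<close>.\<close>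

definition J1 :: nat where "J1 = nat \<lfloor>100000 * real s * real \<nu> * real n * th / (y * y)\<rfloor> + 1"
text \<open>A vertex of degree d is sought at indices up to 2 n k R / d, and heavy vertices have d >
  th.\<close>

definition T :: "nat \<Rightarrow> nat" where "T k = nat \<lfloor>2 * real n * real (k * R) / th\<rfloor> + 1"
text \<open>The probability of being inactive in a slot; the odds \<open>(1 - q v) / q v\<close> are
  \<open>deg v / (n * th)\<close>.\<close>

definition q :: "nat \<Rightarrow> real" where "q v = 1 / (1 + real (deg v) / (real n * th))"
definition active :: "(nat \<Rightarrow> real) \<Rightarrow> nat \<Rightarrow> nat set" where
  "active h j = {v \<in> V. th < real (deg v) \<and> act (q v) (1 - h v) j}"

definition slot :: "nat set \<Rightarrow> (nat \<Rightarrow> real) \<Rightarrow> real \<Rightarrow> (nat \<times> nat) option" where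
  "slot B h a =
    (if B = {} then
       let u = pick a; e = th * frac (real n * a) in
       if e < real (deg u) \<and> real (deg u) \<le> th then Some (u, neighbor_list G h u ! nat \<lfloor>e\<rfloor>) else None
     else if \<exists>w. B = {w} then
       let w = the_elem B in Some (w, neighbor_list G h w ! nat \<lfloor>real (deg w) * a\<rfloor>)
     else None)"

definition sample :: "(nat \<Rightarrow> real) \<Rightarrow> nat \<Rightarrow> nat \<Rightarrow> nat" where "sample r b t = pick (r (b + 2 * t))"

definition capped :: "(nat \<Rightarrow> real) \<Rightarrow> nat \<Rightarrow> nat \<Rightarrow> bool" where
  "capped r b t \<longleftrightarrow> real (deg (sample r b t)) * real n * real R < 4 * y * y * real t"

definition hash_bound :: "nat \<Rightarrow> nat \<Rightarrow> real" where
  "hash_bound k t = 2 * real (k * J1) * real (k * R) / (th * real t)"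

definition enumeration_cost :: "(nat \<Rightarrow> real) \<Rightarrow> (nat \<Rightarrow> real) \<Rightarrow> nat \<Rightarrow> nat \<Rightarrow> nat" where
  "enumeration_cost h r b k = (\<Sum>t\<in>{k * R<..T k}.
     if capped r b t then card {w \<in> N (sample r b t). h w < hash_bound k t} else 0)"

definition activation_cost :: "(nat \<Rightarrow> real) \<Rightarrow> nat \<Rightarrow> nat" where
  "activation_cost h k = (\<Sum>j<k * J1. card (active h j))"

text \<open>A condition on the tape alone. The bound on \<open>deg v * t\<close> makes
  \<open>hash_bound k t\<close> large enough for every hash value that activates \<open>v\<close> in
  the first \<open>k * J1\<close> slots (\<open>active_hash_less\<close>), so hash values need not
  be mentioned.\<close>

definition covers :: "(nat \<Rightarrow> real) \<Rightarrow> nat \<Rightarrow> nat \<Rightarrow> bool" where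
  "covers r b k \<longleftrightarrow> (\<forall>v\<in>V. th < real (deg v) \<longrightarrow>
     (\<exists>t\<in>{k * R<..T k}. capped r b t \<and> v \<in> N (sample r b t) \<and> deg v * t \<le> 2 * n * (k * R)))"

lemma th0: "0 < th"
proof -
  have "0 < y / sqrt (real s)" using y0 s1 by simp
  moreover have "0 \<le> y * y / real n" by simp
  ultimately show ?thesis unfolding th_def by linarith
qed

lemma q_bounds: assumes "0 < deg v" shows "0 < q v" "q v < 1"
proof -
  have "0 < real (deg v) / (real n * th)" using assms n2 th0 by simp
  then show "0 < q v" "q v < 1" unfolding q_def by (auto simp: field_simps)
qed

lemma J1_real: "real_of_int \<lfloor>100000 * real s * real \<nu> * real n * th / (y * y)\<rfloor> + 1 = real J1"
  unfolding J1_def using th0 y0 by simp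

lemma T_real: "real_of_int \<lfloor>2 * real n * real (k * R) / th\<rfloor> + 1 = real (T k)"
  unfolding T_def using th0 by (simp del: of_nat_mult)

end

locale sampler_run = scaled_sampler +
  fixes h r :: "nat \<Rightarrow> real" and base :: nat
  assumes h: "v \<in> V \<Longrightarrow> 0 \<le> h v \<and> h v < 1" and r: "0 \<le> r i \<and> r i < 1"
begin

abbreviation u :: "nat \<Rightarrow> nat" where "u \<equiv> sample r base"
abbreviation cap :: "nat \<Rightarrow> bool" where "cap \<equiv> capped r base"
abbreviation p :: "nat \<Rightarrow> nat \<Rightarrow> real" where "p \<equiv> hash_bound"
abbreviation enum_cost :: "nat \<Rightarrow> nat" where "enum_cost \<equiv> enumeration_cost h r base"
abbreviation act_cost :: "nat \<Rightarrow> nat" where "act_cost \<equiv> activation_cost h"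
abbreviation covered :: "nat \<Rightarrow> bool" where "covered \<equiv> covers r base"

definition a :: "nat \<Rightarrow> real" where "a j = r (base + 2 * j + 1)"
definition successes :: "(nat \<Rightarrow> nat set) \<Rightarrow> nat \<Rightarrow> (nat \<times> nat) list" where
  "successes B J = List.map_filter (\<lambda>j. slot (B j) h (a j)) [0..<J]"

definition params :: "store \<Rightarrow> bool" where
  "params \<sigma> \<longleftrightarrow> \<sigma> ''n'' 0 = real n \<and> \<sigma> ''s'' 0 = real s \<and> \<sigma> ''l'' 0 = real \<l> \<and> \<sigma> ''y'' 0 = y
     \<and> \<sigma> ''th'' 0 = th \<and> \<sigma> ''R'' 0 = real R \<and> \<sigma> ''J1'' 0 = real J1"

lemma wp_mark:
  assumes H: "\<sigma> ''H'' = (\<lambda>j. hval (B j))" and j: "\<sigma> ''j'' 0 = real j" and w: "\<sigma> ''w'' 0 = real w"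
    and Q: "\<And>t \<sigma>'. t \<le> 24 \<Longrightarrow> (\<And>a. a \<noteq> ''H'' \<Longrightarrow> \<sigma>' a = \<sigma> a) \<Longrightarrow>
      \<sigma>' ''H'' = (\<lambda>i. hval (if i = j then insert w (B i) else B i)) \<Longrightarrow> Q t \<sigma>' k"
  shows "wp G h r mark Q \<sigma> k"
proof -
  have upd: "(\<sigma> ''H'')(j := hval (insert w (B j))) = (\<lambda>i. hval (if i = j then insert w (B i) else B i))"
    using H by auto
  have upd': "\<sigma> ''H'' = (\<lambda>i. hval (if i = j then insert w (B i) else B i))"
    if "hval (B j) = real w + 1"
  proof
    fix i
    show "\<sigma> ''H'' i = hval (if i = j then insert w (B i) else B i)"
      using that hval_insert[of w "B j"] by (cases "i = j") (auto simp: H)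
  qed
  show ?thesis
    unfolding mark_def
    apply (rule wp_If)
     apply (rule wp_If)
      apply (rule wp_Write, rule Q)
    subgoal by simp
    subgoal by (simp add: update_def)
    subgoal using upd hval_insert[of w "B j"] H j w by (simp add: update_def)
     apply (rule wp_Skip, rule Q)
    subgoal by simp
    subgoal by simp
    subgoal using upd' H j w by simp
    apply (rule wp_Write, rule Q)
    subgoal by simp
    subgoal by (simp add: update_def)
    subgoal using upd hval_insert[of w "B j"] H j w by (simp add: update_def add.commute)
    done
qed

end

subsection \<open>Verification of the program\<close>

context sampler_run
begin

text \<open>The loop marks every slot it jumps to, including a last one that may lie beyond
  \<open>J\<close>. Therefore \<open>P\<close> is only known to lie between the active slots below
  \<open>J\<close> and all active slots; the surplus mark is still a correct one.\<close>

lemma wp_decode: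
  assumes par: "params \<sigma>" and J: "\<sigma> ''J'' 0 = real J" and w: "\<sigma> ''w'' 0 = real w" "w \<in> V" "th < real (deg w)"
    and H: "\<sigma> ''H'' = (\<lambda>j. hval (B j))"
    and Q: "\<And>t \<sigma>' P. t \<le> 200 * (1 + card {i. i < J \<and> act (q w) (1 - h w) i}) \<Longrightarrow>
      (\<And>a. a \<notin> {''q'', ''z'', ''j'', ''m'', ''H''} \<Longrightarrow> \<sigma>' a = \<sigma> a) \<Longrightarrow>
      {i. i < J \<and> act (q w) (1 - h w) i} \<subseteq> P \<Longrightarrow> P \<subseteq> {i. act (q w) (1 - h w) i} \<Longrightarrow>
      \<sigma>' ''H'' = (\<lambda>i. hval (if i \<in> P then insert w (B i) else B i)) \<Longrightarrow> Q t \<sigma>' k"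
  shows "wp G h r decode Q \<sigma> k"
proof -
  let ?act = "act (q w) (1 - h w)"
  \<comment> \<open>The summand 1 pays for the final jump, which may leave the range without meeting
    another active slot in it.\<close>
  let ?rest = "\<lambda>j. card {i. j \<le> i \<and> i < J \<and> ?act i} + (if j < J then 1 else 0)"
  have dw: "0 < deg w" using w th0 by (cases "deg w = 0") auto
  note qb = q_bounds[OF dw]
  define I where "I = (\<lambda>c \<sigma>' k'. k' = k \<and> (\<forall>a. a \<notin> {''q'', ''z'', ''j'', ''m'', ''H''} \<longrightarrow> \<sigma>' a = \<sigma> a) \<and>
    \<sigma>' ''q'' 0 = q w \<and> (\<exists>j z. \<sigma>' ''j'' 0 = real j \<and> \<sigma>' ''z'' 0 = z \<and> 0 < z \<and> z \<le> 1 \<and>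
      (\<forall>i. act (q w) z i = ?act (j + i)) \<and>
      \<sigma>' ''H'' = (\<lambda>i. hval (if i < j \<and> ?act i then insert w (B i) else B i)) \<and>
      c = 100 * ?rest j + 20))"
  have step: "wp G h r
      (''m'' ::= Unary Floor (Unary Ln (var ''z'') \<^bold>/ Unary Ln (var ''q'')) \<^bold>;
       ''j'' ::= var ''j'' \<^bold>+ var ''m'' \<^bold>;
       mark \<^bold>;
       ''z'' ::= (var ''z'' \<^bold>/ Unary Exp (var ''m'' \<^bold>* Unary Ln (var ''q'')) \<^bold>- var ''q'') \<^bold>/ (Const 1 \<^bold>- var ''q'') \<^bold>;
       ''j'' ::= var ''j'' \<^bold>+ Const 1)
      (\<lambda>t \<sigma>' k'. \<exists>c'. c' + t + 1 + expr_cost (var ''j'' \<^bold>< var ''J'') \<le> c \<and> I c' \<sigma>' k') \<sigma>1 k1"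
    if I1: "I c \<sigma>1 k1" and b: "eval_expr G h \<sigma>1 (var ''j'' \<^bold>< var ''J'') \<noteq> 0" for c \<sigma>1 k1
  proof -
    obtain j z where k1: "k1 = k" and fr: "\<And>a. a \<notin> {''q'', ''z'', ''j'', ''m'', ''H''} \<Longrightarrow> \<sigma>1 a = \<sigma> a"
      and q1: "\<sigma>1 ''q'' 0 = q w" and j: "\<sigma>1 ''j'' 0 = real j" and z: "\<sigma>1 ''z'' 0 = z" "0 < z" "z \<le> 1"
      and az: "\<And>i. act (q w) z i = ?act (j + i)"
      and H1: "\<sigma>1 ''H'' = (\<lambda>i. hval (if i < j \<and> ?act i then insert w (B i) else B i))"
      and c: "c = 100 * ?rest j + 20"
      using I1 unfolding I_def by blast
    have J1': "\<sigma>1 ''J'' = \<sigma> ''J''" "\<sigma>1 ''w'' = \<sigma> ''w''" by (rule fr, simp)+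
    have jJ: "j < J" using b j J J1' by (simp split: if_splits)
    define g where "g = nat \<lfloor>ln z / ln (q w)\<rfloor>"
    note nx = act_next[OF qb z(2,3), folded g_def]
    define z' where "z' = (z / q w ^ g - q w) / (1 - q w)"
    have eg: "exp (real g * ln (q w)) = q w ^ g" using qb by (simp add: exp_of_nat_mult)
    have none: "\<not> ?act i" if "j \<le> i" "i < j + g" for i
      using nx(1) az[of "i - j"] that by auto
    have yes: "?act (j + g)" using nx(2) az by blast
    have after: "act (q w) z' i = ?act (Suc (j + g) + i)" for i
      using nx(3)[of i] az[of "Suc g + i"] by (simp add: z'_def add.assoc)
    have rest: "?rest (Suc (j + g)) + 1 \<le> ?rest j"
    proof (cases "j + g < J")
      case True
      have "insert (j + g) {i. Suc (j + g) \<le> i \<and> i < J \<and> ?act i} \<subseteq> {i. j \<le> i \<and> i < J \<and> ?act i}"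
        using True yes by auto
      from card_mono[OF _ this] have "Suc (card {i. Suc (j + g) \<le> i \<and> i < J \<and> ?act i})
          \<le> card {i. j \<le> i \<and> i < J \<and> ?act i}" by simp
      then show ?thesis using jJ by simp
    next
      case False
      then have "{i. Suc (j + g) \<le> i \<and> i < J \<and> ?act i} = {}" by auto
      then have *: "card {i. Suc (j + g) \<le> i \<and> i < J \<and> ?act i} = 0" by (simp only: card.empty)
      show ?thesis unfolding * using jJ False by simp
    qed
    have Hc: "(\<lambda>i. hval (if i = j + g then insert w (if i < j \<and> ?act i then insert w (B i) else B i)
          else if i < j \<and> ?act i then insert w (B i) else B i))
        = (\<lambda>i. hval (if i < Suc (j + g) \<and> ?act i then insert w (B i) else B i))"
    proof
      fix i
      consider "i < j" | "j \<le> i" "i < j + g" | "i = j + g" | "j + g < i" by linarith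
      then show "hval (if i = j + g then insert w (if i < j \<and> ?act i then insert w (B i) else B i)
          else if i < j \<and> ?act i then insert w (B i) else B i)
        = hval (if i < Suc (j + g) \<and> ?act i then insert w (B i) else B i)"
        by cases (use none yes in auto)
    qed
    define \<sigma>2 where "\<sigma>2 = update (update \<sigma>1 ''m'' 0 (real g)) ''j'' 0 (real (j + g))"
    show ?thesis
      apply (rule wp_Seq, rule wp_Write)
      apply (rule wp_Seq, rule wp_Write)
      apply (rule wp_Seq)
      apply (rule wp_mark[where B = "\<lambda>i. if i < j \<and> ?act i then insert w (B i) else B i" and j = "j + g" and w = w])
      subgoal using H1 by (simp add: update_def)
      subgoal using j z q1 nx(6) by (simp add: update_def)
      subgoal using w J1' by (simp add: update_def)
      subgoal premises prems for t \<sigma>'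
      proof -
        have fr2: "\<sigma>' b i = update (update \<sigma>1 ''m'' 0 (real g)) ''j'' 0 (real (j + g)) b i" if "b \<noteq> ''H''" for b i
          using prems(2)[OF that] j z q1 nx(6) by (simp add: update_apply)
        have v: "\<sigma>' ''m'' 0 = real g" "\<sigma>' ''j'' 0 = real (j + g)" "\<sigma>' ''z'' 0 = z" "\<sigma>' ''q'' 0 = q w"
          using fr2 z q1 by (simp_all add: update_apply)
        have fr3: "\<sigma>' b = \<sigma> b" if "b \<notin> {''q'', ''z'', ''j'', ''m'', ''H''}" for b
        proof
          fix i show "\<sigma>' b i = \<sigma> b i" using that fr2[of b i] fr[of b] by (auto simp: update_apply)
        qed
        show ?thesis
          apply (rule wp_Seq, rule wp_Write, rule wp_Write)
          apply (rule exI[of _ "100 * ?rest (Suc (j + g)) + 20"])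
          apply (rule conjI)
          subgoal using rest prems(1) c by simp
          subgoal
            unfolding I_def
            apply (intro conjI)
            subgoal by (rule k1)
            subgoal using fr3 by (auto simp: update_def)
            subgoal using v by (simp add: update_apply)
            apply (rule exI[of _ "Suc (j + g)"], rule exI[of _ z'], intro conjI)
            subgoal using v by (simp add: update_apply)
            subgoal using v eg by (simp add: update_apply z'_def)
            subgoal using nx(4) by (simp add: z'_def)
            subgoal using nx(5) by (simp add: z'_def)
            subgoal using after by simp
            subgoal using prems(3) Hc by (simp add: update_def)
            subgoal by simp
            done
          done
      qed
      done
  qed
  have I0: "I (100 * ?rest 0 + 20) (update (update (update \<sigma> ''q'' 0 (q w)) ''z'' 0 (1 - h w)) ''j'' 0 0) k"
    unfolding I_def using h[OF w(2)] H by (auto simp: update_def)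
  have e: "index (real_of_int 0) = 0" by simp
  have ev: "eval_expr G h \<sigma> (Const 1 \<^bold>/ (Const 1 \<^bold>+ Degree (var ''w'') \<^bold>/ (var ''n'' \<^bold>* var ''th''))) = q w"
    using par w by (simp add: params_def degree_query_def q_def)
  show ?thesis
    unfolding decode_def
    apply (rule wp_Seq, rule wp_Write)
    apply (rule wp_Seq, rule wp_Write)
    apply (rule wp_Seq, rule wp_Write)
    apply (rule wp_While[where I = I and c = "100 * ?rest 0 + 20"])
    subgoal by (rule step)
    subgoal using I0 ev w by (simp add: hash_query_def update_apply)
    subgoal premises prems for t c' \<sigma>' k'
    proof -
      obtain j where k1: "k' = k" and fr: "\<And>a. a \<notin> {''q'', ''z'', ''j'', ''m'', ''H''} \<Longrightarrow> \<sigma>' a = \<sigma> a"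
        and j: "\<sigma>' ''j'' 0 = real j"
        and H1: "\<sigma>' ''H'' = (\<lambda>i. hval (if i < j \<and> ?act i then insert w (B i) else B i))"
        and c: "c' = 100 * ?rest j + 20"
        using prems(2) unfolding I_def by blast
      have "\<sigma>' ''J'' = \<sigma> ''J''" by (rule fr) simp
      then have jJ: "J \<le> j" using prems(3) j J by (simp split: if_splits)
      have tt: "t \<le> 100 * (card {i. i < J \<and> ?act i} + 1) + 20"
        using prems(1) c by (auto split: if_splits)
      show ?thesis unfolding k1
        apply (rule Q[where P = "{i. i < j \<and> ?act i}"])
        subgoal using tt by simp
        subgoal by (rule fr)
        subgoal using jJ by auto
        subgoal by auto
        subgoal using H1 by simp
        done
    qed
    done
qed

text \<open>The sums are a potential, the decoding work still outstanding in this phase: decoding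
  \<open>w\<close> costs in proportion to the share of \<open>w\<close>, and setting its cell of
  \<open>K\<close> removes that share. Repeated visits therefore pay only a constant each.\<close>

lemma wp_visit:
  assumes par: "params \<sigma>" and J: "\<sigma> ''J'' 0 = real J" and w: "\<sigma> ''w'' 0 = real w" "w \<in> V"
    and k: "\<sigma> ''k'' 0 = real k"
    and H: "\<sigma> ''H'' = (\<lambda>j. hval (B j))" and B: "\<And>j. B j \<subseteq> active h j"
    and vis: "\<And>v j. v \<in> V \<Longrightarrow> \<sigma> ''K'' v \<ge> real k \<Longrightarrow> v \<in> active h j \<Longrightarrow> j < J \<Longrightarrow> v \<in> B j"
    and Q: "\<And>t \<sigma>' B'. t + 200 * (\<Sum>v | v \<in> V \<and> \<sigma>' ''K'' v < real k. card {j. j < J \<and> v \<in> active h j})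
          \<le> 300 + 200 * (\<Sum>v | v \<in> V \<and> \<sigma> ''K'' v < real k. card {j. j < J \<and> v \<in> active h j}) \<Longrightarrow>
      (\<And>a. a \<notin> {''q'', ''z'', ''j'', ''m'', ''H'', ''K''} \<Longrightarrow> \<sigma>' a = \<sigma> a) \<Longrightarrow>
      \<sigma>' ''H'' = (\<lambda>j. hval (B' j)) \<Longrightarrow> (\<And>j. B' j \<subseteq> active h j) \<Longrightarrow>
      (\<And>v. \<sigma> ''K'' v \<ge> real k \<Longrightarrow> \<sigma>' ''K'' v \<ge> real k) \<Longrightarrow>
      (\<And>v j. v \<in> V \<Longrightarrow> \<sigma>' ''K'' v \<ge> real k \<Longrightarrow> v \<in> active h j \<Longrightarrow> j < J \<Longrightarrow> v \<in> B' j) \<Longrightarrow>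
      (th < real (deg w) \<Longrightarrow> \<sigma>' ''K'' w \<ge> real k) \<Longrightarrow>
      (\<And>v. \<sigma>' ''K'' v = \<sigma> ''K'' v \<or> \<sigma>' ''K'' v = real k) \<Longrightarrow> Q t \<sigma>' ks"
  shows "wp G h r visit Q \<sigma> ks"
proof -
  let ?f = "\<lambda>v. card {j. j < J \<and> v \<in> active h j}"
  have p: "\<sigma> ''th'' 0 = th" using par by (simp add: params_def)
  have dw: "degree_query G w = real (deg w)" using w by (simp add: degree_query_def)
  show ?thesis
    unfolding visit_def
  proof (rule wp_If)
    assume b: "eval_expr G h \<sigma> ((Read ''K'' (var ''w'') \<^bold>< var ''k'') \<^bold>* (var ''th'' \<^bold>< Degree (var ''w''))) \<noteq> 0"
    have Kw: "\<sigma> ''K'' w < real k" and hw: "th < real (deg w)"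
      using b w k p dw by (auto split: if_splits)
    define \<sigma>1 where "\<sigma>1 = update \<sigma> ''K'' w (real k)"
    have s1: "update \<sigma> ''K'' (index (eval_expr G h \<sigma> (var ''w''))) (eval_expr G h \<sigma> (var ''k'')) = \<sigma>1"
      using w k by (simp add: \<sigma>1_def)
    have aw: "{i. i < J \<and> act (q w) (1 - h w) i} = {j. j < J \<and> w \<in> active h j}"
      using w hw by (auto simp: active_def)
    have set1: "{v. v \<in> V \<and> \<sigma> ''K'' v < real k} = insert w {v. v \<in> V \<and> \<sigma>1 ''K'' v < real k}"
      using w Kw by (auto simp: \<sigma>1_def update_apply)
    have sum1: "(\<Sum>v | v \<in> V \<and> \<sigma> ''K'' v < real k. ?f v) = ?f w + (\<Sum>v | v \<in> V \<and> \<sigma>1 ''K'' v < real k. ?f v)"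
      unfolding set1 by (subst sum.insert) (auto simp: \<sigma>1_def update_apply)
    show "wp G h r (Write ''K'' (var ''w'') (var ''k'') \<^bold>; decode)
      (\<lambda>t. Q (1 + expr_cost ((Read ''K'' (var ''w'') \<^bold>< var ''k'') \<^bold>* (var ''th'' \<^bold>< Degree (var ''w''))) + t)) \<sigma> ks"
      apply (rule wp_Seq, rule wp_Write, unfold s1)
      apply (rule wp_decode[where J = J and w = w and B = B])
      subgoal using par by (simp add: params_def \<sigma>1_def update_apply)
      subgoal using J by (simp add: \<sigma>1_def update_apply)
      subgoal using w by (simp add: \<sigma>1_def update_apply)
      subgoal by (rule w)
      subgoal by (rule hw)
      subgoal using H by (simp add: \<sigma>1_def update_def)
      subgoal premises prems for t \<sigma>' P
      proof -
        have K': "\<sigma>' ''K'' = \<sigma>1 ''K''" by (rule prems(2)) simp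
        show ?thesis
          apply (rule Q[where B' = "\<lambda>i. if i \<in> P then insert w (B i) else B i"])
          subgoal unfolding K' sum1 using prems(1) unfolding aw by simp
          subgoal for b using prems(2)[of b] by (simp add: \<sigma>1_def update_def)
          subgoal using prems(5) by simp
          subgoal for j using B[of j] prems(4) w hw by (auto simp: active_def)
          subgoal for v unfolding K' by (simp add: \<sigma>1_def update_apply)
          subgoal for v j
            using vis[of v j] prems(3) unfolding K' aw by (auto simp: \<sigma>1_def update_apply split: if_splits)
          subgoal unfolding K' by (simp add: \<sigma>1_def update_apply)
          subgoal unfolding K' by (simp add: \<sigma>1_def update_apply)
          done
      qed
      done
  next
    assume b: "eval_expr G h \<sigma> ((Read ''K'' (var ''w'') \<^bold>< var ''k'') \<^bold>* (var ''th'' \<^bold>< Degree (var ''w''))) = 0"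
    have "th < real (deg w) \<Longrightarrow> real k \<le> \<sigma> ''K'' w" using b w k p dw by (auto split: if_splits)
    then show "wp G h r Skip
      (\<lambda>t. Q (1 + expr_cost ((Read ''K'' (var ''w'') \<^bold>< var ''k'') \<^bold>* (var ''th'' \<^bold>< Degree (var ''w''))) + t)) \<sigma> ks"
      using H B vis by (intro wp_Skip Q[where B' = B]) auto
  qed
qed

text \<open>Soundness is required in all slots, completeness only for the visited vertices. The
  bound on \<open>K\<close> makes every vertex count as unvisited when the next phase
  begins.\<close>

definition marks :: "nat \<Rightarrow> nat \<Rightarrow> store \<Rightarrow> bool" where
  "marks J k \<sigma> \<longleftrightarrow> (\<exists>B. \<sigma> ''H'' = (\<lambda>j. hval (B j)) \<and> (\<forall>j. B j \<subseteq> active h j)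
     \<and> (\<forall>v\<in>V. \<forall>j<J. \<sigma> ''K'' v \<ge> real k \<longrightarrow> v \<in> active h j \<longrightarrow> v \<in> B j))
     \<and> (\<forall>v. \<sigma> ''K'' v \<le> real k)"

definition todo :: "nat \<Rightarrow> nat \<Rightarrow> store \<Rightarrow> nat" where
  "todo J k \<sigma> = (\<Sum>v | v \<in> V \<and> \<sigma> ''K'' v < real k. card {j. j < J \<and> v \<in> active h j})"

lemma wp_visit':
  assumes par: "params \<sigma>" and J: "\<sigma> ''J'' 0 = real J" and w: "\<sigma> ''w'' 0 = real w" "w \<in> V"
    and k: "\<sigma> ''k'' 0 = real k" and m: "marks J k \<sigma>"
    and Q: "\<And>t \<sigma>'. t + 200 * todo J k \<sigma>' \<le> 300 + 200 * todo J k \<sigma> \<Longrightarrow>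
      (\<And>a. a \<notin> {''q'', ''z'', ''j'', ''m'', ''H'', ''K''} \<Longrightarrow> \<sigma>' a = \<sigma> a) \<Longrightarrow> marks J k \<sigma>' \<Longrightarrow>
      (\<And>v. \<sigma> ''K'' v \<ge> real k \<Longrightarrow> \<sigma>' ''K'' v \<ge> real k) \<Longrightarrow>
      (th < real (deg w) \<Longrightarrow> \<sigma>' ''K'' w \<ge> real k) \<Longrightarrow> Q t \<sigma>' ks"
  shows "wp G h r visit Q \<sigma> ks"
proof -
  obtain B where B: "\<sigma> ''H'' = (\<lambda>j. hval (B j))" "\<And>j. B j \<subseteq> active h j"
    "\<And>v j. v \<in> V \<Longrightarrow> j < J \<Longrightarrow> \<sigma> ''K'' v \<ge> real k \<Longrightarrow> v \<in> active h j \<Longrightarrow> v \<in> B j"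
    using m unfolding marks_def by blast
  show ?thesis
  proof (rule wp_visit[OF par J w k B(1,2)])
    show "v \<in> B j" if "v \<in> V" "real k \<le> \<sigma> ''K'' v" "v \<in> active h j" "j < J" for v j
      using B(3) that by blast
  next
    fix t \<sigma>' B'
    assume 1: "t + 200 * (\<Sum>v | v \<in> V \<and> \<sigma>' ''K'' v < real k. card {j. j < J \<and> v \<in> active h j})
          \<le> 300 + 200 * (\<Sum>v | v \<in> V \<and> \<sigma> ''K'' v < real k. card {j. j < J \<and> v \<in> active h j})"
      "\<And>a. a \<notin> {''q'', ''z'', ''j'', ''m'', ''H'', ''K''} \<Longrightarrow> \<sigma>' a = \<sigma> a"
      "\<sigma>' ''H'' = (\<lambda>j. hval (B' j))" "\<And>j. B' j \<subseteq> active h j"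
      "\<And>v. \<sigma> ''K'' v \<ge> real k \<Longrightarrow> \<sigma>' ''K'' v \<ge> real k"
      "\<And>v j. v \<in> V \<Longrightarrow> \<sigma>' ''K'' v \<ge> real k \<Longrightarrow> v \<in> active h j \<Longrightarrow> j < J \<Longrightarrow> v \<in> B' j"
      "th < real (deg w) \<Longrightarrow> \<sigma>' ''K'' w \<ge> real k"
      "\<And>v. \<sigma>' ''K'' v = \<sigma> ''K'' v \<or> \<sigma>' ''K'' v = real k"
    have K: "\<forall>v. \<sigma>' ''K'' v \<le> real k"
    proof
      fix v show "\<sigma>' ''K'' v \<le> real k" using 1(8)[of v] m unfolding marks_def by auto
    qed
    show "Q t \<sigma>' ks"
      apply (rule Q)
      subgoal using 1(1) by (simp add: todo_def)
      subgoal by (rule 1(2))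
      subgoal unfolding marks_def using 1(3,4,6) K by blast
      subgoal by (rule 1(5))
      subgoal by (rule 1(7))
      done
  qed
qed

text \<open>Since the list is sorted by hash value, all \<open>i + 1\<close> entries up to position
  \<open>i\<close> lie below \<open>b\<close>.\<close>

lemma neighbor_prefix:
  assumes "i < deg x" "h (neighbor_list G h x ! i) < b"
  shows "i < card {w \<in> N x. h w < b}"
proof -
  let ?L = "neighbor_list G h x"
  have "h (?L ! i') < b" if "i' \<le> i" for i'
    using sorted_nth_mono[OF sorted_neighbor_list[of h x], of i' i] that assms length_neighbor_list[of h x] by simp
  moreover have "?L ! i' \<in> N x" if "i' \<le> i" for i'
    using that assms length_neighbor_list[of h x] set_neighbor_list[of h x] nth_mem[of i' ?L] by simp
  ultimately have "(\<lambda>i'. ?L ! i') ` {..i} \<subseteq> {w \<in> N x. h w < b}" by auto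
  moreover have "inj_on (\<lambda>i'. ?L ! i') {..i}"
    using distinct_neighbor_list[of h x] assms length_neighbor_list[of h x]
    by (auto simp: inj_on_def nth_eq_iff_index_eq)
  ultimately have "card {..i} \<le> card {w \<in> N x. h w < b}"
    using card_mono[of "{w \<in> N x. h w < b}" "(\<lambda>i'. ?L ! i') ` {..i}"] by (simp add: card_image)
  then show ?thesis by simp
qed

text \<open>Sortedness is used twice: \<open>neighbor_prefix\<close> bounds the number of
  iterations, and at exit every entry beyond the prefix read has a hash value of at least
  \<open>b\<close>, so nothing is missed.\<close>

lemma wp_enumerate:
  fixes x :: nat and b :: real
  defines "c0 \<equiv> card {w \<in> N x. h w < b}"
  assumes par: "params \<sigma>" and J: "\<sigma> ''J'' 0 = real J" and k: "\<sigma> ''k'' 0 = real k" and m: "marks J k \<sigma>"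
    and x: "\<sigma> ''u'' 0 = real x" "\<sigma> ''d'' 0 = real (deg x)" "\<sigma> ''p'' 0 = b" "x \<in> V"
    and Q: "\<And>t \<sigma>'. t + 200 * todo J k \<sigma>' \<le> 400 * (1 + c0) + 200 * todo J k \<sigma> \<Longrightarrow>
      (\<And>a. a \<notin> {''q'', ''z'', ''j'', ''m'', ''H'', ''K'', ''e'', ''w''} \<Longrightarrow> \<sigma>' a = \<sigma> a) \<Longrightarrow> marks J k \<sigma>' \<Longrightarrow>
      (\<And>v. \<sigma> ''K'' v \<ge> real k \<Longrightarrow> \<sigma>' ''K'' v \<ge> real k) \<Longrightarrow>
      (\<And>w. w \<in> N x \<Longrightarrow> h w < b \<Longrightarrow> th < real (deg w) \<Longrightarrow> \<sigma>' ''K'' w \<ge> real k) \<Longrightarrow> Q t \<sigma>' ks"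
  shows "wp G h r enumerate Q \<sigma> ks"
proof -
  let ?L = "neighbor_list G h x"
  let ?F = "{''q'', ''z'', ''j'', ''m'', ''H'', ''K'', ''e'', ''w''}"
  let ?b = "(var ''e'' \<^bold>< var ''d'') \<^bold>* (Hash (Neighbor (var ''u'') (var ''e'')) \<^bold>< var ''p'')"
  define I where "I = (\<lambda>c \<sigma>' k'. k' = ks \<and> (\<forall>a. a \<notin> ?F \<longrightarrow> \<sigma>' a = \<sigma> a) \<and> marks J k \<sigma>' \<and>
    (\<forall>v. \<sigma> ''K'' v \<ge> real k \<longrightarrow> \<sigma>' ''K'' v \<ge> real k) \<and>
    (\<exists>i. \<sigma>' ''e'' 0 = real i \<and> i \<le> deg x \<and> (\<forall>i'<i. th < real (deg (?L ! i')) \<longrightarrow> \<sigma>' ''K'' (?L ! i') \<ge> real k) \<and>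
      c = 400 * (c0 - i) + 200 * todo J k \<sigma>' + 100))"
  have Lx: "?L ! i \<in> N x" if "i < deg x" for i
    using that length_neighbor_list[of h x] set_neighbor_list[of h x] nth_mem[of i ?L] by simp
  have nq: "neighbor_query G h x i = real (?L ! i)" if "i < deg x" for i
    using that x by (simp add: neighbor_query_def)
  have hq: "hash_query G h (?L ! i) = h (?L ! i)" if "i < deg x" for i
    using Lx[OF that] N_subset by (auto simp: hash_query_def)
  have cond: "eval_expr G h \<sigma>' ?b = (if i < deg x \<and> h (?L ! i) < b then 1 else 0)"
    if fr: "\<forall>a. a \<notin> ?F \<longrightarrow> \<sigma>' a = \<sigma> a" and "\<sigma>' ''e'' 0 = real i" for \<sigma>' i
  proof -
    have "\<sigma>' ''u'' = \<sigma> ''u''" "\<sigma>' ''d'' = \<sigma> ''d''" "\<sigma>' ''p'' = \<sigma> ''p''" using fr by simp_all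
    then show ?thesis using that(2) x nq[of i] hq[of i] by (cases "i < deg x") simp_all
  qed
  have step: "wp G h r (''w'' ::= Neighbor (var ''u'') (var ''e'') \<^bold>; visit \<^bold>; ''e'' ::= var ''e'' \<^bold>+ Const 1)
      (\<lambda>t \<sigma>' k'. \<exists>c'. c' + t + 1 + expr_cost ?b \<le> c \<and> I c' \<sigma>' k') \<sigma>1 k1"
    if I1: "I c \<sigma>1 k1" and b0: "eval_expr G h \<sigma>1 ?b \<noteq> 0" for c \<sigma>1 k1
  proof -
    obtain i where k1: "k1 = ks" and fr: "\<forall>a. a \<notin> ?F \<longrightarrow> \<sigma>1 a = \<sigma> a" and m1: "marks J k \<sigma>1"
      and Kmono: "\<forall>v. \<sigma> ''K'' v \<ge> real k \<longrightarrow> \<sigma>1 ''K'' v \<ge> real k"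
      and i: "\<sigma>1 ''e'' 0 = real i"
      and vis: "\<forall>i'<i. th < real (deg (?L ! i')) \<longrightarrow> \<sigma>1 ''K'' (?L ! i') \<ge> real k"
      and c: "c = 400 * (c0 - i) + 200 * todo J k \<sigma>1 + 100"
      using I1 unfolding I_def by blast
    have il: "i < deg x" "h (?L ! i) < b" using b0 unfolding cond[OF fr i] by (auto split: if_splits)
    have ic: "i < c0" unfolding c0_def by (rule neighbor_prefix[OF il])
    have w: "?L ! i \<in> V" using Lx[OF il(1)] N_subset by blast
    have uv: "\<sigma>1 ''u'' = \<sigma> ''u''" using fr by simp
    define \<sigma>2 where "\<sigma>2 = update \<sigma>1 ''w'' 0 (real (?L ! i))"
    have ev: "update \<sigma>1 ''w'' (index (eval_expr G h \<sigma>1 (Const 0))) (eval_expr G h \<sigma>1 (Neighbor (var ''u'') (var ''e''))) = \<sigma>2"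
      using x i uv nq[OF il(1)] by (simp add: \<sigma>2_def)
    show ?thesis
      apply (rule wp_Seq, rule wp_Write, unfold ev)
      apply (rule wp_Seq)
      apply (rule wp_visit'[where J = J and k = k and w = "?L ! i"])
      subgoal using par fr by (simp add: params_def \<sigma>2_def update_apply)
      subgoal using J fr by (simp add: \<sigma>2_def update_apply)
      subgoal by (simp add: \<sigma>2_def update_apply)
      subgoal by (rule w)
      subgoal using k fr by (simp add: \<sigma>2_def update_apply)
      subgoal using m1 by (simp add: \<sigma>2_def marks_def update_def)
      subgoal premises prems for t \<sigma>'
      proof -
        have K2: "\<sigma>2 ''K'' = \<sigma>1 ''K''" by (simp add: \<sigma>2_def update_def)
        have td: "todo J k \<sigma>2 = todo J k \<sigma>1" by (simp add: todo_def K2)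
        have td': "todo J k (update \<sigma>' ''e'' 0 z) = todo J k \<sigma>'" for z by (simp add: todo_def update_def)
        have ee: "\<sigma>' ''e'' = \<sigma>1 ''e''" using prems(2)[of "''e''"] by (simp add: \<sigma>2_def update_def)
        show ?thesis
          apply (rule wp_Write)
          apply (rule exI[of _ "400 * (c0 - Suc i) + 200 * todo J k \<sigma>' + 100"])
          apply (rule conjI)
          subgoal using prems(1) ic unfolding c td by simp
          subgoal
            unfolding I_def
            apply (intro conjI)
            subgoal by (rule k1)
            subgoal using prems(2) fr by (simp add: update_def \<sigma>2_def)
            subgoal using prems(3) by (simp add: marks_def update_def)
            subgoal using Kmono prems(4) K2 by (simp add: update_def)
            apply (rule exI[of _ "Suc i"], intro conjI)
            subgoal using i ee by (simp add: update_apply)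
            subgoal using il by simp
            subgoal using vis prems(4,5) K2 by (auto simp: update_def less_Suc_eq)
            subgoal using ee i by (simp add: td')
            done
          done
      qed
      done
  qed
  have e0: "update \<sigma> ''e'' (index (eval_expr G h \<sigma> (Const 0))) (eval_expr G h \<sigma> (Const 0)) = update \<sigma> ''e'' 0 0"
    by simp
  show ?thesis
    unfolding enumerate_def
    apply (rule wp_Seq, rule wp_Write, unfold e0)
    apply (rule wp_While[where I = I and c = "400 * c0 + 200 * todo J k \<sigma> + 100"])
    subgoal by (rule step)
    subgoal unfolding I_def
      apply (intro conjI exI[of _ 0])
      subgoal by simp
      subgoal by (simp add: update_def)
      subgoal using m by (simp add: marks_def update_def)
      subgoal by (simp add: update_def)
      subgoal by (simp add: update_def)
      subgoal by simp
      subgoal by simp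
      subgoal by (simp add: todo_def update_def)
      done
    subgoal premises prems for t c' \<sigma>' k'
    proof -
      obtain i where k1: "k' = ks" and fr: "\<forall>a. a \<notin> ?F \<longrightarrow> \<sigma>' a = \<sigma> a" and m1: "marks J k \<sigma>'"
        and Kmono: "\<forall>v. \<sigma> ''K'' v \<ge> real k \<longrightarrow> \<sigma>' ''K'' v \<ge> real k"
        and i: "\<sigma>' ''e'' 0 = real i" "i \<le> deg x"
        and vis: "\<forall>i'<i. th < real (deg (?L ! i')) \<longrightarrow> \<sigma>' ''K'' (?L ! i') \<ge> real k"
        and c: "c' = 400 * (c0 - i) + 200 * todo J k \<sigma>' + 100"
        using prems(2) unfolding I_def by blast
      have ex: "\<not> (i < deg x \<and> h (?L ! i) < b)"
        using prems(3) unfolding cond[OF fr i(1)] by (simp split: if_splits)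
      show ?thesis unfolding k1
      proof (rule Q)
        show "1 + (1 + expr_cost (Const 0) + expr_cost (Const 0)) + t + 200 * todo J k \<sigma>' \<le> 400 * (1 + c0) + 200 * todo J k \<sigma>"
          using prems(1) unfolding c by simp
        show "\<sigma>' ''K'' w \<ge> real k" if "w \<in> N x" "h w < b" "th < real (deg w)" for w
        proof -
          have "w \<in> set ?L" using that(1) set_neighbor_list by simp
          then obtain i' where i': "i' < deg x" "?L ! i' = w"
            unfolding in_set_conv_nth length_neighbor_list by blast
          have "i' < i"
          proof (rule ccontr)
            assume "\<not> i' < i"
            then have "i < deg x" "h (?L ! i) \<le> h (?L ! i')"
              using i' sorted_nth_mono[OF sorted_neighbor_list[of h x], of i i'] length_neighbor_list[of h x] by auto
            with ex that i' show False by auto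
          qed
          with vis i' that show ?thesis by auto
        qed
        show "\<sigma>' z = \<sigma> z" if "z \<notin> ?F" for z using fr that by blast
        show "marks J k \<sigma>'" by (rule m1)
        show "real k \<le> \<sigma>' ''K'' v" if "real k \<le> \<sigma> ''K'' v" for v using Kmono that by blast
      qed
    qed
    done
qed

end

section \<open>Searching from random vertices and consuming the tape\<close>

context sampler_run
begin

lemma wp_search:
  assumes par: "params \<sigma>" and J: "\<sigma> ''J'' 0 = real (k * J1)" and k: "\<sigma> ''k'' 0 = real k" and m: "marks (k * J1) k \<sigma>"
    and S: "\<And>t. t \<le> T k \<Longrightarrow> \<sigma> ''S'' t = r (base + 2 * t)"
    and Rk: "\<sigma> ''Rk'' 0 = real (k * R)" "\<sigma> ''T'' 0 = real (T k)"
    and Q: "\<And>t \<sigma>'. t \<le> 1000 * (1 + T k + enum_cost k) + 200 * todo (k * J1) k \<sigma> \<Longrightarrow>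
      (\<And>a. a \<notin> {''q'', ''z'', ''j'', ''m'', ''H'', ''K'', ''e'', ''w'', ''t'', ''u'', ''d'', ''p''} \<Longrightarrow> \<sigma>' a = \<sigma> a) \<Longrightarrow>
      marks (k * J1) k \<sigma>' \<Longrightarrow>
      (\<And>t w. t \<in> {k * R<..T k} \<Longrightarrow> cap t \<Longrightarrow> w \<in> N (u t) \<Longrightarrow> h w < p k t \<Longrightarrow> th < real (deg w) \<Longrightarrow>
         \<sigma>' ''K'' w \<ge> real k) \<Longrightarrow> Q t \<sigma>' ks"
  shows "wp G h r search Q \<sigma> ks"
proof -
  let ?J = "k * J1"
  let ?F = "{''q'', ''z'', ''j'', ''m'', ''H'', ''K'', ''e'', ''w'', ''t'', ''u'', ''d'', ''p''}"
  let ?c = "\<lambda>t. if cap t then card {w \<in> N (u t). h w < p k t} else 0"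
  let ?b = "var ''t'' \<^bold>< var ''T''"
  define I where "I = (\<lambda>c \<sigma>' k'. k' = ks \<and> (\<forall>a. a \<notin> ?F \<longrightarrow> \<sigma>' a = \<sigma> a) \<and> marks ?J k \<sigma>' \<and>
    (\<exists>i. \<sigma>' ''t'' 0 = real i \<and> k * R \<le> i \<and>
      (\<forall>t\<in>{k * R<..i}. cap t \<longrightarrow> (\<forall>w\<in>N (u t). h w < p k t \<longrightarrow> th < real (deg w) \<longrightarrow> \<sigma>' ''K'' w \<ge> real k)) \<and>
      c = 600 * (T k - i) + 400 * (\<Sum>t\<in>{i<..T k}. ?c t) + 200 * todo ?J k \<sigma>' + 100))"
  have step: "wp G h r (''t'' ::= var ''t'' \<^bold>+ Const 1 \<^bold>;
       ''u'' ::= Vertex (var ''n'' \<^bold>* Read ''S'' (var ''t'')) \<^bold>;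
       ''d'' ::= Degree (var ''u'') \<^bold>;
       If (var ''d'' \<^bold>* var ''n'' \<^bold>* var ''R'' \<^bold>< Const 4 \<^bold>* var ''y'' \<^bold>* var ''y'' \<^bold>* var ''t'')
        (''p'' ::= Const 2 \<^bold>* var ''J'' \<^bold>* var ''Rk'' \<^bold>/ (var ''th'' \<^bold>* var ''t'') \<^bold>; enumerate) Skip)
      (\<lambda>t \<sigma>' k'. \<exists>c'. c' + t + 1 + expr_cost ?b \<le> c \<and> I c' \<sigma>' k') \<sigma>1 k1"
    if I1: "I c \<sigma>1 k1" and b0: "eval_expr G h \<sigma>1 ?b \<noteq> 0" for c \<sigma>1 k1
  proof -
    obtain i where k1: "k1 = ks" and fr: "\<And>a. a \<notin> ?F \<Longrightarrow> \<sigma>1 a = \<sigma> a" and m1: "marks ?J k \<sigma>1"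
      and i: "\<sigma>1 ''t'' 0 = real i" "k * R \<le> i"
      and vis: "\<forall>t\<in>{k * R<..i}. cap t \<longrightarrow> (\<forall>w\<in>N (u t). h w < p k t \<longrightarrow> th < real (deg w) \<longrightarrow> \<sigma>1 ''K'' w \<ge> real k)"
      and c: "c = 600 * (T k - i) + 400 * (\<Sum>t\<in>{i<..T k}. ?c t) + 200 * todo ?J k \<sigma>1 + 100"
      using I1 unfolding I_def by blast
    have cs: "\<sigma>1 ''n'' = \<sigma> ''n''" "\<sigma>1 ''S'' = \<sigma> ''S''" "\<sigma>1 ''T'' = \<sigma> ''T''" "\<sigma>1 ''y'' = \<sigma> ''y''" "\<sigma>1 ''R'' = \<sigma> ''R''"
      "\<sigma>1 ''J'' = \<sigma> ''J''" "\<sigma>1 ''Rk'' = \<sigma> ''Rk''" "\<sigma>1 ''th'' = \<sigma> ''th''" "\<sigma>1 ''k'' = \<sigma> ''k''"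
      by (rule fr, simp)+
    have pr: "\<sigma> ''n'' 0 = real n" "\<sigma> ''y'' 0 = y" "\<sigma> ''R'' 0 = real R" "\<sigma> ''th'' 0 = th"
      using par by (simp_all add: params_def)
    have iT: "i < T k" using b0 i Rk cs by (simp split: if_splits)
    define x where "x = u (Suc i)"
    have xV: "x \<in> V" unfolding x_def sample_def using r by (intro pick_in_V) auto
    define \<sigma>2 where "\<sigma>2 = update (update (update \<sigma>1 ''t'' 0 (real (Suc i))) ''u'' 0 (real x)) ''d'' 0 (real (deg x))"
    have S': "\<sigma> ''S'' (Suc i) = r (base + 2 * Suc i)" using S[of "Suc i"] iT by simp
    have vq: "vertex_query G (nat \<lfloor>real n * r (base + 2 * Suc i)\<rfloor>) = real x"
      unfolding x_def sample_def using r by (intro vertex_query_pick) auto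
    have dq: "degree_query G x = real (deg x)" using xV by (simp add: degree_query_def)
    have idx: "nat \<lfloor>1 + real i\<rfloor> = Suc i" using floor_of_nat[of "Suc i"] by linarith
    have fr2: "\<sigma>2 b = \<sigma> b" if "b \<notin> ?F" for b
      using fr[OF that] that by (simp add: \<sigma>2_def update_def)
    have m2: "marks ?J k \<sigma>2" using m1 by (simp add: marks_def \<sigma>2_def update_def)
    have K2: "\<sigma>2 ''K'' = \<sigma>1 ''K''" by (simp add: \<sigma>2_def update_def)
    have td2: "todo ?J k \<sigma>2 = todo ?J k \<sigma>1" by (simp add: todo_def K2)
    have sum: "(\<Sum>t\<in>{i<..T k}. ?c t) = ?c (Suc i) + (\<Sum>t\<in>{Suc i<..T k}. ?c t)"
    proof -
      have "{i<..T k} = insert (Suc i) {Suc i<..T k}" using iT by auto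
      then show ?thesis by simp
    qed
    have set: "{k * R<..Suc i} = insert (Suc i) {k * R<..i}" using i by auto
    show ?thesis
      apply (rule wp_Seq, rule wp_assign[where x = "real (Suc i)"])
      subgoal using i by simp
      apply (rule wp_Seq, rule wp_assign[where x = "real x"])
      subgoal using cs pr S' vq idx by (simp add: update_apply)
      apply (rule wp_Seq, rule wp_assign[where x = "real (deg x)"])
      subgoal using dq by (simp add: update_apply)
      apply (fold \<sigma>2_def)
      apply (rule wp_If)
      subgoal premises prems
      proof -
        have cp: "cap (Suc i)"
          using prems i cs pr by (simp add: \<sigma>2_def update_apply capped_def x_def split: if_splits)
        define \<sigma>3 where "\<sigma>3 = update \<sigma>2 ''p'' 0 (p k (Suc i))"
        have ev3: "update \<sigma>2 ''p'' (index (eval_expr G h \<sigma>2 (Const 0)))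
           (eval_expr G h \<sigma>2 (Const 2 \<^bold>* var ''J'' \<^bold>* var ''Rk'' \<^bold>/ (var ''th'' \<^bold>* var ''t''))) = \<sigma>3"
          using cs pr J Rk by (simp add: \<sigma>3_def hash_bound_def \<sigma>2_def update_apply)
        show ?thesis
          apply (rule wp_Seq, rule wp_Write, unfold ev3)
          apply (rule wp_enumerate[where J = ?J and k = k and x = x and b = "p k (Suc i)"])
          subgoal using par fr2 by (simp add: params_def \<sigma>3_def update_apply)
          subgoal using J fr2 by (simp add: \<sigma>3_def update_apply)
          subgoal using k fr2 by (simp add: \<sigma>3_def update_apply)
          subgoal using m2 by (simp add: marks_def \<sigma>3_def update_def)
          subgoal by (simp add: \<sigma>3_def \<sigma>2_def update_apply)
          subgoal by (simp add: \<sigma>3_def \<sigma>2_def update_apply)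
          subgoal by (simp add: \<sigma>3_def \<sigma>2_def update_apply)
          subgoal by (rule xV)
          subgoal premises pr2 for t \<sigma>'
          proof -
            have K3: "\<sigma>3 ''K'' = \<sigma>1 ''K''" by (simp add: \<sigma>3_def K2 update_def)
            have td3: "todo ?J k \<sigma>3 = todo ?J k \<sigma>1" by (simp add: todo_def K3)
            have t3: "\<sigma>' ''t'' 0 = real (Suc i)" using pr2(2)[of "''t''"] by (simp add: \<sigma>3_def \<sigma>2_def update_apply)
            show ?thesis
              apply (rule exI[of _ "600 * (T k - Suc i) + 400 * (\<Sum>t\<in>{Suc i<..T k}. ?c t) + 200 * todo ?J k \<sigma>' + 100"])
              apply (rule conjI)
              subgoal using pr2(1) iT cp unfolding c sum td3 by (simp add: x_def)
              subgoal
                unfolding I_def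
                apply (intro conjI)
                subgoal by (rule k1)
                subgoal using pr2(2) fr2 by (simp add: \<sigma>3_def update_def)
                subgoal by (rule pr2(3))
                apply (rule exI[of _ "Suc i"], intro conjI)
                subgoal by (rule t3)
                subgoal using i by simp
                subgoal unfolding set using vis pr2(4,5) K3 by (simp add: x_def)
                subgoal by simp
                done
              done
          qed
          done
      qed
      subgoal premises prems
      proof -
        have cp: "\<not> cap (Suc i)"
          using prems i cs pr by (simp add: \<sigma>2_def update_apply capped_def x_def split: if_splits)
        show ?thesis
          apply (rule wp_Skip)
          apply (rule exI[of _ "600 * (T k - Suc i) + 400 * (\<Sum>t\<in>{Suc i<..T k}. ?c t) + 200 * todo ?J k \<sigma>2 + 100"])
          apply (rule conjI)
          subgoal using iT cp unfolding c sum td2 by simp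
          subgoal
            unfolding I_def
            apply (intro conjI)
            subgoal by (rule k1)
            subgoal using fr2 by blast
            subgoal by (rule m2)
            apply (rule exI[of _ "Suc i"], intro conjI)
            subgoal by (simp add: \<sigma>2_def update_apply)
            subgoal using i by simp
            subgoal unfolding set using vis cp K2 by simp
            subgoal by simp
            done
          done
      qed
      done
  qed
  have e0: "update \<sigma> ''t'' (index (eval_expr G h \<sigma> (Const 0))) (eval_expr G h \<sigma> (var ''Rk'')) = update \<sigma> ''t'' 0 (real (k * R))"
    using Rk by simp
  show ?thesis
    unfolding search_def
    apply (rule wp_Seq, rule wp_Write, unfold e0)
    apply (rule wp_While[where I = I and c = "600 * (T k - k * R) + 400 * enum_cost k + 200 * todo ?J k \<sigma> + 100"])
    subgoal by (rule step)
    subgoal unfolding I_def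
      apply (intro conjI exI[of _ "k * R"])
      subgoal by simp
      subgoal by (simp add: update_def)
      subgoal using m by (simp add: marks_def update_def)
      subgoal by (simp add: update_def)
      subgoal by simp
      subgoal by simp
      subgoal by (simp add: todo_def update_def enumeration_cost_def)
      done
    subgoal premises prems for t c' \<sigma>' k'
    proof -
      obtain i where k1: "k' = ks" and fr: "\<And>a. a \<notin> ?F \<Longrightarrow> \<sigma>' a = \<sigma> a" and m1: "marks ?J k \<sigma>'"
        and i: "\<sigma>' ''t'' 0 = real i" "k * R \<le> i"
        and vis: "\<forall>t\<in>{k * R<..i}. cap t \<longrightarrow> (\<forall>w\<in>N (u t). h w < p k t \<longrightarrow> th < real (deg w) \<longrightarrow> \<sigma>' ''K'' w \<ge> real k)"
        using prems(2) unfolding I_def by blast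
      have "\<sigma>' ''T'' = \<sigma> ''T''" by (rule fr) simp
      then have iT: "T k \<le> i" using prems(3) i Rk by (simp split: if_splits)
      show ?thesis unfolding k1
        apply (rule Q)
        subgoal using prems(1) by simp
        subgoal by (rule fr)
        subgoal by (rule m1)
        subgoal using vis iT by auto
        done
    qed
    done
qed

lemma wp_fill:
  assumes TJ: "\<sigma> ''T'' 0 = real t0" "\<sigma> ''J'' 0 = real j0" and f: "\<sigma> ''f'' 0 = real f0" and ks: "ks = base + 2 * f0"
    and SA: "\<And>i. i < f0 \<Longrightarrow> \<sigma> ''S'' i = r (base + 2 * i) \<and> \<sigma> ''A'' i = a i"
    and Q: "\<And>t \<sigma>' f'. t \<le> 50 * (t0 + j0 + 2) \<Longrightarrow>
      (\<And>a. a \<notin> {''S'', ''A'', ''f''} \<Longrightarrow> \<sigma>' a = \<sigma> a) \<Longrightarrow> \<sigma>' ''f'' 0 = real f' \<Longrightarrow> t0 + j0 < f' \<Longrightarrow>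
      (\<And>i. i < f' \<Longrightarrow> \<sigma>' ''S'' i = r (base + 2 * i) \<and> \<sigma>' ''A'' i = a i) \<Longrightarrow> Q t \<sigma>' (base + 2 * f')"
  shows "wp G h r fill Q \<sigma> ks"
proof -
  let ?b = "var ''f'' \<^bold>< var ''T'' \<^bold>+ var ''J'' \<^bold>+ Const 1"
  define I where "I = (\<lambda>c \<sigma>' k'. (\<forall>a. a \<notin> {''S'', ''A'', ''f''} \<longrightarrow> \<sigma>' a = \<sigma> a) \<and>
    (\<exists>i. \<sigma>' ''f'' 0 = real i \<and> k' = base + 2 * i \<and>
      (\<forall>i'<i. \<sigma>' ''S'' i' = r (base + 2 * i') \<and> \<sigma>' ''A'' i' = a i') \<and> c = 50 * (t0 + j0 + 1 - i)))"
  show ?thesis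
    unfolding fill_def
    apply (rule wp_While[where I = I and c = "50 * (t0 + j0 + 1 - f0)"])
    subgoal premises prems for c \<sigma>1 k1
    proof -
      obtain i where fr: "\<And>a. a \<notin> {''S'', ''A'', ''f''} \<Longrightarrow> \<sigma>1 a = \<sigma> a"
        and i: "\<sigma>1 ''f'' 0 = real i" "k1 = base + 2 * i"
        and SA1: "\<And>i'. i' < i \<Longrightarrow> \<sigma>1 ''S'' i' = r (base + 2 * i') \<and> \<sigma>1 ''A'' i' = a i'"
        and c: "c = 50 * (t0 + j0 + 1 - i)"
        using prems(1) unfolding I_def by blast
      have "\<sigma>1 ''T'' = \<sigma> ''T''" "\<sigma>1 ''J'' = \<sigma> ''J''" by (rule fr, simp)+
      then have "real i < real (t0 + j0 + 1)" using prems(2) i TJ by (simp split: if_splits)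
      then have lt: "i < t0 + j0 + 1" by linarith
      show ?thesis
        apply (rule wp_Seq, rule wp_Random, rule wp_Seq, rule wp_Random, rule wp_Write)
        apply (rule exI[of _ "50 * (t0 + j0 + 1 - Suc i)"])
        apply (rule conjI)
        subgoal using lt unfolding c by simp
        subgoal unfolding I_def
          apply (intro conjI exI[of _ "Suc i"])
          subgoal using fr by (simp add: update_def)
          subgoal using i by (simp add: update_apply)
          subgoal using i by simp
          subgoal using SA1 i by (auto simp: update_apply a_def less_Suc_eq)
          subgoal by simp
          done
        done
    qed
    subgoal unfolding I_def using f ks SA by (intro conjI exI[of _ f0]) auto
    subgoal premises prems for t c' \<sigma>' k'
    proof -
      obtain i where fr: "\<And>a. a \<notin> {''S'', ''A'', ''f''} \<Longrightarrow> \<sigma>' a = \<sigma> a"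
        and i: "\<sigma>' ''f'' 0 = real i" "k' = base + 2 * i"
        and SA1: "\<And>i'. i' < i \<Longrightarrow> \<sigma>' ''S'' i' = r (base + 2 * i') \<and> \<sigma>' ''A'' i' = a i'"
        using prems(2) unfolding I_def by blast
      have "\<sigma>' ''T'' = \<sigma> ''T''" "\<sigma>' ''J'' = \<sigma> ''J''" by (rule fr, simp)+
      then have "\<not> real i < real (t0 + j0 + 1)" using prems(3) i TJ by (simp split: if_splits)
      then have lt: "t0 + j0 < i" by linarith
      show ?thesis unfolding i(2)
        apply (rule Q)
        subgoal using prems(1) by simp
        subgoal by (rule fr)
        subgoal by (rule i(1))
        subgoal by (rule lt)
        subgoal by (rule SA1)
        done
    qed
    done
qed

lemma successes_Suc:
  "successes B (Suc j) = successes B j @ (case slot (B j) h (a j) of None \<Rightarrow> [] | Some e \<Rightarrow> [e])"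
  by (simp add: successes_def List.map_filter_def split: option.splits)

text \<open>Slots are numbered across phases and use fixed tape cells, so more phases only append
  successes. Hence the stopping phase has no influence on the first \<open>s\<close> of
  them.\<close>

lemma successes_prefix: "j \<le> J \<Longrightarrow> \<exists>ys. successes B J = successes B j @ ys"
  by (induction J rule: dec_induct) (auto simp: successes_Suc)

end

section \<open>Outcomes of the slots and a complete phase\<close>

context sampler_run
begin

lemma wp_scan_slot:
  assumes par: "params \<sigma>" and H: "\<sigma> ''H'' = (\<lambda>j. hval (B j))" and B: "B j \<subseteq> active h j"
    and A: "\<sigma> ''A'' j = a j" and j: "\<sigma> ''j'' 0 = real j" and i: "\<sigma> ''i'' 0 = real i"
    and Q: "\<And>t \<sigma>'. t \<le> 100 \<Longrightarrow>
      (\<And>x. x \<notin> {''a'', ''u'', ''e'', ''c'', ''w'', ''src'', ''dst'', ''i'', ''j''} \<Longrightarrow> \<sigma>' x = \<sigma> x) \<Longrightarrow>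
      \<sigma>' ''j'' 0 = real (Suc j) \<Longrightarrow>
      (case slot (B j) h (a j) of None \<Rightarrow> \<sigma>' ''i'' 0 = real i \<and> \<sigma>' ''src'' = \<sigma> ''src'' \<and> \<sigma>' ''dst'' = \<sigma> ''dst''
       | Some e \<Rightarrow> \<sigma>' ''i'' 0 = real (Suc i) \<and> \<sigma>' ''src'' = (\<sigma> ''src'')(i := real (fst e))
           \<and> \<sigma>' ''dst'' = (\<sigma> ''dst'')(i := real (snd e))) \<Longrightarrow> Q t \<sigma>' ks"
  shows "wp G h r scan_slot Q \<sigma> ks"
proof -
  have pr: "\<sigma> ''n'' 0 = real n" "\<sigma> ''th'' 0 = th" using par by (simp_all add: params_def)
  have a01: "0 \<le> a j" "a j < 1" using r by (simp_all add: a_def)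
  define X1 where "X1 = update \<sigma> ''a'' 0 (a j)"
  have BV: "B j \<subseteq> V" using B by (auto simp: active_def)
  have idx: "nat \<lfloor>1 + real i\<rfloor> = Suc i" for i using floor_of_nat[of "Suc i"] by linarith
  \<comment> \<open>Writing the outcome is common to both branches of the test on \<open>H\<close>;
    \<open>t0\<close> is the time spent before it.\<close>
  have fin: "wp G h r
     (If (var ''c'')
      (Write ''src'' (var ''i'') (var ''u'') \<^bold>;
       Write ''dst'' (var ''i'') (Neighbor (var ''u'') (var ''e'')) \<^bold>;
       ''i'' ::= var ''i'' \<^bold>+ Const 1) Skip \<^bold>;
     ''j'' ::= var ''j'' \<^bold>+ Const 1) (\<lambda>t'. Q (t0 + t')) \<sigma>2 ks"
    if fr: "\<And>x. x \<notin> {''a'', ''u'', ''e'', ''c'', ''w''} \<Longrightarrow> \<sigma>2 x = \<sigma> x" and t0: "t0 \<le> 60"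
      and c: "case slot (B j) h (a j) of None \<Rightarrow> \<sigma>2 ''c'' 0 = 0
         | Some e \<Rightarrow> \<sigma>2 ''c'' 0 \<noteq> 0 \<and> \<sigma>2 ''u'' 0 = real (fst e)
              \<and> neighbor_query G h (fst e) (index (\<sigma>2 ''e'' 0)) = real (snd e)" for \<sigma>2 t0
  proof -
    have cs: "\<sigma>2 ''i'' = \<sigma> ''i''" "\<sigma>2 ''j'' = \<sigma> ''j''" "\<sigma>2 ''src'' = \<sigma> ''src''" "\<sigma>2 ''dst'' = \<sigma> ''dst''"
      by (rule fr, simp)+
    show ?thesis
      apply (rule wp_Seq, rule wp_If)
      subgoal premises prems
      proof -
        obtain e where e: "slot (B j) h (a j) = Some e" using prems c by (cases "slot (B j) h (a j)") auto
        have c2: "\<sigma>2 ''u'' 0 = real (fst e)" "neighbor_query G h (fst e) (index (\<sigma>2 ''e'' 0)) = real (snd e)"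
          using c unfolding e by auto
        show ?thesis
          apply (rule wp_Seq, rule wp_Write, rule wp_Seq, rule wp_Write, rule wp_Write, rule wp_Write)
          apply (rule Q)
          subgoal using t0 by simp
          subgoal using fr by (simp add: update_def)
          subgoal using cs j by (simp add: update_apply)
          subgoal unfolding e using cs i c2 by (auto simp: update_def)
          done
      qed
      subgoal premises prems
      proof -
        have e: "slot (B j) h (a j) = None" using prems c by (cases "slot (B j) h (a j)") auto
        show ?thesis
          apply (rule wp_Skip, rule wp_Write)
          apply (rule Q)
          subgoal using t0 by simp
          subgoal using fr by (simp add: update_def)
          subgoal using cs j by (simp add: update_apply)
          subgoal unfolding e using cs i by (simp add: update_def)
          done
      qed
      done
  qed
  show ?thesis
    unfolding scan_slot_def
    apply (rule wp_Seq, rule wp_assign[where x = "a j"])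
    subgoal using A j by simp
    apply (rule wp_Seq, rule wp_If)
    subgoal premises prems
    proof -
      have ne: "B j \<noteq> {}" using prems H j by (auto simp: update_apply hval_def)
      show ?thesis
        apply (rule wp_Seq, rule wp_Write, rule wp_Seq, rule wp_Write, rule wp_Write)
        apply (simp only: add.assoc[symmetric])
        apply (rule fin)
        subgoal by (simp add: update_def)
        subgoal by simp
        subgoal
        proof (cases "\<exists>w. B j = {w}")
          case True
          then obtain w where w: "B j = {w}" by blast
          have wV: "w \<in> V" "th < real (deg w)" using B w by (auto simp: active_def)
          then have dw: "0 < deg w" using th0 by (cases "deg w = 0") auto
          have sl: "slot (B j) h (a j) = Some (w, neighbor_list G h w ! nat \<lfloor>real (deg w) * a j\<rfloor>)"
            using w by (simp add: slot_def)
          have hv: "hval (B j) = real w + 1" using w by (simp add: hval_def)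
          have dq: "degree_query G w = real (deg w)" using wV by (simp add: degree_query_def)
          have "real (deg w) * a j < real (deg w) * 1" using a01 dw by (intro mult_strict_left_mono) auto
          then have "nat \<lfloor>real (deg w) * a j\<rfloor> < deg w" using a01 dw by (simp add: floor_less_iff nat_less_iff)
          then have nq: "neighbor_query G h w (nat \<lfloor>real (deg w) * a j\<rfloor>) = real (neighbor_list G h w ! nat \<lfloor>real (deg w) * a j\<rfloor>)"
            using wV by (simp add: neighbor_query_def)
          show ?thesis unfolding sl using H j hv dq nq by (simp add: update_apply)
        next
          case False
          then have sl: "slot (B j) h (a j) = None" and hv: "hval (B j) = - 1"
            using ne by (auto simp: slot_def hval_def)
          show ?thesis unfolding sl using H j hv by (simp add: update_apply)
        qed
        done
    qed
    subgoal premises prems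
    proof -
      have e: "B j = {}"
      proof (rule ccontr)
        assume "B j \<noteq> {}"
        then have "hval (B j) \<noteq> 0" by (auto simp: hval_def)
        then show False using prems H j by (simp add: update_apply)
      qed
      define x where "x = pick (a j)"
      have xV: "x \<in> V" using a01 by (simp add: x_def pick_in_V)
      have dq: "degree_query G x = real (deg x)" using xV by (simp add: degree_query_def)
      have vq: "vertex_query G (nat \<lfloor>real n * a j\<rfloor>) = real x" using vertex_query_pick[OF a01] by (simp add: x_def)
      show ?thesis
        apply (rule wp_Seq, rule wp_assign[where x = "real n * a j"])
        subgoal using pr by (simp add: update_apply)
        apply (rule wp_Seq, rule wp_assign[where x = "real x"])
        subgoal using vq by (simp add: update_apply)
        apply (rule wp_Seq, rule wp_assign[where x = "th * frac (real n * a j)"])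
        subgoal using pr by (simp add: update_apply frac_def)
        apply (rule wp_Write)
        apply (simp only: add.assoc[symmetric])
        apply (rule fin)
        subgoal by (simp add: update_def)
        subgoal by simp
        subgoal
        proof (cases "th * frac (real n * a j) < real (deg x) \<and> real (deg x) \<le> th")
          case True
          have "0 \<le> th * frac (real n * a j)" using th0 by (simp add: frac_ge_0)
          then have "nat \<lfloor>th * frac (real n * a j)\<rfloor> < deg x" using True by (simp add: floor_less_iff nat_less_iff)
          then have nq: "neighbor_query G h x (nat \<lfloor>th * frac (real n * a j)\<rfloor>) = real (neighbor_list G h x ! nat \<lfloor>th * frac (real n * a j)\<rfloor>)"
            using xV by (simp add: neighbor_query_def)
          have sl: "slot (B j) h (a j) = Some (x, neighbor_list G h x ! nat \<lfloor>th * frac (real n * a j)\<rfloor>)"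
            using e True by (simp add: slot_def Let_def x_def)
          show ?thesis unfolding sl using pr dq nq True by (simp add: update_apply)
        next
          case False
          then have sl: "slot (B j) h (a j) = None"
            using e by (auto simp: slot_def Let_def x_def)
          show ?thesis unfolding sl using pr dq False by (auto simp: update_apply)
        qed
        done
    qed
    done
qed

definition writes :: "store \<Rightarrow> (nat \<times> nat) list \<Rightarrow> bool" where
  "writes \<sigma> xs \<longleftrightarrow> \<sigma> ''i'' 0 = real (length xs) \<and>
     (\<forall>i<length xs. \<sigma> ''src'' i = real (fst (xs ! i)) \<and> \<sigma> ''dst'' i = real (snd (xs ! i)))"

lemma wp_scan:
  assumes par: "params \<sigma>" and H: "\<sigma> ''H'' = (\<lambda>j. hval (B j))" and B: "\<And>j. B j \<subseteq> active h j"
    and A: "\<And>j. j < J \<Longrightarrow> \<sigma> ''A'' j = a j" and J: "\<sigma> ''J'' 0 = real J"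
    and Q: "\<And>t \<sigma>'. t \<le> 200 * (1 + J) \<Longrightarrow>
      (\<And>x. x \<notin> {''a'', ''u'', ''e'', ''c'', ''w'', ''src'', ''dst'', ''i'', ''j''} \<Longrightarrow> \<sigma>' x = \<sigma> x) \<Longrightarrow>
      writes \<sigma>' (take s (successes B J)) \<Longrightarrow> Q t \<sigma>' ks"
  shows "wp G h r scan Q \<sigma> ks"
proof -
  let ?F = "{''a'', ''u'', ''e'', ''c'', ''w'', ''src'', ''dst'', ''i'', ''j''}"
  let ?b = "(var ''i'' \<^bold>< var ''s'') \<^bold>* (var ''j'' \<^bold>< var ''J'')"
  define I where "I = (\<lambda>c \<sigma>' k'. k' = ks \<and> (\<forall>x. x \<notin> ?F \<longrightarrow> \<sigma>' x = \<sigma> x) \<and>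
    (\<exists>j\<le>J. \<sigma>' ''j'' 0 = real j \<and> length (successes B j) \<le> s \<and> writes \<sigma>' (successes B j) \<and> c = 150 * (J - j)))"
  have cond: "eval_expr G h \<sigma>' ?b = (if length xs < s \<and> j < J then 1 else 0)"
    if fr: "\<forall>x. x \<notin> ?F \<longrightarrow> \<sigma>' x = \<sigma> x" and "\<sigma>' ''j'' 0 = real j" "writes \<sigma>' xs" for \<sigma>' j xs
  proof -
    have "\<sigma>' ''s'' = \<sigma> ''s''" "\<sigma>' ''J'' = \<sigma> ''J''" using fr by simp_all
    then show ?thesis using that J par by (simp add: writes_def params_def)
  qed
  show ?thesis
    unfolding scan_def
    apply (rule wp_Seq, rule wp_assign[where x = 0], simp)
    apply (rule wp_Seq, rule wp_assign[where x = 0], simp)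
    apply (rule wp_While[where I = I and c = "150 * J"])
    subgoal premises prems for c \<sigma>1 k1
    proof -
      obtain j where k1: "k1 = ks" and fr: "\<forall>x. x \<notin> ?F \<longrightarrow> \<sigma>1 x = \<sigma> x" and jJ: "j \<le> J"
        and j: "\<sigma>1 ''j'' 0 = real j" and wr: "writes \<sigma>1 (successes B j)" and c: "c = 150 * (J - j)"
        using prems(1) unfolding I_def by blast
      have lt: "length (successes B j) < s" "j < J"
        using prems(2) unfolding cond[OF fr j wr] by (auto split: if_splits)
      show ?thesis
        apply (rule wp_scan_slot[where B = B and j = j and i = "length (successes B j)"])
        subgoal using par fr by (simp add: params_def)
        subgoal using H fr by simp
        subgoal by (rule B)
        subgoal using A[OF lt(2)] fr by simp
        subgoal by (rule j)
        subgoal using wr by (simp add: writes_def)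
        subgoal premises pr for t \<sigma>'
          apply (rule exI[of _ "150 * (J - Suc j)"])
          apply (rule conjI)
          subgoal using pr(1) lt unfolding c by simp
          subgoal unfolding I_def
            apply (intro conjI)
            subgoal by (rule k1)
            subgoal using pr(2) fr by simp
            apply (rule exI[of _ "Suc j"], intro conjI)
            subgoal using lt by simp
            subgoal by (rule pr(3))
            subgoal using lt by (simp add: successes_Suc split: option.splits)
            subgoal using pr(4) wr
              by (auto simp: successes_Suc writes_def nth_append less_Suc_eq split: option.splits)
            subgoal by simp
            done
          done
        done
    qed
    subgoal unfolding I_def
      by (intro conjI exI[of _ 0]) (simp_all add: update_def successes_def writes_def List.map_filter_def)
    subgoal premises prems for t c' \<sigma>' k'
    proof -
      obtain j where k1: "k' = ks" and fr: "\<forall>x. x \<notin> ?F \<longrightarrow> \<sigma>' x = \<sigma> x" and jJ: "j \<le> J"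
        and j: "\<sigma>' ''j'' 0 = real j" and wr: "writes \<sigma>' (successes B j)" and le: "length (successes B j) \<le> s"
        using prems(2) unfolding I_def by blast
      have ex: "length (successes B j) = s \<or> j = J"
        using prems(3) le jJ unfolding cond[OF fr j wr] by (auto split: if_splits)
      obtain ys where ys: "successes B J = successes B j @ ys" using successes_prefix[OF jJ] by blast
      have tk: "take s (successes B J) = successes B j"
      proof (cases "length (successes B j) = s")
        case True
        then show ?thesis unfolding ys by simp
      next
        case False
        then have "j = J" using ex by blast
        then show ?thesis using le by simp
      qed
      show ?thesis unfolding k1
        apply (rule Q)
        subgoal using prems(1) by simp
        subgoal using fr by simp
        subgoal using wr by (simp only: tk)
        done
    qed
    done
qed

lemma todo_le_act_cost: "todo (k * J1) k \<sigma> \<le> act_cost k"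
proof -
  have "todo (k * J1) k \<sigma> \<le> (\<Sum>v\<in>V. card {j. j < k * J1 \<and> v \<in> active h j})"
    unfolding todo_def by (intro sum_mono2) auto
  also have "\<dots> = (\<Sum>v\<in>V. \<Sum>j<k * J1. if v \<in> active h j then 1 else 0)"
    by (intro sum.cong refl, subst sum.inter_filter[symmetric]) (auto simp: lessThan_def Collect_conj_eq)
  also have "\<dots> = (\<Sum>j<k * J1. \<Sum>v\<in>V. if v \<in> active h j then 1 else 0)"
    by (rule sum.swap)
  also have "\<dots> = act_cost k"
    unfolding activation_cost_def
  proof (intro sum.cong refl)
    fix j
    have "{v \<in> V. v \<in> active h j} = active h j" by (auto simp: active_def)
    then show "(\<Sum>v\<in>V. if v \<in> active h j then 1 else 0) = card (active h j)"
      by (subst sum.inter_filter[symmetric]) auto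
  qed
  finally show ?thesis .
qed

text \<open>Activity in one of the first J slots forces 1 - h v > q^J. Bernoulli's inequality bounds
  1 - q^J by J (1 - q), and 1 - q is at most \<open>deg v / (n * th)\<close>.\<close>

lemma active_hash_less:
  assumes "v \<in> active h j" "j < k * J1" "deg v * t \<le> 2 * n * (k * R)" "0 < t"
  shows "h v < p k t"
proof -
  let ?J = "k * J1" and ?x = "real (deg v) / (real n * th)"
  have v: "v \<in> V" "th < real (deg v)" "act (q v) (1 - h v) j" using assms by (auto simp: active_def)
  have dv: "0 < deg v" using v th0 by (cases "deg v = 0") auto
  note qb = q_bounds[OF dv]
  have x0: "0 < ?x" using dv n2 th0 by simp
  have "q v ^ ?J < 1 - h v" using act_imp_gt_power[OF qb v(3) assms(2)] .
  moreover have "1 + real ?J * (q v - 1) \<le> (1 + (q v - 1)) ^ ?J"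
    using qb by (intro Bernoulli_inequality) simp
  ultimately have "h v < real ?J * (1 - q v)" by (simp add: algebra_simps)
  also have "1 - q v \<le> ?x"
  proof -
    have "1 - 1 / (1 + x) \<le> x" if "0 < x" for x :: real
      using that by (simp add: field_simps)
    then show ?thesis unfolding q_def using x0 by blast
  qed
  then have "real ?J * (1 - q v) \<le> real ?J * ?x" by (intro mult_left_mono) auto
  also have "\<dots> \<le> p k t"
  proof -
    have "real (deg v) * real t \<le> 2 * real n * real (k * R)"
      using assms(3)[THEN of_nat_mono[where 'a = real]] by simp
    then have "real (deg v) / real n \<le> 2 * real (k * R) / real t"
      using assms(4) n2 by (simp add: field_simps)
    then have "real ?J / th * (real (deg v) / real n) \<le> real ?J / th * (2 * real (k * R) / real t)"
      using th0 by (intro mult_left_mono) auto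
    then show ?thesis unfolding hash_bound_def by (simp add: field_simps)
  qed
  finally show ?thesis .
qed

definition phase_cost :: "nat \<Rightarrow> nat" where
  "phase_cost k = 2000 * (1 + T k + k * J1 + enum_cost k + act_cost k)"

text \<open>Marks of earlier phases stay in \<open>H\<close> even if the search was incomplete, so
  only their soundness is carried over. A covered phase restores completeness, because it visits all
  relevant vertices anew.\<close>

definition phase_state :: "nat \<Rightarrow> store \<Rightarrow> nat \<Rightarrow> bool" where
  "phase_state k \<sigma> ks \<longleftrightarrow> params \<sigma> \<and> \<sigma> ''k'' 0 = real k \<and> \<sigma> ''J'' 0 = real (k * J1) \<and> \<sigma> ''Rk'' 0 = real (k * R)
     \<and> (\<exists>f. \<sigma> ''f'' 0 = real f \<and> ks = base + 2 * f \<and> (\<forall>i<f. \<sigma> ''S'' i = r (base + 2 * i) \<and> \<sigma> ''A'' i = a i))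
     \<and> (\<exists>B. \<sigma> ''H'' = (\<lambda>j. hval (B j)) \<and> (\<forall>j. B j \<subseteq> active h j)) \<and> (\<forall>v. \<sigma> ''K'' v \<le> real k)"

lemma wp_phase:
  assumes st: "phase_state k \<sigma> ks"
    and Q: "\<And>t \<sigma>' ks' B. t \<le> phase_cost (Suc k) \<Longrightarrow> phase_state (Suc k) \<sigma>' ks' \<Longrightarrow> (\<And>j. B j \<subseteq> active h j) \<Longrightarrow>
      (covered (Suc k) \<Longrightarrow> \<forall>j<Suc k * J1. B j = active h j) \<Longrightarrow>
      writes \<sigma>' (take s (successes B (Suc k * J1))) \<Longrightarrow> Q t \<sigma>' ks'"
  shows "wp G h r phase Q \<sigma> ks"
proof -
  let ?k = "Suc k"
  obtain f B0 where par: "params \<sigma>" and k: "\<sigma> ''k'' 0 = real k" and J: "\<sigma> ''J'' 0 = real (k * J1)"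
    and Rk: "\<sigma> ''Rk'' 0 = real (k * R)"
    and f: "\<sigma> ''f'' 0 = real f" "ks = base + 2 * f" "\<And>i. i < f \<Longrightarrow> \<sigma> ''S'' i = r (base + 2 * i) \<and> \<sigma> ''A'' i = a i"
    and B0: "\<sigma> ''H'' = (\<lambda>j. hval (B0 j))" "\<And>j. B0 j \<subseteq> active h j" and K: "\<And>v. \<sigma> ''K'' v \<le> real k"
    using st unfolding phase_state_def by blast
  have pr: "\<sigma> ''n'' 0 = real n" "\<sigma> ''th'' 0 = th" "\<sigma> ''J1'' 0 = real J1" "\<sigma> ''R'' 0 = real R"
    using par by (simp_all add: params_def)
  define \<sigma>1 where "\<sigma>1 = update (update (update (update \<sigma> ''k'' 0 (real ?k)) ''J'' 0 (real (?k * J1)))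
    ''Rk'' 0 (real (?k * R))) ''T'' 0 (real (T ?k))"
  have T: "real_of_int \<lfloor>2 * real n * real (?k * R) / th\<rfloor> + 1 = real (T ?k)" by (rule T_real)
  show ?thesis
    unfolding phase_def
    apply (rule wp_Seq, rule wp_assign[where x = "real ?k"])
    subgoal using k by simp
    apply (rule wp_Seq, rule wp_assign[where x = "real (?k * J1)"])
    subgoal using J pr by (simp add: update_apply algebra_simps)
    apply (rule wp_Seq, rule wp_assign[where x = "real (?k * R)"])
    subgoal using Rk pr by (simp add: update_apply algebra_simps)
    apply (rule wp_Seq, rule wp_assign[where x = "real (T ?k)"])
    subgoal using pr T by (simp add: update_apply del: of_nat_mult of_nat_Suc)
    apply (fold \<sigma>1_def)
    apply (rule wp_Seq, rule wp_fill[where ?t0.0 = "T ?k" and ?j0.0 = "?k * J1" and ?f0.0 = f])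
    subgoal by (simp add: \<sigma>1_def update_apply)
    subgoal by (simp add: \<sigma>1_def update_apply)
    subgoal using f by (simp add: \<sigma>1_def update_apply)
    subgoal by (rule f(2))
    subgoal using f(3) by (simp add: \<sigma>1_def update_apply)
    subgoal premises p1 for t1 \<sigma>2 f'
    proof -
      have c2: "\<sigma>2 ''n'' = \<sigma> ''n''" "\<sigma>2 ''s'' = \<sigma> ''s''" "\<sigma>2 ''l'' = \<sigma> ''l''" "\<sigma>2 ''y'' = \<sigma> ''y''" "\<sigma>2 ''th'' = \<sigma> ''th''"
        "\<sigma>2 ''R'' = \<sigma> ''R''" "\<sigma>2 ''J1'' = \<sigma> ''J1''" "\<sigma>2 ''H'' = \<sigma> ''H''" "\<sigma>2 ''K'' = \<sigma> ''K''"
        "\<sigma>2 ''k'' 0 = real ?k" "\<sigma>2 ''J'' 0 = real (?k * J1)" "\<sigma>2 ''Rk'' 0 = real (?k * R)" "\<sigma>2 ''T'' 0 = real (T ?k)"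
        using p1(2) by (simp_all add: \<sigma>1_def update_def)
      have par2: "params \<sigma>2" using par c2 by (simp add: params_def)
      have Kl: "\<not> real ?k \<le> \<sigma> ''K'' v" for v using K[of v] by simp
      have m2: "marks (?k * J1) ?k \<sigma>2"
        unfolding marks_def c2
      proof (intro conjI exI[of _ B0] allI)
        show "\<forall>v\<in>V. \<forall>j<?k * J1. real ?k \<le> \<sigma> ''K'' v \<longrightarrow> v \<in> active h j \<longrightarrow> v \<in> B0 j" using Kl by blast
        show "\<sigma> ''K'' v \<le> real ?k" for v using Kl[of v] by simp
      qed (use B0 in auto)
      show ?thesis
        apply (rule wp_Seq, rule wp_search[where k = ?k])
        subgoal by (rule par2)
        subgoal by (rule c2)
        subgoal by (rule c2)
        subgoal by (rule m2)
        subgoal using p1(4,5) by simp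
        subgoal by (rule c2)
        subgoal by (rule c2)
        subgoal premises p2 for t2 \<sigma>3
        proof -
          obtain B where B: "\<sigma>3 ''H'' = (\<lambda>j. hval (B j))" "\<And>j. B j \<subseteq> active h j"
            "\<And>v j. v \<in> V \<Longrightarrow> j < ?k * J1 \<Longrightarrow> \<sigma>3 ''K'' v \<ge> real ?k \<Longrightarrow> v \<in> active h j \<Longrightarrow> v \<in> B j"
            and K3: "\<And>v. \<sigma>3 ''K'' v \<le> real ?k"
            using p2(3) unfolding marks_def by blast
          have c3: "\<sigma>3 ''n'' = \<sigma> ''n''" "\<sigma>3 ''s'' = \<sigma> ''s''" "\<sigma>3 ''l'' = \<sigma> ''l''" "\<sigma>3 ''y'' = \<sigma> ''y''" "\<sigma>3 ''th'' = \<sigma> ''th''"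
            "\<sigma>3 ''R'' = \<sigma> ''R''" "\<sigma>3 ''J1'' = \<sigma> ''J1''"
            "\<sigma>3 ''k'' 0 = real ?k" "\<sigma>3 ''J'' 0 = real (?k * J1)" "\<sigma>3 ''Rk'' 0 = real (?k * R)"
            "\<sigma>3 ''f'' = \<sigma>2 ''f''" "\<sigma>3 ''S'' = \<sigma>2 ''S''" "\<sigma>3 ''A'' = \<sigma>2 ''A''"
            using p2(2) c2 by simp_all
          have par3: "params \<sigma>3" using par c3 by (simp add: params_def)
          have cov: "\<forall>j<?k * J1. B j = active h j" if cv: "covered ?k"
          proof (intro allI impI equalityI subsetI)
            fix j v assume j: "j < ?k * J1" and v: "v \<in> active h j"
            have v': "v \<in> V" "th < real (deg v)" using v by (auto simp: active_def)
            obtain t where t: "t \<in> {?k * R<..T ?k}" "cap t" "v \<in> N (u t)" "deg v * t \<le> 2 * n * (?k * R)"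
              using cv v' unfolding covers_def by blast
            have "h v < p ?k t" using active_hash_less[OF v j t(4)] t(1) by simp
            then have "\<sigma>3 ''K'' v \<ge> real ?k" using p2(4) t v' by blast
            then show "v \<in> B j" using B(3) v' j v by blast
          qed (use B(2) in blast)
          show ?thesis
            apply (rule wp_scan[where B = B and J = "?k * J1"])
            subgoal by (rule par3)
            subgoal by (rule B(1))
            subgoal by (rule B(2))
            subgoal using p1(4,5) c3 by simp
            subgoal by (rule c3)
            subgoal premises p3 for t3 \<sigma>4
              apply (rule Q[where B = B])
              subgoal using p1(1) p2(1) p3(1) todo_le_act_cost[of ?k \<sigma>2] unfolding phase_cost_def by simp
              subgoal unfolding phase_state_def
                apply (intro conjI)
                subgoal using p3(2) par3 by (simp add: params_def)
                subgoal using p3(2) c3 by simp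
                subgoal using p3(2) c3 by simp
                subgoal using p3(2) c3 by simp
                subgoal using p3(2) c3 p1(3,5) by (intro exI[of _ f']) simp
                subgoal using p3(2) B(1,2) by (intro exI[of _ B]) simp
                subgoal using p3(2) K3 by simp
                done
              subgoal by (rule B(2))
              subgoal by (rule cov)
              subgoal by (rule p3(3))
              done
            done
        qed
        done
    qed
    done
qed

end

section \<open>Verification of the estimation rounds\<close>

context edge_sampler
begin

context
  fixes h r :: "nat \<Rightarrow> real"
  assumes r: "\<And>i. 0 \<le> r i \<and> r i < 1"
begin

lemma wp_estimate_round:
  assumes v: "\<sigma> ''n'' 0 = real n" "\<sigma> ''i'' 0 = 0" "\<sigma> ''c'' 0 = 0" "\<sigma> ''b'' 0 = real (trials g)" "\<sigma> ''x'' 0 = X g"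
    and Q: "\<And>t \<sigma>'. t \<le> 60 * trials g + 20 \<Longrightarrow> (\<And>x. x \<notin> {''u'', ''w'', ''c'', ''i''} \<Longrightarrow> \<sigma>' x = \<sigma> x) \<Longrightarrow>
      \<sigma>' ''c'' 0 = real (cnt r g) \<Longrightarrow> Q t \<sigma>' (pos (Suc g))"
  shows "wp G h r estimate_round Q \<sigma> (pos g)"
proof -
  let ?F = "{''u'', ''w'', ''c'', ''i''}"
  let ?c = "\<lambda>j. card {i. i < j \<and> hit (X g) (r (pos g + i))}"
  define I where "I = (\<lambda>c \<sigma>' k'. (\<forall>x. x \<notin> ?F \<longrightarrow> \<sigma>' x = \<sigma> x) \<and> (\<exists>j\<le>trials g. \<sigma>' ''i'' 0 = real j \<and>
    k' = pos g + j \<and> \<sigma>' ''c'' 0 = real (?c j) \<and> c = 60 * (trials g - j)))"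
  have cS: "?c (Suc j) = ?c j + (if hit (X g) (r (pos g + j)) then 1 else 0)" for j
  proof -
    have "{i. i < Suc j \<and> hit (X g) (r (pos g + i))} =
      (if hit (X g) (r (pos g + j)) then insert j {i. i < j \<and> hit (X g) (r (pos g + i))}
       else {i. i < j \<and> hit (X g) (r (pos g + i))})" by (auto simp: less_Suc_eq)
    then show ?thesis by simp
  qed
  show ?thesis
    unfolding estimate_round_def
    apply (rule wp_While[where I = I and c = "60 * trials g"])
    subgoal premises prems for c \<sigma>1 k1
    proof -
      obtain j where fr: "\<And>x. x \<notin> ?F \<Longrightarrow> \<sigma>1 x = \<sigma> x" and j: "\<sigma>1 ''i'' 0 = real j" "k1 = pos g + j"
        and c1: "\<sigma>1 ''c'' 0 = real (?c j)" and c: "c = 60 * (trials g - j)"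
        using prems(1) unfolding I_def by blast
      have cs: "\<sigma>1 ''n'' = \<sigma> ''n''" "\<sigma>1 ''b'' = \<sigma> ''b''" "\<sigma>1 ''x'' = \<sigma> ''x''" by (rule fr, simp)+
      have lt: "j < trials g" using prems(2) j v cs by (simp split: if_splits)
      let ?u = "r (pos g + j)"
      have "0 \<le> ?u" "?u < 1" using r by auto
      then have vq: "vertex_query G (nat \<lfloor>real n * ?u\<rfloor>) = real (pick ?u)" and pV: "pick ?u \<in> V"
        using vertex_query_pick pick_in_V by auto
      have dq: "degree_query G (pick ?u) = real (deg (pick ?u))" using pV by (simp add: degree_query_def)
      show ?thesis
        apply (rule wp_Seq, rule wp_Random, rule wp_Seq, rule wp_assign[where x = "real n * ?u"])
        subgoal using v cs j by (simp add: update_apply)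
        apply (rule wp_Seq, rule wp_assign[where x = "real (?c (Suc j))"])
        subgoal unfolding cS using v cs c1 j vq dq by (simp add: update_apply hit_def frac_def)
        apply (rule wp_Write)
        apply (rule exI[of _ "60 * (trials g - Suc j)"])
        apply (rule conjI)
        subgoal using lt unfolding c by simp
        subgoal unfolding I_def
          apply (intro conjI)
          subgoal using fr by (simp add: update_def)
          apply (rule exI[of _ "Suc j"], intro conjI)
          subgoal using lt by simp
          subgoal using j by (simp add: update_apply)
          subgoal using j by simp
          subgoal by (simp add: update_apply)
          subgoal by simp
          done
        done
    qed
    subgoal unfolding I_def using v by (intro conjI exI[of _ 0]) auto
    subgoal premises prems for t c' \<sigma>' k'
    proof -
      obtain j where fr: "\<And>x. x \<notin> ?F \<Longrightarrow> \<sigma>' x = \<sigma> x" and j: "\<sigma>' ''i'' 0 = real j" "k' = pos g + j" "j \<le> trials g"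
        and c1: "\<sigma>' ''c'' 0 = real (?c j)"
        using prems(2) unfolding I_def by blast
      have "\<sigma>' ''b'' = \<sigma> ''b''" by (rule fr) simp
      then have jt: "j = trials g" using prems(3) j v by (simp split: if_splits)
      have k': "k' = pos (Suc g)" using j jt by (simp add: pos_def)
      show ?thesis unfolding k'
        apply (rule Q)
        subgoal using prems(1) by simp
        subgoal by (rule fr)
        subgoal using c1 jt by (simp add: cnt_def)
        done
    qed
    done
qed

lemma wp_estimate:
  assumes st: "stops r g"
    and Q: "\<And>t \<sigma>'. t \<le> 400 * pos (Suc g) \<Longrightarrow>
      (\<And>x. x \<notin> {''l'', ''x'', ''b'', ''c'', ''i'', ''u'', ''w''} \<Longrightarrow> \<sigma>' x = input_store n s \<delta> x) \<Longrightarrow>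
      \<sigma>' ''l'' 0 = real \<l> \<Longrightarrow> \<sigma>' ''x'' 0 = X g / 2 \<Longrightarrow> Q t \<sigma>' (pos (Suc g))"
  shows "wp G h r estimate Q (input_store n s \<delta>) 0"
proof -
  let ?\<sigma> = "input_store n s \<delta>"
  let ?F = "{''l'', ''x'', ''b'', ''c'', ''i'', ''u'', ''w''}"
  let ?cost = "\<lambda>g'. (\<Sum>i\<in>{g'..g}. 60 * trials i + 100)"
  \<comment> \<open>At the guard \<open>g'\<close> rounds are complete, so \<open>c\<close> holds
    the count of round \<open>g' - 1\<close>, or the initial memory value 0 before the first
    round.\<close>
  define I where "I = (\<lambda>c \<sigma>' k'. (\<forall>x. x \<notin> ?F \<longrightarrow> \<sigma>' x = ?\<sigma> x) \<and> \<sigma>' ''l'' 0 = real \<l> \<and> (\<exists>g'\<le>Suc g.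
    \<sigma>' ''x'' 0 = X g' \<and> \<sigma>' ''b'' 0 = real (trials g') \<and> k' = pos g' \<and>
    \<sigma>' ''c'' 0 = (if g' = 0 then 0 else real (cnt r (g' - 1))) \<and> c = ?cost g'))"
  have lo: "cnt r g' < 20 * \<l>" if "g' < g" for g' using st that by (simp add: stops_def)
  have hi: "20 * \<l> \<le> cnt r g" using st by (simp add: stops_def)
  have cost: "?cost 0 + 50 \<le> 400 * pos (Suc g)"
  proof -
    have t40: "40 \<le> trials i" for i
    proof -
      have "1 * 1 \<le> \<l> * 2 ^ i" using \<l>_pos by (intro mult_le_mono) auto
      then show ?thesis unfolding trials_def by (simp add: mult.assoc)
    qed
    have "?cost 0 \<le> (\<Sum>i\<in>{0..g}. 100 * trials i)"
    proof (rule sum_mono)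
      fix i show "60 * trials i + 100 \<le> 100 * trials i" using t40[of i] by simp
    qed
    also have "\<dots> = 100 * pos (Suc g)"
      unfolding pos_def by (simp add: sum_distrib_left atLeast0AtMost lessThan_Suc_atMost)
    finally have "?cost 0 \<le> 100 * pos (Suc g)" .
    moreover have "40 \<le> pos (Suc g)" unfolding pos_def using t40[of 0] by (simp add: sum.lessThan_Suc_shift del: sum.lessThan_Suc)
    ultimately show ?thesis by simp
  qed
  show ?thesis
    unfolding estimate_def
    apply (rule wp_Seq, rule wp_assign[where x = "real \<l>"])
    subgoal using \<l>_real by (simp add: input_store_def)
    apply (rule wp_Seq, rule wp_assign[where x = "real n"])
    subgoal by (simp add: input_store_def update_apply)
    apply (rule wp_Seq, rule wp_assign[where x = "real (trials 0)"])
    subgoal by (simp add: trials_def update_apply)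
    apply (rule wp_While[where I = I and c = "?cost 0"])
    subgoal premises prems for c \<sigma>1 k1
    proof -
      obtain g' where fr: "\<And>x. x \<notin> ?F \<Longrightarrow> \<sigma>1 x = ?\<sigma> x" and l: "\<sigma>1 ''l'' 0 = real \<l>" and g': "g' \<le> Suc g"
        and x: "\<sigma>1 ''x'' 0 = X g'" and b: "\<sigma>1 ''b'' 0 = real (trials g')" and k1: "k1 = pos g'"
        and cc: "\<sigma>1 ''c'' 0 = (if g' = 0 then 0 else real (cnt r (g' - 1)))" and c: "c = ?cost g'"
        using prems(1) unfolding I_def by blast
      have "g' \<noteq> Suc g" using prems(2) cc l hi by (auto split: if_splits)
      with g' have g'g: "g' \<le> g" by simp
      have cs: "?cost g' = 60 * trials g' + 100 + ?cost (Suc g')"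
        using g'g by (simp add: sum.atLeast_Suc_atMost)
      have nn: "\<sigma>1 ''n'' = ?\<sigma> ''n''" by (rule fr) simp
      show ?thesis unfolding k1
        apply (rule wp_Seq, rule wp_assign[where x = 0], simp)
        apply (rule wp_Seq, rule wp_assign[where x = 0], simp)
        apply (rule wp_Seq, rule wp_estimate_round)
        subgoal using nn by (simp add: update_apply input_store_def)
        subgoal by (simp add: update_apply)
        subgoal by (simp add: update_apply)
        subgoal using b by (simp add: update_apply)
        subgoal using x by (simp add: update_apply)
        subgoal premises p for t \<sigma>2
        proof -
          have v2: "\<sigma>2 ''x'' 0 = X g'" "\<sigma>2 ''b'' 0 = real (trials g')" "\<sigma>2 ''l'' 0 = real \<l>"
            using p(2) x b l by (simp_all add: update_apply)
          show ?thesis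
            apply (rule wp_Seq, rule wp_assign[where x = "X (Suc g')"])
            subgoal using v2 by (simp add: X_def)
            apply (rule wp_assign[where x = "real (trials (Suc g'))"])
            subgoal using v2 by (simp add: trials_def update_apply)
            apply (rule exI[of _ "?cost (Suc g')"])
            apply (rule conjI)
            subgoal using p(1) unfolding c cs by simp
            subgoal unfolding I_def
              apply (intro conjI)
              subgoal using p(2) fr by (simp add: update_def)
              subgoal using v2 by (simp add: update_apply)
              apply (rule exI[of _ "Suc g'"], intro conjI)
              subgoal using g'g by simp
              subgoal by (simp add: update_apply)
              subgoal by (simp add: update_apply)
              subgoal by simp
              subgoal using p(3) by (simp add: update_apply)
              subgoal by simp
              done
            done
        qed
        done
    qed
    subgoal unfolding I_def
      by (intro conjI exI[of _ 0]) (simp_all add: update_def input_store_def X_def pos_def)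
    subgoal premises prems for t c' \<sigma>' k'
    proof -
      obtain g' where fr: "\<And>x. x \<notin> ?F \<Longrightarrow> \<sigma>' x = ?\<sigma> x" and l: "\<sigma>' ''l'' 0 = real \<l>" and g': "g' \<le> Suc g"
        and x: "\<sigma>' ''x'' 0 = X g'" and k1: "k' = pos g'"
        and cc: "\<sigma>' ''c'' 0 = (if g' = 0 then 0 else real (cnt r (g' - 1)))"
        using prems(2) unfolding I_def by blast
      have g1: "g' = Suc g"
      proof (rule ccontr)
        assume "g' \<noteq> Suc g"
        with g' have "g' = 0 \<or> g' - 1 < g" by auto
        then show False using prems(3) cc l \<l>_pos lo[of "g' - 1"] by (auto split: if_splits)
      qed
      show ?thesis unfolding k1 g1
        apply (rule Q)
        subgoal using prems(1) cost by simp
        subgoal by (rule fr)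
        subgoal by (rule l)
        subgoal using x unfolding g1 by (simp add: X_def)
        done
    qed
    done
qed

end

end

section \<open>The loop over the phases and the whole run\<close>

context sampler_run
begin

lemma successes_cong: "(\<And>j. j < J \<Longrightarrow> B j = B' j) \<Longrightarrow> successes B J = successes B' J"
  by (induction J) (auto simp: successes_Suc successes_def List.map_filter_def)

text \<open>The clause about the phases before \<open>K\<close> bounds the stopping phase from
  above: a covered phase with enough successes ends the loop, whatever happened earlier.\<close>

lemma wp_phases:
  assumes st: "phase_state 0 \<sigma> ks" and i: "\<sigma> ''i'' 0 = 0"
    and Q: "\<And>t \<sigma>' ks' K B. 1 \<le> K \<Longrightarrow> K \<le> \<l> \<Longrightarrow> t \<le> (\<Sum>k\<in>{0<..K}. phase_cost k + 30) + 30 \<Longrightarrow>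
      (covered K \<Longrightarrow> \<forall>j<K * J1. B j = active h j) \<Longrightarrow>
      writes \<sigma>' (take s (successes B (K * J1))) \<Longrightarrow> s \<le> length (successes B (K * J1)) \<or> K = \<l> \<Longrightarrow>
      (\<And>k. 1 \<le> k \<Longrightarrow> k < K \<Longrightarrow> covered k \<Longrightarrow> length (successes (active h) (k * J1)) < s) \<Longrightarrow> Q t \<sigma>' ks'"
  shows "wp G h r (While ((var ''i'' \<^bold>< var ''s'') \<^bold>* (var ''k'' \<^bold>< var ''l'')) phase) Q \<sigma> ks"
proof -
  let ?b = "(var ''i'' \<^bold>< var ''s'') \<^bold>* (var ''k'' \<^bold>< var ''l'')"
  let ?cost = "\<lambda>k. (\<Sum>k'\<in>{k<..\<l>}. phase_cost k' + 30)"
  define I where "I = (\<lambda>c \<sigma>' ks'. \<exists>k B. k \<le> \<l> \<and> phase_state k \<sigma>' ks' \<and> c = ?cost k \<and>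
    (covered k \<longrightarrow> (\<forall>j<k * J1. B j = active h j)) \<and> writes \<sigma>' (take s (successes B (k * J1))) \<and>
    (\<forall>k'. 1 \<le> k' \<longrightarrow> k' < k \<longrightarrow> covered k' \<longrightarrow> length (successes (active h) (k' * J1)) < s))"
  have cond: "eval_expr G h \<sigma>' ?b = (if length xs < s \<and> k < \<l> then 1 else 0)"
    if "phase_state k \<sigma>' ks'" "writes \<sigma>' (take s xs)" for \<sigma>' k ks' xs
    using that by (simp add: writes_def params_def phase_state_def)
  show ?thesis
    apply (rule wp_While[where I = I and c = "?cost 0"])
    subgoal premises prems for c \<sigma>1 k1
    proof -
      obtain k B where k: "k \<le> \<l>" and ps: "phase_state k \<sigma>1 k1" and c: "c = ?cost k"
        and B: "covered k \<longrightarrow> (\<forall>j<k * J1. B j = active h j)" and wr: "writes \<sigma>1 (take s (successes B (k * J1)))"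
        and prev: "\<forall>k'. 1 \<le> k' \<longrightarrow> k' < k \<longrightarrow> covered k' \<longrightarrow> length (successes (active h) (k' * J1)) < s"
        using prems(1) unfolding I_def by blast
      have lt: "length (successes B (k * J1)) < s" "k < \<l>"
        using prems(2) unfolding cond[OF ps wr] by (auto split: if_splits)
      have cs: "?cost k = phase_cost (Suc k) + 30 + ?cost (Suc k)"
      proof -
        have "{k<..\<l>} = insert (Suc k) {Suc k<..\<l>}" using lt by auto
        then show ?thesis by simp
      qed
      have now: "length (successes (active h) (k * J1)) < s" if "covered k"
        using lt successes_cong[of "k * J1" B "active h"] B that by simp
      show ?thesis
        apply (rule wp_phase[OF ps])
        subgoal premises p for t \<sigma>' ks' B'
          apply (rule exI[of _ "?cost (Suc k)"])
          apply (rule conjI)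
          subgoal using p(1) unfolding c cs by simp
          subgoal unfolding I_def
            apply (rule exI[of _ "Suc k"], rule exI[of _ B'], intro conjI)
            subgoal using lt by simp
            subgoal by (rule p(2))
            subgoal by simp
            subgoal using p(4) by blast
            subgoal by (rule p(5))
            subgoal using prev now by (auto simp: less_Suc_eq)
            done
          done
        done
    qed
    subgoal unfolding I_def
      apply (rule exI[of _ 0], rule exI[of _ "\<lambda>_. {}"], intro conjI)
      subgoal by simp
      subgoal by (rule st)
      subgoal by simp
      subgoal by simp
      subgoal using i by (simp add: writes_def successes_def List.map_filter_def)
      subgoal by simp
      done
    subgoal premises prems for t c' \<sigma>' ks'
    proof -
      obtain k B where k: "k \<le> \<l>" and ps: "phase_state k \<sigma>' ks'" and c: "c' = ?cost k"
        and B: "covered k \<longrightarrow> (\<forall>j<k * J1. B j = active h j)" and wr: "writes \<sigma>' (take s (successes B (k * J1)))"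
        and prev: "\<forall>k'. 1 \<le> k' \<longrightarrow> k' < k \<longrightarrow> covered k' \<longrightarrow> length (successes (active h) (k' * J1)) < s"
        using prems(2) unfolding I_def by blast
      have ex: "s \<le> length (successes B (k * J1)) \<or> k = \<l>"
        using prems(3) k unfolding cond[OF ps wr] by (auto split: if_splits)
      have k0: "1 \<le> k"
      proof (rule ccontr)
        assume "\<not> 1 \<le> k"
        then have "k = 0" by simp
        then show False using ex s1 \<l>_pos by (simp add: successes_def List.map_filter_def)
      qed
      have "?cost 0 = (\<Sum>k\<in>{0<..k}. phase_cost k + 30) + ?cost k"
      proof -
        have "{0<..\<l>} = {0<..k} \<union> {k<..\<l>}" using k by auto
        then show ?thesis by (simp add: sum.union_disjoint)
      qed
      then have t: "t \<le> (\<Sum>k\<in>{0<..k}. phase_cost k + 30) + 30" using prems(1) c by simp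
      show ?thesis
        apply (rule Q[where K = k and B = B])
        subgoal by (rule k0)
        subgoal by (rule k)
        subgoal by (rule t)
        subgoal using B by blast
        subgoal by (rule wr)
        subgoal by (rule ex)
        subgoal using prev by blast
        done
    qed
    done
qed

text \<open>The output claim assumes that all phases are covered because the stopping phase is not
  known in advance. The time claim needs a single covered phase \<open>K\<close> with
  \<open>s\<close> successes, which the loop cannot outlast; this permits a time bound with a
  constant number of phases although \<open>\<l>\<close> are allowed.\<close>

theorem exec_sampler:
  assumes st: "stops r g" and y: "y = 3 * X g" and base: "base = pos (Suc g)"
  obtains t \<sigma> k where "exec G h r (sampler, input_store n s \<delta>, 0) t (\<sigma>, k)"
    "(\<forall>k\<in>{1..\<l>}. covered k) \<Longrightarrow> s \<le> length (successes (active h) (\<l> * J1)) \<Longrightarrow>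
      \<forall>i<s. \<sigma> ''src'' i = real (fst (successes (active h) (\<l> * J1) ! i)) \<and>
            \<sigma> ''dst'' i = real (snd (successes (active h) (\<l> * J1) ! i))"
    "\<And>K. 1 \<le> K \<Longrightarrow> covered K \<Longrightarrow> s \<le> length (successes (active h) (K * J1)) \<Longrightarrow>
      t \<le> 400 * pos (Suc g) + (\<Sum>k\<in>{0<..K}. phase_cost k + 30) + 400"
proof -
  define Q where "Q = (\<lambda>t \<sigma> k :: nat.
    ((\<forall>k\<in>{1..\<l>}. covered k) \<longrightarrow> s \<le> length (successes (active h) (\<l> * J1)) \<longrightarrow>
      (\<forall>i<s. \<sigma> ''src'' i = real (fst (successes (active h) (\<l> * J1) ! i)) \<and>
            \<sigma> ''dst'' i = real (snd (successes (active h) (\<l> * J1) ! i)))) \<and>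
    (\<forall>K. 1 \<le> K \<longrightarrow> covered K \<longrightarrow> s \<le> length (successes (active h) (K * J1)) \<longrightarrow>
      t \<le> 400 * pos (Suc g) + (\<Sum>k\<in>{0<..K}. phase_cost k + 30) + 400))"
  \<comment> \<open>The machine has no square root; \<open>setup_params\<close> computes it by this
    identity.\<close>
  have ss: "exp (ln (real s) / 2) = sqrt (real s)"
    using s1 by (simp add: ln_sqrt[symmetric])
  have "wp G h r sampler Q (input_store n s \<delta>) 0"
    unfolding sampler_def
    apply (rule wp_Seq, rule wp_estimate[OF r st])
    subgoal premises p for t1 \<sigma>1
    proof -
      have v1: "\<sigma>1 ''n'' = input_store n s \<delta> ''n''" "\<sigma>1 ''s'' = input_store n s \<delta> ''s''"
        by (rule p(2), simp)+
      define \<sigma>2 where "\<sigma>2 = update (update (update (update (update \<sigma>1 ''y'' 0 y) ''th'' 0 th) ''R'' 0 (real R))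
        ''J1'' 0 (real J1)) ''i'' 0 0"
      have ps: "phase_state 0 \<sigma>2 (pos (Suc g))"
        unfolding phase_state_def
        apply (intro conjI)
        subgoal unfolding params_def using v1 p(3) by (simp add: \<sigma>2_def update_apply input_store_def)
        subgoal using p(2)[of "''k''"] by (simp add: \<sigma>2_def update_apply input_store_def)
        subgoal using p(2)[of "''J''"] by (simp add: \<sigma>2_def update_apply input_store_def)
        subgoal using p(2)[of "''Rk''"] by (simp add: \<sigma>2_def update_apply input_store_def)
        subgoal using p(2)[of "''f''"] base by (intro exI[of _ 0]) (simp add: \<sigma>2_def update_apply input_store_def)
        subgoal using p(2)[of "''H''"]
          by (intro exI[of _ "\<lambda>_. {}"]) (auto simp add: \<sigma>2_def update_def input_store_def hval_def)
        subgoal using p(2)[of "''K''"] by (simp add: \<sigma>2_def update_apply input_store_def)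
        done
      show ?thesis
        unfolding setup_params_def
        apply (rule wp_Seq, rule wp_Seq, rule wp_assign[where x = y])
        subgoal using p(4) y by simp
        apply (rule wp_Seq, rule wp_assign[where x = th])
        subgoal using v1 ss by (simp add: update_apply input_store_def th_def)
        apply (rule wp_Seq, rule wp_assign[where x = "real R"])
        subgoal using p(3) by (simp add: update_apply R_def)
        apply (rule wp_Seq, rule wp_assign[where x = "real J1"])
        subgoal using v1 J1_real \<nu>_real by (simp add: update_apply input_store_def)
        apply (rule wp_assign[where x = 0], simp)
        apply (fold \<sigma>2_def)
        apply (rule wp_phases[OF ps])
        subgoal by (simp add: \<sigma>2_def update_apply)
        subgoal premises q for t2 \<sigma>3 ks' K B
          unfolding Q_def
        proof (intro conjI impI allI)
          fix i assume cov: "\<forall>k\<in>{1..\<l>}. covered k" and len: "s \<le> length (successes (active h) (\<l> * J1))" and i: "i < s"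
          have "covered K" using cov q(1,2) by simp
          then have eq: "successes B (K * J1) = successes (active h) (K * J1)"
            using q(4) by (intro successes_cong) auto
          obtain ys where ys: "successes (active h) (\<l> * J1) = successes (active h) (K * J1) @ ys"
            using successes_prefix[of "K * J1" "\<l> * J1"] q(2) by auto
          have long: "s \<le> length (successes (active h) (K * J1))"
            using q(6) len eq by auto
          have "take s (successes B (K * J1)) = take s (successes (active h) (\<l> * J1))"
            unfolding eq ys using long by simp
          then show "\<sigma>3 ''src'' i = real (fst (successes (active h) (\<l> * J1) ! i))"
            "\<sigma>3 ''dst'' i = real (snd (successes (active h) (\<l> * J1) ! i))"
            using q(5) i len unfolding writes_def by simp_all
        next
          fix K' assume K': "1 \<le> K'" "covered K'" "s \<le> length (successes (active h) (K' * J1))"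
          have "K \<le> K'" using q(7)[of K'] K' by force
          then have "(\<Sum>k\<in>{0<..K}. phase_cost k + 30) \<le> (\<Sum>k\<in>{0<..K'}. phase_cost k + 30)"
            by (intro sum_mono2) auto
          then show "1 + t1 + (1 + (1 + (2 + expr_cost (Const 6 \<^bold>* var ''x'')) +
                  (1 + (2 + expr_cost (var ''y'' \<^bold>/ Unary Exp (Unary Ln (var ''s'') \<^bold>/ Const 2) \<^bold>+ var ''y'' \<^bold>* var ''y'' \<^bold>/ var ''n'')) +
                   (1 + (2 + expr_cost (Const 8 \<^bold>* var ''l'')) +
                    (1 + (2 + expr_cost (Unary Floor (Const 100000 \<^bold>* var ''s'' \<^bold>* (Unary Floor (Unary Ln (var ''n'')) \<^bold>+ Const 1)
                       \<^bold>* var ''n'' \<^bold>* var ''th'' \<^bold>/ (var ''y'' \<^bold>* var ''y'')) \<^bold>+ Const 1)) +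
                     (2 + expr_cost (Const 0)))))) + t2)
            \<le> 400 * pos (Suc g) + (\<Sum>k\<in>{0<..K'}. phase_cost k + 30) + 400"
            using p(1) q(3) by simp
        qed
        done
    qed
    done
  then show ?thesis using that unfolding wp_def Q_def by blast
qed

end

subsection \<open>Products of uniform distributions\<close>

lemma sets_unif01 [simp, measurable_cong]: "sets unif01 = sets borel"
  and space_unif01 [simp]: "space unif01 = UNIV"
  by (simp_all add: unif01_def)

lemma prob_space_unif01: "prob_space unif01"
  unfolding unif01_def by (rule prob_space_uniform_measure) auto

interpretation unif01: prob_space unif01 by (rule prob_space_unif01)

lemma measure_unif01: "S \<in> sets borel \<Longrightarrow> measure unif01 S = measure lborel ({0..1} \<inter> S)"
  unfolding unif01_def by (subst measure_uniform_measure) auto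

lemma measure_unif01_Ico: "0 \<le> x \<Longrightarrow> x \<le> y \<Longrightarrow> y \<le> 1 \<Longrightarrow> measure unif01 {x..<y} = y - x"
proof -
  assume "0 \<le> x" "x \<le> y" "y \<le> 1"
  then have "{0..1} \<inter> {x..<y} = {x..<y}" by auto
  with \<open>x \<le> y\<close> show ?thesis by (subst measure_unif01) auto
qed

lemma AE_unif01: "AE x in unif01. 0 \<le> x \<and> x < 1"
proof -
  have "measure unif01 {0..<1} = 1" using measure_unif01_Ico[of 0 1] by simp
  then have "AE x in unif01. x \<in> {0..<1}" by (intro unif01.AE_prob_1) auto
  then show ?thesis by simp
qed

interpretation unifs: product_prob_space "\<lambda>_. unif01" I for I :: "'i set"
  by unfold_locales

abbreviation unifs :: "'i set \<Rightarrow> ('i \<Rightarrow> real) measure" where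
  "unifs I \<equiv> \<Pi>\<^sub>M i\<in>I. unif01"

section \<open>Exponential moments and Chernoff bounds\<close>

lemma integral_unifs_prod:
  fixes f :: "'i \<Rightarrow> real \<Rightarrow> real"
  assumes I: "finite I" "I \<subseteq> J" and f: "\<And>i. i \<in> I \<Longrightarrow> f i \<in> borel_measurable borel"
    and bd: "\<And>i x. i \<in> I \<Longrightarrow> \<bar>f i x\<bar> \<le> B i"
  shows "(\<integral>x. (\<Prod>i\<in>I. f i (x i)) \<partial>unifs J) = (\<Prod>i\<in>I. integral\<^sup>L unif01 (f i))"
proof -
  have fm: "f i \<in> borel_measurable unif01" if "i \<in> I" for i using f[OF that] by simp
  have int: "integrable unif01 (f i)" if "i \<in> I" for i
    using that bd fm by (intro unif01.integrable_const_bound[where B = "B i"]) auto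
  have meas: "(\<lambda>x. \<Prod>i\<in>I. f i (x i)) \<in> borel_measurable (unifs I)"
  proof (rule borel_measurable_prod)
    fix i assume "i \<in> I"
    then show "(\<lambda>x. f i (x i)) \<in> borel_measurable (unifs I)"
      using measurable_compose[OF measurable_component_singleton[of i I "\<lambda>_. unif01"] fm[of i]] by simp
  qed
  have "(\<integral>x. (\<Prod>i\<in>I. f i (x i)) \<partial>unifs I)
      = (\<integral>x. (\<Prod>i\<in>I. f i (x i)) \<partial>distr (unifs J) (unifs I) (\<lambda>x. restrict x I))"
    by (subst unifs.distr_PiM_restrict_finite) (use I in auto)
  also have "\<dots> = (\<integral>x. (\<Prod>i\<in>I. f i (restrict x I i)) \<partial>unifs J)"
    using I(2) meas by (intro integral_distr measurable_restrict_subset) auto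
  also have "\<dots> = (\<integral>x. (\<Prod>i\<in>I. f i (x i)) \<partial>unifs J)" by simp
  finally show ?thesis
    using unifs.product_integral_prod[OF I(1), of f] int by simp
qed

lemma measurable_unifs_component: "i \<in> I \<Longrightarrow> (\<lambda>x. x i) \<in> borel_measurable (unifs I)"
  using measurable_component_singleton[of i I "\<lambda>_. unif01"] by (simp cong: measurable_cong_sets)

lemma borel_measurable_unifs:
  fixes f :: "real \<Rightarrow> real"
  shows "i \<in> I \<Longrightarrow> f \<in> borel_measurable borel \<Longrightarrow> (\<lambda>x. f (x i)) \<in> borel_measurable (unifs I)"
  by (rule measurable_compose[OF measurable_unifs_component])

lemma exp_markov_unifs:
  fixes f :: "'i \<Rightarrow> real \<Rightarrow> real"
  assumes I: "finite I" "I \<subseteq> J" and f: "\<And>i. i \<in> I \<Longrightarrow> f i \<in> borel_measurable borel"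
    and bd: "\<And>i x. i \<in> I \<Longrightarrow> \<bar>f i x\<bar> \<le> B"
    and ex: "\<And>i. i \<in> I \<Longrightarrow> (\<integral>x. exp (f i x) \<partial>unif01) \<le> exp (e i)"
  shows "measure (unifs J) {x \<in> space (unifs J). c \<le> (\<Sum>i\<in>I. f i (x i))} \<le> exp ((\<Sum>i\<in>I. e i) - c)"
proof -
  have [measurable]: "(\<lambda>x. f i (x i)) \<in> borel_measurable (unifs J)" if "i \<in> I" for i
    using that I f by (intro borel_measurable_unifs) auto
  have m: "(\<lambda>x. \<Sum>i\<in>I. f i (x i)) \<in> borel_measurable (unifs J)" by (rule borel_measurable_sum) simp
  let ?Z = "\<lambda>x. exp (\<Sum>i\<in>I. f i (x i))"
  have "\<bar>\<Sum>i\<in>I. f i (x i)\<bar> \<le> (\<Sum>i\<in>I. B)" for x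
    using bd by (intro order_trans[OF sum_abs] sum_mono) auto
  then have "?Z x \<le> exp (\<Sum>i\<in>I. B)" for x
    by (simp add: abs_le_iff)
  then have int: "integrable (unifs J) ?Z"
    using m by (intro unifs.P.integrable_const_bound[where B = "exp (\<Sum>i\<in>I. B)"]) auto
  have "{x \<in> space (unifs J). c \<le> (\<Sum>i\<in>I. f i (x i))} = {x \<in> space (unifs J). exp c \<le> ?Z x}" by simp
  also have "measure (unifs J) \<dots> \<le> (\<integral>x. ?Z x \<partial>unifs J) / exp c"
    using int by (intro integral_Markov_inequality_measure[where A = "{}"]) auto
  also have "(\<integral>x. ?Z x \<partial>unifs J) = (\<integral>x. (\<Prod>i\<in>I. exp (f i (x i))) \<partial>unifs J)"
    using I by (simp add: exp_sum)
  also have "\<dots> = (\<Prod>i\<in>I. \<integral>x. exp (f i x) \<partial>unif01)"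
  proof (rule integral_unifs_prod[OF I, where B = "\<lambda>_. exp B"])
    show "(\<lambda>x. exp (f i x)) \<in> borel_measurable borel" if "i \<in> I" for i using f[OF that] by simp
    show "\<bar>exp (f i x)\<bar> \<le> exp B" if "i \<in> I" for i x using bd[OF that, of x] by simp
  qed
  also have "\<dots> \<le> (\<Prod>i\<in>I. exp (e i))"
    using ex by (intro prod_mono) auto
  also have "\<dots> = exp (\<Sum>i\<in>I. e i)" using I by (simp add: exp_sum)
  finally show ?thesis by (simp add: exp_diff divide_right_mono)
qed

text \<open>By convexity exp x <= 1 + 2 x on [0, 1], so the exponential moment of f i / b is at most
  exp (2 E[f i] / b). The level 2 \<mu> + c b then leaves exp (- c), however c compares with the
  mean.\<close>

lemma chernoff_weighted:
  fixes f :: "'i \<Rightarrow> real \<Rightarrow> real"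
  assumes I: "finite I" "I \<subseteq> J" and f: "\<And>i. i \<in> I \<Longrightarrow> f i \<in> borel_measurable borel"
    and b: "0 < b" and bd: "\<And>i x. i \<in> I \<Longrightarrow> 0 \<le> f i x \<and> f i x \<le> b"
    and \<mu>: "(\<Sum>i\<in>I. integral\<^sup>L unif01 (f i)) \<le> \<mu>"
  shows "measure (unifs J) {x \<in> space (unifs J). 2 * \<mu> + c * b \<le> (\<Sum>i\<in>I. f i (x i))} \<le> exp (- c)"
proof -
  have int: "integrable unif01 (f i)" if "i \<in> I" for i
    using that bd f[OF that] by (intro unif01.integrable_const_bound[where B = b]) auto
  have conv: "exp x \<le> 1 + 2 * x" if "0 \<le> x" "x \<le> 1" for x :: real
  proof -
    have "exp x \<le> (1 - x) * exp 0 + x * exp (1::real)"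
      using convex_onD[OF exp_convex, of x 0 1] that by simp
    also have "\<dots> \<le> 1 + 2 * x" using exp_le that mult_left_mono[of "exp 1" 3 x] by (simp add: algebra_simps)
    finally show ?thesis .
  qed
  have ex: "(\<integral>x. exp (f i x / b) \<partial>unif01) \<le> exp (2 * integral\<^sup>L unif01 (f i) / b)" if i: "i \<in> I" for i
  proof -
    have le: "exp (f i x / b) \<le> 1 + 2 * (f i x / b)" for x
      using bd[OF i, of x] b by (intro conv) auto
    have "integrable unif01 (\<lambda>x. exp (f i x / b))"
      using bd[OF i] b f[OF i] by (intro unif01.integrable_const_bound[where B = "exp 1"]) auto
    then have "(\<integral>x. exp (f i x / b) \<partial>unif01) \<le> (\<integral>x. 1 + 2 * (f i x / b) \<partial>unif01)"
      using le int[OF i] by (intro integral_mono) auto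
    also have "\<dots> = 1 + 2 * integral\<^sup>L unif01 (f i) / b"
      using int[OF i] unif01.prob_space by (subst Bochner_Integration.integral_add) auto
    also have "\<dots> \<le> exp (2 * integral\<^sup>L unif01 (f i) / b)" by (rule exp_ge_add_one_self)
    finally show ?thesis .
  qed
  have eq: "{x \<in> space (unifs J). 2 * \<mu> + c * b \<le> (\<Sum>i\<in>I. f i (x i))}
      = {x \<in> space (unifs J). 2 * \<mu> / b + c \<le> (\<Sum>i\<in>I. f i (x i) / b)}"
  proof -
    have "2 * \<mu> / b + c \<le> z / b \<longleftrightarrow> 2 * \<mu> + c * b \<le> z" for z
      using b by (subst pos_le_divide_eq) (auto simp: distrib_right)
    then show ?thesis by (simp add: sum_divide_distrib[symmetric])
  qed
  have "measure (unifs J) {x \<in> space (unifs J). 2 * \<mu> / b + c \<le> (\<Sum>i\<in>I. f i (x i) / b)}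
      \<le> exp ((\<Sum>i\<in>I. 2 * integral\<^sup>L unif01 (f i) / b) - (2 * \<mu> / b + c))"
  proof (rule exp_markov_unifs[OF I, where B = 1])
    show "(\<lambda>x. f i x / b) \<in> borel_measurable borel" if "i \<in> I" for i using f[OF that] by simp
    show "\<bar>f i x / b\<bar> \<le> 1" if "i \<in> I" for i x using bd[OF that, of x] b by simp
  qed (rule ex)
  also have "\<dots> \<le> exp (- c)"
  proof -
    have "(\<Sum>i\<in>I. 2 * integral\<^sup>L unif01 (f i) / b) = 2 * (\<Sum>i\<in>I. integral\<^sup>L unif01 (f i)) / b"
      by (simp add: sum_divide_distrib sum_distrib_left)
    also have "\<dots> \<le> 2 * \<mu> / b" using \<mu> b by (simp add: divide_right_mono)
    finally show ?thesis by simp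
  qed
  finally show ?thesis unfolding eq .
qed

text \<open>The sign of \<open>\<theta>\<close> selects the tail, upper or lower, which is why it
  multiplies both sides of the inequality in the event.\<close>

lemma chernoff_count:
  fixes \<theta> c :: real
  assumes I: "finite I" "I \<subseteq> J" and S: "S \<in> sets borel"
  shows "measure (unifs J) {x \<in> space (unifs J). \<theta> * c \<le> \<theta> * real (card {i \<in> I. x i \<in> S})}
    \<le> exp ((exp \<theta> - 1) * (real (card I) * measure unif01 S) - \<theta> * c)"
proof -
  let ?f = "\<lambda>x. \<theta> * indicat_real S x"
  have cnt: "\<theta> * real (card {i \<in> I. x i \<in> S}) = (\<Sum>i\<in>I. ?f (x i))" for x
    using I by (simp add: sum_distrib_left[symmetric] indicator_def sum.If_cases Int_def)
  have ex: "(\<integral>x. exp (?f x) \<partial>unif01) \<le> exp ((exp \<theta> - 1) * measure unif01 S)"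
  proof -
    have "exp (?f x) = 1 + (exp \<theta> - 1) * indicator S x" for x by (auto simp: indicator_def)
    then have "(\<integral>x. exp (?f x) \<partial>unif01) = (\<integral>x. 1 + (exp \<theta> - 1) * indicator S x \<partial>unif01)" by simp
    also have "\<dots> = 1 + (exp \<theta> - 1) * measure unif01 S"
      using S unif01.prob_space by (subst Bochner_Integration.integral_add) (auto simp: unif01.emeasure_finite less_top[symmetric])
    also have "\<dots> \<le> exp ((exp \<theta> - 1) * measure unif01 S)" by (rule exp_ge_add_one_self)
    finally show ?thesis .
  qed
  have "measure (unifs J) {x \<in> space (unifs J). \<theta> * c \<le> (\<Sum>i\<in>I. ?f (x i))}
    \<le> exp ((\<Sum>i\<in>I. (exp \<theta> - 1) * measure unif01 S) - \<theta> * c)"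
    using S ex by (intro exp_markov_unifs[OF I, where B = "\<bar>\<theta>\<bar>"]) (auto simp: indicator_def)
  then show ?thesis unfolding cnt by (simp add: algebra_simps)
qed

section \<open>Independence of events on disjoint sets of coordinates\<close>

lemma indep_vars_unifs: "prob_space.indep_vars (unifs (UNIV :: 'i set)) (\<lambda>_. unif01) (\<lambda>i x. x i) UNIV"
proof -
  have "distr (unifs UNIV) (unifs UNIV) (\<lambda>x. \<lambda>i\<in>UNIV. x i) = unifs (UNIV :: 'i set)"
    by (simp add: restrict_UNIV distr_id2)
  moreover have "distr (unifs UNIV) unif01 (\<lambda>x. x i) = unif01" for i :: 'i
    using unifs.PiM_component[of i UNIV] by simp
  ultimately show ?thesis
    by (subst unifs.P.indep_vars_iff_distr_eq_PiM') auto
qed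

lemma measure_unifs_indep:
  assumes AB: "A \<inter> B = {}" and [measurable]: "Measurable.pred (unifs UNIV) P" "Measurable.pred (unifs UNIV) Q"
    and P: "\<And>x y. (\<forall>i\<in>A. x i = y i) \<Longrightarrow> P x = P y" and Q: "\<And>x y. (\<forall>i\<in>B. x i = y i) \<Longrightarrow> Q x = Q y"
  shows "measure (unifs UNIV) {x. P x \<and> Q x} = measure (unifs UNIV) {x. P x} * measure (unifs (UNIV :: 'i set)) {x. Q x}"
proof -
  \<comment> \<open>Measurability is only given on the full product. As \<open>P'\<close> depends on
    the coordinates in \<open>C\<close> alone, filling up the others with 0 transfers it to
    \<open>unifs C\<close>.\<close>
  have ext: "{x \<in> space (unifs C). P' x} \<in> sets (unifs C)"
    if P': "\<And>x y. (\<forall>i\<in>C. x i = y i) \<Longrightarrow> P' x = P' y" and [measurable]: "Measurable.pred (unifs UNIV) P'"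
    for C :: "'i set" and P'
  proof -
    have [measurable]: "(\<lambda>x i. if i \<in> C then x i else 0) \<in> measurable (unifs C) (unifs UNIV)"
    proof (rule measurable_PiM_single')
      fix i show "(\<lambda>x. if i \<in> C then x i else 0) \<in> measurable (unifs C) unif01"
        using measurable_unifs_component[of i C] by (cases "i \<in> C") (simp_all cong: measurable_cong_sets)
    qed simp
    have "Measurable.pred (unifs C) (\<lambda>x. P' (\<lambda>i. if i \<in> C then x i else 0))" by measurable
    moreover have "P' (\<lambda>i. if i \<in> C then x i else 0) = P' x" for x by (rule P') simp
    ultimately show ?thesis by simp
  qed
  have iv: "unifs.P.indep_var UNIV (unifs A) (\<lambda>x. restrict (\<lambda>i. x i) A) (unifs B) (\<lambda>x. restrict (\<lambda>i. x i) B)"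
    using unifs.P.indep_var_restrict[OF indep_vars_unifs AB] by simp
  have sp: "space (unifs UNIV) = UNIV" by (simp add: space_PiM)
  have PA: "P (restrict x A) = P x" for x by (rule P) simp
  have QB: "Q (restrict x B) = Q x" for x by (rule Q) simp
  have "measure (unifs UNIV) ((\<lambda>x. (restrict x A, restrict x B)) -` ({x \<in> space (unifs A). P x} \<times> {x \<in> space (unifs B). Q x}) \<inter> space (unifs UNIV))
    = measure (unifs UNIV) ((\<lambda>x. restrict x A) -` {x \<in> space (unifs A). P x} \<inter> space (unifs UNIV)) *
      measure (unifs UNIV) ((\<lambda>x. restrict x B) -` {x \<in> space (unifs B). Q x} \<inter> space (unifs UNIV))"
    using unifs.P.indep_varD[OF iv ext[OF P] ext[OF Q]] by simp
  moreover have "(\<lambda>x. restrict x A) -` {x \<in> space (unifs A). P x} \<inter> space (unifs UNIV) = {x. P x}"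
    by (auto simp: sp space_PiM PA)
  moreover have "(\<lambda>x. restrict x B) -` {x \<in> space (unifs B). Q x} \<inter> space (unifs UNIV) = {x. Q x}"
    by (auto simp: sp space_PiM QB)
  moreover have "(\<lambda>x. (restrict x A, restrict x B)) -` ({x \<in> space (unifs A). P x} \<times> {x \<in> space (unifs B). Q x}) \<inter> space (unifs UNIV)
      = {x. P x \<and> Q x}"
    by (auto simp: sp space_PiM PA QB)
  ultimately show ?thesis by simp
qed

subsection \<open>The distribution of the slots\<close>

lemma measurable_act [measurable]:
  "f \<in> borel_measurable M \<Longrightarrow> Measurable.pred M (\<lambda>x. act q (f x) j)"
proof (induction j arbitrary: f)
  case (Suc j)
  note [measurable] = Suc.prems
  have "(\<lambda>x. if q < f x then (f x - q) / (1 - q) else f x / q) \<in> borel_measurable M" by measurable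
  from Suc.IH[OF this] show ?case by simp
qed simp

text \<open>The first bit selects (q, 1] or (0, q], and the remaining pattern cuts out a scaled copy
  of the interval of a shorter pattern. That the length is a product means that the slots of one
  vertex are independent although all are read off one number.\<close>

lemma act_pattern:
  assumes q: "0 < q" "q < 1"
  shows "\<exists>lo hi. 0 \<le> lo \<and> lo \<le> hi \<and> hi \<le> 1 \<and> hi - lo = (\<Prod>j<J. if c j then 1 - q else q) \<and>
    (\<forall>y. 0 < y \<longrightarrow> y \<le> 1 \<longrightarrow> (\<forall>j<J. act q y j = c j) = (lo < y \<and> y \<le> hi))"
proof (induction J arbitrary: c)
  case 0
  show ?case by (rule exI[of _ 0], rule exI[of _ 1]) auto
next
  case (Suc J)
  obtain lo hi where lh: "0 \<le> lo" "lo \<le> hi" "hi \<le> 1" "hi - lo = (\<Prod>j<J. if c (Suc j) then 1 - q else q)"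
    and pat: "\<And>y. 0 < y \<Longrightarrow> y \<le> 1 \<Longrightarrow> (\<forall>j<J. act q y j = c (Suc j)) = (lo < y \<and> y \<le> hi)"
    using Suc.IH[of "\<lambda>j. c (Suc j)"] by blast
  have all: "(\<forall>j<Suc J. act q y j = c j) = ((q < y) = c 0 \<and>
      (\<forall>j<J. act q (if q < y then (y - q) / (1 - q) else y / q) j = c (Suc j)))" for y
    by (auto simp: less_Suc_eq_0_disj)
  show ?case
  proof (cases "c 0")
    case True
    show ?thesis
    proof (rule exI[of _ "q + (1 - q) * lo"], rule exI[of _ "q + (1 - q) * hi"], intro conjI allI impI)
      show "0 \<le> q + (1 - q) * lo" using q lh by simp
      show "q + (1 - q) * lo \<le> q + (1 - q) * hi" using q lh by simp
      have "(1 - q) * hi \<le> (1 - q) * 1" using q lh by (intro mult_left_mono) auto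
      then show "q + (1 - q) * hi \<le> 1" by simp
      show "q + (1 - q) * hi - (q + (1 - q) * lo) = (\<Prod>j<Suc J. if c j then 1 - q else q)"
        using lh(4) True by (simp add: prod.lessThan_Suc_shift right_diff_distrib[symmetric] del: prod.lessThan_Suc)
      fix y :: real assume y: "0 < y" "y \<le> 1"
      show "(\<forall>j<Suc J. act q y j = c j) = (q + (1 - q) * lo < y \<and> y \<le> q + (1 - q) * hi)"
      proof (cases "q < y")
        case gt: True
        have "(lo < (y - q) / (1 - q) \<and> (y - q) / (1 - q) \<le> hi) = (q + (1 - q) * lo < y \<and> y \<le> q + (1 - q) * hi)"
          using q by (auto simp: field_simps)
        moreover have "0 < (y - q) / (1 - q)" "(y - q) / (1 - q) \<le> 1" using gt y q by auto
        ultimately show ?thesis unfolding all using gt True pat by simp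
      next
        case False
        have "0 \<le> (1 - q) * lo" using q lh by simp
        then show ?thesis unfolding all using False True by auto
      qed
    qed
  next
    case False
    show ?thesis
    proof (rule exI[of _ "q * lo"], rule exI[of _ "q * hi"], intro conjI allI impI)
      show "0 \<le> q * lo" "q * lo \<le> q * hi" using q lh by auto
      have qh: "q * hi \<le> q * 1" using q lh by (intro mult_left_mono) auto
      then show "q * hi \<le> 1" using q by linarith
      show "q * hi - q * lo = (\<Prod>j<Suc J. if c j then 1 - q else q)"
        using lh(4) False by (simp add: prod.lessThan_Suc_shift right_diff_distrib[symmetric] del: prod.lessThan_Suc)
      fix y :: real assume y: "0 < y" "y \<le> 1"
      show "(\<forall>j<Suc J. act q y j = c j) = (q * lo < y \<and> y \<le> q * hi)"
      proof (cases "q < y")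
        case gt: True
        then show ?thesis unfolding all using False qh by auto
      next
        case nle: False
        have "(lo < y / q \<and> y / q \<le> hi) = (q * lo < y \<and> y \<le> q * hi)"
          using q by (auto simp: field_simps)
        moreover have "0 < y / q" "y / q \<le> 1" using nle y q by auto
        ultimately show ?thesis unfolding all using nle False pat by simp
      qed
    qed
  qed
qed

lemma measure_act_pattern:
  assumes q: "0 < q" "q < 1"
  shows "measure unif01 {x. \<forall>j<J. act q (1 - x) j = c j} = (\<Prod>j<J. if c j then 1 - q else q)"
proof -
  obtain lo hi where lh: "0 \<le> lo" "lo \<le> hi" "hi \<le> 1" "hi - lo = (\<Prod>j<J. if c j then 1 - q else q)"
    and pat: "\<And>y. 0 < y \<Longrightarrow> y \<le> 1 \<Longrightarrow> (\<forall>j<J. act q y j = c j) = (lo < y \<and> y \<le> hi)"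
    using act_pattern[OF q, where J = J and c = c] by blast
  have "AE x in unif01. (x \<in> {x. \<forall>j<J. act q (1 - x) j = c j}) = (x \<in> {1 - hi..<1 - lo})"
    using AE_unif01 by eventually_elim (use pat in auto)
  moreover have "{x. \<forall>j<J. act q (1 - x) j = c j} \<in> sets borel"
  proof -
    have "Measurable.pred borel (\<lambda>x. \<forall>j<J. act q (1 - x) j = c j)" by measurable
    then show ?thesis by (simp add: pred_def)
  qed
  ultimately have "measure unif01 {x. \<forall>j<J. act q (1 - x) j = c j} = measure unif01 {1 - hi..<1 - lo}"
    by (intro measure_eq_AE) auto
  also have "\<dots> = hi - lo" using lh by (subst measure_unif01_Ico) auto
  finally show ?thesis using lh by simp
qed

section \<open>Typical random inputs and the number of oriented edges\<close>

context edge_sampler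
begin

lemma AE_hash: "AE h in unifs V. \<forall>v\<in>V. 0 \<le> h v \<and> h v < 1"
proof -
  have "AE h in unifs V. 0 \<le> h v \<and> h v < 1" if "v \<in> V" for v
    using that AE_unif01 by (intro unifs.AE_component) auto
  then show ?thesis by (simp add: AE_finite_all)
qed

lemma AE_tape: "AE r in unifs (UNIV :: nat set). \<forall>i. 0 \<le> r i \<and> r i < 1"
  using AE_unif01 by (subst AE_all_countable) (intro allI unifs.AE_component, auto)

lemma finite_E: "finite (oriented_edges G)" and card_E: "card (oriented_edges G) = 2 * m"
  and E_iff: "(x, z) \<in> oriented_edges G \<longleftrightarrow> z \<in> N x"
  and sum_deg: "(\<Sum>v\<in>V. deg v) = 2 * m"
proof -
  show iff: "(x, z) \<in> oriented_edges G \<longleftrightarrow> z \<in> N x" for x z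
    by (simp add: oriented_edges_def neighbors_def)
  have E: "oriented_edges G = Sigma V N"
  proof (intro set_eqI, clarify)
    fix a b show "(a, b) \<in> oriented_edges G \<longleftrightarrow> (a, b) \<in> Sigma V N"
      using iff[of a b] N_sym[of b a] N_subset[of b] by auto
  qed
  then show fin: "finite (oriented_edges G)" by simp
  have "card (oriented_edges G) = (\<Sum>v\<in>V. deg v)" unfolding E by simp
  moreover have "card (oriented_edges G) = 2 * m"
  proof -
    have f2: "card {p \<in> oriented_edges G. (\<lambda>(x, z). {x, z}) p = e} = 2" if e: "e \<in> edges G" for e
    proof -
      have "card e = 2" using wf e unfolding wf_graph_def by auto
      then obtain x z where xz: "e = {x, z}" "x \<noteq> z" by (auto simp: card_2_iff)
      then have "{p \<in> oriented_edges G. (\<lambda>(x, z). {x, z}) p = e} = {(x, z), (z, x)}"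
        using e by (auto simp: oriented_edges_def doubleton_eq_iff insert_commute)
      then show ?thesis using xz by simp
    qed
    have fe: "finite (edges G)" using wf unfolding wf_graph_def by (intro finite_subset[of "edges G" "Pow V"]) auto
    have im: "(\<lambda>(x, z). {x, z}) ` oriented_edges G \<subseteq> edges G" by (auto simp: oriented_edges_def)
    have "card (oriented_edges G) = (\<Sum>e\<in>edges G. card {p \<in> oriented_edges G. (\<lambda>(x, z). {x, z}) p = e})"
      using sum.group[OF fin fe im, of "\<lambda>_. 1 :: nat"] by (simp only: card_eq_sum)
    also have "\<dots> = 2 * m" using f2 by (simp add: num_edges_def)
    finally show ?thesis .
  qed
  ultimately show "card (oriented_edges G) = 2 * m" "(\<Sum>v\<in>V. deg v) = 2 * m" by simp_all
qed

end

section \<open>Law of the active sets and of a single slot\<close>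

context scaled_sampler
begin

definition heavy :: "nat set" where "heavy = {v \<in> V. th < real (deg v)}"

text \<open>The probability that the vertices active in a given slot are exactly those in
  \<open>B\<close>.\<close>

definition \<pi> :: "nat set \<Rightarrow> real" where "\<pi> B = (\<Prod>v\<in>B. 1 - q v) * (\<Prod>v\<in>heavy - B. q v)"

definition Z :: real where "Z = (\<Prod>v\<in>heavy. q v)"

lemma finite_heavy [simp]: "finite heavy" by (simp add: heavy_def)

lemma active_subset: "active h j \<subseteq> heavy"
  by (auto simp: active_def heavy_def)

lemma heavy_deg: "v \<in> heavy \<Longrightarrow> 0 < deg v"
  using th0 by (cases "deg v = 0") (auto simp: heavy_def)

lemma \<pi>_nonneg: "B \<subseteq> heavy \<Longrightarrow> 0 \<le> \<pi> B"
  unfolding \<pi>_def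
  by (intro mult_nonneg_nonneg prod_nonneg) (use q_bounds heavy_deg in \<open>force simp: less_imp_le\<close>)+

lemma measurable_active_eq [measurable]: "Measurable.pred (unifs V) (\<lambda>h. active h j = B)"
proof -
  have [measurable]: "(\<lambda>h. h v) \<in> borel_measurable (unifs V)" if "v \<in> heavy" for v
    using that by (intro measurable_unifs_component) (auto simp: heavy_def)
  have "active h j = B \<longleftrightarrow> B \<subseteq> heavy \<and> (\<forall>v\<in>heavy. act (q v) (1 - h v) j = (v \<in> B))" for h
    by (auto simp: active_def heavy_def)
  then show ?thesis by (simp cong: measurable_cong)
qed

text \<open>Vertices are independent by the product measure, the slots of one vertex by
  \<open>measure_act_pattern\<close>; exchanging the two products regroups by slot.\<close>

lemma measure_active:
  assumes B: "\<And>j. j < J \<Longrightarrow> B j \<subseteq> heavy"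
  shows "measure (unifs V) {h \<in> space (unifs V). \<forall>j<J. active h j = B j} = (\<Prod>j<J. \<pi> (B j))"
proof -
  let ?S = "\<lambda>v. {x. \<forall>j<J. act (q v) (1 - x) j = (v \<in> B j)}"
  have Sm: "?S v \<in> sets unif01" for v
  proof -
    have "Measurable.pred borel (\<lambda>x. \<forall>j<J. act (q v) (1 - x) j = (v \<in> B j))" by measurable
    then show ?thesis by (simp add: pred_def)
  qed
  have "{h \<in> space (unifs V). \<forall>j<J. active h j = B j} = {h \<in> space (unifs V). \<forall>v\<in>heavy. h v \<in> ?S v}"
    using B by (fastforce simp: active_def heavy_def)
  also have "measure (unifs V) \<dots> = (\<Prod>v\<in>heavy. measure unif01 (?S v))"
  proof -
    have "emeasure (unifs V) {h \<in> space (unifs V). \<forall>v\<in>heavy. h v \<in> ?S v} = (\<Prod>v\<in>heavy. emeasure unif01 (?S v))"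
      using Sm by (intro unifs.emeasure_PiM_Collect) (auto simp: heavy_def)
    then show ?thesis
      by (simp add: unifs.P.emeasure_eq_measure unif01.emeasure_eq_measure prod_ennreal prod_nonneg)
  qed
  also have "\<dots> = (\<Prod>v\<in>heavy. \<Prod>j<J. if v \<in> B j then 1 - q v else q v)"
    by (intro prod.cong refl measure_act_pattern q_bounds heavy_deg)
  also have "\<dots> = (\<Prod>j<J. \<Prod>v\<in>heavy. if v \<in> B j then 1 - q v else q v)"
    by (rule prod.swap)
  also have "\<dots> = (\<Prod>j<J. \<pi> (B j))"
  proof (intro prod.cong refl)
    fix j assume "j \<in> {..<J}"
    then have "B j \<subseteq> heavy" using B by simp
    then have "heavy \<inter> {v. v \<in> B j} = B j" "heavy \<inter> - {v. v \<in> B j} = heavy - B j" by auto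
    then show "(\<Prod>v\<in>heavy. if v \<in> B j then 1 - q v else q v) = \<pi> (B j)"
      unfolding \<pi>_def by (subst prod.If_cases) auto
  qed
  finally show ?thesis .
qed

text \<open>The active sets of the first \<open>J\<close> slots are independent with law
  \<open>\<pi>\<close>. This form serves both the law of the outcomes and the exponential moment of
  \<open>activation_cost\<close>.\<close>

lemma integral_active:
  fixes f :: "nat \<Rightarrow> nat set \<Rightarrow> real"
  shows "(\<integral>h. (\<Prod>j<J. f j (active h j)) \<partial>unifs V) = (\<Prod>j<J. \<Sum>B\<in>Pow heavy. \<pi> B * f j B)"
proof -
  let ?P = "{..<J} \<rightarrow>\<^sub>E Pow heavy"
  let ?A = "\<lambda>Bs. {h \<in> space (unifs V). \<forall>j<J. active h j = Bs j}"
  have fin: "finite ?P" by (intro finite_PiE) auto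
  have Am: "?A Bs \<in> sets (unifs V)" for Bs
  proof -
    have "Measurable.pred (unifs V) (\<lambda>h. \<forall>j<J. active h j = Bs j)" by measurable
    then show ?thesis by (simp add: pred_def)
  qed
  have split: "(\<Prod>j<J. f j (active h j)) = (\<Sum>Bs\<in>?P. indicator (?A Bs) h * (\<Prod>j<J. f j (Bs j)))"
    if h: "h \<in> space (unifs V)" for h
  proof -
    let ?Bs = "restrict (active h) {..<J}"
    have mem: "?Bs \<in> ?P" using active_subset by auto
    have "indicat_real (?A Bs) h = (if Bs = ?Bs then 1 else 0)" if "Bs \<in> ?P" for Bs
    proof -
      have "(\<forall>j<J. active h j = Bs j) \<longleftrightarrow> Bs = ?Bs"
        using that by (auto simp: fun_eq_iff PiE_iff extensional_def)
      then show ?thesis using h by (auto simp: indicator_def)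
    qed
    then have "(\<Sum>Bs\<in>?P. indicator (?A Bs) h * (\<Prod>j<J. f j (Bs j)))
        = (\<Sum>Bs\<in>?P. if Bs = ?Bs then (\<Prod>j<J. f j (Bs j)) else 0)"
      by (intro sum.cong) auto
    also have "\<dots> = (\<Prod>j<J. f j (?Bs j))" using fin mem by (simp add: sum.delta)
    finally show ?thesis by simp
  qed
  have "(\<integral>h. (\<Prod>j<J. f j (active h j)) \<partial>unifs V)
      = (\<integral>h. (\<Sum>Bs\<in>?P. indicator (?A Bs) h * (\<Prod>j<J. f j (Bs j))) \<partial>unifs V)"
    by (intro Bochner_Integration.integral_cong refl split)
  also have "\<dots> = (\<Sum>Bs\<in>?P. measure (unifs V) (?A Bs) * (\<Prod>j<J. f j (Bs j)))"
    using Am by (subst Bochner_Integration.integral_sum)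
      (auto simp: unifs.P.emeasure_finite less_top[symmetric] intro!: integrable_mult_left integrable_real_indicator)
  also have "\<dots> = (\<Sum>Bs\<in>?P. \<Prod>j<J. \<pi> (Bs j) * f j (Bs j))"
  proof (intro sum.cong refl)
    fix Bs assume "Bs \<in> ?P"
    then have "measure (unifs V) (?A Bs) = (\<Prod>j<J. \<pi> (Bs j))" by (intro measure_active) auto
    then show "measure (unifs V) (?A Bs) * (\<Prod>j<J. f j (Bs j)) = (\<Prod>j<J. \<pi> (Bs j) * f j (Bs j))"
      by (simp add: prod.distrib)
  qed
  also have "\<dots> = (\<Prod>j<J. \<Sum>B\<in>Pow heavy. \<pi> B * f j B)"
    by (subst prod_sum_PiE) auto
  finally show ?thesis .
qed

text \<open>The conditional probability of outcome \<open>e\<close> given the active set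
  \<open>B\<close>.\<close>

definition slot_prob :: "nat set \<Rightarrow> nat \<times> nat \<Rightarrow> real" where
  "slot_prob B e = (if B = {} then (if real (deg (fst e)) \<le> th then 1 / (real n * th) else 0)
     else if B = {fst e} then 1 / real (deg (fst e)) else 0)"

lemma borel_slot [measurable]: "(\<lambda>x. slot B h x) \<in> measurable borel (count_space UNIV)"
proof -
  have [measurable]: "(\<lambda>x. pick x) \<in> measurable borel (count_space UNIV)"
    unfolding pick_def by measurable
  have [measurable]: "(\<lambda>x. frac (real n * x)) \<in> borel_measurable borel"
    unfolding frac_def by measurable
  have [measurable]: "(\<lambda>x. neighbor_list G h (pick x) ! nat \<lfloor>th * frac (real n * x)\<rfloor>) \<in> measurable borel (count_space UNIV)"
    by (rule measurable_compose_countable[where f = "\<lambda>v x. neighbor_list G h v ! nat \<lfloor>th * frac (real n * x)\<rfloor>"]) measurable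
  show ?thesis unfolding slot_def Let_def by measurable
qed

text \<open>For fixed \<open>h\<close> the sorted list is just some enumeration of the neighbors, so
  the value is the same for all \<open>h\<close>. This is what frees the outcome of a slot from the
  hash values once \<open>B\<close> is given.\<close>

lemma measure_slot:
  assumes e: "e \<in> oriented_edges G" and B: "B \<subseteq> heavy"
  shows "measure unif01 {x. slot B h x = Some e} = slot_prob B e"
proof -
  obtain x z where xz: "e = (x, z)" by (cases e)
  have zN: "z \<in> N x" using e xz E_iff by simp
  then have xV: "x \<in> V" using N_sym N_subset by blast
  obtain l where l: "l < deg x" "neighbor_list G h x ! l = z"
  proof -
    have "z \<in> set (neighbor_list G h x)" using zN set_neighbor_list by simp
    then show ?thesis using that unfolding in_set_conv_nth length_neighbor_list by blast
  qed
  have lu: "neighbor_list G h x ! l' = z \<longleftrightarrow> l' = l" if "l' < deg x" for l'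
    using l that distinct_neighbor_list[of h x] length_neighbor_list[of h x] by (auto simp: nth_eq_iff_index_eq)
  obtain i where i: "i < n" "vertices G ! i = x"
    using xV unfolding in_set_conv_nth num_vertices_def by blast
  have iu: "vertices G ! i' = x \<longleftrightarrow> i' = i" if "i' < n" for i'
    using i that wf by (auto simp: wf_graph_def num_vertices_def nth_eq_iff_index_eq)
  have n0: "0 < real n" using n2 by simp
  have Sm: "{a. slot B h a = Some e} \<in> sets borel"
  proof -
    have "Measurable.pred borel (\<lambda>a. slot B h a = Some e)" by measurable
    then show ?thesis by (simp add: pred_def)
  qed
  consider "B = {}" "real (deg x) \<le> th" | "B = {}" "\<not> real (deg x) \<le> th" | "B = {x}" | "B \<noteq> {}" "B \<noteq> {x}" by blast
  then show ?thesis
  proof cases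
    case 1
    let ?lo = "(real i + real l / th) / real n" and ?hi = "(real i + (real l + 1) / th) / real n"
    \<comment> \<open>A degree of at most \<open>th\<close> keeps the accepted part inside the
      stretch of length 1 / n that selects vertex \<open>i\<close>; for heavy vertices some
      neighbors would be cut off.\<close>
    have lt: "(real l + 1) / th \<le> 1" using l 1 th0 by simp
    have iff: "slot B h a = Some e \<longleftrightarrow> a \<in> {?lo..<?hi}" if a: "0 \<le> a" "a < 1" for a
    proof -
      have pk: "pick a = x \<longleftrightarrow> nat \<lfloor>real n * a\<rfloor> = i" unfolding pick_def using iu pick_index[OF a] by simp
      have pk': "pick a = x \<longleftrightarrow> \<lfloor>real n * a\<rfloor> = int i" unfolding pk using a n0 by auto
      let ?f = "frac (real n * a)"
      have f: "0 \<le> th * ?f" using th0 by (simp add: frac_ge_0)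
      have "slot B h a = Some e \<longleftrightarrow> pick a = x \<and> th * ?f < real (deg x) \<and> neighbor_list G h x ! nat \<lfloor>th * ?f\<rfloor> = z"
        using 1 xz by (auto simp: slot_def Let_def)
      also have "\<dots> \<longleftrightarrow> pick a = x \<and> nat \<lfloor>th * ?f\<rfloor> = l"
      proof -
        have "nat \<lfloor>th * ?f\<rfloor> < deg x \<longleftrightarrow> th * ?f < real (deg x)" using f by (simp add: nat_less_iff floor_less_iff)
        then show ?thesis using lu l by auto
      qed
      also have "\<dots> \<longleftrightarrow> \<lfloor>real n * a\<rfloor> = int i \<and> real l \<le> th * ?f \<and> th * ?f < real l + 1"
        using pk' f by (auto simp: floor_eq_iff nat_eq_iff)
      also have "\<dots> \<longleftrightarrow> \<lfloor>real n * a\<rfloor> = int i \<and> real l / th \<le> real n * a - real i \<and> real n * a - real i < (real l + 1) / th"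
        using th0 by (auto simp: frac_def field_simps)
      also have "\<dots> \<longleftrightarrow> real l / th \<le> real n * a - real i \<and> real n * a - real i < (real l + 1) / th"
      proof -
        have "0 \<le> real l / th" using th0 by simp
        then show ?thesis using lt by (auto simp: floor_eq_iff)
      qed
      also have "\<dots> \<longleftrightarrow> a \<in> {?lo..<?hi}"
        using n0 by (auto simp: pos_divide_le_eq pos_less_divide_eq mult.commute)
      finally show ?thesis .
    qed
    have "AE a in unif01. (a \<in> {a. slot B h a = Some e}) = (a \<in> {?lo..<?hi})"
      using AE_unif01 by eventually_elim (use iff in auto)
    then have "measure unif01 {a. slot B h a = Some e} = measure unif01 {?lo..<?hi}"
      using Sm by (intro measure_eq_AE) auto
    also have "\<dots> = ?hi - ?lo"
    proof (rule measure_unif01_Ico)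
      show "0 \<le> ?lo" using th0 n0 by simp
      show "?lo \<le> ?hi" using th0 n0 by (simp add: divide_right_mono)
      have "real i + (real l + 1) / th \<le> real n" using lt i by linarith
      then show "?hi \<le> 1" using n0 by simp
    qed
    also have "\<dots> = 1 / (real n * th)" using n0 th0 by (simp add: field_simps)
    finally show ?thesis using 1 xz by (simp add: slot_prob_def)
  next
    case 2
    then have "{a. slot B h a = Some e} = {}" using xz by (auto simp: slot_def Let_def split: if_splits)
    then show ?thesis using 2 xz by (simp add: slot_prob_def)
  next
    case 3
    have d0: "0 < real (deg x)" using l by simp
    let ?lo = "real l / real (deg x)" and ?hi = "(real l + 1) / real (deg x)"
    have iff: "slot B h a = Some e \<longleftrightarrow> a \<in> {?lo..<?hi}" if a: "0 \<le> a" "a < 1" for a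
    proof -
      have f: "0 \<le> real (deg x) * a" using a by simp
      have "real (deg x) * a < real (deg x) * 1" using a d0 by (intro mult_strict_left_mono) auto
      then have lt: "nat \<lfloor>real (deg x) * a\<rfloor> < deg x" using f d0 by (simp add: nat_less_iff floor_less_iff)
      have "slot B h a = Some e \<longleftrightarrow> neighbor_list G h x ! nat \<lfloor>real (deg x) * a\<rfloor> = z"
        using 3 xz by (auto simp: slot_def Let_def)
      also have "\<dots> \<longleftrightarrow> nat \<lfloor>real (deg x) * a\<rfloor> = l" using lu[OF lt] .
      also have "\<dots> \<longleftrightarrow> real l \<le> real (deg x) * a \<and> real (deg x) * a < real l + 1"
        using f by (auto simp: floor_eq_iff nat_eq_iff)
      also have "\<dots> \<longleftrightarrow> a \<in> {?lo..<?hi}"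
        using d0 by (auto simp: pos_divide_le_eq pos_less_divide_eq mult.commute)
      finally show ?thesis .
    qed
    have "AE a in unif01. (a \<in> {a. slot B h a = Some e}) = (a \<in> {?lo..<?hi})"
      using AE_unif01 by eventually_elim (use iff in auto)
    then have "measure unif01 {a. slot B h a = Some e} = measure unif01 {?lo..<?hi}"
      using Sm by (intro measure_eq_AE) auto
    also have "\<dots> = ?hi - ?lo"
      using l d0 by (intro measure_unif01_Ico) (auto simp: divide_right_mono)
    also have "\<dots> = 1 / real (deg x)" by (simp add: add_divide_distrib)
    finally show ?thesis using 3 xz by (simp add: slot_prob_def)
  next
    case 4
    then have "{a. slot B h a = Some e} = {}" using xz by (auto simp: slot_def Let_def)
    then show ?thesis using 4 xz by (simp add: slot_prob_def)
  qed
qed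

lemma slot_edge:
  assumes a: "0 \<le> a" "a < 1" and B: "B \<subseteq> heavy" and s: "slot B h a = Some e"
  shows "e \<in> oriented_edges G"
proof (cases "B = {}")
  case True
  let ?x = "pick a" and ?l = "nat \<lfloor>th * frac (real n * a)\<rfloor>"
  have f: "0 \<le> th * frac (real n * a)" using th0 by (simp add: frac_ge_0)
  have "th * frac (real n * a) < real (deg ?x)" "e = (?x, neighbor_list G h ?x ! ?l)"
    using s True by (auto simp: slot_def Let_def split: if_splits)
  moreover from this have "?l < deg ?x" using f by (simp add: nat_less_iff floor_less_iff)
  ultimately show ?thesis
    using nth_mem[of ?l "neighbor_list G h ?x"] by (simp add: E_iff length_neighbor_list set_neighbor_list)
next
  case False
  then obtain x where x: "B = {x}" "e = (x, neighbor_list G h x ! nat \<lfloor>real (deg x) * a\<rfloor>)"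
    using s by (auto simp: slot_def Let_def split: if_splits)
  have d0: "0 < real (deg x)" using heavy_deg B x by simp
  then have "real (deg x) * a < real (deg x) * 1" using a by (intro mult_strict_left_mono) auto
  then have "nat \<lfloor>real (deg x) * a\<rfloor> < deg x" using a d0 by (simp add: nat_less_iff floor_less_iff)
  then show ?thesis
    using x nth_mem[of "nat \<lfloor>real (deg x) * a\<rfloor>" "neighbor_list G h x"]
    by (simp add: E_iff length_neighbor_list set_neighbor_list)
qed

text \<open>Only one active set contributes. For a light source it is the empty set, giving Z / (n
  th). For a heavy source x it is {x}, giving (1 - q x) / q x * Z / deg x, and the odds deg x / (n
  th) cancel the degree.\<close>

lemma sum_slot_prob:
  assumes e: "e \<in> oriented_edges G"
  shows "(\<Sum>B\<in>Pow heavy. \<pi> B * slot_prob B e) = Z / (real n * th)"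
proof -
  obtain x z where xz: "e = (x, z)" by (cases e)
  have zN: "z \<in> N x" using e xz E_iff by simp
  then have xV: "x \<in> V" using N_sym N_subset by blast
  have dx: "0 < deg x" using zN by (auto simp: card_gt_0_iff)
  have z0: "\<pi> {} = Z" by (simp add: \<pi>_def Z_def)
  show ?thesis
  proof (cases "x \<in> heavy")
    case True
    have "(\<Sum>B\<in>Pow heavy. \<pi> B * slot_prob B e) = (\<Sum>B\<in>{{x}}. \<pi> B * slot_prob B e)"
      using True xz by (intro sum.mono_neutral_right) (auto simp: slot_prob_def heavy_def)
    also have "\<dots> = (1 - q x) * (\<Prod>v\<in>heavy - {x}. q v) / real (deg x)"
      using xz by (simp add: slot_prob_def \<pi>_def)
    also have "1 - q x = q x * (real (deg x) / (real n * th))"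
    proof -
      have "0 < 1 + real (deg x) / (real n * th)" using th0 n2 by (simp add: add_pos_nonneg)
      then show ?thesis unfolding q_def by (simp add: diff_divide_eq_iff)
    qed
    also have "q x * (real (deg x) / (real n * th)) * (\<Prod>v\<in>heavy - {x}. q v) / real (deg x)
        = (q x * (\<Prod>v\<in>heavy - {x}. q v)) / (real n * th)"
      using dx[THEN less_imp_neq] by (simp add: field_simps del: card_0_eq card_eq_0_iff)
    also have "q x * (\<Prod>v\<in>heavy - {x}. q v) = Z"
      unfolding Z_def using True by (simp add: prod.remove)
    finally show ?thesis .
  next
    case False
    then have le: "real (deg x) \<le> th" using xV by (simp add: heavy_def)
    have "(\<Sum>B\<in>Pow heavy. \<pi> B * slot_prob B e) = (\<Sum>B\<in>{{}}. \<pi> B * slot_prob B e)"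
      using False xz by (intro sum.mono_neutral_right) (auto simp: slot_prob_def)
    then show ?thesis using le xz z0 by (simp add: slot_prob_def)
  qed
qed

lemma sum_\<pi>: "(\<Sum>B\<in>Pow heavy. \<pi> B) = 1"
  unfolding \<pi>_def by (subst prod_add[symmetric]) auto

end

section \<open>Successes in a sequence of independent trials\<close>

lemma pmf_replicate_pmf:
  "pmf (replicate_pmf (length xs) P) xs = (\<Prod>j<length xs. pmf P (xs ! j))"
proof (induction xs)
  case (Cons x xs)
  have "pmf (replicate_pmf (length (x # xs)) P) (x # xs)
      = pmf (map_pmf (\<lambda>(y, ys). y # ys) (pair_pmf P (replicate_pmf (length xs) P))) ((\<lambda>(y, ys). y # ys) (x, xs))"
    by (simp add: pair_pmf_def map_bind_pmf map_return_pmf)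
  also have "\<dots> = pmf (pair_pmf P (replicate_pmf (length xs) P)) (x, xs)"
    by (rule pmf_map_inj') (auto simp: inj_def)
  also have "\<dots> = (\<Prod>j<length (x # xs). pmf P ((x # xs) ! j))"
    using Cons by (simp add: pmf_pair prod.lessThan_Suc_shift del: prod.lessThan_Suc)
  finally show ?case .
qed simp

definition somes :: "'a option list \<Rightarrow> 'a list" where "somes = List.map_filter id"

lemma somes_simps [simp]: "somes [] = []" "somes (None # xs) = somes xs" "somes (Some x # xs) = x # somes xs"
  by (simp_all add: somes_def List.map_filter_def)

text \<open>Split by the first trial: a success prepends a fresh value and lowers \<open>s\<close>
  by one, a failure changes nothing. The values are thus independent of the number of
  successes.\<close>

lemma take_somes_pmf:
  fixes U :: "'a pmf"
  assumes p: "0 \<le> p" "p \<le> 1"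
  defines "W \<equiv> bind_pmf (bernoulli_pmf p) (\<lambda>b. if b then map_pmf Some U else return_pmf None)"
  shows "map_pmf (\<lambda>cs. take s (somes cs)) (replicate_pmf J W) = bind_pmf (binomial_pmf J p) (\<lambda>k. replicate_pmf (min s k) U)"
proof (induction J arbitrary: s)
  case 0
  show ?case using p by (simp add: binomial_pmf_0 bind_return_pmf)
next
  case (Suc J)
  have eq: "map_pmf (\<lambda>cs. take s (somes cs)) (replicate_pmf (Suc J) W) =
    bind_pmf (bernoulli_pmf p) (\<lambda>b. if b then bind_pmf U (\<lambda>x. map_pmf (\<lambda>cs. take s (x # somes cs)) (replicate_pmf J W))
      else map_pmf (\<lambda>cs. take s (somes cs)) (replicate_pmf J W))"
    unfolding replicate_pmf.simps W_def[symmetric]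
    apply (subst (1) W_def)
    apply (simp add: map_bind_pmf bind_assoc_pmf map_return_pmf)
    apply (intro bind_pmf_cong refl)
    apply (auto simp: bind_map_pmf bind_return_pmf map_pmf_def bind_assoc_pmf)
    done
  have rhs: "bind_pmf (binomial_pmf (Suc J) p) (\<lambda>k. replicate_pmf (min s k) U) =
    bind_pmf (bernoulli_pmf p) (\<lambda>b. bind_pmf (binomial_pmf J p) (\<lambda>k. replicate_pmf (min s ((if b then 1 else 0) + k)) U))"
    using p by (simp add: binomial_pmf_Suc bind_assoc_pmf bind_return_pmf)
  have T: "bind_pmf U (\<lambda>x. map_pmf (\<lambda>cs. take s (x # somes cs)) (replicate_pmf J W))
      = bind_pmf (binomial_pmf J p) (\<lambda>k. replicate_pmf (min s (1 + k)) U)"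
  proof (cases s)
    case 0
    then show ?thesis by simp
  next
    case (Suc s')
    have "map_pmf (\<lambda>cs. take s (x # somes cs)) (replicate_pmf J W)
        = map_pmf (\<lambda>ys. x # ys) (map_pmf (\<lambda>cs. take s' (somes cs)) (replicate_pmf J W))" for x
      using Suc by (simp add: map_pmf_comp)
    then have "bind_pmf U (\<lambda>x. map_pmf (\<lambda>cs. take s (x # somes cs)) (replicate_pmf J W))
        = bind_pmf U (\<lambda>x. bind_pmf (binomial_pmf J p) (\<lambda>k. map_pmf (\<lambda>ys. x # ys) (replicate_pmf (min s' k) U)))"
      by (simp add: Suc.IH map_bind_pmf)
    also have "\<dots> = bind_pmf (binomial_pmf J p) (\<lambda>k. bind_pmf U (\<lambda>x. map_pmf (\<lambda>ys. x # ys) (replicate_pmf (min s' k) U)))"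
      by (rule bind_commute_pmf)
    also have "\<dots> = bind_pmf (binomial_pmf J p) (\<lambda>k. replicate_pmf (Suc (min s' k)) U)"
      by (simp add: map_pmf_def)
    finally show ?thesis using Suc by simp
  qed
  show ?case unfolding eq rhs
    by (intro bind_pmf_cong refl) (simp add: T Suc.IH)
qed

text \<open>With fewer than \<open>s\<close> successes the truncated list is too short to equal
  \<open>x\<close>, so only the part of the mixture with \<open>s \<le> k\<close> contributes, and
  there the law is \<open>replicate_pmf s U\<close>.\<close>

lemma prob_take_somes:
  fixes U :: "'a pmf"
  assumes p: "0 \<le> p" "p \<le> 1" and x: "length x = s"
  defines "W \<equiv> bind_pmf (bernoulli_pmf p) (\<lambda>b. if b then map_pmf Some U else return_pmf None)"
  shows "measure (replicate_pmf J W) {cs. s \<le> length (somes cs) \<and> take s (somes cs) = x}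
    = measure (binomial_pmf J p) {k. s \<le> k} * pmf (replicate_pmf s U) x"
proof -
  have "s \<le> length l" if "take s l = x" for l
  proof -
    have "length (take s l) = s" using that x by simp
    then show ?thesis by simp
  qed
  then have "{cs. s \<le> length (somes cs) \<and> take s (somes cs) = x} = (\<lambda>cs. take s (somes cs)) -` {x}"
    by auto
  then have "measure (replicate_pmf J W) {cs. s \<le> length (somes cs) \<and> take s (somes cs) = x}
      = pmf (map_pmf (\<lambda>cs. take s (somes cs)) (replicate_pmf J W)) x"
    by (simp add: pmf_map)
  also have "\<dots> = (\<integral>k. pmf (replicate_pmf (min s k) U) x \<partial>binomial_pmf J p)"
    unfolding W_def take_somes_pmf[OF p] by (rule pmf_bind)
  also have "\<dots> = (\<integral>k. indicator {k. s \<le> k} k * pmf (replicate_pmf s U) x \<partial>binomial_pmf J p)"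
  proof (intro Bochner_Integration.integral_cong refl)
    fix k
    show "pmf (replicate_pmf (min s k) U) x = indicator {k. s \<le> k} k * pmf (replicate_pmf s U) x"
    proof (cases "s \<le> k")
      case False
      then have "x \<notin> set_pmf (replicate_pmf (min s k) U)" using x by (auto simp: set_replicate_pmf)
      then show ?thesis using False by (simp add: set_pmf_iff)
    qed simp
  qed
  also have "\<dots> = measure (binomial_pmf J p) {k. s \<le> k} * pmf (replicate_pmf s U) x"
    by simp
  finally show ?thesis .
qed

lemma prob_length_somes:
  fixes U :: "'a pmf"
  assumes p: "0 \<le> p" "p \<le> 1"
  defines "W \<equiv> bind_pmf (bernoulli_pmf p) (\<lambda>b. if b then map_pmf Some U else return_pmf None)"
  shows "measure (replicate_pmf J W) {cs. length (somes cs) < s} = measure (binomial_pmf J p) {k. k < s}"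
proof -
  have "{cs :: 'a option list. length (somes cs) < s} = (\<lambda>cs. take s (somes cs)) -` {xs. length xs < s}" by auto
  then have "measure (replicate_pmf J W) {cs. length (somes cs) < s}
      = measure (map_pmf (\<lambda>cs. take s (somes cs)) (replicate_pmf J W)) {xs. length xs < s}"
    by (simp only: measure_map_pmf)
  also have "\<dots> = measure (map_pmf length (bind_pmf (binomial_pmf J p) (\<lambda>k. replicate_pmf (min s k) U))) {k. k < s}"
    unfolding W_def take_somes_pmf[OF p] by (simp add: vimage_def)
  also have "map_pmf length (bind_pmf (binomial_pmf J p) (\<lambda>k. replicate_pmf (min s k) U)) = map_pmf (\<lambda>k. min s k) (binomial_pmf J p)"
  proof -
    have "map_pmf length (replicate_pmf k U) = return_pmf k" for k
      by (rule map_pmf_const[THEN subst[where P = "\<lambda>z. map_pmf length (replicate_pmf k U) = z"]], rule map_pmf_cong)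
        (auto simp: set_replicate_pmf)
    then show ?thesis by (simp add: map_bind_pmf) (simp add: map_pmf_def)
  qed
  also have "measure \<dots> {k. k < s} = measure (binomial_pmf J p) {k. k < s}"
    by (simp add: vimage_def min_less_iff_disj)
  finally show ?thesis .
qed

text \<open>The exponential moment method with parameter -1, carried out as an induction over the
  trials; the auxiliary number is the moment of a single trial.\<close>

lemma binomial_lower_tail:
  assumes p: "0 \<le> p" "p \<le> 1"
  shows "measure (binomial_pmf J p) {k. k < s} \<le> exp (real s - real J * p / 2)"
proof -
  let ?\<kappa> = "p * exp (- 1) + (1 - p)"
  have "measure (binomial_pmf J p) {k. k < s} \<le> exp (real s) * ?\<kappa> ^ J"
  proof (induction J arbitrary: s)
    case 0
    have "measure (binomial_pmf 0 p) {k. k < s} \<le> 1" by simp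
    also have "1 \<le> exp (real s)" by simp
    finally show ?case by simp
  next
    case (Suc J)
    have em: "emeasure (binomial_pmf (Suc J) p) {k. k < s} = ennreal (measure (binomial_pmf J p) {k. Suc k < s} * p + measure (binomial_pmf J p) {k. k < s} * (1 - p))"
    proof -
      have "binomial_pmf (Suc J) p = bind_pmf (bernoulli_pmf p) (\<lambda>b. map_pmf (\<lambda>k. (if b then 1 else 0) + k) (binomial_pmf J p))"
        using p by (simp add: binomial_pmf_Suc map_pmf_def)
      then have "emeasure (binomial_pmf (Suc J) p) {k. k < s} = emeasure (binomial_pmf J p) {k. Suc k < s} * p
          + emeasure (binomial_pmf J p) {k. k < s} * (1 - p)"
        using p by (simp add: vimage_def)
      then show ?thesis
        using p by (simp add: measure_pmf.emeasure_eq_measure ennreal_mult[symmetric] ennreal_plus[symmetric] del: ennreal_plus)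
    qed
    then have eq: "measure (binomial_pmf (Suc J) p) {k. k < s} = measure (binomial_pmf J p) {k. Suc k < s} * p + measure (binomial_pmf J p) {k. k < s} * (1 - p)"
      using p unfolding measure_pmf.emeasure_eq_measure by (subst (asm) ennreal_inj) auto
    have "measure (binomial_pmf J p) {k. Suc k < s} \<le> exp (real s - 1) * ?\<kappa> ^ J"
    proof (cases s)
      case 0
      then show ?thesis using p by simp
    next
      case (Suc s')
      then show ?thesis using Suc.IH[of s'] by simp
    qed
    then have "measure (binomial_pmf (Suc J) p) {k. k < s} \<le> exp (real s - 1) * ?\<kappa> ^ J * p + exp (real s) * ?\<kappa> ^ J * (1 - p)"
      unfolding eq using p Suc.IH[of s] by (intro add_mono mult_right_mono) auto
    also have "\<dots> = exp (real s) * ?\<kappa> ^ Suc J"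
      by (simp add: exp_diff exp_minus field_simps)
    finally show ?case .
  qed
  also have "?\<kappa> \<le> exp (- (p / 2))"
  proof -
    have "2 \<le> exp (1 :: real)" using exp_ge_add_one_self[of 1] by simp
    then have "exp (- 1) \<le> (1 / 2 :: real)" by (simp add: exp_minus field_simps)
    then have "?\<kappa> \<le> 1 + - (p / 2)" using p mult_left_mono[of "exp (- 1)" "1 / 2" p] by simp
    also have "\<dots> \<le> exp (- (p / 2))" by (rule exp_ge_add_one_self)
    finally show ?thesis .
  qed
  then have "exp (real s) * ?\<kappa> ^ J \<le> exp (real s) * exp (- (p / 2)) ^ J"
    using p by (intro mult_left_mono power_mono) auto
  also have "\<dots> = exp (real s - real J * p / 2)"
    by (simp add: exp_of_nat_mult[symmetric] exp_add[symmetric])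
  finally show ?thesis .
qed

section \<open>Joint law of all slots\<close>

context scaled_sampler
begin

definition slot_pmf :: "(nat \<times> nat) option pmf" where
  "slot_pmf = bind_pmf (bernoulli_pmf (2 * real m * Z / (real n * th)))
     (\<lambda>b. if b then map_pmf Some (pmf_of_set (oriented_edges G)) else return_pmf None)"

definition outcomes :: "(nat \<times> nat) option set" where
  "outcomes = insert None (Some ` oriented_edges G)"

definition outcome_prob :: "nat set \<Rightarrow> (nat \<times> nat) option \<Rightarrow> real" where
  "outcome_prob B c = (case c of None \<Rightarrow> 1 - (\<Sum>e\<in>oriented_edges G. slot_prob B e) | Some e \<Rightarrow> slot_prob B e)"

lemma finite_outcomes [simp]: "finite outcomes"
  by (simp add: outcomes_def finite_E)

lemma sets_slot: "{x. slot B h x = c} \<in> sets borel"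
proof -
  have "Measurable.pred borel (\<lambda>a. slot B h a = c)" by measurable
  then show ?thesis by (simp add: pred_def)
qed

lemma measure_slot_outcome:
  assumes B: "B \<subseteq> heavy" and c: "c \<in> outcomes"
  shows "measure unif01 {x. slot B h x = c} = outcome_prob B c"
proof (cases c)
  case (Some e)
  then show ?thesis using c measure_slot[OF _ B] by (auto simp: outcomes_def outcome_prob_def)
next
  case None
  have "AE x in unif01. x \<in> (\<Union>c\<in>outcomes. {x. slot B h x = c})"
    using AE_unif01
  proof eventually_elim
    case (elim x)
    show ?case using slot_edge[OF _ _ B, of x h] elim by (cases "slot B h x") (auto simp: outcomes_def)
  qed
  then have "measure unif01 (\<Union>c\<in>outcomes. {x. slot B h x = c}) = 1"
    using sets_slot by (subst unif01.prob_eq_1) auto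
  then have "1 = measure unif01 (\<Union>c\<in>outcomes. {x. slot B h x = c})" ..
  also have "\<dots> = (\<Sum>c\<in>outcomes. measure unif01 {x. slot B h x = c})"
    using sets_slot by (intro unif01.finite_measure_finite_Union) (auto simp: disjoint_family_on_def)
  also have "\<dots> = measure unif01 {x. slot B h x = None} + (\<Sum>e\<in>oriented_edges G. measure unif01 {x. slot B h x = Some e})"
    unfolding outcomes_def using finite_E by (subst sum.insert) (auto simp: sum.reindex)
  also have "(\<Sum>e\<in>oriented_edges G. measure unif01 {x. slot B h x = Some e}) = (\<Sum>e\<in>oriented_edges G. slot_prob B e)"
    by (intro sum.cong refl measure_slot B)
  finally show ?thesis using None by (simp add: outcome_prob_def)
qed

lemma E_nonempty: "oriented_edges G \<noteq> {}"
  using card_E m1 by fastforce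

text \<open>The number is the total probability of the edges as outcomes of a slot, averaged over
  the active sets, and therefore at most 1; no estimate of \<open>Z\<close> against \<open>m\<close>
  is required.\<close>

lemma success_prob_bounds: "0 \<le> 2 * real m * Z / (real n * th)" "2 * real m * Z / (real n * th) \<le> 1"
proof -
  have Z0: "0 \<le> Z" unfolding Z_def using q_bounds heavy_deg by (intro prod_nonneg) (auto simp: less_imp_le)
  then show "0 \<le> 2 * real m * Z / (real n * th)" using th0 by simp
  have "2 * real m * Z / (real n * th) = (\<Sum>e\<in>oriented_edges G. Z / (real n * th))"
    using card_E by simp
  also have "\<dots> = (\<Sum>e\<in>oriented_edges G. \<Sum>B\<in>Pow heavy. \<pi> B * slot_prob B e)"
    by (intro sum.cong refl) (simp add: sum_slot_prob)
  also have "\<dots> = (\<Sum>B\<in>Pow heavy. \<pi> B * (\<Sum>e\<in>oriented_edges G. slot_prob B e))"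
    by (subst sum.swap) (simp add: sum_distrib_left)
  also have "\<dots> \<le> (\<Sum>B\<in>Pow heavy. \<pi> B * 1)"
  proof (intro sum_mono mult_left_mono)
    fix B assume "B \<in> Pow heavy"
    then have B: "B \<subseteq> heavy" by simp
    show "0 \<le> \<pi> B" by (rule \<pi>_nonneg[OF B])
    \<comment> \<open>Any hash function will do here, since \<open>slot_prob\<close> does not depend
      on it.\<close>
    have "measure unif01 {x. slot B (\<lambda>_. 0) x = None} = 1 - (\<Sum>e\<in>oriented_edges G. slot_prob B e)"
      using measure_slot_outcome[OF B, of None] by (simp add: outcomes_def outcome_prob_def)
    then show "(\<Sum>e\<in>oriented_edges G. slot_prob B e) \<le> 1"
      using measure_nonneg[of unif01 "{x. slot B (\<lambda>_. 0) x = None}"] by linarith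
  qed
  finally show "2 * real m * Z / (real n * th) \<le> 1" by (simp add: sum_\<pi>)
qed

lemma pmf_slot_pmf:
  assumes "c \<in> outcomes"
  shows "pmf slot_pmf c = (\<Sum>B\<in>Pow heavy. \<pi> B * outcome_prob B c)"
proof -
  let ?p = "2 * real m * Z / (real n * th)"
  have pm: "pmf slot_pmf c = pmf (map_pmf Some (pmf_of_set (oriented_edges G))) c * ?p + pmf (return_pmf None) c * (1 - ?p)"
    unfolding slot_pmf_def using success_prob_bounds by (subst pmf_bind) simp
  show ?thesis
  proof (cases c)
    case (Some e)
    then have e: "e \<in> oriented_edges G" using assms by (auto simp: outcomes_def)
    have "pmf (map_pmf Some (pmf_of_set (oriented_edges G))) (Some e) = pmf (pmf_of_set (oriented_edges G)) e"
      by (intro pmf_map_inj') auto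
    then have "pmf (map_pmf Some (pmf_of_set (oriented_edges G))) c = 1 / real (2 * m)"
      unfolding Some using e E_nonempty finite_E card_E by simp
    moreover have "pmf (return_pmf None) c = 0" unfolding Some by simp
    ultimately have "pmf slot_pmf c = 1 / real (2 * m) * ?p" unfolding pm by simp
    also have "\<dots> = Z / (real n * th)" using m1 by simp
    also have "\<dots> = (\<Sum>B\<in>Pow heavy. \<pi> B * outcome_prob B c)"
      using sum_slot_prob[OF e] Some by (simp add: outcome_prob_def)
    finally show ?thesis .
  next
    case None
    have "None \<notin> set_pmf (map_pmf Some (pmf_of_set (oriented_edges G)))" by auto
    then have "pmf (map_pmf Some (pmf_of_set (oriented_edges G))) c = 0" using None by (simp add: pmf_eq_0_set_pmf)
    moreover have "pmf (return_pmf None) c = 1" unfolding None by simp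
    ultimately have "pmf slot_pmf c = 1 - ?p" unfolding pm by simp
    also have "\<dots> = (\<Sum>B\<in>Pow heavy. \<pi> B) - (\<Sum>e\<in>oriented_edges G. \<Sum>B\<in>Pow heavy. \<pi> B * slot_prob B e)"
      using sum_slot_prob card_E by (simp add: sum_\<pi>)
    also have "\<dots> = (\<Sum>B\<in>Pow heavy. \<pi> B * outcome_prob B c)"
      by (subst sum.swap) (simp add: None outcome_prob_def sum_subtractf sum_distrib_left right_diff_distrib)
    finally show ?thesis .
  qed
qed

lemma set_slot_pmf: "set_pmf slot_pmf \<subseteq> outcomes"
  unfolding slot_pmf_def outcomes_def by (auto simp: set_pmf_of_set[OF E_nonempty finite_E] split: if_splits)

lemma measurable_hash [measurable]: "v \<in> V \<Longrightarrow> (\<lambda>\<omega>. fst \<omega> v) \<in> borel_measurable (rand_space G)"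
  and measurable_tape [measurable]: "(\<lambda>\<omega>. snd \<omega> i) \<in> borel_measurable (rand_space G)"
  and measurable_fst_rand [measurable]: "fst \<in> measurable (rand_space G) (unifs V)"
  and measurable_snd_rand [measurable]: "snd \<in> measurable (rand_space G) (unifs UNIV)"
  unfolding rand_space_def
  using measurable_compose[OF measurable_fst measurable_unifs_component]
    measurable_compose[OF measurable_snd measurable_unifs_component] by auto

lemma measurable_slot_rand [measurable]:
  "(\<lambda>\<omega>. slot B (fst \<omega>) (snd \<omega> i)) \<in> measurable (rand_space G) (count_space UNIV)"
proof -
  have nl [measurable]: "(\<lambda>\<omega>. neighbor_list G (fst \<omega>) v) \<in> measurable (rand_space G) (count_space UNIV)" for v
    by (rule measurable_neighbor_list[OF wf measurable_hash])
  have pk [measurable]: "(\<lambda>\<omega>. pick (snd \<omega> i)) \<in> measurable (rand_space G) (count_space UNIV)"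
    unfolding pick_def by measurable
  have [measurable]: "(\<lambda>\<omega>. frac (real n * snd \<omega> i)) \<in> borel_measurable (rand_space G)"
    unfolding frac_def by measurable
  have [measurable]: "(\<lambda>\<omega>. neighbor_list G (fst \<omega>) (pick (snd \<omega> i)) ! nat \<lfloor>th * frac (real n * snd \<omega> i)\<rfloor>)
      \<in> measurable (rand_space G) (count_space UNIV)"
    by (rule measurable_compose_countable[where f = "\<lambda>v \<omega>. neighbor_list G (fst \<omega>) v ! nat \<lfloor>th * frac (real n * snd \<omega> i)\<rfloor>", OF _ pk]) measurable
  show ?thesis unfolding slot_def Let_def by measurable
qed

lemma measurable_slot_active [measurable]:
  "Measurable.pred (rand_space G) (\<lambda>\<omega>. slot (active (fst \<omega>) j) (fst \<omega>) (snd \<omega> i) = c)"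
proof -
  have eq: "(\<lambda>\<omega>. slot (active (fst \<omega>) j) (fst \<omega>) (snd \<omega> i) = c) =
      (\<lambda>\<omega>. \<exists>B\<in>Pow heavy. active (fst \<omega>) j = B \<and> slot B (fst \<omega>) (snd \<omega> i) = c)"
    using active_subset by (intro ext) auto
  have [measurable]: "Measurable.pred (rand_space G) (\<lambda>\<omega>. active (fst \<omega>) j = B)" for B
    using measurable_compose[OF measurable_fst_rand measurable_active_eq] by simp
  show ?thesis unfolding eq by (intro pred_intros_finite) simp_all
qed

lemma prob_space_rand: "prob_space (rand_space G)"
  unfolding rand_space_def by (intro prob_space_pair unifs.P.prob_space_axioms)

end

sublocale edge_sampler \<subseteq> rand: pair_prob_space "unifs (set (vertices G))" "unifs (UNIV :: nat set)"
  by unfold_locales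

context scaled_sampler
begin

lemma measure_rand_fubini:
  assumes X: "{\<omega> \<in> space (rand_space G). P \<omega>} \<in> sets (rand_space G)"
    and f: "\<And>h. h \<in> space (unifs V) \<Longrightarrow> measure (unifs UNIV) {r. P (h, r)} = f h"
    and fm: "f \<in> borel_measurable (unifs V)"
  shows "measure (rand_space G) {\<omega> \<in> space (rand_space G). P \<omega>} = (\<integral>h. f h \<partial>unifs V)"
proof -
  have f01: "0 \<le> f h" "f h \<le> 1" if "h \<in> space (unifs V)" for h
    using f[OF that] by (metis measure_nonneg, metis unifs.P.prob_le_1)
  have "emeasure (rand_space G) {\<omega> \<in> space (rand_space G). P \<omega>}
      = (\<integral>\<^sup>+h. emeasure (unifs UNIV) (Pair h -` {\<omega> \<in> space (rand_space G). P \<omega>}) \<partial>unifs V)"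
    using X unfolding rand_space_def by (intro unifs.P.emeasure_pair_measure_alt)
  also have "\<dots> = (\<integral>\<^sup>+h. ennreal (f h) \<partial>unifs V)"
  proof (intro nn_integral_cong)
    fix h assume h: "h \<in> space (unifs V)"
    then have "Pair h -` {\<omega> \<in> space (rand_space G). P \<omega>} = {r. P (h, r)}"
      by (auto simp: rand_space_def space_pair_measure space_PiM)
    then show "emeasure (unifs UNIV) (Pair h -` {\<omega> \<in> space (rand_space G). P \<omega>}) = ennreal (f h)"
      using f[OF h] by (simp add: unifs.P.emeasure_eq_measure)
  qed
  also have "\<dots> = ennreal (\<integral>h. f h \<partial>unifs V)"
    using f01 fm by (intro nn_integral_eq_integral unifs.P.integrable_const_bound[where B = 1] AE_I2) auto
  finally have em: "emeasure (rand_space G) {\<omega> \<in> space (rand_space G). P \<omega>} = ennreal (\<integral>h. f h \<partial>unifs V)" .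
  have "0 \<le> (\<integral>h. f h \<partial>unifs V)" using f01 by (intro Bochner_Integration.integral_nonneg) auto
  then show ?thesis using em by (simp add: measure_def)
qed

text \<open>For fixed hash values the active sets are fixed and the slots read distinct tape cells
  outside \<open>K\<close>, so the outcomes are independent of each other and of \<open>Q\<close>.
  Only afterwards are the hash values averaged, by \<open>integral_active\<close>.\<close>

lemma measure_slots:
  assumes Q: "Measurable.pred (unifs UNIV) Q" and dep: "\<And>x y. (\<forall>i\<in>K. x i = y i) \<Longrightarrow> Q x = Q y"
    and K: "\<And>j. b + 2 * j + 1 \<notin> K" and c: "\<And>j. j < J \<Longrightarrow> c j \<in> outcomes"
  shows "measure (rand_space G) {\<omega> \<in> space (rand_space G). Q (snd \<omega>) \<and>
      (\<forall>j<J. slot (active (fst \<omega>) j) (fst \<omega>) (snd \<omega> (b + 2 * j + 1)) = c j)}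
    = measure (unifs UNIV) {r. Q r} * (\<Prod>j<J. pmf slot_pmf (c j))"
proof -
  let ?f = "\<lambda>h. measure (unifs UNIV) {r. Q r} * (\<Prod>j<J. outcome_prob (active h j) (c j))"
  have [measurable]: "Measurable.pred (rand_space G) (\<lambda>\<omega>. Q (snd \<omega>))"
    using measurable_compose[OF measurable_snd_rand Q] .
  have "measure (rand_space G) {\<omega> \<in> space (rand_space G). Q (snd \<omega>) \<and>
      (\<forall>j<J. slot (active (fst \<omega>) j) (fst \<omega>) (snd \<omega> (b + 2 * j + 1)) = c j)} = (\<integral>h. ?f h \<partial>unifs V)"
  proof (rule measure_rand_fubini)
    have "Measurable.pred (rand_space G) (\<lambda>\<omega>. Q (snd \<omega>) \<and>
      (\<forall>j<J. slot (active (fst \<omega>) j) (fst \<omega>) (snd \<omega> (b + 2 * j + 1)) = c j))" by measurable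
    then show "{\<omega> \<in> space (rand_space G). Q (snd \<omega>) \<and>
      (\<forall>j<J. slot (active (fst \<omega>) j) (fst \<omega>) (snd \<omega> (b + 2 * j + 1)) = c j)} \<in> sets (rand_space G)"
      by (simp add: pred_def)
  next
    fix h assume "h \<in> space (unifs V)"
    let ?S = "\<lambda>j. {x. slot (active h j) h x = c j}"
    let ?I = "(\<lambda>j. b + 2 * j + 1) ` {..<J}"
    have inj: "inj_on (\<lambda>j. b + 2 * j + 1) {..<J}" by (auto simp: inj_on_def)
    define g where "g = (\<lambda>i. (i - b - 1) div 2)"
    have g: "g (b + 2 * j + 1) = j" "g (Suc (b + 2 * j)) = j" for j by (simp_all add: g_def)
    have W: "Measurable.pred (unifs UNIV) (\<lambda>r. \<forall>j<J. r (b + 2 * j + 1) \<in> ?S j)"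
    proof -
      have "Measurable.pred (unifs UNIV) (\<lambda>r. r i \<in> ?S j)" for i :: nat and j
        using measurable_compose[OF measurable_unifs_component[of i UNIV], of "\<lambda>x. x \<in> ?S j" "count_space UNIV"] sets_slot
        by (simp add: pred_def)
      then show ?thesis by measurable
    qed
    have "measure (unifs UNIV) {r. Q r \<and> (\<forall>j<J. r (b + 2 * j + 1) \<in> ?S j)}
        = measure (unifs UNIV) {r. Q r} * measure (unifs UNIV) {r. \<forall>j<J. r (b + 2 * j + 1) \<in> ?S j}"
    proof (rule measure_unifs_indep[where A = K and B = ?I])
      show "K \<inter> ?I = {}" using K by auto
    qed (use Q W dep in auto)
    also have "measure (unifs UNIV) {r. \<forall>j<J. r (b + 2 * j + 1) \<in> ?S j} = (\<Prod>i\<in>?I. measure unif01 (?S (g i)))"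
    proof -
      have "{r. \<forall>j<J. r (b + 2 * j + 1) \<in> ?S j} = {r \<in> space (unifs UNIV). \<forall>i\<in>?I. r i \<in> ?S (g i)}"
        by (auto simp: g space_PiM)
      moreover have "emeasure (unifs UNIV) {r \<in> space (unifs UNIV). \<forall>i\<in>?I. r i \<in> ?S (g i)} = (\<Prod>i\<in>?I. emeasure unif01 (?S (g i)))"
        using sets_slot by (intro unifs.emeasure_PiM_Collect) auto
      ultimately show ?thesis
        by (simp add: unifs.P.emeasure_eq_measure unif01.emeasure_eq_measure prod_ennreal prod_nonneg)
    qed
    also have "\<dots> = (\<Prod>j<J. measure unif01 (?S j))"
      by (subst prod.reindex[OF inj]) (simp add: g)
    also have "\<dots> = (\<Prod>j<J. outcome_prob (active h j) (c j))"
      using c active_subset by (intro prod.cong refl measure_slot_outcome) auto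
    finally show "measure (unifs UNIV) {r. Q (snd (h, r)) \<and>
        (\<forall>j<J. slot (active (fst (h, r)) j) (fst (h, r)) (snd (h, r) (b + 2 * j + 1)) = c j)} = ?f h"
      by simp
  next
    have "(\<lambda>h. outcome_prob (active h j) (c j)) \<in> borel_measurable (unifs V)" for j
    proof -
      have eq: "(\<lambda>h. outcome_prob (active h j) (c j)) = (\<lambda>h. \<Sum>B\<in>Pow heavy. if active h j = B then outcome_prob B (c j) else 0)"
        using active_subset by (intro ext) (simp add: sum.delta')
      show ?thesis unfolding eq by measurable
    qed
    then show "?f \<in> borel_measurable (unifs V)" by simp
  qed
  also have "\<dots> = measure (unifs UNIV) {r. Q r} * (\<Prod>j<J. pmf slot_pmf (c j))"
    using c integral_active[where J = J and f = "\<lambda>j B. outcome_prob B (c j)"] by (simp add: pmf_slot_pmf)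
  finally show ?thesis .
qed

definition slot_list :: "nat \<Rightarrow> nat \<Rightarrow> (nat \<Rightarrow> real) \<times> (nat \<Rightarrow> real) \<Rightarrow> (nat \<times> nat) option list" where
  "slot_list b J \<omega> = map (\<lambda>j. slot (active (fst \<omega>) j) (fst \<omega>) (snd \<omega> (b + 2 * j + 1))) [0..<J]"

lemma AE_rand: "AE \<omega> in rand_space G. (\<forall>v\<in>V. 0 \<le> fst \<omega> v \<and> fst \<omega> v < 1) \<and> (\<forall>i. 0 \<le> snd \<omega> i \<and> snd \<omega> i < 1)"
proof -
  have m: "{\<omega> \<in> space (unifs V \<Otimes>\<^sub>M unifs (UNIV :: nat set)). (\<forall>v\<in>V. 0 \<le> fst \<omega> v \<and> fst \<omega> v < 1) \<and> (\<forall>i. 0 \<le> snd \<omega> i \<and> snd \<omega> i < 1)}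
      \<in> sets (unifs V \<Otimes>\<^sub>M unifs UNIV)"
  proof -
    have "Measurable.pred (rand_space G) (\<lambda>\<omega>. (\<forall>v\<in>V. 0 \<le> fst \<omega> v \<and> fst \<omega> v < 1) \<and> (\<forall>i. 0 \<le> snd \<omega> i \<and> snd \<omega> i < 1))"
      by measurable
    then show ?thesis by (simp only: pred_def rand_space_def)
  qed
  show ?thesis unfolding rand_space_def
  proof (rule rand.AE_pair_measure[OF m])
    show "AE h in unifs V. AE r in unifs (UNIV :: nat set). (\<forall>v\<in>V. 0 \<le> fst (h, r) v \<and> fst (h, r) v < 1) \<and> (\<forall>i. 0 \<le> snd (h, r) i \<and> snd (h, r) i < 1)"
      using AE_hash
    proof eventually_elim
      case (elim h)
      show ?case using AE_tape by eventually_elim (use elim in auto)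
    qed
  qed
qed

lemma measurable_slot_list [measurable]: "Measurable.pred (rand_space G) (\<lambda>\<omega>. slot_list b J \<omega> = cs)"
proof -
  have "slot_list b J \<omega> = cs \<longleftrightarrow> length cs = J \<and>
      (\<forall>j<J. slot (active (fst \<omega>) j) (fst \<omega>) (snd \<omega> (b + 2 * j + 1)) = cs ! j)" for \<omega>
    by (auto simp: slot_list_def list_eq_iff_nth_eq)
  then show ?thesis by simp
qed

lemma measurable_slot_list_count [measurable]:
  "slot_list b J \<in> measurable (rand_space G) (count_space UNIV)"
proof (subst measurable_count_space_eq2_countable, intro conjI ballI)
  fix cs
  have "Measurable.pred (rand_space G) (\<lambda>\<omega>. slot_list b J \<omega> = cs)" by measurable
  then show "slot_list b J -` {cs} \<inter> space (rand_space G) \<in> sets (rand_space G)"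
    by (simp add: pred_def vimage_def Int_def conj_commute)
qed simp

text \<open>Almost surely all outcomes lie in the finite set \<open>outcomes\<close>, so an
  arbitrary event is a finite sum of single outcome lists.\<close>

lemma measure_slot_list:
  assumes Q: "Measurable.pred (unifs UNIV) Q" and dep: "\<And>x y. (\<forall>i\<in>K. x i = y i) \<Longrightarrow> Q x = Q y"
    and K: "\<And>j. b + 2 * j + 1 \<notin> K"
  shows "measure (rand_space G) {\<omega> \<in> space (rand_space G). Q (snd \<omega>) \<and> \<Phi> (slot_list b J \<omega>)}
    = measure (unifs UNIV) {r. Q r} * measure (replicate_pmf J slot_pmf) {cs. \<Phi> cs}"
proof -
  interpret P: prob_space "rand_space G" by (rule prob_space_rand)
  let ?L = "{cs. set cs \<subseteq> outcomes \<and> length cs = J \<and> \<Phi> cs}"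
  have finL: "finite ?L" by (rule finite_subset[OF _ finite_lists_length_eq[OF finite_outcomes, of J]]) auto
  have [measurable]: "Measurable.pred (rand_space G) (\<lambda>\<omega>. Q (snd \<omega>))"
    using measurable_compose[OF measurable_snd_rand Q] .
  let ?A = "\<lambda>cs. {\<omega> \<in> space (rand_space G). Q (snd \<omega>) \<and> slot_list b J \<omega> = cs}"
  have Am: "?A cs \<in> sets (rand_space G)" for cs by measurable
  have "measure (rand_space G) {\<omega> \<in> space (rand_space G). Q (snd \<omega>) \<and> \<Phi> (slot_list b J \<omega>)}
      = measure (rand_space G) (\<Union>cs\<in>?L. ?A cs)"
  proof (rule measure_eq_AE)
    show "AE \<omega> in rand_space G. (\<omega> \<in> {\<omega> \<in> space (rand_space G). Q (snd \<omega>) \<and> \<Phi> (slot_list b J \<omega>)}) = (\<omega> \<in> (\<Union>cs\<in>?L. ?A cs))"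
      using AE_rand
    proof eventually_elim
      case (elim \<omega>)
      have "set (slot_list b J \<omega>) \<subseteq> outcomes"
      proof
        fix c assume "c \<in> set (slot_list b J \<omega>)"
        then obtain j where c: "c = slot (active (fst \<omega>) j) (fst \<omega>) (snd \<omega> (b + 2 * j + 1))"
          by (auto simp: slot_list_def)
        show "c \<in> outcomes"
          using slot_edge[OF _ _ active_subset, of "snd \<omega> (b + 2 * j + 1)" "fst \<omega>" j "fst \<omega>"] elim c
          by (cases c) (auto simp: outcomes_def)
      qed
      moreover have "length (slot_list b J \<omega>) = J" by (simp add: slot_list_def)
      ultimately show ?case by auto
    qed
    show "{\<omega> \<in> space (rand_space G). Q (snd \<omega>) \<and> \<Phi> (slot_list b J \<omega>)} \<in> sets (rand_space G)" by measurable
    show "(\<Union>cs\<in>?L. ?A cs) \<in> sets (rand_space G)" using finL Am by (intro sets.finite_UN) auto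
  qed
  also have "\<dots> = (\<Sum>cs\<in>?L. measure (rand_space G) (?A cs))"
    using finL Am by (intro P.finite_measure_finite_Union) (auto simp: disjoint_family_on_def)
  also have "\<dots> = (\<Sum>cs\<in>?L. measure (unifs UNIV) {r. Q r} * pmf (replicate_pmf J slot_pmf) cs)"
  proof (intro sum.cong refl)
    fix cs assume cs: "cs \<in> ?L"
    have "?A cs = {\<omega> \<in> space (rand_space G). Q (snd \<omega>) \<and>
      (\<forall>j<J. slot (active (fst \<omega>) j) (fst \<omega>) (snd \<omega> (b + 2 * j + 1)) = cs ! j)}"
      using cs by (auto simp: slot_list_def list_eq_iff_nth_eq)
    moreover have "cs ! j \<in> outcomes" if "j < J" for j using cs that nth_mem[of j cs] by auto
    ultimately show "measure (rand_space G) (?A cs) = measure (unifs UNIV) {r. Q r} * pmf (replicate_pmf J slot_pmf) cs"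
      using measure_slots[OF Q dep K, where J = J and c = "\<lambda>j. cs ! j"] pmf_replicate_pmf[of cs slot_pmf] cs by simp
  qed
  also have "\<dots> = measure (unifs UNIV) {r. Q r} * measure (replicate_pmf J slot_pmf) ?L"
    using finL by (simp add: sum_distrib_left measure_measure_pmf_finite)
  also have "measure (replicate_pmf J slot_pmf) ?L = measure (replicate_pmf J slot_pmf) {cs. \<Phi> cs}"
  proof (rule measure_prob_cong_0)
    fix cs assume "cs \<in> {cs. \<Phi> cs} - ?L"
    then have "cs \<notin> set_pmf (replicate_pmf J slot_pmf)"
      using set_slot_pmf by (auto simp: set_replicate_pmf)
    then show "pmf (replicate_pmf J slot_pmf) cs = 0" by (simp add: set_pmf_iff)
  qed auto
  finally show ?thesis .
qed

end

subsection \<open>The estimate of the number of edges\<close>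

context edge_sampler
begin

definition F :: "real \<Rightarrow> real" where "F x = (\<Sum>v\<in>V. min (real (deg v)) x)"

lemma X_pos: "0 < X g"
  using n2 by (simp add: X_def)

lemma F_le: "F x \<le> 2 * real m"
proof -
  have "F x \<le> (\<Sum>v\<in>V. real (deg v))" unfolding F_def by (intro sum_mono) auto
  also have "\<dots> = real (\<Sum>v\<in>V. deg v)" by simp
  also have "\<dots> = 2 * real m" unfolding sum_deg by simp
  finally show ?thesis .
qed

text \<open>
  If fewer than \<open>x\<close> vertices have degree at least \<open>x\<close>, then fewer than \<open>x\<^sup>2\<close> oriented edges join two
  of them, and at least half of the others start at a vertex of smaller degree.
\<close>

lemma F_ge:
  assumes x0: "0 < x" and x: "x\<^sup>2 \<le> 2 * real m / 3"
  shows "x\<^sup>2 \<le> F x"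
proof -
  define H where "H = {v \<in> V. x \<le> real (deg v)}"
  have HV: "H \<subseteq> V" "finite H" by (auto simp: H_def)
  have split: "F x = (\<Sum>v\<in>H. min (real (deg v)) x) + (\<Sum>v\<in>V - H. min (real (deg v)) x)"
    unfolding F_def using HV by (simp add: sum.subset_diff)
  have FH: "(\<Sum>v\<in>H. min (real (deg v)) x) = real (card H) * x"
  proof -
    have "(\<Sum>v\<in>H. min (real (deg v)) x) = (\<Sum>v\<in>H. x)" by (intro sum.cong) (auto simp: H_def)
    then show ?thesis by simp
  qed
  have FL: "(\<Sum>v\<in>V - H. min (real (deg v)) x) = (\<Sum>v\<in>V - H. real (deg v))"
    by (intro sum.cong) (auto simp: H_def)
  show ?thesis
  proof (cases "x \<le> real (card H)")
    case True
    have "x\<^sup>2 \<le> real (card H) * x" using True x0 by (simp add: power2_eq_square)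
    moreover have "0 \<le> (\<Sum>v\<in>V - H. min (real (deg v)) x)" unfolding FL by (intro sum_nonneg) auto
    ultimately show ?thesis unfolding split FH by linarith
  next
    case False
    let ?e = "\<lambda>A B. \<Sum>v\<in>A. card (N v \<inter> B)"
    have d: "deg v = card (N v \<inter> H) + card (N v \<inter> (V - H))" for v
    proof -
      have "N v = (N v \<inter> H) \<union> (N v \<inter> (V - H))" using N_subset by blast
      then show ?thesis by (metis card_Un_disjoint finite_Int finite_N Int_Diff Diff_disjoint Int_assoc Int_left_commute inf_bot_right)
    qed
    have cross: "?e H (V - H) = ?e (V - H) H"
    proof -
      have "?e H (V - H) = (\<Sum>v\<in>H. \<Sum>w\<in>V - H. if w \<in> N v then 1 else 0)"
        by (intro sum.cong refl) (simp add: sum.If_cases Int_commute)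
      also have "\<dots> = (\<Sum>w\<in>V - H. \<Sum>v\<in>H. if v \<in> N w then 1 else 0)"
        by (subst sum.swap) (simp add: N_sym)
      also have "\<dots> = ?e (V - H) H"
        using HV by (intro sum.cong refl) (simp add: sum.If_cases Int_commute)
      finally show ?thesis .
    qed
    have "2 * m = (\<Sum>v\<in>H. deg v) + (\<Sum>v\<in>V - H. deg v)"
      using HV sum_deg by (simp add: sum.subset_diff)
    also have "(\<Sum>v\<in>H. deg v) = ?e H H + ?e H (V - H)"
      by (subst sum.distrib[symmetric]) (intro sum.cong refl d)
    also have "?e H (V - H) \<le> (\<Sum>v\<in>V - H. deg v)"
      unfolding cross by (intro sum_mono card_mono) auto
    also have "?e H H \<le> (\<Sum>v\<in>H. card H)"
      using HV by (intro sum_mono card_mono) auto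
    finally have "2 * m \<le> card H * card H + 2 * (\<Sum>v\<in>V - H. deg v)" by simp
    then have "real (2 * m) \<le> real (card H * card H + 2 * (\<Sum>v\<in>V - H. deg v))" by (rule of_nat_mono)
    then have 1: "2 * real m \<le> real (card H) * real (card H) + 2 * (\<Sum>v\<in>V - H. real (deg v))" by simp
    have "real (card H) * real (card H) \<le> x * x" using False by (intro mult_mono) auto
    then have "x\<^sup>2 \<le> (\<Sum>v\<in>V - H. real (deg v))" using 1 x by (simp add: power2_eq_square)
    moreover have "0 \<le> real (card H) * x" using x0 by simp
    ultimately show ?thesis unfolding split FH FL by linarith
  qed
qed

text \<open>Each min d x / x decreases in x. This carries the lower bound of \<open>F_ge\<close>
  from the first suitable round to all later ones.\<close>

lemma F_ratio_antimono:
  assumes "0 < x" "x \<le> x'"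
  shows "F x' / x' \<le> F x / x"
proof -
  have "min d x' / x' \<le> min d x / x" if "0 \<le> d" for d
  proof (cases "d \<le> x")
    case True
    then show ?thesis using assms that by (simp add: frac_le)
  next
    case False
    then show ?thesis using assms by (simp add: min_def)
  qed
  then show ?thesis unfolding F_def sum_divide_distrib by (intro sum_mono) auto
qed

lemma sets_hit: "{a. hit x a} \<in> sets borel"
proof -
  have [measurable]: "(\<lambda>x. pick x) \<in> measurable borel (count_space UNIV)"
    unfolding pick_def by measurable
  have "Measurable.pred borel (\<lambda>a. hit x a)"
    unfolding hit_def frac_def by measurable
  then show ?thesis by (simp add: pred_def)
qed

text \<open>Up to a null set the hits form n disjoint intervals; the i-th starts at i / n and has
  length min 1 (d / x) / n, where d is the degree of the i-th vertex.\<close>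

lemma measure_hit:
  assumes x: "0 < x"
  shows "measure unif01 {a. hit x a} = F x / (real n * x)"
proof -
  let ?d = "\<lambda>i. real (deg (vertices G ! i))"
  let ?I = "\<lambda>i. {real i / real n..<(real i + min 1 (?d i / x)) / real n}"
  have n0: "0 < real n" using n2 by simp
  have "AE a in unif01. (a \<in> {a. hit x a}) = (a \<in> (\<Union>i<n. ?I i))"
    using AE_unif01
  proof eventually_elim
    case (elim a)
    let ?i = "nat \<lfloor>real n * a\<rfloor>"
    have i: "?i < n" using pick_index elim by blast
    have fl: "real_of_int \<lfloor>real n * a\<rfloor> = real ?i" using elim n0 by simp
    have fr: "frac (real n * a) = real n * a - real ?i" by (simp only: frac_def fl)
    have f1: "0 \<le> real n * a - real ?i" "real n * a - real ?i < 1" using fl by linarith+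
    have "hit x a \<longleftrightarrow> real n * a - real ?i < ?d ?i / x"
      unfolding hit_def fr pick_def using x by (simp add: pos_less_divide_eq)
    also have "\<dots> \<longleftrightarrow> a \<in> ?I ?i"
      using f1 n0 by (auto simp: pos_divide_le_eq pos_less_divide_eq mult.commute)
    also have "\<dots> \<longleftrightarrow> a \<in> (\<Union>i<n. ?I i)"
    proof
      assume "a \<in> (\<Union>i<n. ?I i)"
      then obtain i' where i': "i' < n" "a \<in> ?I i'" by blast
      then have "real i' \<le> real n * a" "real n * a < real i' + 1"
        using n0 by (auto simp: pos_divide_le_eq pos_less_divide_eq mult.commute)
      then have "\<lfloor>real n * a\<rfloor> = int i'" by (simp add: floor_eq_iff)
      then have "?i = i'" by simp
      then show "a \<in> ?I ?i" using i' by simp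
    qed (use i in blast)
    finally show ?case by simp
  qed
  then have "measure unif01 {a. hit x a} = measure unif01 (\<Union>i<n. ?I i)"
    using sets_hit by (intro measure_eq_AE) auto
  also have "\<dots> = (\<Sum>i<n. measure unif01 (?I i))"
  proof (rule unif01.finite_measure_finite_Union)
    show "disjoint_family_on ?I {..<n}"
    proof (unfold disjoint_family_on_def, intro ballI impI, rule ccontr)
      fix i j assume "i \<noteq> j" and "?I i \<inter> ?I j \<noteq> {}"
      then obtain a where "a \<in> ?I i" "a \<in> ?I j" by blast
      then have "real i \<le> real n * a" "real n * a < real i + 1" "real j \<le> real n * a" "real n * a < real j + 1"
        using n0 by (auto simp: pos_divide_le_eq pos_less_divide_eq mult.commute)
      then have "i = j" by linarith
      with \<open>i \<noteq> j\<close> show False by simp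
    qed
  qed auto
  also have "\<dots> = (\<Sum>i<n. min (?d i) x / (real n * x))"
  proof (intro sum.cong refl)
    fix i assume "i \<in> {..<n}"
    then have i: "real i + 1 \<le> real n" by simp
    have "real i + min 1 (?d i / x) \<le> real n" using i by linarith
    moreover have "0 \<le> ?d i / x" using x by simp
    ultimately have "measure unif01 (?I i) = (real i + min 1 (?d i / x)) / real n - real i / real n"
      using n0 by (intro measure_unif01_Ico) (auto simp: divide_right_mono)
    also have "\<dots> = min 1 (?d i / x) / real n" by (simp add: add_divide_distrib)
    also have "\<dots> = min (?d i) x / (real n * x)"
      using x by (auto simp: min_def field_simps)
    finally show "measure unif01 (?I i) = min (?d i) x / (real n * x)" .
  qed
  also have "\<dots> = F x / (real n * x)"
  proof -
    have "bij_betw ((!) (vertices G)) {..<n} V"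
      using wf by (intro bij_betw_nth) (auto simp: wf_graph_def num_vertices_def)
    from sum.reindex_bij_betw[OF this, of "\<lambda>v. min (real (deg v)) x / (real n * x)"]
    show ?thesis by (simp add: F_def sum_divide_distrib)
  qed
  finally show ?thesis .
qed

text \<open>The mean count of round \<open>g\<close> is \<open>40 * \<l> * \<rho> g\<close>, so the
  stopping level corresponds to the value 1 / 2.\<close>

definition \<rho> :: "nat \<Rightarrow> real" where "\<rho> g = F (X g) / (X g)\<^sup>2"

lemma trials_mean: "real (trials g) * measure unif01 {a. hit (X g) a} = 40 * real \<l> * \<rho> g"
  using X_pos[of g] n2 unfolding measure_hit[OF X_pos] \<rho>_def trials_def
  by (simp add: X_def field_simps power2_eq_square)

lemma measurable_cnt [measurable]: "(\<lambda>r. cnt r g) \<in> measurable (unifs UNIV) (count_space UNIV)"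
proof -
  have [measurable]: "Measurable.pred (unifs UNIV) (\<lambda>r. hit x (r i))" for x i
    using measurable_compose[OF measurable_unifs_component[of i UNIV], of "hit x" "count_space UNIV"] sets_hit
    by (simp add: pred_def)
  have "real (cnt r g) = (\<Sum>i<trials g. if hit (X g) (r (pos g + i)) then 1 else 0)" for r
    by (simp add: cnt_def sum.If_cases lessThan_def Collect_conj_eq)
  then have "cnt r g = nat \<lfloor>\<Sum>i<trials g. if hit (X g) (r (pos g + i)) then 1 else 0 :: real\<rfloor>" for r
    by (metis floor_of_nat nat_int)
  then show ?thesis by (subst measurable_cong[where g = "\<lambda>r. nat \<lfloor>\<Sum>i<trials g. if hit (X g) (r (pos g + i)) then 1 else 0 :: real\<rfloor>"]) measurable
qed

lemma cnt_tail:
  fixes \<theta> :: real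
  shows "measure (unifs UNIV) {r. \<theta> * real (20 * \<l>) \<le> \<theta> * real (cnt r g)}
    \<le> exp (real \<l> * ((exp \<theta> - 1) * 40 * \<rho> g - 20 * \<theta>))"
proof -
  let ?I = "{pos g..<pos g + trials g}"
  have c: "card {i \<in> ?I. r i \<in> {a. hit (X g) a}} = cnt r g" for r
  proof -
    have "{i \<in> ?I. r i \<in> {a. hit (X g) a}} = (\<lambda>i. pos g + i) ` {i. i < trials g \<and> hit (X g) (r (pos g + i))}"
      by (auto simp: image_iff) (metis add_less_cancel_left le_add_diff_inverse)
    then show ?thesis by (simp add: cnt_def card_image)
  qed
  have "measure (unifs UNIV) {r \<in> space (unifs UNIV). \<theta> * real (20 * \<l>) \<le> \<theta> * real (card {i \<in> ?I. r i \<in> {a. hit (X g) a}})}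
    \<le> exp ((exp \<theta> - 1) * (real (card ?I) * measure unif01 {a. hit (X g) a}) - \<theta> * real (20 * \<l>))"
    using sets_hit by (intro chernoff_count) auto
  then show ?thesis unfolding c using trials_mean[of g] by (simp add: space_PiM algebra_simps)
qed

lemma cnt_low_tail:
  assumes "1 \<le> \<rho> g"
  shows "measure (unifs UNIV) {r. cnt r g < 20 * \<l>} \<le> exp (- 4 * real \<l> * \<rho> g)"
proof -
  \<comment> \<open>With 2 / 5 the mean contributes at most -24 \<open>\<rho> g\<close>; since
    \<open>1 \<le> \<rho> g\<close>, the stopping level contributes at most 20
    \<open>\<rho> g\<close>, which leaves -4 \<open>\<rho> g\<close>.\<close>
  have e: "exp (- 1) \<le> (2 / 5 :: real)"
  proof -
    have "5 / 2 \<le> exp (1 :: real)" using exp_lower_Taylor_quadratic[of 1] by simp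
    then show ?thesis by (simp add: exp_minus field_simps)
  qed
  have "{r. cnt r g < 20 * \<l>} \<subseteq> {r. (- 1) * real (20 * \<l>) \<le> (- 1) * real (cnt r g)}"
    by (auto simp: less_imp_le)
  then have "measure (unifs UNIV) {r. cnt r g < 20 * \<l>} \<le> measure (unifs UNIV) {r. (- 1) * real (20 * \<l>) \<le> (- 1) * real (cnt r g)}"
  proof (rule unifs.P.finite_measure_mono)
    have "Measurable.pred (unifs UNIV) (\<lambda>r. (- 1) * real (20 * \<l>) \<le> (- 1) * real (cnt r g))" by measurable
    then show "{r. (- 1) * real (20 * \<l>) \<le> (- 1) * real (cnt r g)} \<in> sets (unifs UNIV)"
      by (simp add: pred_def space_PiM)
  qed
  also have "\<dots> \<le> exp (real \<l> * ((exp (- 1) - 1) * 40 * \<rho> g - 20 * (- 1)))" by (rule cnt_tail)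
  also have "\<dots> \<le> exp (- 4 * real \<l> * \<rho> g)"
  proof -
    have "(exp (- 1) - 1) * (40 * \<rho> g) \<le> (2 / 5 - 1) * (40 * \<rho> g)" using e assms by (intro mult_right_mono) auto
    then have "(exp (- 1) - 1) * 40 * \<rho> g \<le> - 24 * \<rho> g" by (simp only: mult.assoc) simp
    then have "(exp (- 1) - 1) * 40 * \<rho> g - 20 * (- 1) \<le> - 4 * \<rho> g" using assms by linarith
    then have "real \<l> * ((exp (- 1) - 1) * 40 * \<rho> g - 20 * (- 1)) \<le> real \<l> * (- 4 * \<rho> g)"
      by (intro mult_left_mono) auto
    then show ?thesis by (simp add: algebra_simps)
  qed
  finally show ?thesis .
qed

text \<open>Take \<theta> = 4 + c. The hypothesis forces exp \<theta> * \<open>\<rho> g\<close> to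
  be at most 2, so the mean contributes at most 80 \<open>\<l>\<close> to the exponent; the level
  contributes -20 \<theta> \<open>\<l>\<close>, and -20 c \<open>\<l>\<close> remains.\<close>

lemma cnt_high_tail:
  assumes c: "0 \<le> c" and "exp (4 + c) * real m < (X g)\<^sup>2"
  shows "measure (unifs UNIV) {r. 20 * \<l> \<le> cnt r g} \<le> exp (- 20 * c * real \<l>)"
proof -
  have "{r. 20 * \<l> \<le> cnt r g} = {r. (4 + c) * real (20 * \<l>) \<le> (4 + c) * real (cnt r g)}"
    using c by (auto simp: mult_le_cancel_left)
  then have "measure (unifs UNIV) {r. 20 * \<l> \<le> cnt r g} \<le> exp (real \<l> * ((exp (4 + c) - 1) * 40 * \<rho> g - 20 * (4 + c)))"
    using cnt_tail[of "4 + c" g] by simp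
  also have "(exp (4 + c) - 1) * 40 * \<rho> g - 20 * (4 + c) \<le> - 20 * c"
  proof -
    have X0: "0 < (X g)\<^sup>2" using X_pos[of g] by simp
    have "\<rho> g \<le> 2 * real m / (X g)\<^sup>2" unfolding \<rho>_def using F_le X0 by (intro divide_right_mono) auto
    then have "exp (4 + c) * \<rho> g \<le> exp (4 + c) * (2 * real m / (X g)\<^sup>2)" by (intro mult_left_mono) auto
    also have "\<dots> = 2 * (exp (4 + c) * real m / (X g)\<^sup>2)" by simp
    also have "\<dots> \<le> 2 * 1" using assms(2) X0 by (intro mult_left_mono) auto
    finally have "exp (4 + c) * \<rho> g \<le> 2" by simp
    moreover have "0 \<le> \<rho> g" unfolding \<rho>_def F_def using X_pos by (intro divide_nonneg_nonneg sum_nonneg) (auto simp: less_imp_le)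
    ultimately show ?thesis by (simp add: algebra_simps)
  qed
  then have "exp (real \<l> * ((exp (4 + c) - 1) * 40 * \<rho> g - 20 * (4 + c))) \<le> exp (real \<l> * (- 20 * c))"
    unfolding exp_le_cancel_iff by (intro mult_left_mono) auto
  finally show ?thesis by (simp add: algebra_simps)
qed

text \<open>Both parameters trade accuracy for confidence. At the first round with (X g)^2 <= 2 m /
  3, \<open>F_ge\<close> makes \<open>\<rho>\<close> at least 1, and \<open>j\<close> rounds later
  it is at least \<open>2 ^ j\<close>, so running past that round is very unlikely. Correctness uses
  \<open>j = 0\<close> and \<open>c = 1\<close>, the time bound larger values.\<close>

lemma estimate_tail:
  assumes c: "0 \<le> c"
  shows "measure (unifs UNIV) {r. \<not> (\<exists>g. stops r g \<and> real m / (6 * 4 ^ j) \<le> (X g)\<^sup>2 \<and> (X g)\<^sup>2 \<le> exp (4 + c) * real m)}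
    \<le> exp (- 4 * real \<l> * 2 ^ j) + real n * exp (- 20 * c * real \<l>)"
proof -
  have Xto: "\<exists>g. (X g)\<^sup>2 \<le> 2 * real m / 3"
  proof -
    have "(X n)\<^sup>2 \<le> 2 * real m / 3"
    proof -
      have "2 * real k \<le> 2 ^ k" if "2 \<le> k" for k :: nat
        using that by (induction k rule: dec_induct) auto
      from this[OF n2] have "2 * real n \<le> 2 ^ n" .
      then have "X n \<le> 1 / 2" by (simp add: X_def field_simps)
      then have "(X n)\<^sup>2 \<le> (1 / 2)\<^sup>2" using X_pos[of n] by (intro power_mono) auto
      also have "\<dots> \<le> 2 * real m / 3" using m1 by (simp add: power2_eq_square)
      finally show ?thesis .
    qed
    then show ?thesis by blast
  qed
  define g0 where "g0 = (LEAST g. (X g)\<^sup>2 \<le> 2 * real m / 3)"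
  have g0: "(X g0)\<^sup>2 \<le> 2 * real m / 3" unfolding g0_def using Xto by (rule LeastI_ex)
  \<comment> \<open>The initial \<open>X 0 = n\<close> is too large because n^2 >= 2 m. So
    \<open>g0\<close> has a predecessor violating the condition, which yields the matching lower
    bound on \<open>X g0\<close>.\<close>
  have g0_pos: "g0 \<noteq> 0"
  proof
    assume "g0 = 0"
    then have "(real n)\<^sup>2 \<le> 2 * real m / 3" using g0 by (simp add: X_def)
    moreover have "2 * real m \<le> (real n)\<^sup>2"
    proof -
      have "2 * m = (\<Sum>v\<in>V. deg v)" by (rule sum_deg[symmetric])
      also have "\<dots> \<le> (\<Sum>v\<in>V. n)" using deg_less by (intro sum_mono) (auto simp: less_imp_le)
      also have "\<dots> = n * n" by (simp add: card_V)
      finally have "real (2 * m) \<le> real (n * n)" by (rule of_nat_mono)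
      then show ?thesis by (simp add: power2_eq_square)
    qed
    ultimately show False using m1 by simp
  qed
  have X0: "real m / 6 \<le> (X g0)\<^sup>2"
  proof -
    have "\<not> (X (g0 - 1))\<^sup>2 \<le> 2 * real m / 3" using g0_pos not_less_Least[of "g0 - 1" "\<lambda>g. (X g)\<^sup>2 \<le> 2 * real m / 3", folded g0_def] by simp
    moreover have "X (g0 - 1) = 2 * X g0" using g0_pos by (cases g0) (simp_all add: X_def)
    ultimately show ?thesis by (simp add: power2_eq_square)
  qed
  define g1 where "g1 = g0 + j"
  have X1: "X g1 = X g0 / 2 ^ j" by (simp add: g1_def X_def power_add)
  have rho1: "2 ^ j \<le> \<rho> g1"
  proof -
    have "X g1 \<le> X g0" unfolding X1 using X_pos[of g0] by (simp add: divide_le_eq)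
    from F_ratio_antimono[OF X_pos this] have "F (X g0) / X g0 \<le> F (X g1) / X g1" .
    moreover have "X g0 \<le> F (X g0) / X g0"
      using F_ge[OF X_pos g0] X_pos[of g0] by (simp add: pos_le_divide_eq power2_eq_square)
    ultimately have "X g0 / X g1 \<le> F (X g1) / X g1 / X g1"
      using X_pos[of g1] by (intro divide_right_mono) auto
    moreover have "X g0 / X g1 = 2 ^ j" unfolding X1 using X_pos[of g0] by simp
    ultimately show ?thesis by (simp add: \<rho>_def power2_eq_square)
  qed
  \<comment> \<open>From round \<open>n\<close> on, \<open>X g\<close> is at most 1; hence at most
    \<open>n\<close> rounds could stop too early, and a union bound over them is affordable.\<close>
  define Big where "Big = {g. g < n \<and> exp (4 + c) * real m < (X g)\<^sup>2}"
  have bigI: "g \<in> Big" if "exp (4 + c) * real m < (X g)\<^sup>2" for g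
  proof -
    have "g < n"
    proof (rule ccontr)
      assume "\<not> g < n"
      have "real n \<le> 2 ^ n" by (simp add: less_imp_le)
      also have "\<dots> \<le> (2 :: real) ^ g" using \<open>\<not> g < n\<close> by (intro power_increasing) auto
      finally have "X g \<le> 1" by (simp add: X_def)
      then have "(X g)\<^sup>2 \<le> 1" using X_pos[of g] by (simp add: power_le_one)
      moreover have "1 * 1 \<le> exp (4 + c) * real m" using c m1 by (intro mult_mono) auto
      ultimately show False using that by simp
    qed
    then show ?thesis using that by (simp add: Big_def)
  qed
  let ?bad = "{r. cnt r g1 < 20 * \<l>} \<union> (\<Union>g\<in>Big. {r. 20 * \<l> \<le> cnt r g})"
  have sub: "{r. \<not> (\<exists>g. stops r g \<and> real m / (6 * 4 ^ j) \<le> (X g)\<^sup>2 \<and> (X g)\<^sup>2 \<le> exp (4 + c) * real m)} \<subseteq> ?bad"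
  proof (rule subsetI, rule ccontr)
    fix r assume r: "r \<in> {r. \<not> (\<exists>g. stops r g \<and> real m / (6 * 4 ^ j) \<le> (X g)\<^sup>2 \<and> (X g)\<^sup>2 \<le> exp (4 + c) * real m)}"
      and "r \<notin> ?bad"
    then have 1: "20 * \<l> \<le> cnt r g1" and 2: "\<And>g. g \<in> Big \<Longrightarrow> cnt r g < 20 * \<l>" by auto
    define g where "g = (LEAST g. 20 * \<l> \<le> cnt r g)"
    have g: "20 * \<l> \<le> cnt r g" unfolding g_def using 1 by (rule LeastI)
    have gle: "g \<le> g1" unfolding g_def using 1 by (rule Least_le)
    have "cnt r g' < 20 * \<l>" if "g' < g" for g'
      using not_less_Least[OF that[unfolded g_def]] by simp
    then have st: "stops r g" unfolding stops_def using g by blast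
    have "X g1 \<le> X g" unfolding X_def using gle by (intro divide_left_mono power_increasing) auto
    then have "(X g1)\<^sup>2 \<le> (X g)\<^sup>2" using X_pos[of g1] by (intro power_mono) auto
    moreover have "real m / (6 * 4 ^ j) \<le> (X g1)\<^sup>2"
    proof -
      have "(X g1)\<^sup>2 = (X g0)\<^sup>2 / 4 ^ j"
        unfolding X1 by (simp add: power_divide power_mult[symmetric] power2_eq_square power_mult_distrib[symmetric])
      then show ?thesis using X0 divide_right_mono[of "real m / 6" "(X g0)\<^sup>2" "4 ^ j"] by simp
    qed
    moreover have "(X g)\<^sup>2 \<le> exp (4 + c) * real m"
    proof (rule ccontr)
      assume "\<not> (X g)\<^sup>2 \<le> exp (4 + c) * real m"
      then have "g \<in> Big" by (intro bigI) simp
      then show False using 2[of g] g by simp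
    qed
    ultimately show False using r st by auto
  qed
  have Bigfin: "finite Big" "card Big \<le> n"
  proof -
    have "Big \<subseteq> {..<n}" by (auto simp: Big_def)
    then show "finite Big" "card Big \<le> n" using finite_subset card_mono[of "{..<n}" Big] by auto
  qed
  have s1: "{r. cnt r g < k} \<in> sets (unifs UNIV)" "{r. k \<le> cnt r g} \<in> sets (unifs UNIV)" for g k
  proof -
    have "Measurable.pred (unifs UNIV) (\<lambda>r. cnt r g < k)" "Measurable.pred (unifs UNIV) (\<lambda>r. k \<le> cnt r g)" by measurable
    then show "{r. cnt r g < k} \<in> sets (unifs UNIV)" "{r. k \<le> cnt r g} \<in> sets (unifs UNIV)" by (simp_all add: pred_def space_PiM)
  qed
  have "measure (unifs UNIV) {r. \<not> (\<exists>g. stops r g \<and> real m / (6 * 4 ^ j) \<le> (X g)\<^sup>2 \<and> (X g)\<^sup>2 \<le> exp (4 + c) * real m)} \<le> measure (unifs UNIV) ?bad"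
    using sub Bigfin s1 by (intro unifs.P.finite_measure_mono) (auto intro!: sets.Un sets.finite_UN)
  also have "\<dots> \<le> measure (unifs UNIV) {r. cnt r g1 < 20 * \<l>} + measure (unifs UNIV) (\<Union>g\<in>Big. {r. 20 * \<l> \<le> cnt r g})"
    using Bigfin s1 by (intro measure_Un_le sets.finite_UN) auto
  also have "measure (unifs UNIV) (\<Union>g\<in>Big. {r. 20 * \<l> \<le> cnt r g}) \<le> (\<Sum>g\<in>Big. measure (unifs UNIV) {r. 20 * \<l> \<le> cnt r g})"
    using Bigfin s1 by (intro measure_UNION_le) auto
  also have "\<dots> \<le> (\<Sum>g\<in>Big. exp (- 20 * c * real \<l>))"
    using c by (intro sum_mono cnt_high_tail) (auto simp: Big_def)
  also have "\<dots> \<le> real n * exp (- 20 * c * real \<l>)" using Bigfin by simp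
  also have "measure (unifs UNIV) {r. cnt r g1 < 20 * \<l>} \<le> exp (- 4 * real \<l> * \<rho> g1)"
  proof (rule cnt_low_tail)
    have "(1 :: real) \<le> 2 ^ j" by simp
    then show "1 \<le> \<rho> g1" using rho1 by linarith
  qed
  also have "\<dots> \<le> exp (- 4 * real \<l> * 2 ^ j)"
  proof -
    have "real \<l> * 2 ^ j \<le> real \<l> * \<rho> g1" using rho1 by (intro mult_left_mono) auto
    then show ?thesis by simp
  qed
  finally show ?thesis by simp
qed

lemma stops_unique: "stops r g \<Longrightarrow> stops r g' \<Longrightarrow> g = g'"
  unfolding stops_def by (metis linorder_cases not_le)

lemma measurable_stops [measurable]: "Measurable.pred (unifs UNIV) (\<lambda>r. stops r g)"
  unfolding stops_def by measurable

end

lemma measure_unifs_box: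
  fixes f :: "'a \<Rightarrow> 'i"
  assumes I: "finite I" "inj_on f I" and S: "\<And>t. t \<in> I \<Longrightarrow> S t \<in> sets borel"
  shows "measure (unifs UNIV) {r. \<forall>t\<in>I. r (f t) \<in> S t} = (\<Prod>t\<in>I. measure unif01 (S t))"
proof -
  let ?g = "the_inv_into I f"
  have g: "?g (f t) = t" if "t \<in> I" for t using I that by (simp add: the_inv_into_f_f)
  have "{r. \<forall>t\<in>I. r (f t) \<in> S t} = {r \<in> space (unifs UNIV). \<forall>i\<in>f ` I. r i \<in> S (?g i)}"
    by (auto simp: g space_PiM)
  moreover have "emeasure (unifs UNIV) {r \<in> space (unifs UNIV). \<forall>i\<in>f ` I. r i \<in> S (?g i)}
      = (\<Prod>i\<in>f ` I. emeasure unif01 (S (?g i)))"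
    using I S g by (intro unifs.emeasure_PiM_Collect) auto
  ultimately have "measure (unifs UNIV) {r. \<forall>t\<in>I. r (f t) \<in> S t} = (\<Prod>i\<in>f ` I. measure unif01 (S (?g i)))"
    by (simp add: unifs.P.emeasure_eq_measure unif01.emeasure_eq_measure prod_ennreal prod_nonneg)
  also have "\<dots> = (\<Prod>t\<in>I. measure unif01 (S t))"
    using g by (subst prod.reindex[OF I(2)]) (auto intro!: prod.cong)
  finally show ?thesis .
qed

text \<open>The harmonic sum over sample indices, from 1 / (b + 1) <= ln ((b + 1) / b).\<close>

lemma sum_inverse_le_ln:
  assumes "0 < a" "a \<le> b"
  shows "(\<Sum>t\<in>{a<..b}. 1 / real t) \<le> ln (real b / real a)"
  using assms(2)
proof (induction b rule: dec_induct)
  case (step b)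
  have b0: "0 < real b" using assms step by simp
  have "{a<..Suc b} = insert (Suc b) {a<..b}" using step by auto
  then have "(\<Sum>t\<in>{a<..Suc b}. 1 / real t) = 1 / real (Suc b) + (\<Sum>t\<in>{a<..b}. 1 / real t)" by simp
  also have "\<dots> \<le> 1 / real (Suc b) + ln (real b / real a)" using step.IH by simp
  also have "1 / real (Suc b) \<le> ln (real (Suc b) / real b)"
  proof -
    have "ln (real b / real (Suc b)) \<le> real b / real (Suc b) - 1" using b0 by (intro ln_le_minus_one) simp
    moreover have "ln (real b / real (Suc b)) = - ln (real (Suc b) / real b)" using b0 by (simp add: ln_div)
    moreover have "real b / real (Suc b) - 1 = - (1 / real (Suc b))" by (simp add: field_simps)
    ultimately show ?thesis by linarith
  qed
  also have "ln (real (Suc b) / real b) + ln (real b / real a) = ln (real (Suc b) / real a)"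
    using b0 assms by (simp add: ln_div)
  finally show ?case by simp
qed (use assms in simp)

context edge_sampler
begin

subsection \<open>Uniform vertices\<close>

lemma sum_deg_real: "(\<Sum>v\<in>V. real (deg v)) = 2 * real m"
  unfolding of_nat_sum[symmetric] sum_deg by simp

lemma measurable_pick [measurable]: "(\<lambda>x. pick x) \<in> measurable borel (count_space UNIV)"
  unfolding pick_def by measurable

lemma measure_pick_eq:
  assumes v: "v \<in> V"
  shows "measure unif01 {a. pick a = v} = 1 / real n"
proof -
  obtain i where i: "i < n" "vertices G ! i = v"
    using v unfolding in_set_conv_nth num_vertices_def by blast
  have iu: "vertices G ! i' = v \<longleftrightarrow> i' = i" if "i' < n" for i'
    using i that wf by (auto simp: wf_graph_def num_vertices_def nth_eq_iff_index_eq)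
  have n0: "0 < real n" using n2 by simp
  have "AE a in unif01. (a \<in> {a. pick a = v}) = (a \<in> {real i / real n..<(real i + 1) / real n})"
    using AE_unif01
  proof eventually_elim
    case (elim a)
    have "pick a = v \<longleftrightarrow> nat \<lfloor>real n * a\<rfloor> = i" unfolding pick_def using iu pick_index elim by blast
    also have "\<dots> \<longleftrightarrow> \<lfloor>real n * a\<rfloor> = int i" using elim n0 by auto
    also have "\<dots> \<longleftrightarrow> a \<in> {real i / real n..<(real i + 1) / real n}"
      using n0 by (auto simp: floor_eq_iff pos_divide_le_eq pos_less_divide_eq mult.commute)
    finally show ?case by simp
  qed
  moreover have "{a. pick a = v} \<in> sets borel"
  proof -
    have "Measurable.pred borel (\<lambda>a. pick a = v)" by measurable
    then show ?thesis by (simp add: pred_def)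
  qed
  ultimately have "measure unif01 {a. pick a = v} = measure unif01 {real i / real n..<(real i + 1) / real n}"
    by (intro measure_eq_AE) auto
  also have "\<dots> = (real i + 1) / real n - real i / real n"
    using i n0 by (intro measure_unif01_Ico) (auto simp: divide_right_mono)
  also have "\<dots> = 1 / real n" by (simp add: add_divide_distrib)
  finally show ?thesis .
qed

lemma integral_pick: "(\<integral>a. f (pick a) \<partial>unif01) = (\<Sum>v\<in>V. f v) / real n" for f :: "nat \<Rightarrow> real"
proof -
  have S: "{a. pick a = v} \<in> sets borel" for v
  proof -
    have "Measurable.pred borel (\<lambda>a. pick a = v)" by measurable
    then show ?thesis by (simp add: pred_def)
  qed
  have "(\<integral>a. f (pick a) \<partial>unif01) = (\<integral>a. (\<Sum>v\<in>V. f v * indicator {a. pick a = v} a) \<partial>unif01)"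
  proof (rule integral_cong_AE)
    show "AE a in unif01. f (pick a) = (\<Sum>v\<in>V. f v * indicator {a. pick a = v} a)"
      using AE_unif01
    proof eventually_elim
      case (elim a)
      have "(\<Sum>v\<in>V. f v * indicator {a. pick a = v} a) = (\<Sum>v\<in>V. if v = pick a then f v else 0)"
        by (intro sum.cong) (auto simp: indicator_def)
      then show ?case using pick_in_V elim by (simp add: sum.delta)
    qed
    show "(\<lambda>a. f (pick a)) \<in> borel_measurable unif01" by measurable
    show "(\<lambda>a. \<Sum>v\<in>V. f v * indicator {a. pick a = v} a) \<in> borel_measurable unif01"
      using S by (intro borel_measurable_sum borel_measurable_times borel_measurable_indicator) auto
  qed
  also have "\<dots> = (\<Sum>v\<in>V. f v * measure unif01 {a. pick a = v})"
    using S by (subst Bochner_Integration.integral_sum)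
      (auto intro!: integrable_mult_right integrable_real_indicator simp: less_top[symmetric])
  also have "\<dots> = (\<Sum>v\<in>V. f v) / real n"
    by (simp add: measure_pick_eq sum_divide_distrib)
  finally show ?thesis .
qed

lemma measure_pick:
  assumes "W \<subseteq> V"
  shows "measure unif01 {a. pick a \<in> W} = real (card W) / real n"
proof -
  have "measure unif01 {a. pick a \<in> W} = (\<integral>a. indicator W (pick a) \<partial>unif01)"
  proof -
    have "Measurable.pred borel (\<lambda>a. pick a \<in> W)" by measurable
    then have "{a. pick a \<in> W} \<in> sets unif01" by (simp add: pred_def)
    then have "measure unif01 {a. pick a \<in> W} = (\<integral>a. indicator {a. pick a \<in> W} a \<partial>unif01)" by simp
    then show ?thesis by (simp add: indicator_def)
  qed
  also have "\<dots> = (\<Sum>v\<in>V. indicator W v) / real n" by (rule integral_pick)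
  also have "(\<Sum>v\<in>V. indicator W v :: real) = real (card W)"
    using assms by (simp add: indicator_def sum.If_cases Int_absorb1)
  finally show ?thesis .
qed

end

context scaled_sampler
begin

subsection \<open>Coverage\<close>

lemma R_pos: "1 \<le> R" using \<l>_pos by (simp add: R_def)

lemma measurable_sample [measurable]: "(\<lambda>r. sample r b t) \<in> measurable (unifs UNIV) (count_space UNIV)"
  unfolding sample_def using measurable_compose[OF measurable_unifs_component measurable_pick] by simp

lemma measurable_capped [measurable]: "Measurable.pred (unifs UNIV) (\<lambda>r. capped r b t)"
  unfolding capped_def by measurable

lemma measurable_covers [measurable]: "Measurable.pred (unifs UNIV) (\<lambda>r. covers r b k)"
  unfolding covers_def by measurable

lemma covers_cong: "(\<And>t. r (b + 2 * t) = r' (b + 2 * t)) \<Longrightarrow> covers r b k = covers r' b k"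
  by (simp add: covers_def capped_def sample_def)

text \<open>Let d = deg v and x = n k R / d. Each index t in [x, 2 x] draws a neighbor of v that
  passes the degree test with probability at least d / (2 n), and there are at least x - 1 such
  indices. All of them fail with probability at most exp (- (x - 1) d / (2 n)), and R = 8 \<l> makes
  x d / (2 n) equal to 4 k \<l>. The hypothesis on \<open>m\<close> shows that later phases cope
  with worse underestimates of it.\<close>

lemma uncovered_vertex:
  assumes v: "v \<in> heavy" and k: "1 \<le> k" and mk: "real m \<le> real k * (y * y)"
  shows "measure (unifs UNIV) {r. \<not> (\<exists>t\<in>{k * R<..T k}. capped r b t \<and> v \<in> N (sample r b t) \<and> deg v * t \<le> 2 * n * (k * R))}
    \<le> exp (1 / 2 - 4 * real k * real \<l>)"
proof -
  let ?d = "real (deg v)"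
  define Rk where "Rk = real (k * R)"
  have d0: "0 < ?d" using heavy_deg[OF v] by simp
  have vV: "v \<in> V" and vth: "th < ?d" using v by (auto simp: heavy_def)
  have dn: "?d < real n" using deg_less[OF vV] by simp
  have R0: "1 \<le> k * R" using k R_pos by simp
  then have R0': "1 \<le> Rk" unfolding Rk_def using of_nat_mono[of 1 "k * R"] by simp
  define x where "x = real n * Rk / ?d"
  have xR: "Rk < x"
  proof -
    have "Rk * ?d < Rk * real n" using dn R0' by (intro mult_strict_left_mono) auto
    then show ?thesis unfolding x_def using d0 by (simp add: pos_less_divide_eq mult.commute)
  qed
  have xd: "?d * x = real n * Rk"
    by (simp only: x_def times_divide_eq_right nonzero_mult_div_cancel_left[OF less_imp_neq[OF d0, symmetric]])
  define I where "I = {nat \<lceil>x\<rceil>..nat \<lfloor>2 * x\<rfloor>}"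
  have x0: "0 < x" using xR R0' by linarith
  have tI: "x \<le> real t" "real t \<le> 2 * x" if "t \<in> I" for t
  proof -
    have "nat \<lceil>x\<rceil> \<le> t" "t \<le> nat \<lfloor>2 * x\<rfloor>" using that by (auto simp: I_def)
    then show "x \<le> real t" "real t \<le> 2 * x" using x0 by linarith+
  qed
  have card: "x - 1 \<le> real (card I)"
  proof -
    have "real (nat \<lfloor>2 * x\<rfloor>) = real_of_int \<lfloor>2 * x\<rfloor>" "real (nat \<lceil>x\<rceil>) = real_of_int \<lceil>x\<rceil>" using x0 by auto
    moreover have "real (card I) \<ge> real (nat \<lfloor>2 * x\<rfloor>) + 1 - real (nat \<lceil>x\<rceil>)" unfolding I_def by simp
    ultimately show ?thesis by linarith
  qed
  have good: "t \<in> {k * R<..T k} \<and> deg v * t \<le> 2 * n * (k * R)" if t: "t \<in> I" for t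
  proof -
    have "Rk < real t" using tI(1)[OF t] xR by linarith
    then have 1: "k * R < t" unfolding Rk_def of_nat_less_iff .
    have "2 * x \<le> 2 * real n * Rk / th"
      unfolding x_def using vth th0 n2 R0' by (simp add: frac_le)
    then have "real t \<le> 2 * real n * Rk / th" using tI(2)[OF t] by linarith
    then have 2: "t \<le> T k" using T_real[of k, folded Rk_def] by linarith
    have "?d * real t \<le> ?d * (2 * x)" using tI(2)[OF t] d0 by (intro mult_left_mono) auto
    also have "\<dots> = 2 * real n * Rk" using xd by simp
    finally have "real (deg v * t) \<le> real (2 * n * (k * R))" by (simp add: Rk_def)
    then have "deg v * t \<le> 2 * n * (k * R)" by (simp only: of_nat_le_iff)
    then show ?thesis using 1 2 by simp
  qed
  define W where "W = (\<lambda>t. {w \<in> N v. real (deg w) * real n * real R < 4 * y * y * real t})"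
  have WV: "W t \<subseteq> V" for t using N_subset by (auto simp: W_def)
  \<comment> \<open>A neighbor failing the test has degree at least 4 k y^2 / d, because t >= x. As
    all degrees sum to 2 m <= 2 k y^2, at most d / 2 neighbors fail.\<close>
  have cW: "?d / 2 \<le> real (card (W t))" if t: "t \<in> I" for t
  proof -
    let ?B = "N v - W t" and ?c = "4 * y * y * real t / (real n * real R)"
    have t0: "0 < real t" using tI(1)[OF t] x0 by linarith
    have nR: "0 < real n * real R" using n2 R_pos by simp
    have c0: "0 < ?c" using t0 y0 nR by simp
    have "real (card ?B) * ?c = (\<Sum>w\<in>?B. ?c)" by simp
    also have "\<dots> \<le> (\<Sum>w\<in>?B. real (deg w))"
      using nR by (intro sum_mono) (auto simp: W_def pos_divide_le_eq not_less mult.assoc)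
    also have "\<dots> \<le> (\<Sum>w\<in>V. real (deg w))" using N_subset by (intro sum_mono2) auto
    also have "\<dots> = 2 * real m" by (rule sum_deg_real)
    also have "\<dots> \<le> 2 * (real k * (y * y))" using mk by simp
    finally have "real (card ?B) * (4 * y * y * real t) \<le> 2 * (real k * (y * y)) * (real n * real R)"
      using nR by (simp add: pos_divide_le_eq)
    then have "(y * y) * (2 * real (card ?B) * real t) \<le> (y * y) * (real n * Rk)" by (simp add: Rk_def algebra_simps)
    then have "2 * real (card ?B) * real t \<le> real n * Rk" using y0 by (simp add: mult_le_cancel_left)
    also have "\<dots> = x * ?d" using xd by (simp add: mult.commute)
    also have "\<dots> \<le> real t * ?d" using tI(1)[OF t] d0 by (intro mult_right_mono) auto
    finally have "2 * real (card ?B) \<le> ?d" using t0 by (simp add: mult.commute)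
    moreover have "deg v = card (W t) + card ?B"
    proof -
      have "W t \<subseteq> N v" by (auto simp: W_def)
      then show ?thesis using card_Diff_subset[of "W t" "N v"] card_mono[of "N v" "W t"] finite_subset[of "W t" "N v"] by simp
    qed
    ultimately show ?thesis by linarith
  qed
  have Sb: "{a. pick a \<notin> W t} \<in> sets borel" for t
  proof -
    have "Measurable.pred borel (\<lambda>a. pick a \<notin> W t)" by measurable
    then show ?thesis by (simp add: pred_def)
  qed
  have "{r. \<not> (\<exists>t\<in>{k * R<..T k}. capped r b t \<and> v \<in> N (sample r b t) \<and> deg v * t \<le> 2 * n * (k * R))}
      \<subseteq> {r. \<forall>t\<in>I. r (b + 2 * t) \<in> {a. pick a \<notin> W t}}"
    using good by (auto simp: W_def capped_def sample_def N_sym[of v])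
  then have "measure (unifs UNIV) {r. \<not> (\<exists>t\<in>{k * R<..T k}. capped r b t \<and> v \<in> N (sample r b t) \<and> deg v * t \<le> 2 * n * (k * R))}
      \<le> measure (unifs UNIV) {r. \<forall>t\<in>I. r (b + 2 * t) \<in> {a. pick a \<notin> W t}}"
  proof (rule unifs.P.finite_measure_mono)
    have "Measurable.pred (unifs UNIV) (\<lambda>r. r i \<in> {a. pick a \<notin> W t})" for i :: nat and t
      using measurable_compose[OF measurable_unifs_component[of i UNIV], of "\<lambda>a. pick a \<notin> W t" "count_space UNIV"] Sb
      by (simp add: pred_def)
    then have "Measurable.pred (unifs UNIV) (\<lambda>r. \<forall>t\<in>I. r (b + 2 * t) \<in> {a. pick a \<notin> W t})"
      by (intro pred_intros_finite) (auto simp: I_def)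
    then show "{r. \<forall>t\<in>I. r (b + 2 * t) \<in> {a. pick a \<notin> W t}} \<in> sets (unifs UNIV)" by (simp add: pred_def space_PiM)
  qed
  also have "\<dots> = (\<Prod>t\<in>I. measure unif01 {a. pick a \<notin> W t})"
    using Sb by (intro measure_unifs_box) (auto simp: I_def inj_on_def)
  also have "\<dots> \<le> (\<Prod>t\<in>I. exp (- (?d / (2 * real n))))"
  proof (intro prod_mono conjI)
    fix t assume t: "t \<in> I"
    have eq: "{a. pick a \<notin> W t} = space unif01 - {a. pick a \<in> W t}" by auto
    have "{a. pick a \<in> W t} \<in> sets unif01"
    proof -
      have "Measurable.pred borel (\<lambda>a. pick a \<in> W t)" by measurable
      then show ?thesis by (simp add: pred_def)
    qed
    then have "measure unif01 {a. pick a \<notin> W t} = 1 - real (card (W t)) / real n"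
      unfolding eq by (subst unif01.prob_compl) (auto simp: measure_pick[OF WV])
    also have "\<dots> \<le> 1 + - (?d / (2 * real n))"
    proof -
      have "?d / 2 / real n \<le> real (card (W t)) / real n" using cW[OF t] by (intro divide_right_mono) auto
      then show ?thesis by simp
    qed
    also have "\<dots> \<le> exp (- (?d / (2 * real n)))" by (rule exp_ge_add_one_self)
    finally show "measure unif01 {a. pick a \<notin> W t} \<le> exp (- (?d / (2 * real n)))" .
  qed simp
  also have "\<dots> = exp (- (real (card I) * (?d / (2 * real n))))"
    by (simp add: exp_of_nat_mult[symmetric])
  also have "\<dots> \<le> exp (1 / 2 - 4 * real k * real \<l>)"
  proof -
    have "(x - 1) * (?d / (2 * real n)) \<le> real (card I) * (?d / (2 * real n))"
      using card by (intro mult_right_mono) auto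
    moreover have "(x - 1) * (?d / (2 * real n)) = Rk / 2 - ?d / (2 * real n)"
    proof -
      have "(x - 1) * (?d / (2 * real n)) = (?d * x) / (2 * real n) - ?d / (2 * real n)" by (simp add: algebra_simps diff_divide_distrib)
      then show ?thesis unfolding xd using n2 by simp
    qed
    \<comment> \<open>This is the loss from rounding \<open>x\<close>, the origin of the factor exp
      (1 / 2).\<close>
    moreover have "?d / (2 * real n) \<le> 1 / 2" using dn n2 by (simp add: field_simps)
    moreover have "Rk / 2 = 4 * real k * real \<l>" by (simp add: Rk_def R_def)
    ultimately show ?thesis by simp
  qed
  finally show ?thesis .
qed

lemma covers_tail:
  assumes k: "1 \<le> k" and mk: "real m \<le> real k * (y * y)"
  shows "measure (unifs UNIV) {r. \<not> covers r b k} \<le> real n * exp (1 / 2 - 4 * real k * real \<l>)"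
proof -
  let ?U = "\<lambda>v. {r. \<not> (\<exists>t\<in>{k * R<..T k}. capped r b t \<and> v \<in> N (sample r b t) \<and> deg v * t \<le> 2 * n * (k * R))}"
  have m: "?U v \<in> sets (unifs UNIV)" for v
  proof -
    have "Measurable.pred (unifs UNIV) (\<lambda>r. \<not> (\<exists>t\<in>{k * R<..T k}. capped r b t \<and> v \<in> N (sample r b t) \<and> deg v * t \<le> 2 * n * (k * R)))"
      by measurable
    then show ?thesis by (simp add: pred_def space_PiM)
  qed
  have eq: "{r. \<not> covers r b k} = (\<Union>v\<in>heavy. ?U v)" by (auto simp: covers_def heavy_def)
  have "measure (unifs UNIV) {r. \<not> covers r b k} \<le> (\<Sum>v\<in>heavy. measure (unifs UNIV) (?U v))"
    unfolding eq by (intro measure_UNION_le finite_heavy m)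
  also have "\<dots> \<le> (\<Sum>v\<in>heavy. exp (1 / 2 - 4 * real k * real \<l>))"
    by (rule sum_mono, rule uncovered_vertex[OF _ k mk])
  also have "\<dots> = real (card heavy) * exp (1 / 2 - 4 * real k * real \<l>)" by simp
  also have "\<dots> \<le> real n * exp (1 / 2 - 4 * real k * real \<l>)"
  proof -
    have "card heavy \<le> n" using card_mono[of V heavy] card_V by (auto simp: heavy_def)
    then show ?thesis by (intro mult_right_mono) auto
  qed
  finally show ?thesis .
qed

subsection \<open>Costs\<close>

text \<open>Given the tape, an upper bound on the expected \<open>enumeration_cost\<close>. The two
  sources of randomness are treated one after the other, each time as a sum of independent
  terms.\<close>

definition search_weight :: "(nat \<Rightarrow> real) \<Rightarrow> nat \<Rightarrow> nat \<Rightarrow> real" where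
  "search_weight r b k = (\<Sum>t\<in>{k * R<..T k}. if capped r b t then hash_bound k t * real (deg (sample r b t)) else 0)"

lemma hash_bound_nonneg: "0 \<le> hash_bound k t"
  using th0 by (simp add: hash_bound_def)

text \<open>The degree test bounds the degree by a multiple of \<open>t\<close>, which cancels the
  factor 1 / t of \<open>hash_bound\<close>, so all summands share one bound. A random vertex has
  mean degree 2 m / n, and the remaining sum is harmonic.\<close>

lemma search_weight_tail:
  assumes k: "1 \<le> k"
  shows "measure (unifs UNIV) {r. 2 * (4 * real (k * J1) * real (k * R) * real m / (th * real n) * ln (1 + 2 * real n / th))
      + c * (8 * (real k)\<^sup>2 * real J1 * (y * y) / (real n * th)) \<le> search_weight r b k} \<le> exp (- c)"
proof -
  let ?D = "{k * R<..T k}"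
  let ?f = "\<lambda>t a. if real (deg (pick a)) * real n * real R < 4 * y * y * real t then hash_bound k t * real (deg (pick a)) else 0"
  let ?g = "\<lambda>i. (i - b) div 2"
  let ?I = "(\<lambda>t. b + 2 * t) ` ?D"
  let ?\<mu> = "4 * real (k * J1) * real (k * R) * real m / (th * real n) * ln (1 + 2 * real n / th)"
  let ?b = "8 * (real k)\<^sup>2 * real J1 * (y * y) / (real n * th)"
  have inj: "inj_on (\<lambda>t. b + 2 * t) ?D" by (auto simp: inj_on_def)
  have J0: "0 < real J1" by (simp add: J1_def)
  have kR: "0 < k * R" using k R_pos by simp
  have gg: "(b + 2 * t - b) div 2 = t" for t by simp
  have sw: "search_weight r b k = (\<Sum>i\<in>?I. ?f (?g i) (r i))" for r
    by (subst sum.reindex[OF inj]) (simp only: search_weight_def capped_def sample_def comp_def gg)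
  have fm: "?f t \<in> borel_measurable borel" for t by measurable
  have fb: "0 \<le> ?f t a \<and> ?f t a \<le> ?b" if t: "t \<in> ?D" for t a
  proof (cases "real (deg (pick a)) * real n * real R < 4 * y * y * real t")
    case True
    have t0: "0 < real t" using t kR by simp
    have nR: "0 < real n * real R" using n2 R_pos by simp
    have "real (deg (pick a)) \<le> 4 * y * y * real t / (real n * real R)"
      using True nR by (simp add: pos_le_divide_eq mult.assoc)
    then have "hash_bound k t * real (deg (pick a)) \<le> hash_bound k t * (4 * y * y * real t / (real n * real R))"
      using hash_bound_nonneg by (intro mult_left_mono)
    also have "\<dots> = ?b" unfolding hash_bound_def using t0 nR th0 R_pos by (simp add: field_simps power2_eq_square)
    finally show ?thesis using True hash_bound_nonneg by simp
  next
    case False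
    then show ?thesis using th0 by simp
  qed
  have fE: "integral\<^sup>L unif01 (?f t) \<le> hash_bound k t * (2 * real m) / real n" for t
  proof -
    have "integral\<^sup>L unif01 (?f t) = (\<Sum>v\<in>V. if real (deg v) * real n * real R < 4 * y * y * real t then hash_bound k t * real (deg v) else 0) / real n"
      by (rule integral_pick)
    also have "\<dots> \<le> (\<Sum>v\<in>V. hash_bound k t * real (deg v)) / real n"
      using hash_bound_nonneg by (intro divide_right_mono sum_mono) auto
    also have "\<dots> = hash_bound k t * (2 * real m) / real n"
      by (simp only: sum_distrib_left[symmetric] sum_deg_real)
    finally show ?thesis .
  qed
  have "measure (unifs UNIV) {r \<in> space (unifs UNIV). 2 * ?\<mu> + c * ?b \<le> (\<Sum>i\<in>?I. ?f (?g i) (r i))} \<le> exp (- c)"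
  proof (rule chernoff_weighted)
    show "0 < ?b" using k J0 y0 th0 n2 by simp
    have "(\<Sum>i\<in>?I. integral\<^sup>L unif01 (?f (?g i))) = (\<Sum>t\<in>?D. integral\<^sup>L unif01 (?f t))"
      by (subst sum.reindex[OF inj]) (simp only: comp_def gg)
    also have "\<dots> \<le> (\<Sum>t\<in>?D. hash_bound k t * (2 * real m) / real n)" by (intro sum_mono fE)
    also have "\<dots> = 4 * real (k * J1) * real (k * R) * real m / (th * real n) * (\<Sum>t\<in>?D. 1 / real t)"
      unfolding sum_distrib_left
    proof (intro sum.cong refl)
      fix t
      have "2 * A * B / (th * t') * (2 * M) / n' = 4 * A * B * M / (th * n') * (1 / t')" for A B M n' t' :: real
        by (simp add: mult_ac)
      then show "hash_bound k t * (2 * real m) / real n = 4 * real (k * J1) * real (k * R) * real m / (th * real n) * (1 / real t)"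
        unfolding hash_bound_def .
    qed
    also have "\<dots> \<le> ?\<mu>"
    proof (intro mult_left_mono)
      show "(\<Sum>t\<in>?D. 1 / real t) \<le> ln (1 + 2 * real n / th)"
      proof (cases "k * R \<le> T k")
        case True
        have kR': "1 \<le> real (k * R)" using kR by (metis One_nat_def Suc_leI of_nat_1 of_nat_mono)
        have "real (T k) \<le> 2 * real n * real (k * R) / th + 1" using T_real[of k] by linarith
        then have "real (T k) / real (k * R) \<le> (2 * real n * real (k * R) / th + 1) / real (k * R)"
          by (intro divide_right_mono) auto
        also have "\<dots> \<le> 1 + 2 * real n / th"
        proof -
          have "(2 * real n * K / th + 1) / K \<le> 1 + 2 * real n / th" if "1 \<le> K" for K :: real
            using that by (simp add: add_divide_distrib)
          from this[OF kR'] show ?thesis .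
        qed
        finally have "ln (real (T k) / real (k * R)) \<le> ln (1 + 2 * real n / th)"
          using kR' True by (subst ln_le_cancel_iff) (auto simp: add_pos_nonneg T_def th0 less_imp_le)
        then show ?thesis using sum_inverse_le_ln[OF kR True] by linarith
      next
        case False
        then have "(\<Sum>t\<in>?D. 1 / real t) = 0" by simp
        then show ?thesis using th0 by simp
      qed
    qed (use th0 in simp)
    finally show "(\<Sum>i\<in>?I. integral\<^sup>L unif01 (?f (?g i))) \<le> ?\<mu>" .
    show "0 \<le> ?f (?g i) a \<and> ?f (?g i) a \<le> ?b" if "i \<in> ?I" for i a
    proof -
      have "?g i \<in> ?D" using that by auto
      then show ?thesis by (rule fb)
    qed
  qed (use fm in auto)
  then show ?thesis unfolding sw[symmetric] by (simp add: space_PiM)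
qed

lemma enumeration_cost_eq:
  "real (enumeration_cost h r b k) = (\<Sum>w\<in>V. \<Sum>t\<in>{k * R<..T k}.
     if capped r b t \<and> w \<in> N (sample r b t) \<and> h w < hash_bound k t then 1 else 0)"
proof -
  have "real (enumeration_cost h r b k) = (\<Sum>t\<in>{k * R<..T k}. \<Sum>w\<in>V.
      if capped r b t \<and> w \<in> N (sample r b t) \<and> h w < hash_bound k t then 1 else 0)"
    unfolding enumeration_cost_def of_nat_sum
  proof (intro sum.cong refl)
    fix t
    have "{w \<in> V. w \<in> N (sample r b t) \<and> h w < hash_bound k t} = {w \<in> N (sample r b t). h w < hash_bound k t}"
      using N_subset by blast
    then show "real (if capped r b t then card {w \<in> N (sample r b t). h w < hash_bound k t} else 0)
      = (\<Sum>w\<in>V. if capped r b t \<and> w \<in> N (sample r b t) \<and> h w < hash_bound k t then 1 else 0)"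
      by (simp add: sum.If_cases Int_def)
  qed
  then show ?thesis by (subst (asm) sum.swap)
qed

text \<open>With the tape fixed, the cost is regrouped by the neighbor that is met: the share of
  \<open>w\<close> is a function of \<open>h w\<close> alone and at most \<open>T k\<close>.\<close>

lemma enumeration_cost_tail:
  assumes k: "1 \<le> k"
  shows "measure (unifs V) {h \<in> space (unifs V). 2 * search_weight r b k + c * real (T k) \<le> real (enumeration_cost h r b k)} \<le> exp (- c)"
proof -
  let ?D = "{k * R<..T k}"
  let ?f = "\<lambda>w x. (\<Sum>t\<in>?D. if capped r b t \<and> w \<in> N (sample r b t) \<and> x < hash_bound k t then 1 else 0 :: real)"
  note ec = enumeration_cost_eq[of _ r b k]
  have T0: "0 < real (T k)" by (simp add: T_def)
  have "measure (unifs V) {h \<in> space (unifs V). 2 * search_weight r b k + c * real (T k) \<le> (\<Sum>w\<in>V. ?f w (h w))} \<le> exp (- c)"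
  proof (rule chernoff_weighted)
    show "?f w \<in> borel_measurable borel" for w by measurable
    show "0 < real (T k)" by (rule T0)
    show "0 \<le> ?f w x \<and> ?f w x \<le> real (T k)" for w x
    proof
      show "0 \<le> ?f w x" by (intro sum_nonneg) auto
      have "?f w x \<le> (\<Sum>t\<in>?D. 1)" by (intro sum_mono) auto
      also have "\<dots> \<le> real (T k)" by simp
      finally show "?f w x \<le> real (T k)" .
    qed
    have int1: "(\<integral>x. (if x < p then 1 else 0 :: real) \<partial>unif01) \<le> p" if "0 \<le> p" for p
    proof -
      have "(\<integral>x. (if x < p then 1 else 0 :: real) \<partial>unif01) = (\<integral>x. indicator {..<p} x \<partial>unif01)"
        by (intro Bochner_Integration.integral_cong) (auto simp: indicator_def)
      also have "\<dots> = measure unif01 {..<p}" by simp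
      also have "\<dots> = measure lborel ({0..1} \<inter> {..<p})" by (rule measure_unif01) simp
      also have "\<dots> \<le> measure lborel {0..p}" using that by (intro measure_mono_fmeasurable) (auto simp: fmeasurable_def)
      also have "\<dots> = p" using that by simp
      finally show ?thesis .
    qed
    have fE: "integral\<^sup>L unif01 (?f w) \<le> (\<Sum>t\<in>?D. if capped r b t \<and> w \<in> N (sample r b t) then hash_bound k t else 0)" for w
    proof -
      have im: "integrable unif01 (\<lambda>x. if capped r b t \<and> w \<in> N (sample r b t) \<and> x < hash_bound k t then 1 else 0 :: real)" for t
        by (intro unif01.integrable_const_bound[where B = 1]) (auto)
      have "integral\<^sup>L unif01 (?f w) = (\<Sum>t\<in>?D. \<integral>x. (if capped r b t \<and> w \<in> N (sample r b t) \<and> x < hash_bound k t then 1 else 0 :: real) \<partial>unif01)"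
        using im by (intro Bochner_Integration.integral_sum) auto
      also have "\<dots> \<le> (\<Sum>t\<in>?D. if capped r b t \<and> w \<in> N (sample r b t) then hash_bound k t else 0)"
      proof (intro sum_mono)
        fix t
        show "(\<integral>x. (if capped r b t \<and> w \<in> N (sample r b t) \<and> x < hash_bound k t then 1 else 0 :: real) \<partial>unif01)
          \<le> (if capped r b t \<and> w \<in> N (sample r b t) then hash_bound k t else 0)"
          using int1[OF hash_bound_nonneg, of k t] by (cases "capped r b t \<and> w \<in> N (sample r b t)") auto
      qed
      finally show ?thesis .
    qed
    have "(\<Sum>w\<in>V. integral\<^sup>L unif01 (?f w)) \<le> (\<Sum>w\<in>V. \<Sum>t\<in>?D. if capped r b t \<and> w \<in> N (sample r b t) then hash_bound k t else 0)"
      by (intro sum_mono fE)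
    also have "\<dots> = (\<Sum>t\<in>?D. \<Sum>w\<in>V. if capped r b t \<and> w \<in> N (sample r b t) then hash_bound k t else 0)"
      by (rule sum.swap)
    also have "\<dots> = search_weight r b k"
      unfolding search_weight_def
    proof (intro sum.cong refl)
      fix t
      have "V \<inter> {w. w \<in> N (sample r b t)} = N (sample r b t)" using N_subset by blast
      then show "(\<Sum>w\<in>V. if capped r b t \<and> w \<in> N (sample r b t) then hash_bound k t else 0)
        = (if capped r b t then hash_bound k t * real (deg (sample r b t)) else 0)"
        by (simp add: sum.If_cases)
    qed
    finally show "(\<Sum>w\<in>V. integral\<^sup>L unif01 (?f w)) \<le> search_weight r b k" .
  qed auto
  then show ?thesis unfolding ec .
qed

lemma sum_one_minus_q: "(\<Sum>v\<in>heavy. 1 - q v) \<le> 2 * real m / (real n * th)"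
proof -
  have "1 - q v \<le> real (deg v) / (real n * th)" for v
  proof -
    have "1 - 1 / (1 + x) \<le> x" if "0 \<le> x" for x :: real
      using that by (simp add: field_simps)
    then show ?thesis unfolding q_def using th0 by simp
  qed
  then have "(\<Sum>v\<in>heavy. 1 - q v) \<le> (\<Sum>v\<in>heavy. real (deg v) / (real n * th))" by (intro sum_mono)
  also have "\<dots> \<le> (\<Sum>v\<in>V. real (deg v) / (real n * th))"
    using th0 by (intro sum_mono2) (auto simp: heavy_def)
  also have "\<dots> = 2 * real m / (real n * th)"
    by (simp only: sum_divide_distrib[symmetric] sum_deg_real)
  finally show ?thesis .
qed

lemma measurable_card_active [measurable]: "(\<lambda>h. real (card (active h j))) \<in> borel_measurable (unifs V)"
proof -
  have eq: "(\<lambda>h. real (card (active h j))) = (\<lambda>h. \<Sum>B\<in>Pow heavy. if active h j = B then real (card B) else 0)"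
    using active_subset by (intro ext) (simp add: sum.delta')
  show ?thesis unfolding eq by measurable
qed

text \<open>The slots are independent, and in each of them the exponential moment of the number of
  active vertices is the product of the factors 1 + (e - 1) (1 - q v), at most exp (2 (1 - q v))
  each.\<close>

lemma activation_cost_tail:
  "measure (unifs V) {h \<in> space (unifs V). 4 * real (k * J1) * real m / (real n * th) + c \<le> real (activation_cost h k)} \<le> exp (- c)"
proof -
  let ?J = "k * J1" and ?\<mu> = "4 * real (k * J1) * real m / (real n * th)"
  let ?Z = "\<lambda>h. \<Prod>j<?J. exp (real (card (active h j)))"
  have Zm: "?Z \<in> borel_measurable (unifs V)" by measurable
  have Zb: "?Z h \<le> (\<Prod>j<?J. exp (real (card heavy)))" for h
    using card_mono[OF finite_heavy active_subset] by (intro prod_mono) auto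
  have int: "integrable (unifs V) ?Z"
    using Zm Zb by (intro unifs.P.integrable_const_bound[where B = "\<Prod>j<?J. exp (real (card heavy))"]) (auto simp: prod_nonneg)
  have ZE: "?Z h = exp (real (activation_cost h k))" for h
    by (simp add: activation_cost_def exp_sum)
  have e2: "exp 1 \<le> (3 :: real)" by (rule exp_le)
  have step: "(\<Sum>B\<in>Pow heavy. \<pi> B * exp (real (card B))) \<le> exp (4 * real m / (real n * th))"
  proof -
    have "(\<Sum>B\<in>Pow heavy. \<pi> B * exp (real (card B))) = (\<Sum>B\<in>Pow heavy. (\<Prod>v\<in>B. (1 - q v) * exp 1) * (\<Prod>v\<in>heavy - B. q v))"
      by (intro sum.cong refl) (simp add: \<pi>_def prod.distrib exp_of_nat_mult[symmetric])
    also have "\<dots> = (\<Prod>v\<in>heavy. (1 - q v) * exp 1 + q v)" by (rule prod_add[symmetric]) simp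
    also have "\<dots> \<le> (\<Prod>v\<in>heavy. exp (2 * (1 - q v)))"
    proof (intro prod_mono conjI)
      fix v assume "v \<in> heavy"
      note qb = q_bounds[OF heavy_deg[OF this]]
      show "0 \<le> (1 - q v) * exp 1 + q v" using qb by (intro add_nonneg_nonneg) auto
      have "(1 - q v) * exp 1 \<le> (1 - q v) * 3" using qb e2 by (intro mult_left_mono) auto
      then have "(1 - q v) * exp 1 + q v \<le> 1 + 2 * (1 - q v)" by (simp add: algebra_simps)
      also have "\<dots> \<le> exp (2 * (1 - q v))" by (rule exp_ge_add_one_self)
      finally show "(1 - q v) * exp 1 + q v \<le> exp (2 * (1 - q v))" .
    qed
    also have "\<dots> = exp (2 * (\<Sum>v\<in>heavy. 1 - q v))" by (simp add: exp_sum sum_distrib_left)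
    also have "\<dots> \<le> exp (4 * real m / (real n * th))" using sum_one_minus_q by simp
    finally show ?thesis .
  qed
  have "{h \<in> space (unifs V). ?\<mu> + c \<le> real (activation_cost h k)} = {h \<in> space (unifs V). exp (?\<mu> + c) \<le> ?Z h}"
    unfolding ZE by simp
  also have "measure (unifs V) \<dots> \<le> (\<integral>h. ?Z h \<partial>unifs V) / exp (?\<mu> + c)"
    using int by (intro integral_Markov_inequality_measure[where A = "{}"]) (auto simp: prod_nonneg)
  also have "(\<integral>h. ?Z h \<partial>unifs V) = (\<Prod>j<?J. \<Sum>B\<in>Pow heavy. \<pi> B * exp (real (card B)))"
    by (rule integral_active)
  also have "\<dots> \<le> (\<Prod>j<?J. exp (4 * real m / (real n * th)))"
    using step \<pi>_nonneg by (intro prod_mono conjI sum_nonneg) auto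
  also have "\<dots> = exp ?\<mu>" by (simp add: exp_of_nat_mult[symmetric])
  finally show ?thesis by (simp add: exp_add exp_minus divide_right_mono field_simps)
qed

text \<open>Each factor 1 / (1 + x) is at least exp (- x), and the odds of the heavy vertices sum to
  at most \<open>2 * m / (n * th)\<close>.\<close>

lemma Z_ge: "exp (- (2 * real m / (real n * th))) \<le> Z"
proof -
  have "exp (- (\<Sum>v\<in>heavy. real (deg v) / (real n * th))) \<le> Z"
    unfolding Z_def sum_negf[symmetric] exp_sum[OF finite_heavy]
  proof (intro prod_mono conjI)
    fix v
    let ?x = "real (deg v) / (real n * th)"
    have x: "0 \<le> ?x" using th0 by simp
    have "1 + ?x \<le> exp ?x" by (rule exp_ge_add_one_self)
    then have "inverse (exp ?x) \<le> inverse (1 + ?x)" using x by (intro le_imp_inverse_le) auto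
    then show "exp (- ?x) \<le> q v" by (simp add: exp_minus q_def inverse_eq_divide)
  qed simp
  moreover have "(\<Sum>v\<in>heavy. real (deg v) / (real n * th)) \<le> 2 * real m / (real n * th)"
  proof -
    have "(\<Sum>v\<in>heavy. real (deg v) / (real n * th)) \<le> (\<Sum>v\<in>V. real (deg v) / (real n * th))"
      using th0 by (intro sum_mono2) (auto simp: heavy_def)
    also have "\<dots> = 2 * real m / (real n * th)"
      by (simp only: sum_divide_distrib[symmetric] sum_deg_real)
    finally show ?thesis .
  qed
  ultimately show ?thesis by (smt (verit) exp_le_cancel_iff)
qed

lemma success_tail:
  "measure (rand_space G) {\<omega> \<in> space (rand_space G). length (somes (slot_list b (k * J1) \<omega>)) < s}
    \<le> exp (real s - real (k * J1) * (2 * real m * Z / (real n * th)) / 2)"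
proof -
  have "measure (rand_space G) {\<omega> \<in> space (rand_space G). True \<and> length (somes (slot_list b (k * J1) \<omega>)) < s}
      = measure (unifs (UNIV :: nat set)) {r. True} * measure (replicate_pmf (k * J1) slot_pmf) {cs. length (somes cs) < s}"
    by (rule measure_slot_list[where K = "{}"]) auto
  also have "measure (replicate_pmf (k * J1) slot_pmf) {cs. length (somes cs) < s}
      = measure (binomial_pmf (k * J1) (2 * real m * Z / (real n * th))) {k. k < s}"
    unfolding slot_pmf_def by (rule prob_length_somes[OF success_prob_bounds])
  also have "measure (unifs (UNIV :: nat set)) {r. True} = 1"
    using unifs.P.prob_space[where I = "UNIV :: nat set"] by (simp add: space_PiM)
  finally show ?thesis using binomial_lower_tail[OF success_prob_bounds, of "k * J1" s] by simp
qed

end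

subsection \<open>Correctness\<close>

lemma exp_half_le: "exp (1 / 2) \<le> (2 :: real)"
proof -
  have "exp (1 / 2 :: real) ^ 2 \<le> 2 ^ 2" using exp_le by (simp add: exp_of_nat_mult[symmetric])
  then show ?thesis by (rule power2_le_imp_le) simp
qed

context edge_sampler
begin

lemma pos_mono: "g \<le> g' \<Longrightarrow> pos g \<le> pos g'"
  unfolding pos_def by (intro sum_mono2) auto

text \<open>Stopping at round \<open>g\<close> is decided by the tape before the position where the
  phases begin, hence independently of them.\<close>

lemma stops_cong:
  assumes "\<forall>i<pos (Suc g). r i = r' i"
  shows "stops r g = stops r' g"
proof -
  have "cnt r g' = cnt r' g'" if "g' \<le> g" for g'
  proof -
    have "pos g' + i < pos (Suc g)" if "i < trials g'" for i
      using that pos_mono[of "Suc g'" "Suc g"] \<open>g' \<le> g\<close> by (simp add: pos_def)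
    then have "{i. i < trials g' \<and> hit (X g') (r (pos g' + i))} = {i. i < trials g' \<and> hit (X g') (r' (pos g' + i))}"
      using assms by auto
    then show ?thesis by (simp add: cnt_def)
  qed
  then show ?thesis by (simp add: stops_def)
qed

definition regular :: "(nat \<Rightarrow> real) \<times> (nat \<Rightarrow> real) \<Rightarrow> bool" where
  "regular \<omega> \<longleftrightarrow> (\<forall>v\<in>V. 0 \<le> fst \<omega> v \<and> fst \<omega> v < 1) \<and> (\<forall>i. 0 \<le> snd \<omega> i \<and> snd \<omega> i < 1)"

lemma exp_\<l>: "exp (- real \<l>) \<le> \<delta> / real n"
proof -
  have "exp (- real \<l>) \<le> exp (- ln (real n / \<delta>))" using \<l>_ge by simp
  also have "\<dots> = \<delta> / real n" using \<delta>0 n2 by (simp add: exp_minus)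
  finally show ?thesis .
qed

end

context scaled_sampler
begin

lemma measure_rand_tape:
  assumes "Measurable.pred (unifs UNIV) Q"
  shows "measure (rand_space G) {\<omega> \<in> space (rand_space G). Q (snd \<omega>)} = measure (unifs UNIV) {r. Q r}"
proof -
  have "{\<omega> \<in> space (rand_space G). Q (snd \<omega>)} \<in> sets (rand_space G)"
    using measurable_compose[OF measurable_snd_rand assms] by (simp add: pred_def)
  from measure_rand_fubini[OF this, of "\<lambda>_. measure (unifs UNIV) {r. Q r}"] show ?thesis
    using rand.M1.prob_space by simp
qed

lemma measurable_regular [measurable]: "Measurable.pred (rand_space G) regular"
  unfolding regular_def by measurable

lemma AE_regular: "AE \<omega> in rand_space G. regular \<omega>"
  using AE_rand by (simp add: regular_def)

text \<open>All \<open>\<l>\<close> phases are included, whether or not they are executed. So the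
  event does not refer to the stopping phase and splits into a condition on the tape and a count of
  successes.\<close>

definition correct_run :: "nat \<Rightarrow> (nat \<Rightarrow> real) \<times> (nat \<Rightarrow> real) \<Rightarrow> bool" where
  "correct_run g \<omega> \<longleftrightarrow> stops (snd \<omega>) g \<and> (\<forall>k\<in>{1..\<l>}. covers (snd \<omega>) (pos (Suc g)) k)
     \<and> s \<le> length (somes (slot_list (pos (Suc g)) (\<l> * J1) \<omega>))"

definition result :: "nat \<Rightarrow> (nat \<Rightarrow> real) \<times> (nat \<Rightarrow> real) \<Rightarrow> (nat \<times> nat) list" where
  "result g \<omega> = take s (somes (slot_list (pos (Suc g)) (\<l> * J1) \<omega>))"

lemma measurable_correct_run [measurable]: "Measurable.pred (rand_space G) (correct_run g)"
  and measurable_result [measurable]: "result g \<in> measurable (rand_space G) (count_space UNIV)"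
proof -
  have [measurable]: "Measurable.pred (rand_space G) (\<lambda>\<omega>. stops (snd \<omega>) g)"
    using measurable_compose[OF measurable_snd_rand measurable_stops] .
  have [measurable]: "Measurable.pred (rand_space G) (\<lambda>\<omega>. covers (snd \<omega>) b k)" for b k
    using measurable_compose[OF measurable_snd_rand measurable_covers] .
  show "Measurable.pred (rand_space G) (correct_run g)"
    unfolding correct_run_def by measurable
  show "result g \<in> measurable (rand_space G) (count_space UNIV)"
    unfolding result_def by measurable
qed

text \<open>Stopping and coverage read the tape below \<open>pos (Suc g)\<close> and at even offsets
  beyond it, slots at odd offsets; hence \<open>measure_slot_list\<close> factors. Within the slots,
  the first \<open>s\<close> values are independent of there being at least \<open>s\<close> of
  them.\<close>

lemma measure_correct_run_result:
  assumes x: "length xs = s"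
  shows "measure (rand_space G) {\<omega> \<in> space (rand_space G). correct_run g \<omega> \<and> result g \<omega> = xs}
    = measure (rand_space G) {\<omega> \<in> space (rand_space G). correct_run g \<omega>} * pmf (replicate_pmf s (pmf_of_set (oriented_edges G))) xs"
proof -
  let ?b = "pos (Suc g)" and ?J = "\<l> * J1" and ?U = "pmf_of_set (oriented_edges G)"
  let ?p = "2 * real m * Z / (real n * th)"
  let ?Q = "\<lambda>r. stops r g \<and> (\<forall>k\<in>{1..\<l>}. covers r ?b k)"
  let ?K = "{i. i < ?b} \<union> range (\<lambda>t. ?b + 2 * t)"
  have Q: "Measurable.pred (unifs UNIV) ?Q" by measurable
  have dep: "?Q r = ?Q r'" if "\<forall>i\<in>?K. r i = r' i" for r r'
    using stops_cong[of g r r'] covers_cong[of r ?b r'] that by auto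
  have K: "?b + 2 * j + 1 \<notin> ?K" for j
  proof
    assume "?b + 2 * j + 1 \<in> ?K"
    then obtain t where "?b + 2 * j + 1 = ?b + 2 * t" by auto
    then have "2 * j + 1 = 2 * t" by simp
    then show False by presburger
  qed
  have W: "slot_pmf = bind_pmf (bernoulli_pmf ?p) (\<lambda>b. if b then map_pmf Some ?U else return_pmf None)"
    by (simp add: slot_pmf_def)
  have "measure (rand_space G) {\<omega> \<in> space (rand_space G). correct_run g \<omega> \<and> result g \<omega> = xs}
      = measure (rand_space G) {\<omega> \<in> space (rand_space G). ?Q (snd \<omega>) \<and>
          (s \<le> length (somes (slot_list ?b ?J \<omega>)) \<and> take s (somes (slot_list ?b ?J \<omega>)) = xs)}"
    by (simp add: correct_run_def result_def conj_ac)
  also have "\<dots> = measure (unifs UNIV) {r. ?Q r} *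
      measure (replicate_pmf ?J slot_pmf) {cs. s \<le> length (somes cs) \<and> take s (somes cs) = xs}"
    by (rule measure_slot_list[OF Q dep K, where \<Phi> = "\<lambda>cs. s \<le> length (somes cs) \<and> take s (somes cs) = xs"]) auto
  also have "measure (replicate_pmf ?J slot_pmf) {cs. s \<le> length (somes cs) \<and> take s (somes cs) = xs}
      = measure (binomial_pmf ?J ?p) {k. s \<le> k} * pmf (replicate_pmf s ?U) xs"
    unfolding W by (rule prob_take_somes[OF success_prob_bounds x])
  also have "measure (binomial_pmf ?J ?p) {k. s \<le> k} = measure (replicate_pmf ?J slot_pmf) {cs. s \<le> length (somes cs)}"
  proof -
    have "{k. s \<le> k} = space (measure_pmf (binomial_pmf ?J ?p)) - {k. k < s}" by auto
    then have "measure (binomial_pmf ?J ?p) {k. s \<le> k} = 1 - measure (binomial_pmf ?J ?p) {k. k < s}"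
      by (simp only:) (subst measure_pmf.prob_compl, auto)
    moreover have "{cs. s \<le> length (somes cs)} = space (measure_pmf (replicate_pmf ?J slot_pmf)) - {cs. length (somes cs) < s}" by auto
    then have "measure (replicate_pmf ?J slot_pmf) {cs. s \<le> length (somes cs)} = 1 - measure (replicate_pmf ?J slot_pmf) {cs. length (somes cs) < s}"
      by (simp only:) (subst measure_pmf.prob_compl, auto)
    ultimately show ?thesis using prob_length_somes[OF success_prob_bounds, of ?J ?U s, folded W] by simp
  qed
  also have "measure (unifs UNIV) {r. ?Q r} * (measure (replicate_pmf ?J slot_pmf) {cs. s \<le> length (somes cs)} * pmf (replicate_pmf s ?U) xs)
      = measure (unifs UNIV) {r. ?Q r} * measure (replicate_pmf ?J slot_pmf) {cs. s \<le> length (somes cs)} * pmf (replicate_pmf s ?U) xs"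
    by simp
  also have "measure (unifs UNIV) {r. ?Q r} * measure (replicate_pmf ?J slot_pmf) {cs. s \<le> length (somes cs)}
      = measure (rand_space G) {\<omega> \<in> space (rand_space G). ?Q (snd \<omega>) \<and> s \<le> length (somes (slot_list ?b ?J \<omega>))}"
    by (rule measure_slot_list[OF Q dep K, where \<Phi> = "\<lambda>cs. s \<le> length (somes cs)", symmetric]) auto
  also have "\<dots> = measure (rand_space G) {\<omega> \<in> space (rand_space G). correct_run g \<omega>}"
    by (simp add: correct_run_def conj_ac)
  finally show ?thesis .
qed

text \<open>By determinism the run provided by \<open>exec_sampler\<close> is the only one, which
  yields the direction from left to right.\<close>

lemma returns_result:
  assumes y: "y = 3 * X g" and reg: "regular \<omega>" and cr: "correct_run g \<omega>"
  shows "returns sampler G s \<delta> \<omega> xs \<longleftrightarrow> result g \<omega> = xs"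
proof -
  interpret run: sampler_run G s \<delta> y "fst \<omega>" "snd \<omega>" "pos (Suc g)"
    using reg by unfold_locales (auto simp: regular_def)
  let ?L = "somes (slot_list (pos (Suc g)) (\<l> * J1) \<omega>)"
  have L: "run.successes (active (fst \<omega>)) (\<l> * J1) = ?L"
    by (simp add: run.successes_def slot_list_def somes_def List.map_filter_def run.a_def comp_def filter_map)
  have st: "stops (snd \<omega>) g" and cov: "\<forall>k\<in>{1..\<l>}. covers (snd \<omega>) (pos (Suc g)) k" and len: "s \<le> length ?L"
    using cr by (auto simp: correct_run_def)
  obtain t \<sigma> k where ex: "exec G (fst \<omega>) (snd \<omega>) (sampler, input_store n s \<delta>, 0) t (\<sigma>, k)"
    and out: "\<forall>i<s. \<sigma> ''src'' i = real (fst (?L ! i)) \<and> \<sigma> ''dst'' i = real (snd (?L ! i))"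
    using run.exec_sampler[OF st y refl] cov len L by metis
  show ?thesis
  proof
    assume "returns sampler G s \<delta> \<omega> xs"
    then obtain t' \<sigma>' k' where xs: "length xs = s"
      and ex': "exec G (fst \<omega>) (snd \<omega>) (sampler, input_store n s \<delta>, 0) t' (\<sigma>', k')"
      and out': "\<forall>i<s. \<sigma>' ''src'' i = real (fst (xs ! i)) \<and> \<sigma>' ''dst'' i = real (snd (xs ! i))"
      unfolding returns_def by blast
    have "\<sigma>' = \<sigma>" using exec_deterministic[OF ex ex'] by simp
    then have "?L ! i = xs ! i" if "i < s" for i using out out' that by (simp add: prod_eq_iff)
    then show "result g \<omega> = xs" unfolding result_def using xs len by (intro nth_equalityI) auto
  next
    assume "result g \<omega> = xs"
    then have xs: "xs = take s ?L" by (simp add: result_def)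
    then show "returns sampler G s \<delta> \<omega> xs"
      unfolding returns_def using len ex out by (intro conjI exI[of _ t] exI[of _ \<sigma>] exI[of _ k]) auto
  qed
qed

lemma n_th_ge: "y * y \<le> real n * th"
proof -
  have "0 \<le> real n * (y / sqrt (real s))" using y0 by simp
  moreover have "real n * th = real n * (y / sqrt (real s)) + y * y" unfolding th_def using n2 by (simp add: field_simps)
  ultimately show ?thesis by linarith
qed

lemma J1_ge: "100000 * real s * real \<nu> * real n * th / (y * y) \<le> real J1"
  using J1_real by linarith

text \<open>The right-hand side is the expected number of successes among \<open>J1\<close> slots.
  By \<open>n_th_ge\<close> the odds sum to at most \<open>2 * a\<close>, so \<open>Z\<close> is at
  least exp (- 2 a).\<close>

lemma mean_successes:
  assumes "real m \<le> a * (y * y)" "0 \<le> a"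
  shows "200000 * real s * real \<nu> * (real m / (y * y)) * exp (- 2 * a) \<le> real J1 * (2 * real m * Z / (real n * th))"
proof -
  have yy: "0 < y * y" using y0 by simp
  have nth: "0 < real n * th" using n_th_ge yy by linarith
  have "2 * real m / (real n * th) \<le> 2 * a"
  proof -
    have "2 * real m \<le> 2 * (a * (y * y))" using assms by simp
    also have "\<dots> \<le> 2 * (a * (real n * th))" using n_th_ge assms by (intro mult_left_mono) auto
    finally show ?thesis using nth by (simp add: pos_divide_le_eq mult_ac)
  qed
  then have "exp (- 2 * a) \<le> exp (- (2 * real m / (real n * th)))" by simp
  also have "\<dots> \<le> Z" by (rule Z_ge)
  finally have Z: "exp (- 2 * a) \<le> Z" .
  have "200000 * real s * real \<nu> * (real m / (y * y)) * exp (- 2 * a)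
      \<le> 200000 * real s * real \<nu> * (real m / (y * y)) * Z"
    using Z by (intro mult_left_mono) auto
  also have "\<dots> = (100000 * real s * real \<nu> * real n * th / (y * y)) * (2 * real m * Z / (real n * th))"
    using th0 n2 by (simp add: field_simps)
  also have "\<dots> \<le> real J1 * (2 * real m * Z / (real n * th))"
    using J1_ge success_prob_bounds(1) by (rule mult_right_mono)
  finally show ?thesis .
qed

lemma \<nu>_ge: "1 \<le> \<nu>" "ln (real n) \<le> real \<nu>"
  unfolding \<nu>_def by linarith+

text \<open>The factor for \<open>stops\<close> is kept so that the bounds for all \<open>g\<close>
  add up to 3 / 4 of \<open>\<delta>\<close>. The factor 3 in \<open>y\<close> turns the lower bound
  on \<open>X g\<close> into \<open>m \<le> y * y\<close>, which lets even the first phase be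
  covered.\<close>

lemma incorrect_run:
  assumes y: "y = 3 * X g" and lo: "real m / 6 \<le> (X g)\<^sup>2" and hi: "(X g)\<^sup>2 \<le> exp 5 * real m"
  shows "measure (rand_space G) {\<omega> \<in> space (rand_space G). stops (snd \<omega>) g \<and> \<not> correct_run g \<omega>}
    \<le> measure (unifs UNIV) {r. stops r g} * (3 / 4 * \<delta>)"
proof -
  interpret P: prob_space "rand_space G" by (rule prob_space_rand)
  let ?b = "pos (Suc g)" and ?J = "\<l> * J1"
  let ?A = "\<lambda>k. {\<omega> \<in> space (rand_space G). stops (snd \<omega>) g \<and> \<not> covers (snd \<omega>) ?b k}"
  let ?B = "{\<omega> \<in> space (rand_space G). stops (snd \<omega>) g \<and> length (somes (slot_list ?b ?J \<omega>)) < s}"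
  have [measurable]: "Measurable.pred (rand_space G) (\<lambda>\<omega>. stops (snd \<omega>) g)"
    using measurable_compose[OF measurable_snd_rand measurable_stops] .
  have [measurable]: "Measurable.pred (rand_space G) (\<lambda>\<omega>. covers (snd \<omega>) b k)" for b k
    using measurable_compose[OF measurable_snd_rand measurable_covers] .
  have yy: "y * y = 9 * (X g)\<^sup>2" by (simp add: y power2_eq_square)
  have my: "real m \<le> 1 * (y * y)" using lo unfolding yy by linarith
  let ?S = "measure (unifs UNIV) {r. stops r g}"
  have S0: "0 \<le> ?S" by simp
  have A: "measure (rand_space G) (?A k) \<le> ?S * (real n * exp (1 / 2) * exp (- 4 * real \<l>))" if k: "k \<in> {1..\<l>}" for k
  proof -
    have "measure (rand_space G) (?A k) = measure (unifs UNIV) {r. stops r g \<and> \<not> covers r ?b k}"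
      by (rule measure_rand_tape) measurable
    also have "\<dots> = ?S * measure (unifs UNIV) {r. \<not> covers r ?b k}"
    proof (rule measure_unifs_indep[where A = "{i. i < ?b}" and B = "range (\<lambda>t. ?b + 2 * t)"])
      show "stops x g = stops x' g" if "\<forall>i\<in>{i. i < ?b}. x i = x' i" for x x'
        using stops_cong that by auto
      show "(\<not> covers x ?b k) = (\<not> covers x' ?b k)" if "\<forall>i\<in>range (\<lambda>t. ?b + 2 * t). x i = x' i" for x x'
        using covers_cong[of x ?b x' k] that by auto
    qed auto
    also have "\<dots> \<le> ?S * (real n * exp (1 / 2 - 4 * real k * real \<l>))"
    proof (intro mult_left_mono covers_tail)
      show "1 \<le> k" using k by simp
      have "1 * (y * y) \<le> real k * (y * y)" using k by (intro mult_right_mono) auto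
      then show "real m \<le> real k * (y * y)" using my by linarith
    qed simp
    also have "\<dots> \<le> ?S * (real n * (exp (1 / 2) * exp (- 4 * real \<l>)))"
    proof (intro mult_left_mono)
      have "1 * real \<l> \<le> real k * real \<l>" using k by (intro mult_right_mono) auto
      then show "exp (1 / 2 - 4 * real k * real \<l>) \<le> exp (1 / 2) * exp (- 4 * real \<l>)"
        by (simp add: exp_add[symmetric])
    qed auto
    finally show ?thesis by (simp add: mult.assoc)
  qed
  have B: "measure (rand_space G) ?B \<le> ?S * exp (- 4 * real \<l>)"
  proof -
    have "measure (rand_space G) ?B = ?S * measure (replicate_pmf ?J slot_pmf) {cs. length (somes cs) < s}"
    proof (rule measure_slot_list[where K = "{i. i < ?b}" and \<Phi> = "\<lambda>cs. length (somes cs) < s"])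
      show "stops x g = stops x' g" if "\<forall>i\<in>{i. i < ?b}. x i = x' i" for x x'
        using stops_cong that by auto
    qed auto
    also have "measure (replicate_pmf ?J slot_pmf) {cs. length (somes cs) < s}
        = measure (binomial_pmf ?J (2 * real m * Z / (real n * th))) {k. k < s}"
      unfolding slot_pmf_def by (rule prob_length_somes[OF success_prob_bounds])
    also have "\<dots> \<le> exp (real s - real ?J * (2 * real m * Z / (real n * th)) / 2)"
      by (rule binomial_lower_tail[OF success_prob_bounds])
    also have "\<dots> \<le> exp (- 4 * real \<l>)"
    proof -
      have e: "exp 1 ^ 5 \<le> (3 :: real) ^ 5" by (intro power_mono exp_le) simp
      have e5: "exp 5 \<le> (243 :: real)" using e by (simp add: exp_of_nat_mult[symmetric])
      have "exp 1 ^ 2 \<le> (3 :: real) ^ 2" by (intro power_mono exp_le) simp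
      then have "exp 2 \<le> (9 :: real)" by (simp add: exp_of_nat_mult[symmetric])
      then have e2: "1 / 9 \<le> exp (- 2 :: real)" by (simp add: exp_minus field_simps)
      have "y * y \<le> 2187 * real m"
      proof -
        have "exp 5 * real m \<le> 243 * real m" using e5 by (intro mult_right_mono) auto
        then show ?thesis unfolding yy using hi by linarith
      qed
      then have mr: "1 / 2187 \<le> real m / (y * y)" using y0 by (simp add: field_simps)
      \<comment> \<open>This fixes the constant of \<open>J1\<close>: exp 5 <= 243 gives
        \<open>y * y \<le> 2187 * m\<close>, and 200000 / (2187 * 9) exceeds 10.\<close>
      have "10 * real s * 1 \<le> 200000 * real s * real \<nu> * (1 / 2187) * (1 / 9)"
      proof -
        have "real s * 1 \<le> real s * real \<nu>" using \<nu>_ge(1) by (intro mult_left_mono) auto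
        then show ?thesis by simp
      qed
      also have "\<dots> \<le> 200000 * real s * real \<nu> * (real m / (y * y)) * exp (- 2 * 1)"
        using mr e2 by (intro mult_mono) auto
      also have "\<dots> \<le> real J1 * (2 * real m * Z / (real n * th))"
        using my by (intro mean_successes) auto
      finally have "real \<l> * (10 * real s) \<le> real \<l> * (real J1 * (2 * real m * Z / (real n * th)))"
        by (intro mult_left_mono) auto
      then have 1: "10 * (real \<l> * real s) \<le> real ?J * (2 * real m * Z / (real n * th))" by (simp add: mult_ac)
      have "1 * real s \<le> real \<l> * real s" "real \<l> * 1 \<le> real \<l> * real s"
        using \<l>_pos s1 by (auto intro!: mult_right_mono mult_left_mono)
      then show ?thesis using 1 by simp
    qed
    finally show ?thesis by (simp add: mult_left_mono)
  qed
  have "{\<omega> \<in> space (rand_space G). stops (snd \<omega>) g \<and> \<not> correct_run g \<omega>} \<subseteq> (\<Union>k\<in>{1..\<l>}. ?A k) \<union> ?B"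
    unfolding correct_run_def by auto
  then have "measure (rand_space G) {\<omega> \<in> space (rand_space G). stops (snd \<omega>) g \<and> \<not> correct_run g \<omega>}
      \<le> measure (rand_space G) ((\<Union>k\<in>{1..\<l>}. ?A k) \<union> ?B)"
    by (intro P.finite_measure_mono) auto
  also have "\<dots> \<le> measure (rand_space G) (\<Union>k\<in>{1..\<l>}. ?A k) + measure (rand_space G) ?B"
    by (intro measure_Un_le) auto
  also have "measure (rand_space G) (\<Union>k\<in>{1..\<l>}. ?A k) \<le> (\<Sum>k\<in>{1..\<l>}. measure (rand_space G) (?A k))"
    by (intro measure_UNION_le) auto
  also have "\<dots> \<le> (\<Sum>k\<in>{1..\<l>}. ?S * (real n * exp (1 / 2) * exp (- 4 * real \<l>)))"
    by (rule sum_mono) (rule A)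
  also have "\<dots> = ?S * (real \<l> * (real n * exp (1 / 2) * exp (- 4 * real \<l>)))" by simp
  also note B
  finally have "measure (rand_space G) {\<omega> \<in> space (rand_space G). stops (snd \<omega>) g \<and> \<not> correct_run g \<omega>}
      \<le> ?S * (real \<l> * (real n * exp (1 / 2) * exp (- 4 * real \<l>)) + exp (- 4 * real \<l>))"
    by (simp add: algebra_simps)
  also have "\<dots> \<le> ?S * (3 / 4 * \<delta>)"
  \<comment> \<open>For E = exp (- \<l>), all of \<l> E <= 1, n E <= \<delta> and E <= 1 / 2 hold.
    The union over \<l> phases and at most n heavy vertices costs \<delta> / 2 and a lack of
    successes \<delta> / 4; the last quarter is left to the estimate.\<close>
  proof (intro mult_left_mono S0)
    let ?E = "exp (- real \<l>)"
    have pw: "exp (- 4 * real \<l>) = ?E ^ 4" by (simp add: exp_of_nat_mult[symmetric])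
    have E0: "0 < ?E" by simp
    have ED: "?E \<le> \<delta> / real n" by (rule exp_\<l>)
    have nE: "real n * ?E \<le> \<delta>" using ED n2 by (simp add: pos_le_divide_eq mult.commute)
    have E2: "?E \<le> 1 / 2"
    proof -
      have "\<delta> / real n \<le> 1 / 2" using \<delta>1 n2 \<delta>0 by (simp add: field_simps)
      then show ?thesis using ED by linarith
    qed
    have lE: "real \<l> * ?E \<le> 1"
    proof -
      have "real \<l> \<le> exp (real \<l>)" using exp_ge_add_one_self[of "real \<l>"] by linarith
      then show ?thesis by (simp add: exp_minus field_simps)
    qed
    have "real \<l> * (real n * exp (1 / 2) * ?E ^ 4) = (real \<l> * ?E) * (real n * ?E) * exp (1 / 2) * ?E ^ 2"
      by (simp add: power2_eq_square power4_eq_xxxx)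
    also have "\<dots> \<le> 1 * \<delta> * 2 * (1 / 2) ^ 2"
      using lE nE exp_half_le E2 E0 \<delta>0 by (intro mult_mono power_mono mult_nonneg_nonneg) auto
    finally have 1: "real \<l> * (real n * exp (1 / 2) * ?E ^ 4) \<le> \<delta> / 2" by (simp add: power2_eq_square)
    have "?E ^ 4 = ?E * ?E ^ 3" by (simp add: power4_eq_xxxx power3_eq_cube)
    also have "\<dots> \<le> \<delta> / real n * (1 / 2) ^ 3" using ED E2 E0 \<delta>0 by (intro mult_mono power_mono) auto
    also have "\<dots> \<le> \<delta> / 4" using n2 \<delta>0 by (simp add: power3_eq_cube field_simps)
    finally have "?E ^ 4 \<le> \<delta> / 4" .
    then show "real \<l> * (real n * exp (1 / 2) * exp (- 4 * real \<l>)) + exp (- 4 * real \<l>) \<le> 3 / 4 * \<delta>"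
      unfolding pw using 1 by linarith
  qed
  finally show ?thesis .
qed

end

section \<open>The distribution of the output\<close>

context edge_sampler
begin

lemma scaled: "scaled_sampler G s \<delta> (3 * X g)"
  using X_pos[of g] by unfold_locales simp

text \<open>The success event splits over the stopping round into disjoint pieces. On each piece the
  output has the desired law scaled by the measure of the piece, so the same holds for their
  union.\<close>

theorem samples_with_prob_sampler:
  "samples_with_prob sampler G s \<delta> (replicate_pmf s (pmf_of_set (oriented_edges G)))"
proof -
  let ?M = "rand_space G" and ?D = "replicate_pmf s (pmf_of_set (oriented_edges G))"
  interpret S0: scaled_sampler G s \<delta> "3 * X 0" by (rule scaled)
  interpret P: prob_space ?M by (rule S0.prob_space_rand)
  define C where "C = (\<lambda>g. scaled_sampler.correct_run G s \<delta> (3 * X g) g)"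
  define res where "res = (\<lambda>g. scaled_sampler.result G s \<delta> (3 * X g) g)"
  \<comment> \<open>The limits are those of \<open>estimate_tail\<close> for \<open>j = 0\<close>
    and \<open>c = 1\<close>.\<close>
  define Good where "Good = {g. real m / 6 \<le> (X g)\<^sup>2 \<and> (X g)\<^sup>2 \<le> exp 5 * real m}"
  have finG: "finite Good"
  proof (rule finite_subset)
    show "Good \<subseteq> {..3 * n}"
    proof
      fix g assume "g \<in> Good"
      then have "1 / 9 \<le> (X g)\<^sup>2" using m1 by (auto simp: Good_def)
      then have "(1 / 3)\<^sup>2 \<le> (X g)\<^sup>2" by (simp add: power2_eq_square)
      then have "1 / 3 \<le> X g" by (rule power2_le_imp_le) (rule less_imp_le[OF X_pos])
      then have "2 ^ g \<le> real (3 * n)" by (simp add: X_def field_simps)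
      moreover have "real g \<le> 2 ^ g" by (simp add: less_imp_le)
      ultimately have "real g \<le> real (3 * n)" by linarith
      then show "g \<in> {..3 * n}" by simp
    qed
  qed simp
  have Cm [measurable]: "Measurable.pred ?M (C g)" for g
    unfolding C_def by (rule scaled_sampler.measurable_correct_run[OF scaled])
  have rm [measurable]: "res g \<in> measurable ?M (count_space UNIV)" for g
    unfolding res_def by (rule scaled_sampler.measurable_result[OF scaled])
  have st [measurable]: "Measurable.pred ?M (\<lambda>\<omega>. stops (snd \<omega>) g)" for g
    using measurable_compose[OF S0.measurable_snd_rand measurable_stops] .
  have Cst: "C g \<omega> \<Longrightarrow> stops (snd \<omega>) g" for g \<omega>
    unfolding C_def scaled_sampler.correct_run_def[OF scaled] by blast
  define A where "A = {\<omega> \<in> space ?M. regular \<omega> \<and> (\<exists>g\<in>Good. C g \<omega>)}"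
  have Am: "A \<in> sets ?M" unfolding A_def using finG by measurable
  have sum: "measure ?M {\<omega> \<in> A. P \<omega>} = (\<Sum>g\<in>Good. measure ?M {\<omega> \<in> space ?M. C g \<omega> \<and> P' g \<omega>})"
    if P': "\<And>g. Measurable.pred ?M (P' g)" and eq: "\<And>g \<omega>. regular \<omega> \<Longrightarrow> C g \<omega> \<Longrightarrow> P \<omega> = P' g \<omega>" for P P'
  proof -
    have m': "{\<omega> \<in> space ?M. C g \<omega> \<and> P' g \<omega>} \<in> sets ?M" for g using P'[of g] by measurable
    have Aeq: "{\<omega> \<in> A. P \<omega>} = {\<omega> \<in> space ?M. regular \<omega> \<and> (\<exists>g\<in>Good. C g \<omega> \<and> P' g \<omega>)}"
      unfolding A_def using eq by blast
    have "measure ?M {\<omega> \<in> A. P \<omega>} = measure ?M (\<Union>g\<in>Good. {\<omega> \<in> space ?M. C g \<omega> \<and> P' g \<omega>})"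
    proof (rule measure_eq_AE)
      show "AE \<omega> in ?M. (\<omega> \<in> {\<omega> \<in> A. P \<omega>}) = (\<omega> \<in> (\<Union>g\<in>Good. {\<omega> \<in> space ?M. C g \<omega> \<and> P' g \<omega>}))"
        using S0.AE_regular unfolding Aeq by eventually_elim auto
      show "{\<omega> \<in> A. P \<omega>} \<in> sets ?M" unfolding Aeq using finG P' by measurable
      show "(\<Union>g\<in>Good. {\<omega> \<in> space ?M. C g \<omega> \<and> P' g \<omega>}) \<in> sets ?M" by (intro sets.finite_UN finG m')
    qed
    also have "\<dots> = (\<Sum>g\<in>Good. measure ?M {\<omega> \<in> space ?M. C g \<omega> \<and> P' g \<omega>})"
    proof (rule P.finite_measure_finite_Union[OF finG])
      show "disjoint_family_on (\<lambda>g. {\<omega> \<in> space ?M. C g \<omega> \<and> P' g \<omega>}) Good"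
        unfolding disjoint_family_on_def using Cst stops_unique by blast
    qed (use m' in blast)
    finally show ?thesis .
  qed
  have PA: "measure ?M A = (\<Sum>g\<in>Good. measure ?M {\<omega> \<in> space ?M. C g \<omega>})"
    using sum[of "\<lambda>_ _. True" "\<lambda>_. True"] by simp
  have "1 - \<delta> \<le> measure ?M A"
  proof -
    let ?N = "{\<omega> \<in> space ?M. \<not> (\<exists>g. stops (snd \<omega>) g \<and> real m / (6 * 4 ^ 0) \<le> (X g)\<^sup>2 \<and> (X g)\<^sup>2 \<le> exp (4 + 1) * real m)}"
    have N: "measure ?M ?N \<le> \<delta> / 4"
    proof -
      have "measure ?M ?N = measure (unifs UNIV) {r. \<not> (\<exists>g. stops r g \<and> real m / (6 * 4 ^ 0) \<le> (X g)\<^sup>2 \<and> (X g)\<^sup>2 \<le> exp (4 + 1) * real m)}"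
        by (rule S0.measure_rand_tape) measurable
      also have "\<dots> \<le> exp (- 4 * real \<l> * 2 ^ 0) + real n * exp (- 20 * 1 * real \<l>)"
        by (rule estimate_tail) simp
      also have "\<dots> \<le> \<delta> / 4"
      proof -
        let ?E = "exp (- real \<l>)"
        have pw: "exp (- 4 * real \<l>) = ?E ^ 4" "exp (- 20 * real \<l>) = ?E ^ 20" by (simp_all add: exp_of_nat_mult[symmetric])
        have E0: "0 < ?E" by simp
        have ED: "?E \<le> \<delta> / real n" by (rule exp_\<l>)
        have nE: "real n * ?E \<le> \<delta>" using ED n2 by (simp add: pos_le_divide_eq mult.commute)
        have nD: "\<delta> / real n \<le> \<delta> / 2" using n2 \<delta>0 by (intro divide_left_mono) auto
        then have Ed: "?E \<le> \<delta> / 2" using ED by linarith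
        then have E2: "?E \<le> 1 / 2" using \<delta>1 by linarith
        have "?E ^ 4 = ?E * ?E ^ 3" by (simp add: power4_eq_xxxx power3_eq_cube)
        also have "\<dots> \<le> \<delta> / 2 * (1 / 2) ^ 3" using Ed E2 E0 \<delta>0 by (intro mult_mono power_mono) auto
        finally have 1: "?E ^ 4 \<le> \<delta> / 16" by (simp add: power3_eq_cube)
        have "real n * ?E ^ 20 = (real n * ?E) * ?E ^ 19" by (simp add: power_Suc[symmetric] mult.assoc del: power_Suc)
        also have "\<dots> \<le> \<delta> * (1 / 2) ^ 19" using nE E2 E0 \<delta>0 by (intro mult_mono power_mono) auto
        also have "\<dots> \<le> \<delta> * (1 / 16)" using \<delta>0 by (intro mult_left_mono) (auto simp: power_divide)
        finally have "real n * ?E ^ 20 \<le> \<delta> / 16" by simp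
        then show ?thesis using 1 unfolding pw[symmetric] using \<delta>0 by simp
      qed
      finally show ?thesis .
    qed
    let ?W = "\<lambda>g. {\<omega> \<in> space ?M. stops (snd \<omega>) g \<and> \<not> C g \<omega>}"
    have W: "measure ?M (?W g) \<le> measure (unifs UNIV) {r. stops r g} * (3 / 4 * \<delta>)" if "g \<in> Good" for g
      using scaled_sampler.incorrect_run[OF scaled[of g], of g] that by (simp add: Good_def C_def)
    have Nm: "?N \<in> sets ?M" by measurable
    have Wm: "?W g \<in> sets ?M" for g by measurable
    have sumS: "(\<Sum>g\<in>Good. measure (unifs UNIV) {r. stops r g}) \<le> 1"
    proof -
      have m: "{r. stops r g} \<in> sets (unifs UNIV)" for g using measurable_stops[of g] by (simp add: pred_def space_PiM)
      have "(\<Sum>g\<in>Good. measure (unifs UNIV) {r. stops r g}) = measure (unifs UNIV) (\<Union>g\<in>Good. {r. stops r g})"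
        using finG m stops_unique by (intro unifs.P.finite_measure_finite_Union[symmetric]) (auto simp: disjoint_family_on_def)
      also have "\<dots> \<le> 1" by (rule unifs.P.prob_le_1)
      finally show ?thesis .
    qed
    have "1 - measure ?M A = measure ?M (space ?M - A)" using P.prob_compl[OF Am] by simp
    also have "\<dots> \<le> measure ?M (?N \<union> (\<Union>g\<in>Good. ?W g))"
    proof (rule P.finite_measure_mono_AE)
      show "AE \<omega> in ?M. \<omega> \<in> space ?M - A \<longrightarrow> \<omega> \<in> ?N \<union> (\<Union>g\<in>Good. ?W g)"
        using S0.AE_regular
      proof eventually_elim
        case (elim \<omega>)
        show ?case using elim by (auto simp: A_def Good_def)
      qed
      show "?N \<union> (\<Union>g\<in>Good. ?W g) \<in> sets ?M" by (intro sets.Un Nm sets.finite_UN finG Wm)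
    qed
    also have "\<dots> \<le> measure ?M ?N + measure ?M (\<Union>g\<in>Good. ?W g)"
      by (intro measure_Un_le Nm sets.finite_UN finG Wm)
    also have "measure ?M (\<Union>g\<in>Good. ?W g) \<le> (\<Sum>g\<in>Good. measure ?M (?W g))"
      by (intro measure_UNION_le finG Wm)
    also have "\<dots> \<le> (\<Sum>g\<in>Good. measure (unifs UNIV) {r. stops r g} * (3 / 4 * \<delta>))" by (rule sum_mono) (rule W)
    also have "\<dots> = (\<Sum>g\<in>Good. measure (unifs UNIV) {r. stops r g}) * (3 / 4 * \<delta>)" by (rule sum_distrib_right[symmetric])
    also have "\<dots> \<le> 1 * (3 / 4 * \<delta>)" using sumS \<delta>0 by (intro mult_right_mono) auto
    also note N
    finally show ?thesis by simp
  qed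
  moreover have "\<P>(\<omega> in ?M. returns sampler G s \<delta> \<omega> xs \<bar> \<omega> \<in> A) = pmf ?D xs" for xs
  proof (cases "length xs = s")
    case True
    have ret: "returns sampler G s \<delta> \<omega> xs = (res g \<omega> = xs)" if "regular \<omega>" "C g \<omega>" for g \<omega>
      using scaled_sampler.returns_result[OF scaled refl that(1)] that(2) unfolding C_def res_def by blast
    have "measure ?M {\<omega> \<in> A. returns sampler G s \<delta> \<omega> xs} = (\<Sum>g\<in>Good. measure ?M {\<omega> \<in> space ?M. C g \<omega> \<and> res g \<omega> = xs})"
      using ret by (intro sum) measurable
    also have "\<dots> = (\<Sum>g\<in>Good. measure ?M {\<omega> \<in> space ?M. C g \<omega>} * pmf ?D xs)"
      unfolding C_def res_def by (intro sum.cong refl scaled_sampler.measure_correct_run_result[OF scaled True])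
    also have "\<dots> = measure ?M A * pmf ?D xs" unfolding PA by (rule sum_distrib_right[symmetric])
    finally have "measure ?M {\<omega> \<in> A. returns sampler G s \<delta> \<omega> xs} = measure ?M A * pmf ?D xs" .
    moreover have "{\<omega> \<in> space ?M. returns sampler G s \<delta> \<omega> xs \<and> \<omega> \<in> A} = {\<omega> \<in> A. returns sampler G s \<delta> \<omega> xs}"
      "{\<omega> \<in> space ?M. \<omega> \<in> A} = A" by (auto simp: A_def)
    \<comment> \<open>Conditioning on a null event would yield 0 by division;
      \<open>\<delta> < 1\<close> excludes this.\<close>
    moreover have "0 < measure ?M A" using \<open>1 - \<delta> \<le> measure ?M A\<close> \<delta>1 by linarith
    ultimately show ?thesis by (simp add: cond_prob_def)
  next
    case False
    then have "xs \<notin> set_pmf ?D" by (simp add: set_replicate_pmf)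
    then have "pmf ?D xs = 0" by (simp add: set_pmf_iff)
    moreover have "\<not> returns sampler G s \<delta> \<omega> xs" for \<omega> using False by (simp add: returns_def)
    ultimately show ?thesis by (simp add: cond_prob_def)
  qed
  ultimately show ?thesis unfolding samples_with_prob_def using Am by blast
qed

end

subsection \<open>Running time\<close>

context edge_sampler
begin

abbreviation \<Lambda> :: real where "\<Lambda> \<equiv> ln (real n)"
abbreviation L :: real where "L \<equiv> ln (real n / \<delta>)"
abbreviation \<tau> :: real where "\<tau> \<equiv> time_bound n m s \<delta>"

lemma \<Lambda>_ge: "1 / 2 \<le> \<Lambda>" "1 / 2 \<le> L" "\<Lambda> \<le> L"
proof -
  have "ln (exp (1 / 2)) \<le> ln (real n)" using exp_half_le n2 by (subst ln_le_cancel_iff) auto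
  then show "1 / 2 \<le> \<Lambda>" by simp
  then show "1 / 2 \<le> L" using ln_n_le by linarith
  show "\<Lambda> \<le> L" by (rule ln_n_le)
qed

lemma \<l>_le: "real \<l> \<le> 3 * L" and \<nu>_le: "real \<nu> \<le> 3 * \<Lambda>"
  using \<l>_real \<nu>_real \<Lambda>_ge by linarith+

text \<open>As \<open>n\<close> is at least 2, both logarithms are at least 1 / 2, so omitting one
  costs only a constant factor.\<close>

lemma \<tau>_bounds:
  "1 \<le> 8 * \<tau>" "\<Lambda> \<le> 4 * \<tau>" "real s * \<Lambda> \<le> 4 * \<tau>" "real s * \<Lambda> * \<Lambda> \<le> 2 * \<tau>" "real s * \<Lambda> * \<Lambda> * L \<le> \<tau>"
  "real n / sqrt (real m) * L \<le> 2 * \<tau>" "sqrt (real s) * (real n / sqrt (real m)) * \<Lambda> \<le> 2 * \<tau>"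
  "sqrt (real s) * (real n / sqrt (real m)) * L \<le> 2 * \<tau>"
  "sqrt (real s) * (real n / sqrt (real m)) * \<Lambda> * L \<le> \<tau>" "0 < \<tau>"
proof -
  define x where "x = sqrt (real s) * (real n / sqrt (real m))"
  have x0: "0 \<le> x" by (simp add: x_def)
  have s1': "1 \<le> real s" using s1 by simp
  have ll: "1 / 4 \<le> \<Lambda> * L" using mult_mono[OF \<Lambda>_ge(1,2)] \<Lambda>_ge by simp
  have p1: "0 \<le> x * \<Lambda> * L" using x0 \<Lambda>_ge by simp
  have p2: "0 \<le> real s * \<Lambda> * \<Lambda> * L" using \<Lambda>_ge by simp
  have \<tau>: "\<tau> = x * \<Lambda> * L + real s * \<Lambda> * \<Lambda> * L" by (simp add: time_bound_def power2_eq_square x_def)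
  show a: "real s * \<Lambda> * \<Lambda> * L \<le> \<tau>" using \<tau> p1 by linarith
  have b: "x * \<Lambda> * L \<le> \<tau>" using \<tau> p2 by linarith
  then show "sqrt (real s) * (real n / sqrt (real m)) * \<Lambda> * L \<le> \<tau>" unfolding x_def .
  have "real s * \<Lambda> * (1 / 4) \<le> real s * \<Lambda> * (\<Lambda> * L)" using ll \<Lambda>_ge by (intro mult_left_mono) auto
  then show sl: "real s * \<Lambda> \<le> 4 * \<tau>" using a by (simp add: mult.assoc)
  have "1 * \<Lambda> \<le> real s * \<Lambda>" using s1' \<Lambda>_ge by (intro mult_right_mono) auto
  then show l: "\<Lambda> \<le> 4 * \<tau>" using sl by linarith
  then show "1 \<le> 8 * \<tau>" "0 < \<tau>" using \<Lambda>_ge by linarith+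
  have "real s * \<Lambda> * \<Lambda> * (1 / 2) \<le> real s * \<Lambda> * \<Lambda> * L" using \<Lambda>_ge by (intro mult_left_mono) auto
  then show "real s * \<Lambda> * \<Lambda> \<le> 2 * \<tau>" using a by simp
  have "x * \<Lambda> * (1 / 2) \<le> x * \<Lambda> * L" using \<Lambda>_ge x0 by (intro mult_left_mono) auto
  then have "x * \<Lambda> \<le> 2 * \<tau>" using b by simp
  then show "sqrt (real s) * (real n / sqrt (real m)) * \<Lambda> \<le> 2 * \<tau>" unfolding x_def .
  have "x * L * (1 / 2) \<le> x * L * \<Lambda>" using \<Lambda>_ge x0 by (intro mult_left_mono) auto
  then have c: "x * L \<le> 2 * \<tau>" using b by (simp add: mult_ac)
  then show "sqrt (real s) * (real n / sqrt (real m)) * L \<le> 2 * \<tau>" unfolding x_def .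
  have "1 * (real n / sqrt (real m)) \<le> x" unfolding x_def using s1' by (intro mult_right_mono) auto
  then have "real n / sqrt (real m) * L \<le> x * L" using \<Lambda>_ge by (intro mult_right_mono) auto
  then show "real n / sqrt (real m) * L \<le> 2 * \<tau>" using c by linarith
qed

end

text \<open>The four groups in the bracket bound \<open>T k\<close>, \<open>k * J1\<close>, the
  enumeration cost and the activation cost by multiples of the time bound \<tau>. The leading 16240
  = 8 * 2030 covers additive constants, using 1 <= 8 \<tau>.\<close>

definition phase_const :: "real \<Rightarrow> real \<Rightarrow> nat \<Rightarrow> real" where
  "phase_const \<alpha> c K = 16240 + 2000 * (104 * real K * \<alpha> + 2000000 * real K * \<alpha>
     + (2 * ((real K)\<^sup>2 * (76800000 * \<alpha>\<^sup>2 * (2 * ln (1 + 2 * \<alpha>) + 2) + 6400000 * c)) + 52 * c * real K * \<alpha>)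
     + (6400000 * real K * \<alpha>\<^sup>2 + 4 * c))"

definition time_const :: "real \<Rightarrow> real \<Rightarrow> nat \<Rightarrow> real" where
  "time_const \<alpha> c K = 576000 * \<alpha> + real K * phase_const \<alpha> c K + 3200"

context scaled_sampler
begin

text \<open>
  Both thresholds bound twice an expected cost plus \<open>c * \<Lambda>\<close> times the largest single contribution, the
  level at which the Chernoff bound gives a failure probability of \<open>exp (- (c * \<Lambda>))\<close>.
\<close>

definition weight_threshold :: "real \<Rightarrow> nat \<Rightarrow> real" where
  "weight_threshold c k = 2 * (4 * real (k * J1) * real (k * R) * real m / (th * real n) * ln (1 + 2 * real n / th))
      + (c * \<Lambda>) * (8 * (real k)\<^sup>2 * real J1 * (y * y) / (real n * th))"

definition act_threshold :: "real \<Rightarrow> nat \<Rightarrow> real" where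
  "act_threshold c k = 4 * real (k * J1) * real m / (real n * th) + c * \<Lambda>"

text \<open>Phase \<open>K\<close> is to suffice, so coverage and successes are demanded there only;
  costs are controlled in all phases up to \<open>K\<close>, since the earlier ones may be executed
  too.\<close>

definition fast_run :: "real \<Rightarrow> nat \<Rightarrow> nat \<Rightarrow> (nat \<Rightarrow> real) \<times> (nat \<Rightarrow> real) \<Rightarrow> bool" where
  "fast_run c K b \<omega> \<longleftrightarrow> covers (snd \<omega>) b K \<and> s \<le> length (somes (slot_list b (K * J1) \<omega>)) \<and>
     (\<forall>k\<in>{0<..K}. search_weight (snd \<omega>) b k < weight_threshold c k \<and>
        real (enumeration_cost (fst \<omega>) (snd \<omega>) b k) < 2 * search_weight (snd \<omega>) b k + c * \<Lambda> * real (T k) \<and>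
        real (activation_cost (fst \<omega>) k) < act_threshold c k)"

section \<open>Time bound of a favourable run\<close>

context
  fixes \<alpha> :: real
  assumes \<alpha>: "1 \<le> \<alpha>" "sqrt (real m) \<le> \<alpha> * y"
begin

lemma m_pos: "0 < sqrt (real m)"
  using m1 by simp

lemma inverse_y: "x / y \<le> \<alpha> * (x / sqrt (real m))" if "0 \<le> x"
proof -
  have "x * sqrt (real m) \<le> x * (\<alpha> * y)" using \<alpha> that by (intro mult_left_mono)
  then show ?thesis using y0 m_pos by (simp add: field_simps)
qed

lemma m_le: "real m \<le> \<alpha>\<^sup>2 * (y * y)"
proof -
  have "sqrt (real m) * sqrt (real m) \<le> (\<alpha> * y) * (\<alpha> * y)" using \<alpha> m_pos y0 by (intro mult_mono) auto
  then show ?thesis by (simp add: power2_eq_square mult_ac)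
qed

lemma J1_le: "real J1 \<le> 2000000 * \<alpha> * \<tau>"
proof -
  let ?x = "sqrt (real s) * (real n / sqrt (real m))"
  have ss: "0 < sqrt (real s)" using s1 by simp
  have yy: "0 < y * y" using y0 by simp
  have "real J1 \<le> 100000 * real s * real \<nu> * real n * th / (y * y) + 1" using J1_real by linarith
  \<comment> \<open>The two terms of \<open>th\<close> turn into sqrt s * n / y and s, the two
    summands of the time bound up to logarithms.\<close>
  also have "100000 * real s * real \<nu> * real n * th / (y * y) = 100000 * real \<nu> * (sqrt (real s) * (real n / y) + real s)"
  proof -
    have "real n * th = real n * y / sqrt (real s) + y * y" unfolding th_def using n2 by (simp add: field_simps)
    then have "real s * (real n * th) / (y * y) = sqrt (real s) * sqrt (real s) * (real n * y / sqrt (real s) + y * y) / (y * y)" by simp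
    also have "\<dots> = sqrt (real s) * (real n / y) + real s" using ss y0 by (simp add: field_simps)
    finally have eq: "real s * (real n * th) / (y * y) = sqrt (real s) * (real n / y) + real s" .
    have "100000 * real s * real \<nu> * real n * th / (y * y) = 100000 * real \<nu> * (real s * (real n * th) / (y * y))" by simp
    then show ?thesis unfolding eq .
  qed
  also have "\<dots> \<le> 100000 * (3 * \<Lambda>) * (\<alpha> * ?x + real s)"
  proof (rule mult_mono)
    have "sqrt (real s) * (real n / y) \<le> \<alpha> * ?x"
      using mult_left_mono[OF inverse_y[of "real n"], of "sqrt (real s)"] by (simp add: mult_ac)
    then show "sqrt (real s) * (real n / y) + real s \<le> \<alpha> * ?x + real s" by simp
    show "0 \<le> sqrt (real s) * (real n / y) + real s" using y0 by simp
  qed (use \<nu>_le \<Lambda>_ge in auto)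
  also have "\<dots> = 300000 * (\<alpha> * (?x * \<Lambda>) + real s * \<Lambda>)" by (simp add: algebra_simps)
  also have "\<dots> \<le> 300000 * (\<alpha> * (2 * \<tau>) + 4 * \<tau>)"
    using \<tau>_bounds(3,7) \<alpha> by (intro mult_left_mono add_mono) auto
  finally have 1: "real J1 \<le> 300000 * (\<alpha> * (2 * \<tau>) + 4 * \<tau>) + 1" by simp
  have "1 * \<tau> \<le> \<alpha> * \<tau>" using \<alpha> \<tau>_bounds(10) by (intro mult_right_mono) auto
  then have "real J1 \<le> 2000000 * (\<alpha> * \<tau>)" using 1 \<tau>_bounds(1) by argo
  then show ?thesis by (simp only: mult.assoc)
qed

lemma T_le_aux: "real (T k) \<le> 48 * real k * \<alpha> * (sqrt (real s) * (real n / sqrt (real m)) * L) + 1"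
proof -
  let ?x = "sqrt (real s) * (real n / sqrt (real m))"
  have ss: "0 < sqrt (real s)" using s1 by simp
  have "y / sqrt (real s) \<le> th" unfolding th_def using n2 by simp
  then have inv: "1 / th \<le> sqrt (real s) / y"
    using y0 ss th0 by (simp add: field_simps)
  have "real (T k) \<le> 2 * real n * real (k * R) / th + 1" using T_real[of k] by linarith
  also have "2 * real n * real (k * R) / th = 2 * real n * real k * real R * (1 / th)" by simp
  also have "\<dots> \<le> 2 * real n * real k * (24 * L) * (sqrt (real s) / y)"
    using inv \<l>_le th0 \<Lambda>_ge by (intro mult_mono) (auto simp: R_def)
  also have "\<dots> = 48 * real k * L * sqrt (real s) * (real n / y)" by simp
  also have "\<dots> \<le> 48 * real k * L * sqrt (real s) * (\<alpha> * (real n / sqrt (real m)))"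
    using inverse_y[of "real n"] \<Lambda>_ge by (intro mult_left_mono) auto
  finally show ?thesis by (simp add: mult_ac)
qed

lemma T_le: assumes k: "1 \<le> k" shows "real (T k) \<le> 104 * real k * \<alpha> * \<tau>" "\<Lambda> * real (T k) \<le> 52 * real k * \<alpha> * \<tau>"
proof -
  define x where "x = sqrt (real s) * (real n / sqrt (real m))"
  note aux = T_le_aux[of k, folded x_def]
  have ka: "1 \<le> real k * \<alpha>" using k \<alpha> mult_mono[of 1 "real k" 1 \<alpha>] by simp
  then have kt: "1 * \<tau> \<le> real k * \<alpha> * \<tau>" using \<tau>_bounds(10) by (intro mult_right_mono) auto
  have "48 * real k * \<alpha> * (x * L) \<le> 48 * real k * \<alpha> * (2 * \<tau>)"
    using \<tau>_bounds(8)[folded x_def] \<alpha> by (intro mult_left_mono) auto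
  then show "real (T k) \<le> 104 * real k * \<alpha> * \<tau>" using aux \<tau>_bounds(1) kt by linarith
  have "\<Lambda> * real (T k) \<le> \<Lambda> * (48 * real k * \<alpha> * (x * L) + 1)" using aux \<Lambda>_ge by (intro mult_left_mono) auto
  also have "\<dots> = 48 * real k * \<alpha> * (x * \<Lambda> * L) + \<Lambda>" by (simp add: algebra_simps)
  also have "\<dots> \<le> 48 * real k * \<alpha> * \<tau> + 4 * \<tau>"
    using \<tau>_bounds(2) \<tau>_bounds(9)[folded x_def] \<alpha> by (intro add_mono mult_left_mono) auto
  finally show "\<Lambda> * real (T k) \<le> 52 * real k * \<alpha> * \<tau>" using kt by linarith
qed

lemma J1_ratio: "real J1 * (y * y) / (real n * th) \<le> 400000 * (real s * \<Lambda>)"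
  "real J1 * real m / (real n * th) \<le> 400000 * \<alpha>\<^sup>2 * (real s * \<Lambda>)"
proof -
  have yy: "0 < y * y" using y0 by simp
  have nth: "0 < real n * th" using n_th_ge yy by linarith
  have s1': "1 \<le> real s * real \<nu>" using s1 \<nu>_ge(1) mult_mono[of 1 "real s" 1 "real \<nu>"] by simp
  have "real J1 * (y * y) \<le> (100000 * real s * real \<nu> * real n * th / (y * y) + 1) * (y * y)"
    using J1_real yy by (intro mult_right_mono) linarith+
  also have "\<dots> = 100000 * (real s * real \<nu>) * (real n * th) + y * y" using y0 by (simp add: distrib_right mult.assoc)
  also have "\<dots> \<le> 100000 * (real s * real \<nu>) * (real n * th) + 1 * (real n * th)" using n_th_ge by simp
  also have "\<dots> \<le> 100000 * (real s * real \<nu>) * (real n * th) + (real s * real \<nu>) * (real n * th)"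
    using s1' nth by (intro add_mono mult_right_mono) auto
  finally have "real J1 * (y * y) \<le> 100001 * (real s * real \<nu>) * (real n * th)" by (simp add: algebra_simps)
  then have "real J1 * (y * y) / (real n * th) \<le> 100001 * (real s * real \<nu>)" using nth by (simp add: pos_divide_le_eq)
  also have "\<dots> \<le> 100001 * (real s * (3 * \<Lambda>))" using \<nu>_le by (intro mult_left_mono) auto
  also have "\<dots> \<le> 400000 * (real s * \<Lambda>)" using \<Lambda>_ge by simp
  finally show 1: "real J1 * (y * y) / (real n * th) \<le> 400000 * (real s * \<Lambda>)" .
  have "real J1 * real m / (real n * th) \<le> real J1 * (\<alpha>\<^sup>2 * (y * y)) / (real n * th)"
    using m_le nth by (intro divide_right_mono mult_left_mono) auto
  also have "\<dots> = \<alpha>\<^sup>2 * (real J1 * (y * y) / (real n * th))" by simp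
  also have "\<dots> \<le> \<alpha>\<^sup>2 * (400000 * (real s * \<Lambda>))" using 1 by (intro mult_left_mono) auto
  finally show "real J1 * real m / (real n * th) \<le> 400000 * \<alpha>\<^sup>2 * (real s * \<Lambda>)" by (simp add: mult_ac)
qed

text \<open>From \<open>th \<ge> y / sqrt s\<close> and \<open>s \<le> n\<close>, the quotient n /
  th is at most \<alpha> n^2, so its logarithm is of order ln n.\<close>

lemma ln_th_le: "ln (1 + 2 * real n / th) \<le> (2 * ln (1 + 2 * \<alpha>) + 2) * \<Lambda>"
proof -
  have ss: "0 < sqrt (real s)" using s1 by simp
  have n1: "1 \<le> real n" using n2 by simp
  have "sqrt (real s) \<le> real n" using sn s1 by (intro real_le_lsqrt) (auto simp: power2_eq_square intro: order_trans[OF _ mult_mono[of 1 "real n" "real s" "real n"]])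
  then have "sqrt (real s) / y \<le> real n / y" using y0 by (intro divide_right_mono) auto
  also have "\<dots> \<le> \<alpha> * (real n / sqrt (real m))" by (rule inverse_y) simp
  also have "\<dots> \<le> \<alpha> * (real n / 1)" using m1 \<alpha> by (intro mult_left_mono divide_left_mono) auto
  finally have a: "sqrt (real s) / y \<le> \<alpha> * real n" by simp
  have "y / sqrt (real s) \<le> th" unfolding th_def using n2 by simp
  then have "1 / th \<le> sqrt (real s) / y" using y0 ss th0 by (simp add: field_simps)
  then have "1 / th \<le> \<alpha> * real n" using a by linarith
  then have "2 * real n * (1 / th) \<le> 2 * real n * (\<alpha> * real n)" by (intro mult_left_mono) auto
  then have "1 + 2 * real n / th \<le> 1 * 1 + 2 * \<alpha> * (real n * real n)" by (simp add: mult_ac)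
  also have "\<dots> \<le> (real n * real n) * 1 + 2 * \<alpha> * (real n * real n)" using mult_mono[of 1 "real n" 1 "real n"] n1 by simp
  also have "\<dots> = (1 + 2 * \<alpha>) * (real n * real n)" by (simp add: algebra_simps)
  finally have "ln (1 + 2 * real n / th) \<le> ln ((1 + 2 * \<alpha>) * (real n * real n))"
    using th0 \<alpha> n1 by (subst ln_le_cancel_iff) (auto simp: add_pos_nonneg)
  also have "\<dots> = ln (1 + 2 * \<alpha>) + 2 * \<Lambda>" using \<alpha> n1 by (simp add: ln_mult)
  also have "\<dots> \<le> 2 * ln (1 + 2 * \<alpha>) * \<Lambda> + 2 * \<Lambda>"
  proof -
    have "0 \<le> ln (1 + 2 * \<alpha>)" using \<alpha> by simp
    then have "2 * ln (1 + 2 * \<alpha>) * (1 / 2) \<le> 2 * ln (1 + 2 * \<alpha>) * \<Lambda>" using \<Lambda>_ge by (intro mult_left_mono) auto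
    then show ?thesis by simp
  qed
  finally show ?thesis by (simp add: algebra_simps)
qed

text \<open>The main term multiplies \<open>s\<close> by a logarithm from \<open>J1\<close>, a
  factor of order \<open>L\<close> from \<open>R\<close> and a logarithm from the harmonic sum:
  exactly the second summand of \<open>time_bound\<close>.\<close>

lemma weight_threshold_le:
  assumes c: "0 \<le> c"
  shows "weight_threshold c k \<le> (real k)\<^sup>2 * (76800000 * \<alpha>\<^sup>2 * (2 * ln (1 + 2 * \<alpha>) + 2) + 6400000 * c) * \<tau>"
proof -
  let ?\<eta> = "2 * ln (1 + 2 * \<alpha>) + 2"
  have \<eta>: "0 \<le> ?\<eta>" using \<alpha> by simp
  have nt: "0 < real n * th" using th0 n2 by simp
  have l0: "0 \<le> ln (1 + 2 * real n / th)" using th0 by simp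
  have "2 * (4 * real (k * J1) * real (k * R) * real m / (th * real n) * ln (1 + 2 * real n / th))
      = 8 * (real k)\<^sup>2 * real R * (real J1 * real m / (real n * th)) * ln (1 + 2 * real n / th)"
    by (simp add: power2_eq_square mult_ac)
  also have "\<dots> \<le> 8 * (real k)\<^sup>2 * (24 * L) * (400000 * \<alpha>\<^sup>2 * (real s * \<Lambda>)) * (?\<eta> * \<Lambda>)"
    using \<l>_le J1_ratio(2) ln_th_le l0 \<Lambda>_ge nt by (intro mult_mono mult_nonneg_nonneg) (auto simp: R_def)
  also have "\<dots> = (real k)\<^sup>2 * (76800000 * \<alpha>\<^sup>2 * ?\<eta>) * (real s * \<Lambda> * \<Lambda> * L)" by (simp add: mult_ac)
  also have "\<dots> \<le> (real k)\<^sup>2 * (76800000 * \<alpha>\<^sup>2 * ?\<eta>) * \<tau>"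
    using \<tau>_bounds(5) \<eta> by (intro mult_left_mono) auto
  finally have 1: "2 * (4 * real (k * J1) * real (k * R) * real m / (th * real n) * ln (1 + 2 * real n / th))
      \<le> (real k)\<^sup>2 * (76800000 * \<alpha>\<^sup>2 * ?\<eta>) * \<tau>" .
  have "(c * \<Lambda>) * (8 * (real k)\<^sup>2 * real J1 * (y * y) / (real n * th)) = 8 * c * (real k)\<^sup>2 * \<Lambda> * (real J1 * (y * y) / (real n * th))"
    by simp
  also have "\<dots> \<le> 8 * c * (real k)\<^sup>2 * \<Lambda> * (400000 * (real s * \<Lambda>))"
    using J1_ratio(1) c \<Lambda>_ge by (intro mult_left_mono) auto
  also have "\<dots> = 3200000 * c * (real k)\<^sup>2 * (real s * \<Lambda> * \<Lambda>)" by (simp add: mult_ac)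
  also have "\<dots> \<le> 3200000 * c * (real k)\<^sup>2 * (2 * \<tau>)"
    using \<tau>_bounds(4) c by (intro mult_left_mono) auto
  finally have "(c * \<Lambda>) * (8 * (real k)\<^sup>2 * real J1 * (y * y) / (real n * th)) \<le> 6400000 * c * (real k)\<^sup>2 * \<tau>" by simp
  then show ?thesis unfolding weight_threshold_def using 1 by (simp add: algebra_simps)
qed

lemma act_threshold_le:
  assumes c: "0 \<le> c"
  shows "act_threshold c k \<le> (6400000 * real k * \<alpha>\<^sup>2 + 4 * c) * \<tau>"
proof -
  have "4 * real (k * J1) * real m / (real n * th) = 4 * real k * (real J1 * real m / (real n * th))" by simp
  also have "\<dots> \<le> 4 * real k * (400000 * \<alpha>\<^sup>2 * (real s * \<Lambda>))" using J1_ratio(2) by (intro mult_left_mono) auto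
  also have "\<dots> = 1600000 * real k * \<alpha>\<^sup>2 * (real s * \<Lambda>)" by simp
  also have "\<dots> \<le> 1600000 * real k * \<alpha>\<^sup>2 * (4 * \<tau>)" using \<tau>_bounds(3) by (intro mult_left_mono) auto
  finally have "4 * real (k * J1) * real m / (real n * th) \<le> 6400000 * real k * \<alpha>\<^sup>2 * \<tau>" by simp
  moreover have "c * \<Lambda> \<le> c * (4 * \<tau>)" using \<tau>_bounds(2) c by (intro mult_left_mono) auto
  ultimately show ?thesis unfolding act_threshold_def by (simp add: algebra_simps)
qed

lemma pos_le:
  assumes y: "y = 3 * X g"
  shows "real (pos (Suc g)) \<le> 1440 * \<alpha> * \<tau>"
proof -
  \<comment> \<open>The lengths of the rounds double, so the last round dominates their sum.\<close>
  have "real (pos g') \<le> 40 * real \<l> * 2 ^ g'" for g'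
    unfolding pos_def trials_def by (induction g') auto
  from this[of "Suc g"] have "real (pos (Suc g)) \<le> 80 * real \<l> * 2 ^ g" by simp
  also have "(2 :: real) ^ g = 3 * (real n / y)" unfolding y X_def using n2 by simp
  also have "80 * real \<l> * (3 * (real n / y)) \<le> 80 * (3 * L) * (3 * (\<alpha> * (real n / sqrt (real m))))"
    using \<l>_le inverse_y[of "real n"] y0 by (intro mult_mono) auto
  also have "\<dots> = 720 * \<alpha> * (real n / sqrt (real m) * L)" by simp
  also have "\<dots> \<le> 720 * \<alpha> * (2 * \<tau>)" using \<tau>_bounds(6) \<alpha> by (intro mult_left_mono) auto
  finally show ?thesis by simp
qed

lemma runs_in_time_fast_run:
  assumes y: "y = 3 * X g" and reg: "regular \<omega>" and st: "stops (snd \<omega>) g" and K: "1 \<le> K" and c: "0 \<le> c"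
    and fast: "fast_run c K (pos (Suc g)) \<omega>"
  shows "runs_in_time sampler G s \<delta> \<omega> (time_const \<alpha> c K * \<tau>)"
proof -
  interpret run: sampler_run G s \<delta> y "fst \<omega>" "snd \<omega>" "pos (Suc g)"
    using reg by unfold_locales (auto simp: regular_def)
  have L: "run.successes (active (fst \<omega>)) (K * J1) = somes (slot_list (pos (Suc g)) (K * J1) \<omega>)"
    by (simp add: run.successes_def slot_list_def somes_def List.map_filter_def run.a_def comp_def filter_map)
  obtain t \<sigma> k where ex: "exec G (fst \<omega>) (snd \<omega>) (sampler, input_store n s \<delta>, 0) t (\<sigma>, k)"
    and t: "t \<le> 400 * pos (Suc g) + (\<Sum>k\<in>{0<..K}. run.phase_cost k + 30) + 400"
    using run.exec_sampler[OF st y refl] fast K L unfolding fast_run_def by metis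
  have ph: "real (run.phase_cost k + 30) \<le> phase_const \<alpha> c K * \<tau>" if k: "k \<in> {0<..K}" for k
  proof -
    have k1: "1 \<le> k" and kK: "real k \<le> real K" using k by auto
    let ?W = "76800000 * \<alpha>\<^sup>2 * (2 * ln (1 + 2 * \<alpha>) + 2) + 6400000 * c"
    have W0: "0 \<le> ?W" using \<alpha> c by simp
    have f: "search_weight (snd \<omega>) (pos (Suc g)) k < weight_threshold c k"
      "real (run.enum_cost k) < 2 * search_weight (snd \<omega>) (pos (Suc g)) k + c * \<Lambda> * real (T k)"
      "real (run.act_cost k) < act_threshold c k"
      using fast k unfolding fast_run_def by auto
    have 1: "real (T k) \<le> 104 * real K * \<alpha> * \<tau>"
    proof -
      have "104 * real k * \<alpha> * \<tau> \<le> 104 * real K * \<alpha> * \<tau>" using kK \<alpha> \<tau>_bounds(10) by (intro mult_right_mono mult_left_mono) auto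
      then show ?thesis using T_le(1)[OF k1] by linarith
    qed
    have 2: "real (k * J1) \<le> 2000000 * real K * \<alpha> * \<tau>"
    proof -
      have "real k * real J1 \<le> real K * (2000000 * \<alpha> * \<tau>)" using kK J1_le by (intro mult_mono) auto
      then show ?thesis by (simp add: mult_ac)
    qed
    have 3: "weight_threshold c k \<le> (real K)\<^sup>2 * ?W * \<tau>"
    proof -
      have "(real k)\<^sup>2 * ?W * \<tau> \<le> (real K)\<^sup>2 * ?W * \<tau>"
        using kK W0 \<tau>_bounds(10) by (intro mult_right_mono power_mono) auto
      then show ?thesis using weight_threshold_le[OF c, of k] by linarith
    qed
    have 4: "c * \<Lambda> * real (T k) \<le> 52 * c * real K * \<alpha> * \<tau>"
    proof -
      have "c * (\<Lambda> * real (T k)) \<le> c * (52 * real k * \<alpha> * \<tau>)" using T_le(2)[OF k1] c by (intro mult_left_mono)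
      also have "\<dots> \<le> c * (52 * real K * \<alpha> * \<tau>)" using kK \<alpha> \<tau>_bounds(10) c by (intro mult_left_mono mult_right_mono) auto
      finally show ?thesis by (simp add: mult_ac)
    qed
    have 5: "act_threshold c k \<le> (6400000 * real K * \<alpha>\<^sup>2 + 4 * c) * \<tau>"
    proof -
      have "(6400000 * real k * \<alpha>\<^sup>2 + 4 * c) * \<tau> \<le> (6400000 * real K * \<alpha>\<^sup>2 + 4 * c) * \<tau>"
        using kK \<tau>_bounds(10) by (intro mult_right_mono add_mono mult_left_mono) auto
      then show ?thesis using act_threshold_le[OF c, of k] by linarith
    qed
    have "real (run.phase_cost k + 30) = 2030 + 2000 * (real (T k) + real (k * J1) + real (run.enum_cost k) + real (run.act_cost k))"
      by (simp add: run.phase_cost_def)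
    also have "\<dots> \<le> 2030 * (8 * \<tau>) + 2000 * (104 * real K * \<alpha> * \<tau> + 2000000 * real K * \<alpha> * \<tau>
        + (2 * ((real K)\<^sup>2 * ?W * \<tau>) + 52 * c * real K * \<alpha> * \<tau>) + (6400000 * real K * \<alpha>\<^sup>2 + 4 * c) * \<tau>)"
    proof -
      have "2030 + 2000 * (a1 + a2 + a3 + a4) \<le> 2030 * (8 * z) + 2000 * (b1 + b2 + (2 * b3 + b4) + b5)"
        if "a1 \<le> b1" "a2 \<le> b2" "w \<le> w'" "w' \<le> b3" "a3 \<le> 2 * w + x" "x \<le> b4" "a4 \<le> x'" "x' \<le> b5" "1 \<le> 8 * z"
        for a1 a2 a3 a4 b1 b2 b3 b4 b5 w w' x x' z :: real
      proof -
        have "a1 + a2 + a3 + a4 \<le> b1 + b2 + (2 * b3 + b4) + b5" using that(1-8) by linarith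
        then show ?thesis using that(9) by argo
      qed
      from this[OF 1 2 less_imp_le[OF f(1)] 3 less_imp_le[OF f(2)] 4 less_imp_le[OF f(3)] 5 \<tau>_bounds(1)]
      show ?thesis .
    qed
    also have "\<dots> = phase_const \<alpha> c K * \<tau>" unfolding phase_const_def by (simp add: algebra_simps)
    finally show ?thesis .
  qed
  have "real t \<le> real (400 * pos (Suc g) + (\<Sum>k\<in>{0<..K}. run.phase_cost k + 30) + 400)" using t by (rule of_nat_mono)
  also have "\<dots> = 400 * real (pos (Suc g)) + (\<Sum>k\<in>{0<..K}. real (run.phase_cost k + 30)) + 400" by simp
  also have "\<dots> \<le> 400 * (1440 * \<alpha> * \<tau>) + (\<Sum>k\<in>{0<..K}. phase_const \<alpha> c K * \<tau>) + 400 * (8 * \<tau>)"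
    using pos_le[OF y] ph \<tau>_bounds(1) by (intro add_mono sum_mono) auto
  also have "\<dots> = time_const \<alpha> c K * \<tau>" unfolding time_const_def by (simp add: algebra_simps)
  finally show ?thesis unfolding runs_in_time_def using ex by blast
qed

end

end

section \<open>Probability of a favourable run\<close>

context scaled_sampler
begin

lemma measure_rand_le:
  assumes P: "Measurable.pred (rand_space G) P" and e: "0 \<le> e"
    and le: "\<And>r. measure (unifs V) {h \<in> space (unifs V). P (h, r)} \<le> e"
  shows "measure (rand_space G) {\<omega> \<in> space (rand_space G). P \<omega>} \<le> e"
proof -
  interpret P: prob_space "rand_space G" by (rule prob_space_rand)
  let ?A = "{\<omega> \<in> space (rand_space G). P \<omega>}"
  have A: "?A \<in> sets (rand_space G)" using P by (simp add: pred_def)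
  then have "emeasure (rand_space G) ?A = (\<integral>\<^sup>+r. emeasure (unifs V) ((\<lambda>h. (h, r)) -` ?A) \<partial>unifs (UNIV :: nat set))"
    unfolding rand_space_def by (rule rand.emeasure_pair_measure_alt2)
  also have "\<dots> \<le> (\<integral>\<^sup>+r. ennreal e \<partial>unifs (UNIV :: nat set))"
  proof (rule nn_integral_mono)
    fix r :: "nat \<Rightarrow> real"
    have "(\<lambda>h. (h, r)) -` ?A = {h \<in> space (unifs V). P (h, r)}"
      by (auto simp: rand_space_def space_pair_measure space_PiM)
    then show "emeasure (unifs V) ((\<lambda>h. (h, r)) -` ?A) \<le> ennreal e"
      using le[of r] by (simp add: unifs.P.emeasure_eq_measure ennreal_leI)
  qed
  also have "\<dots> = ennreal e" using unifs.P.emeasure_space_1[where I = "UNIV :: nat set"] by simp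
  finally show ?thesis using e by (simp add: P.emeasure_eq_measure)
qed

lemma measurable_search_weight [measurable]: "(\<lambda>r. search_weight r b k) \<in> borel_measurable (unifs UNIV)"
  unfolding search_weight_def by measurable

lemma measurable_activation_cost [measurable]: "(\<lambda>h. real (activation_cost h k)) \<in> borel_measurable (unifs V)"
  unfolding activation_cost_def of_nat_sum by measurable

lemma measurable_enumeration_cost [measurable]:
  "(\<lambda>\<omega>. real (enumeration_cost (fst \<omega>) (snd \<omega>) b k)) \<in> borel_measurable (rand_space G)"
  unfolding enumeration_cost_eq
proof (intro borel_measurable_sum)
  fix w t assume w: "w \<in> V"
  have [measurable]: "(\<lambda>\<omega>. fst \<omega> w) \<in> borel_measurable (rand_space G)" using w by (rule measurable_hash)
  have [measurable]: "Measurable.pred (rand_space G) (\<lambda>\<omega>. capped (snd \<omega>) b t)"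
    using measurable_compose[OF measurable_snd_rand measurable_capped] .
  have [measurable]: "(\<lambda>\<omega>. sample (snd \<omega>) b t) \<in> measurable (rand_space G) (count_space UNIV)"
    using measurable_compose[OF measurable_snd_rand measurable_sample] .
  show "(\<lambda>\<omega>. if capped (snd \<omega>) b t \<and> w \<in> N (sample (snd \<omega>) b t) \<and> fst \<omega> w < hash_bound k t then 1 else 0 :: real)
      \<in> borel_measurable (rand_space G)" by measurable
qed

lemma measurable_costs_rand [measurable]:
  "(\<lambda>\<omega>. real (activation_cost (fst \<omega>) k)) \<in> borel_measurable (rand_space G)"
  "Measurable.pred (rand_space G) (\<lambda>\<omega>. covers (snd \<omega>) b k)"
  using measurable_compose[OF measurable_fst_rand measurable_activation_cost]
    measurable_compose[OF measurable_snd_rand measurable_covers] .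

lemma measurable_fast_run [measurable]: "Measurable.pred (rand_space G) (fast_run c K b)"
  unfolding fast_run_def by measurable

lemma fast_run_tail:
  assumes K: "1 \<le> K" and mK: "real m \<le> real K * (y * y)"
  shows "measure (rand_space G) {\<omega> \<in> space (rand_space G). \<not> fast_run c K b \<omega>}
    \<le> real n * exp (1 / 2 - 4 * real K * real \<l>)
      + exp (real s - real (K * J1) * (2 * real m * Z / (real n * th)) / 2) + real K * (3 * exp (- (c * \<Lambda>)))"
proof -
  let ?M = "rand_space G"
  interpret P: prob_space ?M by (rule prob_space_rand)
  let ?A = "{\<omega> \<in> space ?M. \<not> covers (snd \<omega>) b K}"
  let ?B = "{\<omega> \<in> space ?M. length (somes (slot_list b (K * J1) \<omega>)) < s}"
  let ?C = "\<lambda>k. {\<omega> \<in> space ?M. weight_threshold c k \<le> search_weight (snd \<omega>) b k}"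
  let ?D = "\<lambda>k. {\<omega> \<in> space ?M. 2 * search_weight (snd \<omega>) b k + c * \<Lambda> * real (T k) \<le> real (enumeration_cost (fst \<omega>) (snd \<omega>) b k)}"
  let ?E = "\<lambda>k. {\<omega> \<in> space ?M. act_threshold c k \<le> real (activation_cost (fst \<omega>) k)}"
  have sets: "?A \<in> sets ?M" "?B \<in> sets ?M" "?C k \<in> sets ?M" "?D k \<in> sets ?M" "?E k \<in> sets ?M" for k by measurable
  have A: "measure ?M ?A \<le> real n * exp (1 / 2 - 4 * real K * real \<l>)"
  proof -
    have "measure ?M ?A = measure (unifs UNIV) {r. \<not> covers r b K}" by (rule measure_rand_tape) measurable
    then show ?thesis using covers_tail[OF K mK] by simp
  qed
  have C: "measure ?M (?C k) \<le> exp (- (c * \<Lambda>))" if "1 \<le> k" for k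
  proof -
    have "measure ?M (?C k) = measure (unifs UNIV) {r. weight_threshold c k \<le> search_weight r b k}"
      by (rule measure_rand_tape) measurable
    then show ?thesis using search_weight_tail[OF that, of "c * \<Lambda>" b] by (simp only: weight_threshold_def)
  qed
  have D: "measure ?M (?D k) \<le> exp (- (c * \<Lambda>))" if "1 \<le> k" for k
  proof (rule measure_rand_le)
    show "measure (unifs V) {h \<in> space (unifs V). 2 * search_weight (snd (h, r)) b k + c * \<Lambda> * real (T k)
        \<le> real (enumeration_cost (fst (h, r)) (snd (h, r)) b k)} \<le> exp (- (c * \<Lambda>))" for r
      using enumeration_cost_tail[OF that, of r b "c * \<Lambda>"] by simp
  qed auto
  have E: "measure ?M (?E k) \<le> exp (- (c * \<Lambda>))" for k
  proof (rule measure_rand_le)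
    show "measure (unifs V) {h \<in> space (unifs V). act_threshold c k \<le> real (activation_cost (fst (h, r)) k)} \<le> exp (- (c * \<Lambda>))"
      for r :: "nat \<Rightarrow> real"
      using activation_cost_tail[of k "c * \<Lambda>"] by (simp add: act_threshold_def)
  qed auto
  have "{\<omega> \<in> space ?M. \<not> fast_run c K b \<omega>} \<subseteq> ?A \<union> ?B \<union> (\<Union>k\<in>{0<..K}. ?C k \<union> ?D k \<union> ?E k)"
    unfolding fast_run_def not_less[symmetric] by blast
  then have "measure ?M {\<omega> \<in> space ?M. \<not> fast_run c K b \<omega>} \<le> measure ?M (?A \<union> ?B \<union> (\<Union>k\<in>{0<..K}. ?C k \<union> ?D k \<union> ?E k))"
    by (intro P.finite_measure_mono sets.Un sets.finite_UN sets) auto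
  also have "\<dots> \<le> measure ?M ?A + measure ?M ?B + measure ?M (\<Union>k\<in>{0<..K}. ?C k \<union> ?D k \<union> ?E k)"
    by (intro order_trans[OF measure_Un_le] add_mono order_refl sets.Un sets.finite_UN sets) auto
  also have "measure ?M (\<Union>k\<in>{0<..K}. ?C k \<union> ?D k \<union> ?E k) \<le> (\<Sum>k\<in>{0<..K}. measure ?M (?C k \<union> ?D k \<union> ?E k))"
    by (intro measure_UNION_le sets.Un sets) auto
  also have "\<dots> \<le> (\<Sum>k\<in>{0<..K}. 3 * exp (- (c * \<Lambda>)))"
  proof (rule sum_mono)
    fix k assume "k \<in> {0<..K}"
    then have k: "1 \<le> k" by simp
    have "measure ?M (?C k \<union> ?D k \<union> ?E k) \<le> measure ?M (?C k) + measure ?M (?D k) + measure ?M (?E k)"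
      by (intro order_trans[OF measure_Un_le] add_mono order_refl measure_Un_le sets.Un sets)
    then show "measure ?M (?C k \<union> ?D k \<union> ?E k) \<le> 3 * exp (- (c * \<Lambda>))"
      using C[OF k] D[OF k] E[of k] by linarith
  qed
  also note A
  also note success_tail[of b K]
  finally show ?thesis by simp
qed

end

lemma time_const_pos:
  assumes "1 \<le> \<alpha>" "0 \<le> c"
  shows "0 < time_const \<alpha> c K"
proof -
  have "0 \<le> phase_const \<alpha> c K"
    unfolding phase_const_def using assms by (intro add_nonneg_nonneg mult_nonneg_nonneg) auto
  then show ?thesis unfolding time_const_def using assms by (intro add_nonneg_pos add_nonneg_nonneg mult_nonneg_nonneg) auto
qed

context edge_sampler
begin

text \<open>The square of \<open>X g\<close> shrinks by the factor 4 per round, so few rounds fit a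
  window of ratio \<open>A * H\<close>. The time analysis takes a plain union bound over the
  possible stopping rounds, whose number must not depend on the input.\<close>

lemma card_estimates:
  fixes A H :: real and B :: nat
  assumes A: "0 < A" and B: "A * H \<le> real B"
  shows "finite {g. real m / A \<le> (X g)\<^sup>2 \<and> (X g)\<^sup>2 \<le> H * real m}"
    and "card {g. real m / A \<le> (X g)\<^sup>2 \<and> (X g)\<^sup>2 \<le> H * real m} \<le> B"
proof -
  let ?R = "{g. real m / A \<le> (X g)\<^sup>2 \<and> (X g)\<^sup>2 \<le> H * real m}"
  have "\<exists>g0. ?R \<subseteq> {g0..<g0 + B}"
  proof (cases "?R = {}")
    case False
    then obtain g1 where "g1 \<in> ?R" by blast
    then have g0: "(LEAST g. g \<in> ?R) \<in> ?R" by (rule LeastI)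
    define g0 where "g0 = (LEAST g. g \<in> ?R)"
    have "?R \<subseteq> {g0..<g0 + B}"
    proof
      fix g assume g: "g \<in> ?R"
      then have le: "g0 \<le> g" unfolding g0_def by (rule Least_le)
      define d where "d = g - g0"
      have gd: "g = g0 + d" using le by (simp add: d_def)
      have "(X g0)\<^sup>2 = 4 ^ d * (X g)\<^sup>2"
        unfolding X_def gd by (simp add: power_add power_divide power_mult_distrib power_mult[symmetric] mult.commute[of _ 2] power_mult)
      moreover have "(X g0)\<^sup>2 \<le> H * real m" using g0 unfolding g0_def by blast
      moreover have "4 ^ d * (real m / A) \<le> 4 ^ d * (X g)\<^sup>2" using g by (intro mult_left_mono) auto
      ultimately have "4 ^ d * (real m / A) \<le> H * real m" by linarith
      then have "4 ^ d * real m \<le> (A * H) * real m" using A by (simp add: field_simps)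
      then have "4 ^ d \<le> A * H" using m1 by simp
      then have "(4 :: real) ^ d \<le> real B" using B by linarith
      then have "4 ^ d \<le> B" by (metis of_nat_le_iff of_nat_numeral of_nat_power)
      moreover have "d < 4 ^ d" by (induction d) auto
      ultimately show "g \<in> {g0..<g0 + B}" using gd by simp
    qed
    then show ?thesis by blast
  qed auto
  then obtain g0 where R: "?R \<subseteq> {g0..<g0 + B}" by blast
  then show "finite ?R" by (rule finite_subset) simp
  have "card ?R \<le> card {g0..<g0 + B}" using R by (rule card_mono[rotated]) simp
  then show "card ?R \<le> B" by simp
qed

text \<open>\<open>A\<close> and \<open>H\<close> measure the error of the estimate downwards and
  upwards. An underestimate costs a factor exp (2 A) in \<open>Z\<close>, an overestimate a factor
  \<open>H\<close> in the success rate; \<open>K\<close> phases compensate for both. The summand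
  \<open>K\<close> in the confidence parameter pays for the union over \<open>K\<close>
  phases.\<close>

lemma fast_run_tail_scaled:
  fixes c A H :: real and B K g :: nat
  assumes c: "0 < c" and A: "1 \<le> A" and H: "1 \<le> H" and K: "(c + real B + 5) * H * exp (2 * A) \<le> real K"
    and lo: "real m / A \<le> (X g)\<^sup>2" and hi: "(X g)\<^sup>2 \<le> H * real m"
  shows "measure (rand_space G) {\<omega> \<in> space (rand_space G).
      \<not> scaled_sampler.fast_run G s \<delta> (3 * X g) (c + real B + 4 + real K) K (pos (Suc g)) \<omega>}
    \<le> 6 * exp (- ((c + real B + 4) * \<Lambda>))"
proof -
  interpret S: scaled_sampler G s \<delta> "3 * X g" by (rule scaled)
  define d where "d = c + real B + 4"
  have d4: "4 \<le> d" using c by (simp add: d_def)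
  let ?y = "3 * X g"
  have yy: "?y * ?y = 9 * (X g)\<^sup>2" by (simp add: power2_eq_square)
  have K': "(d + 1) * H * exp (2 * A) \<le> real K" using K by (simp add: d_def algebra_simps)
  have E1: "1 \<le> exp (2 * A)" using A by simp
  have dH: "d + 1 \<le> (d + 1) * H" using mult_left_mono[OF H, of "d + 1"] d4 by simp
  then have dH1: "1 \<le> (d + 1) * H" using d4 by linarith
  have "(d + 1) * H * 1 \<le> (d + 1) * H * exp (2 * A)" using E1 dH1 by (intro mult_left_mono) linarith+
  then have dK: "d + 1 \<le> real K" using K' dH by linarith
  have "A \<le> exp (2 * A)" using exp_ge_add_one_self[of "2 * A"] A by linarith
  also have "\<dots> \<le> (d + 1) * H * exp (2 * A)" using mult_right_mono[OF dH1, of "exp (2 * A)"] by simp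
  finally have AK: "A \<le> real K" using K' by linarith
  have K1: "1 \<le> K" using dK d4 by simp
  have mA: "real m \<le> A * (?y * ?y)"
  proof -
    have "real m \<le> A * (X g)\<^sup>2" using lo A by (simp add: pos_divide_le_eq mult.commute)
    moreover have "0 \<le> A * (X g)\<^sup>2" using A by simp
    ultimately show ?thesis unfolding yy by simp
  qed
  have mK: "real m \<le> real K * (?y * ?y)"
    using mA mult_right_mono[OF AK, of "?y * ?y"] by simp
  have l: "\<Lambda> \<le> real \<l>" using \<l>_ge \<Lambda>_ge by linarith
  have e1: "real n * exp (1 / 2 - 4 * real K * real \<l>) \<le> 2 * exp (- (d * \<Lambda>))"
  proof -
    have "4 * (d + 1) * \<Lambda> \<le> 4 * real K * real \<l>" using dK l d4 \<Lambda>_ge by (intro mult_mono) auto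
    moreover have "(d + 1) * \<Lambda> \<le> 4 * (d + 1) * \<Lambda>" using d4 \<Lambda>_ge by (intro mult_right_mono) auto
    ultimately have "exp (\<Lambda> + (1 / 2 - 4 * real K * real \<l>)) \<le> exp (1 / 2 + - (d * \<Lambda>))" by (simp add: algebra_simps)
    also have "\<dots> \<le> 2 * exp (- (d * \<Lambda>))" unfolding exp_add using exp_half_le by (intro mult_right_mono) auto
    finally show ?thesis using n2 unfolding exp_add by simp
  qed
  have e2: "exp (real s - real (K * S.J1) * (2 * real m * S.Z / (real n * S.th)) / 2) \<le> exp (- (d * \<Lambda>))"
  proof -
    let ?\<mu> = "real S.J1 * (2 * real m * S.Z / (real n * S.th))"
    have "X g * X g > 0" using X_pos[of g] by simp
    then have "1 / (9 * H) \<le> real m / (?y * ?y)" unfolding yy using hi H by (simp add: field_simps power2_eq_square)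
    then have "200000 * real s * real \<nu> * (1 / (9 * H)) * exp (- 2 * A) \<le> 200000 * real s * real \<nu> * (real m / (?y * ?y)) * exp (- 2 * A)"
      by (intro mult_left_mono mult_right_mono) auto
    also have "\<dots> \<le> ?\<mu>" using mA A by (intro S.mean_successes) auto
    finally have \<mu>: "200000 * real s * real \<nu> * (1 / (9 * H)) * exp (- 2 * A) \<le> ?\<mu>" .
    have \<nu>1: "1 \<le> real \<nu>" using S.\<nu>_ge(1) by simp
    have s1': "1 \<le> real s" using s1 by simp
    have s\<nu>: "real s * 1 \<le> real s * real \<nu>" "1 * \<Lambda> \<le> real s * real \<nu>"
      using \<nu>1 s1' S.\<nu>_ge(2) \<Lambda>_ge by (intro mult_left_mono mult_mono; linarith)+
    have "2 * ((d + 1) * (real s * real \<nu>)) \<le> 200000 / 9 * ((d + 1) * (real s * real \<nu>))"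
      using d4 by (intro mult_right_mono) auto
    also have "\<dots> = ((d + 1) * H * exp (2 * A)) * (200000 * real s * real \<nu> * (1 / (9 * H)) * exp (- 2 * A))"
      using H by (simp add: exp_minus field_simps)
    also have "\<dots> \<le> real K * ?\<mu>" using H by (intro mult_mono[OF K' \<mu>]) auto
    finally have 1: "2 * ((d + 1) * (real s * real \<nu>)) \<le> real K * ?\<mu>" .
    have "d * (1 * \<Lambda>) \<le> d * (real s * real \<nu>)" using s\<nu>(2) d4 by (intro mult_left_mono) auto
    then have "real s + d * \<Lambda> \<le> (d + 1) * (real s * real \<nu>)" using s\<nu>(1) by (simp add: distrib_right)
    then show ?thesis using 1 by simp
  qed
  have e3: "real K * (3 * exp (- ((d + real K) * \<Lambda>))) \<le> 3 * exp (- (d * \<Lambda>))"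
  proof -
    have "real K \<le> exp (real K * \<Lambda>)"
    proof -
      have "real K \<le> 2 ^ K" by (simp add: less_imp_le)
      also have "\<dots> \<le> real n ^ K" using n2 by (intro power_mono) auto
      also have "\<dots> = exp (real K * \<Lambda>)" using n2 by (simp add: exp_of_nat_mult)
      finally show ?thesis .
    qed
    then have "real K * (3 * exp (- ((d + real K) * \<Lambda>))) \<le> exp (real K * \<Lambda>) * (3 * exp (- ((d + real K) * \<Lambda>)))"
      by (intro mult_right_mono) auto
    also have "\<dots> = 3 * exp (- (d * \<Lambda>))" by (simp add: mult_exp_exp algebra_simps)
    finally show ?thesis .
  qed
  show ?thesis
    using S.fast_run_tail[OF K1 mK, of "d + real K" "pos (Suc g)"] e1 e2 e3 unfolding d_def by linarith
qed

text \<open>Of \<open>\<l>\<close> only the lower bound by ln n is used, so \<delta> does not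
  influence the failure probability. All exponents are prepared with a surplus of 4 over
  \<open>c\<close>, plus \<open>B\<close> where a union over stopping rounds is taken.\<close>

lemma runs_in_time_sampler:
  fixes c :: real and j B K :: nat
  defines "A \<equiv> 6 * 4 ^ j" and "H \<equiv> exp (5 + c)"
  assumes c: "0 < c" and j: "c \<le> real j" and B: "A * H \<le> real B"
    and K: "(c + real B + 5) * H * exp (2 * A) \<le> real K"
  shows "1 - real n powr (- c) \<le> \<P>(\<omega> in rand_space G.
    runs_in_time sampler G s \<delta> \<omega> (time_const (sqrt A) (c + real B + 4 + real K) K * \<tau>))"
proof -
  let ?M = "rand_space G" and ?c = "c + real B + 4 + real K"
  interpret S0: scaled_sampler G s \<delta> "3 * X 0" by (rule scaled)
  interpret P: prob_space ?M by (rule S0.prob_space_rand)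
  define Range where "Range = {g. real m / A \<le> (X g)\<^sup>2 \<and> (X g)\<^sup>2 \<le> H * real m}"
  define Fast where "Fast = (\<lambda>g. scaled_sampler.fast_run G s \<delta> (3 * X g) ?c K (pos (Suc g)))"
  let ?good = "\<lambda>\<omega>. runs_in_time sampler G s \<delta> \<omega> (time_const (sqrt A) ?c K * \<tau>)"
  let ?N = "{\<omega> \<in> space ?M. \<not> (\<exists>g. stops (snd \<omega>) g \<and> real m / (6 * 4 ^ j) \<le> (X g)\<^sup>2 \<and> (X g)\<^sup>2 \<le> exp (4 + (1 + c)) * real m)}"
  let ?W = "\<lambda>g. {\<omega> \<in> space ?M. \<not> Fast g \<omega>}"
  have A1: "1 \<le> A" unfolding A_def using one_le_power[of "4 :: real" j] by linarith
  have H1: "1 \<le> H" unfolding H_def using c by simp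
  have E1: "1 \<le> exp (2 * A)" using A1 by simp
  have K1: "1 \<le> K"
  proof -
    have "1 \<le> (c + real B + 5) * H * exp (2 * A)"
      using mult_mono[OF mult_mono[of 1 "c + real B + 5" 1 H] E1] H1 c by simp
    then show ?thesis using K by simp
  qed
  have finR: "finite Range" and cardR: "card Range \<le> B"
    unfolding Range_def using card_estimates[of A H B] A1 B by auto
  have Fm [measurable]: "Measurable.pred ?M (Fast g)" for g
    unfolding Fast_def by (rule scaled_sampler.measurable_fast_run[OF scaled])
  have st [measurable]: "Measurable.pred ?M (\<lambda>\<omega>. stops (snd \<omega>) g)" for g
    using measurable_compose[OF S0.measurable_snd_rand measurable_stops] .
  have Nm: "?N \<in> sets ?M" by measurable
  have Wm: "?W g \<in> sets ?M" for g by measurable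
  have good: "?good \<omega>" if reg: "regular \<omega>" and g: "g \<in> Range" and sg: "stops (snd \<omega>) g" and fg: "Fast g \<omega>" for \<omega> g
  proof (rule scaled_sampler.runs_in_time_fast_run[OF scaled _ _ refl reg sg K1])
    show "1 \<le> sqrt A" using A1 by simp
    have "real m \<le> A * (X g)\<^sup>2" using g A1 by (simp add: Range_def pos_divide_le_eq mult.commute)
    then have "sqrt (real m) \<le> sqrt (A * (X g)\<^sup>2)" by (rule real_sqrt_le_mono)
    also have "\<dots> = sqrt A * X g" using X_pos[of g] by (simp add: real_sqrt_mult)
    also have "\<dots> \<le> sqrt A * (3 * X g)" using X_pos[of g] A1 by (intro mult_left_mono) auto
    finally show "sqrt (real m) \<le> sqrt A * (3 * X g)" .
    show "0 \<le> ?c" using c by simp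
  qed (use fg in \<open>simp add: Fast_def\<close>)
  define z where "z = exp (- ((c + 4) * \<Lambda>))"
  have N: "measure ?M ?N \<le> 2 * z"
  proof -
    have l: "\<Lambda> \<le> real \<l>" using \<l>_ge \<Lambda>_ge by linarith
    have "measure ?M ?N = measure (unifs UNIV) {r. \<not> (\<exists>g. stops r g \<and> real m / (6 * 4 ^ j) \<le> (X g)\<^sup>2 \<and> (X g)\<^sup>2 \<le> exp (4 + (1 + c)) * real m)}"
      by (rule S0.measure_rand_tape) measurable
    also have "\<dots> \<le> exp (- 4 * real \<l> * 2 ^ j) + real n * exp (- 20 * (1 + c) * real \<l>)"
      using c by (intro estimate_tail) simp
    also have "exp (- 4 * real \<l> * 2 ^ j) \<le> z"
    proof -
      have "Suc j \<le> 2 ^ j" by (induction j) auto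
      then have "real (Suc j) \<le> 2 ^ j" by (metis of_nat_le_iff of_nat_numeral of_nat_power)
      then have "c + 4 \<le> 4 * 2 ^ j" using j c by simp
      then have "\<Lambda> * (c + 4) \<le> real \<l> * (4 * 2 ^ j)" using l c by (intro mult_mono) auto
      then show ?thesis unfolding z_def by (simp add: mult_ac)
    qed
    also have "real n * exp (- 20 * (1 + c) * real \<l>) \<le> z"
    proof -
      have "20 * (1 + c) * \<Lambda> \<le> 20 * (1 + c) * real \<l>" using l c by (intro mult_left_mono) auto
      moreover have "(c + 5) * \<Lambda> \<le> 20 * (1 + c) * \<Lambda>" using c \<Lambda>_ge by (intro mult_right_mono) auto
      ultimately have "exp (\<Lambda> + - 20 * (1 + c) * real \<l>) \<le> z" unfolding z_def by (simp add: algebra_simps)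
      then show ?thesis using n2 unfolding exp_add by simp
    qed
    finally show ?thesis by simp
  qed
  have W: "measure ?M (?W g) \<le> 6 * exp (- ((c + real B + 4) * \<Lambda>))" if "g \<in> Range" for g
    unfolding Fast_def using that c A1 H1 K by (intro fast_run_tail_scaled[where A = A and H = H]) (auto simp: Range_def)
  have "1 - \<P>(\<omega> in ?M. ?good \<omega>) = measure ?M (space ?M - {\<omega> \<in> space ?M. ?good \<omega>})"
    using P.prob_compl[OF sets_rand_space_runs_in_time[OF wf]] by simp
  also have "\<dots> \<le> measure ?M (?N \<union> (\<Union>g\<in>Range. ?W g))"
  proof (rule P.finite_measure_mono_AE)
    show "AE \<omega> in ?M. \<omega> \<in> space ?M - {\<omega> \<in> space ?M. ?good \<omega>} \<longrightarrow> \<omega> \<in> ?N \<union> (\<Union>g\<in>Range. ?W g)"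
      using S0.AE_regular
    proof eventually_elim
      case (elim \<omega>)
      have H: "H = exp (4 + (1 + c))" by (simp add: H_def)
      show ?case
      proof (intro impI, rule ccontr)
        assume \<omega>: "\<omega> \<in> space ?M - {\<omega> \<in> space ?M. ?good \<omega>}" and "\<omega> \<notin> ?N \<union> (\<Union>g\<in>Range. ?W g)"
        then obtain g where "g \<in> Range" "stops (snd \<omega>) g" "Fast g \<omega>"
          unfolding Range_def A_def H by blast
        then show False using good[OF elim] \<omega> by blast
      qed
    qed
    show "?N \<union> (\<Union>g\<in>Range. ?W g) \<in> sets ?M" by (intro sets.Un Nm sets.finite_UN finR Wm)
  qed
  also have "\<dots> \<le> measure ?M ?N + measure ?M (\<Union>g\<in>Range. ?W g)"
    by (intro measure_Un_le Nm sets.finite_UN finR Wm)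
  also have "measure ?M (\<Union>g\<in>Range. ?W g) \<le> (\<Sum>g\<in>Range. measure ?M (?W g))"
    by (intro measure_UNION_le finR Wm)
  also have "\<dots> \<le> (\<Sum>g\<in>Range. 6 * exp (- ((c + real B + 4) * \<Lambda>)))" by (rule sum_mono) (rule W)
  also have "\<dots> \<le> 6 * z"
  proof -
    \<comment> \<open>By B <= 2^B <= n^B the surplus \<open>B\<close> in the exponent absorbs the
      number of stopping rounds.\<close>
    have "real (card Range) \<le> real B" using cardR by simp
    also have "\<dots> \<le> 2 ^ B" by (simp add: less_imp_le)
    also have "\<dots> \<le> real n ^ B" using n2 by (intro power_mono) auto
    also have "\<dots> = exp (real B * \<Lambda>)" using n2 by (simp add: exp_of_nat_mult)
    finally have "real (card Range) * (6 * exp (- ((c + real B + 4) * \<Lambda>))) \<le> exp (real B * \<Lambda>) * (6 * exp (- ((c + real B + 4) * \<Lambda>)))"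
      by (intro mult_right_mono) auto
    also have "\<dots> = 6 * z" unfolding z_def by (simp add: mult_exp_exp algebra_simps)
    finally show ?thesis by simp
  qed
  also note N
  \<comment> \<open>The surplus 4 gives a factor n^4 >= 16, more than the total of 8.\<close>
  also have "2 * z + 6 * z \<le> exp (- c * \<Lambda>)"
  proof -
    have "exp (4 * \<Lambda>) = real n ^ 4" using exp_of_nat_mult[of 4 \<Lambda>] n2 by simp
    moreover have "(2 :: real) ^ 4 \<le> real n ^ 4" using n2 by (intro power_mono) auto
    ultimately have "16 \<le> exp (4 * \<Lambda>)" by simp
    then have "16 * z \<le> exp (4 * \<Lambda>) * z" unfolding z_def by (intro mult_right_mono) auto
    also have "\<dots> = exp (- c * \<Lambda>)" unfolding z_def by (simp add: mult_exp_exp algebra_simps)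
    finally show ?thesis unfolding z_def by (smt (verit) exp_ge_zero)
  qed
  also have "exp (- c * \<Lambda>) = real n powr (- c)" using n2 by (simp add: powr_def)
  finally show ?thesis by simp
qed

end

theorem mainTheorem4:
  shows "\<exists>p :: prog.
    (\<forall>G s \<delta>. valid_input G s \<delta> \<longrightarrow>
       samples_with_prob p G s \<delta> (replicate_pmf s (pmf_of_set (oriented_edges G)))) \<and>
    (\<forall>c>0. \<exists>C>0. \<forall>G s \<delta>. valid_input G s \<delta> \<longrightarrow>
       \<P>(\<omega> in rand_space G.
          runs_in_time p G s \<delta> \<omega> (C * time_bound (num_vertices G) (num_edges G) s \<delta>))
       \<ge> 1 - real (num_vertices G) powr (- c))"
proof (intro exI[of _ sampler] conjI allI impI)
  show "samples_with_prob sampler G s \<delta> (replicate_pmf s (pmf_of_set (oriented_edges G)))"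
    if "valid_input G s \<delta>" for G s \<delta>
    using edge_sampler.samples_with_prob_sampler[of G s \<delta>] that by (simp add: edge_sampler_def)
next
  fix c :: real assume c: "0 < c"
  \<comment> \<open>Each constant depends only on \<open>c\<close> and the preceding ones: the
    tolerated accuracy \<open>j\<close>, the number \<open>B\<close> of possible stopping rounds,
    the number \<open>K\<close> of phases. None depends on the graph, on \<open>s\<close> or on
    \<open>\<delta>\<close>.\<close>
  obtain j :: nat where j: "c \<le> real j" using real_arch_simple by blast
  obtain B :: nat where B: "6 * 4 ^ j * exp (5 + c) \<le> real B" using real_arch_simple by blast
  obtain K :: nat where K: "(c + real B + 5) * exp (5 + c) * exp (2 * (6 * 4 ^ j)) \<le> real K" using real_arch_simple by blast
  let ?C = "time_const (sqrt (6 * 4 ^ j)) (c + real B + 4 + real K) K"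
  have "1 \<le> sqrt (6 * 4 ^ j)" using one_le_power[of "4 :: real" j] by (simp only: real_sqrt_ge_1_iff) linarith
  then have "0 < ?C" using c by (intro time_const_pos) auto
  moreover have "\<P>(\<omega> in rand_space G. runs_in_time sampler G s \<delta> \<omega> (?C * time_bound (num_vertices G) (num_edges G) s \<delta>))
      \<ge> 1 - real (num_vertices G) powr (- c)" if "valid_input G s \<delta>" for G s \<delta>
    using edge_sampler.runs_in_time_sampler[OF _ c j B K, of G s \<delta>] that by (simp add: edge_sampler_def)
  ultimately show "\<exists>C>0. \<forall>G s \<delta>. valid_input G s \<delta> \<longrightarrow>
       \<P>(\<omega> in rand_space G.
          runs_in_time sampler G s \<delta> \<omega> (C * time_bound (num_vertices G) (num_edges G) s \<delta>))
       \<ge> 1 - real (num_vertices G) powr (- c)" by blast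
qed

end
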